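(* Let $\mu$ be a box-like self-affine measure of separated type, with support $F$, satisfying the rectangular open set condition. Then \[ \dim_{\mathrm B}F=\dim_{\mathrm P}F=\max\{\gamma_A(0),\gamma_B(0)\}. \] If, in addition, $\tau_1$ and $\tau_2$ are differentiable at $q=1$, then $\dim_{\mathrm H}\mu=\dim_{\mathrm P}\mu=\dim_{\mathrm e}\mu=-\gamma'(1)$, where $\gamma'(1)=\min\{\gamma_A'(1),\gamma_B'(1)\}$ if $\min\{\gamma_A'(1),\gamma_B'(1)\}\ge\tau_1'(1)+\tau_2'(1)$ and $\gamma'(1)=\max\{\gamma_A'(1),\gamma_B'(1)\}$ if $\max\{\gamma_A'(1),\gamma_B'(1)\}\le\tau_1'(1)+\tau_2'(1)$; here \[ \gamma_A'(1)=-\frac{\sum_{i\in\mathcal I}p_i\big(\log p_i+\tau_1'(1)\log(c_i/d_i)\big)}{\sum_{i\in\mathcal I}p_i\log d_i},\qquad \gamma_B'(1)=-\frac{\sum_{i\in\mathcal I}p_i\big(\log p_i+\tau_2'(1)\log(d_i/c_i)\big)}{\sum_{i\in\mathcal I}p_i\log c_i}. \] Moreover, if $c_i\ge d_i$ for all $i\in\mathcal I$, then $\dim_{\mathrm B}F=\dim_{\mathrm P}F=\gamma_A(0)$, and if $\tau_1$ is differentiable at $q=1$, then \[ \dim_{\mathrm H}\mu=\dim_{\mathrm P}\mu=\dim_{\mathrm e}\mu=-\gamma_A'(1)=\frac{\sum_{i\in\mathcal I}p_i\big(\log p_i+\tau_1'(1)\log(c_i/d_i)\big)}{\sum_{i\in\mathcal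 I}p_i\log d_i}. \] If $d_i\ge c_i$ for all $i\in\mathcal I$, then $\dim_{\mathrm B}F=\dim_{\mathrm P}F=\gamma_B(0)$, and if $\tau_2$ is differentiable at $q=1$, then \[ \dim_{\mathrm H}\mu=\dim_{\mathrm P}\mu=\dim_{\mathrm e}\mu=-\gamma_B'(1)=\frac{\sum_{i\in\mathcal I}p_i\big(\log p_i+\tau_2'(1)\log(d_i/c_i)\big)}{\sum_{i\in\mathcal I}p_i\log c_i}. \]
   Context: Box-like self-affine measure of separated type: $\mathcal I$ is a finite index set with $|\mathcal I|\ge2$; for each $i\in\mathcal I$, $S_i:\mathbb{R}^2\to\mathbb{R}^2$ is an affine map with linear part $\begin{pmatrix}\pm c_i&0\\0&\pm d_i\end{pmatrix}$, $c_i,d_i\in(0,1)$ (signs depending on $i$), and $S_i([0,1]^2)\subseteq[0,1]^2$; $(p_i)_{i\in\mathcal I}$ is a probability vector with all $p_i\in(0,1)$; $\mu$ is the unique Borel probability measure with $\mu=\sum_{i\in\mathcal I}p_i\,\mu\circ S_i^{-1}$; its support $F$ is the unique non-empty compact set with $F=\bigcup_iS_i(F)$. Rectangular open set condition: there is a non-empty open rectangle $R=(a,b)\times(c,d)\subset\mathbb{R}^2$ such that the sets $S_i(R)$, $i\in\mathcal I$, are pairwise disjoint subsets of $R$. For a compactly supported Borel probability measure $\nu$, $\tau_\nu(q)=\lim_{\delta\to0}\log\int_{\operatorname{supp}\nu}\nu(B(x,\delta))^{q-1}d\nu(x)/(-\log\delta)$ when the limit exists ($L^q$-spectrum). Let $\pi_1(x,y)=x$,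 $\pi_2(x,y)=y$, $\pi_j(\mu)=\mu\circ\pi_j^{-1}$, and $\tau_j(q)=\tau_{\pi_j(\mu)}(q)$, which exists for all $q\ge0$. For $\mathbf i=(i_1,\dots,i_k)\in\mathcal I^k$ put $p(\mathbf i)=p_{i_1}\cdots p_{i_k}$, $c_{\mathbf i}=c_{i_1}\cdots c_{i_k}$, $d_{\mathbf i}=d_{i_1}\cdots d_{i_k}$, $\alpha_1(\mathbf i)=\max\{c_{\mathbf i},d_{\mathbf i}\}$, $\alpha_2(\mathbf i)=\min\{c_{\mathbf i},d_{\mathbf i}\}$, and $\tau_{\mathbf i}=\tau_1$ if $c_{\mathbf i}\ge d_{\mathbf i}$, $\tau_{\mathbf i}=\tau_2$ otherwise. For $s\in\mathbb{R}$, $q\ge0$ let $\psi^{s,q}(\mathbf i)=p(\mathbf i)^q\alpha_1(\mathbf i)^{\tau_{\mathbf i}(q)}\alpha_2(\mathbf i)^{s-\tau_{\mathbf i}(q)}$, $\Psi_k^{s,q}=\sum_{\mathbf i\in\mathcal I^k}\psi^{s,q}(\mathbf i)$, $P(s,q)=\lim_{k\to\infty}(\Psi_k^{s,q})^{1/k}$ (the limit exists), and let $\gamma(q)$ be the unique real number with $P(\gamma(q),q)=1$. The functions $\gamma_A,\gamma_B:[0,\infty)\to\mathbb{R}$ are defined by $\sum_{i\in\mathcal I}p_i^q\,c_i^{\tau_1(q)}d_i^{\gamma_A(q)-\tau_1(q)}=1$ and $\sum_{i\in\mathcal I}p_i^q\,d_i^{\tau_2(q)}c_i^{\gamma_B(q)-\tau_2(q)}=1$.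 $\dim_{\mathrm B},\dim_{\mathrm P},\dim_{\mathrm H}$ denote box, packing and Hausdorff dimension of sets. For measures, $\dim_{\mathrm H}\mu=\inf\{\dim_{\mathrm H}E:E\text{ Borel},\ \mu(E)=1\}$, $\dim_{\mathrm P}\mu=\inf\{\dim_{\mathrm P}E:E\text{ Borel},\ \mu(E)=1\}$, and the entropy dimension is $\dim_{\mathrm e}\mu=\lim_{\delta\to0}\frac{1}{\log\delta}\sum_{Q}\mu(Q)\log\mu(Q)$, the sum being over half-open $\delta$-mesh squares $Q$ with $\mu(Q)>0$. *)

theory Defs
  imports "HOL-Probability.Probability_Measure"
begin

section \<open>Dimensions of sets\<close>

text \<open>
  The convention is that \<open>diameter U\<close> to the power 0 is 1 for nonempty \<open>U\<close>
  (whereas \<open>0 powr 0 = 0\<close>).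
\<close>
definition diam_pow :: "real \<Rightarrow> 'a::metric_space set \<Rightarrow> real" where
  "diam_pow s U = (if U = {} then 0 else if s = 0 then 1 else diameter U powr s)"

text \<open>
  Boundedness of the covering sets is required because \<open>diameter\<close> carries no information
  on unbounded sets.
\<close>
definition hausdorff_premeasure :: "real \<Rightarrow> real \<Rightarrow> 'a::metric_space set \<Rightarrow> ennreal" where
  "hausdorff_premeasure s \<delta> E =
     (INF U \<in> {U :: nat \<Rightarrow> 'a set. E \<subseteq> (\<Union>n. U n) \<and> (\<forall>n. bounded (U n) \<and> diameter (U n) \<le> \<delta>)}.
        (\<Sum>n. ennreal (diam_pow s (U n))))"

definition hausdorff_measure :: "real \<Rightarrow> 'a::metric_space set \<Rightarrow> ennreal" where
  "hausdorff_measure s E = (SUP \<delta> \<in> {0<..}. hausdorff_premeasure s \<delta> E)"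

definition hausdorff_dim :: "'a::metric_space set \<Rightarrow> ereal" where
  "hausdorff_dim E = Inf {ereal s |s. 0 \<le> s \<and> hausdorff_measure s E = 0}"

text \<open>
  A packing of \<open>E\<close> is a countable set \<open>B\<close> of (centre, radius) pairs whose closed balls are
  pairwise disjoint.  A ball of radius \<open>r\<close> contributes its diameter \<open>2 * r\<close> to the power \<open>s\<close>.
\<close>
definition packing_premeasure_at ::
    "real \<Rightarrow> real \<Rightarrow> 'a::euclidean_space set \<Rightarrow> ennreal" where
  "packing_premeasure_at s \<delta> E =
     (SUP B \<in> {B :: ('a \<times> real) set. countable B \<and> B \<subseteq> E \<times> {0<..\<delta>} \<and>
                  disjoint_family_on (\<lambda>(x, r). cball x r) B}.
        (\<Sum>\<^sub>\<infinity>(x, r)\<in>B. ennreal ((2 * r) powr s)))"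

definition packing_premeasure :: "real \<Rightarrow> 'a::euclidean_space set \<Rightarrow> ennreal" where
  "packing_premeasure s E = (INF \<delta> \<in> {0<..}. packing_premeasure_at s \<delta> E)"

definition packing_measure :: "real \<Rightarrow> 'a::euclidean_space set \<Rightarrow> ennreal" where
  "packing_measure s E =
     (INF A \<in> {A :: nat \<Rightarrow> 'a set. E \<subseteq> (\<Union>n. A n)}. (\<Sum>n. packing_premeasure s (A n)))"

definition packing_dim :: "'a::euclidean_space set \<Rightarrow> ereal" where
  "packing_dim E = Inf {ereal s |s. 0 \<le> s \<and> packing_measure s E = 0}"

text \<open>Only meaningful for totally bounded \<open>E\<close>; otherwise the infimum of \<open>{}\<close> is 0 on \<open>nat\<close>.\<close>
definition covering_number :: "real \<Rightarrow> 'a::metric_space set \<Rightarrow> nat" where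
  "covering_number \<delta> E =
     Inf {card \<U> |\<U>. finite \<U> \<and> E \<subseteq> \<Union>\<U> \<and> (\<forall>U\<in>\<U>. bounded U \<and> diameter U \<le> \<delta>)}"

text \<open>The box dimension exists (lower and upper box dimension agree) and equals \<open>v\<close>.\<close>
definition has_box_dim :: "'a::metric_space set \<Rightarrow> real \<Rightarrow> bool" where
  "has_box_dim E v \<longleftrightarrow>
     ((\<lambda>\<delta>. ln (real (covering_number \<delta> E)) / (- ln \<delta>)) \<longlongrightarrow> v) (at_right 0)"


section \<open>Dimensions and \<open>L\<^sup>q\<close>-spectra of measures\<close>

definition measure_support :: "'a::topological_space measure \<Rightarrow> 'a set" where
  "measure_support \<nu> = {x. \<forall>U. open U \<and> x \<in> U \<longrightarrow> emeasure \<nu> U > 0}"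

definition hausdorff_dim_measure :: "'a::metric_space measure \<Rightarrow> ereal" where
  "hausdorff_dim_measure \<mu> = (INF E \<in> {E \<in> sets borel. emeasure \<mu> E = 1}. hausdorff_dim E)"

definition packing_dim_measure :: "'a::euclidean_space measure \<Rightarrow> ereal" where
  "packing_dim_measure \<mu> = (INF E \<in> {E \<in> sets borel. emeasure \<mu> E = 1}. packing_dim E)"

definition mesh_squares :: "real \<Rightarrow> (real \<times> real) set set" where
  "mesh_squares \<delta> =
     {{of_int m * \<delta> ..< (of_int m + 1) * \<delta>} \<times> {of_int n * \<delta> ..< (of_int n + 1) * \<delta>} |m n :: int. True}"

text \<open>The entropy dimension exists and equals \<open>v\<close>.\<close>
definition has_entropy_dim :: "(real \<times> real) measure \<Rightarrow> real \<Rightarrow> bool" where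
  "has_entropy_dim \<mu> v \<longleftrightarrow>
     ((\<lambda>\<delta>. 1 / ln \<delta> *
          (\<Sum>\<^sub>\<infinity>Q\<in>{Q \<in> mesh_squares \<delta>. measure \<mu> Q > 0}. measure \<mu> Q * ln (measure \<mu> Q)))
       \<longlongrightarrow> v) (at_right 0)"

definition Lq_spectrum :: "'a::metric_space measure \<Rightarrow> real \<Rightarrow> real" where
  "Lq_spectrum \<nu> q = Lim (at_right 0)
     (\<lambda>\<delta>. ln (LINT x:measure_support \<nu>|\<nu>. measure \<nu> (cball x \<delta>) powr (q - 1)) / (- ln \<delta>))"


section \<open>Box-like self-affine measures of separated type\<close>

definition diagonal_affine :: "real \<Rightarrow> real \<Rightarrow> (real \<times> real \<Rightarrow> real \<times> real) \<Rightarrow> bool" where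
  "diagonal_affine c d f \<longleftrightarrow>
     (\<exists>e\<in>{1, -1}. \<exists>e'\<in>{1, -1}. \<exists>u v. f = (\<lambda>(x, y). (e * c * x + u, e' * d * y + v)))"

definition box_like_ifs ::
    "'i set \<Rightarrow> ('i \<Rightarrow> real \<times> real \<Rightarrow> real \<times> real) \<Rightarrow> ('i \<Rightarrow> real) \<Rightarrow> ('i \<Rightarrow> real) \<Rightarrow> bool" where
  "box_like_ifs I S c d \<longleftrightarrow>
     finite I \<and> card I \<ge> 2 \<and>
     (\<forall>i\<in>I. 0 < c i \<and> c i < 1 \<and> 0 < d i \<and> d i < 1 \<and> diagonal_affine (c i) (d i) (S i) \<and>
             S i ` ({0..1} \<times> {0..1}) \<subseteq> {0..1} \<times> {0..1})"

definition probability_vector_on :: "'i set \<Rightarrow> ('i \<Rightarrow> real) \<Rightarrow> bool" where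
  "probability_vector_on I p \<longleftrightarrow> (\<forall>i\<in>I. 0 < p i \<and> p i < 1) \<and> (\<Sum>i\<in>I. p i) = 1"

text \<open>These conditions determine \<open>\<mu>\<close> uniquely for a contracting system \<open>S\<close>.\<close>
definition is_self_affine_measure ::
    "'i set \<Rightarrow> ('i \<Rightarrow> real \<times> real \<Rightarrow> real \<times> real) \<Rightarrow> ('i \<Rightarrow> real) \<Rightarrow> (real \<times> real) measure \<Rightarrow> bool" where
  "is_self_affine_measure I S p \<mu> \<longleftrightarrow>
     prob_space \<mu> \<and> sets \<mu> = sets borel \<and>
     (\<forall>A\<in>sets borel. measure \<mu> A = (\<Sum>i\<in>I. p i * measure (distr \<mu> borel (S i)) A))"

definition rectangular_osc :: "'i set \<Rightarrow> ('i \<Rightarrow> real \<times> real \<Rightarrow> real \<times> real) \<Rightarrow> bool" where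
  "rectangular_osc I S \<longleftrightarrow>
     (\<exists>a b a' b'. a < b \<and> a' < b' \<and>
        (let R = {a<..<b} \<times> {a'<..<b'} in
           (\<forall>i\<in>I. S i ` R \<subseteq> R) \<and> disjoint_family_on (\<lambda>i. S i ` R) I))"


section \<open>Pressure and the functions \<open>\<gamma>\<close>, \<open>\<gamma>\<^sub>A\<close>, \<open>\<gamma>\<^sub>B\<close>\<close>

definition words :: "'i set \<Rightarrow> nat \<Rightarrow> 'i list set" where
  "words I k = {w. set w \<subseteq> I \<and> length w = k}"

definition word_prod :: "('i \<Rightarrow> real) \<Rightarrow> 'i list \<Rightarrow> real" where
  "word_prod f w = prod_list (map f w)"

definition psi ::
    "('i \<Rightarrow> real) \<Rightarrow> ('i \<Rightarrow> real) \<Rightarrow> ('i \<Rightarrow> real) \<Rightarrow> (real \<Rightarrow> real) \<Rightarrow> (real \<Rightarrow> real) \<Rightarrow>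
     real \<Rightarrow> real \<Rightarrow> 'i list \<Rightarrow> real" where
  "psi p c d \<tau>1 \<tau>2 s q w =
     (let C = word_prod c w; D = word_prod d w;
          t = (if C \<ge> D then \<tau>1 q else \<tau>2 q)
      in word_prod p w powr q * max C D powr t * min C D powr (s - t))"

definition pressure ::
    "'i set \<Rightarrow> ('i \<Rightarrow> real) \<Rightarrow> ('i \<Rightarrow> real) \<Rightarrow> ('i \<Rightarrow> real) \<Rightarrow> (real \<Rightarrow> real) \<Rightarrow> (real \<Rightarrow> real) \<Rightarrow>
     real \<Rightarrow> real \<Rightarrow> real" where
  "pressure I p c d \<tau>1 \<tau>2 s q = lim (\<lambda>k. root k (\<Sum>w\<in>words I k. psi p c d \<tau>1 \<tau>2 s q w))"

definition gamma ::
    "'i set \<Rightarrow> ('i \<Rightarrow> real) \<Rightarrow> ('i \<Rightarrow> real) \<Rightarrow> ('i \<Rightarrow> real) \<Rightarrow> (real \<Rightarrow> real) \<Rightarrow> (real \<Rightarrow> real) \<Rightarrow>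
     real \<Rightarrow> real" where
  "gamma I p c d \<tau>1 \<tau>2 q = (THE s. pressure I p c d \<tau>1 \<tau>2 s q = 1)"

definition gamma_A ::
    "'i set \<Rightarrow> ('i \<Rightarrow> real) \<Rightarrow> ('i \<Rightarrow> real) \<Rightarrow> ('i \<Rightarrow> real) \<Rightarrow> (real \<Rightarrow> real) \<Rightarrow> real \<Rightarrow> real" where
  "gamma_A I p c d \<tau>1 q =
     (THE s. (\<Sum>i\<in>I. p i powr q * c i powr \<tau>1 q * d i powr (s - \<tau>1 q)) = 1)"

definition gamma_B ::
    "'i set \<Rightarrow> ('i \<Rightarrow> real) \<Rightarrow> ('i \<Rightarrow> real) \<Rightarrow> ('i \<Rightarrow> real) \<Rightarrow> (real \<Rightarrow> real) \<Rightarrow> real \<Rightarrow> real" where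
  "gamma_B I p c d \<tau>2 q =
     (THE s. (\<Sum>i\<in>I. p i powr q * d i powr \<tau>2 q * c i powr (s - \<tau>2 q)) = 1)"

end

theory Submission
 imports Defs "HOL-Probability.Probability" "HOL-Library.Sublist"
begin

text \<open>
 The \<open>L\<^sup>q\<close>-spectra are read off mesh moments \<open>\<Sum>Q. \<mu> Q powr q\<close>. On the line, moments of a self-similar
 measure are sub- or supermultiplicative up to constants (group the words of a cut by position), so
 they have exact growth exponents, and these agree with the exponents of the ball integrals.

 In the plane, cut words where the short side of \<open>S w (R)\<close> reaches \<open>\<delta>\<close>. By the rectangular open set
 condition a cell meets boundedly many such rectangles, and in each of them only the long coordinate
 is resolved, so planar moments are comparable to \<open>\<delta> powr (-s)\<close> times the sum of \<open>psi\<close> over the cut.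
 For \<open>q = 0\<close>, counting rectangles with prescribed sides gives \<open>\<Sum>i. c i powr \<tau>1 0 * d i powr \<tau>2 0 \<le> 1\<close>;
 hence \<open>\<gamma>A 0\<close> and \<open>\<gamma>B 0\<close> do not exceed \<open>\<tau>1 0 + \<tau>2 0\<close>, where \<open>psi\<close> is the maximum of the two multiplicative
 weights behind \<open>\<gamma>A\<close> and \<open>\<gamma>B\<close>. Moment bounds on both sides of \<open>q = 1\<close> with a common slope control the
 local dimension almost everywhere and the entropy. Near \<open>q = 1\<close>, \<open>psi\<close> is the maximum or the minimum
 of the two weights according to the sign of \<open>s - \<tau>1 q - \<tau>2 q\<close>; a variance bound shows that the
 minimum loses nothing to first order.
\<close>

text \<open>Growth rates are known only as exponents: a power bound with a uniform constant is
  available for each exponent strictly beyond \<open>\<tau>1 q\<close> or \<open>\<tau>2 q\<close>,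
  not for the spectrum itself. The planar estimates are therefore stated for constants
  \<open>t\<close>, \<open>t'\<close> in place of the spectra, and strict inequalities around the
  roots leave room for this perturbation. Near \<open>q = 1\<close> the planar spectrum is never
  computed. Upper bounds for planar moments suffice: for \<open>q > 1\<close> they bound local
  dimensions from below, for \<open>q < 1\<close> from above. Lower planar bounds occur only at
  \<open>q = 0\<close>. The derivative of \<open>gamma\<close> is obtained separately from the
  pressure, and the two computations meet in the same explicit slope. Which slope it is depends on
  the Lyapunov exponents: with \<open>X = - h - t1 * \<chi>1 - t2 * \<chi>2\<close>, the slopes of
  \<open>\<gamma>A\<close> and \<open>\<gamma>B\<close> at 1 are
  \<open>t1 + t2 + X / \<chi>2\<close> and \<open>t1 + t2 + X / \<chi>1\<close>. They lie on the
  same side of \<open>t1 + t2\<close>, so one of the two alternatives of the theorem always applies,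
  and the slope with the larger denominator is the derivative.\<close>

section \<open>Counting integers, and Jensen inequalities for powers\<close>

lemma card_int_window:
 fixes X :: "int set"
 assumes "\<And>j. j \<in> X \<Longrightarrow> \<bar>of_int j - z\<bar> \<le> (L::real)" "0 \<le> L"
 shows "finite X" "real (card X) \<le> 2 * L + 1"
proof -
 have sub: "X \<subseteq> {\<lceil>z - L\<rceil>..\<lfloor>z + L\<rfloor>}"
 proof
  fix j assume "j \<in> X"
  then have "\<bar>of_int j - z\<bar> \<le> L" using assms by blast
  then have "z - L \<le> of_int j" "of_int j \<le> z + L" by linarith+
  then show "j \<in> {\<lceil>z - L\<rceil>..\<lfloor>z + L\<rfloor>}" by (simp add: ceiling_le_iff le_floor_iff)
 qed
 then show "finite X" by (rule finite_subset) simp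
 have "card X \<le> card {\<lceil>z - L\<rceil>..\<lfloor>z + L\<rfloor>}" by (intro card_mono sub) simp
 also have "\<dots> = nat (\<lfloor>z + L\<rfloor> - \<lceil>z - L\<rceil> + 1)" by simp
 finally have "real (card X) \<le> real (nat (\<lfloor>z + L\<rfloor> - \<lceil>z - L\<rceil> + 1))" by simp
 also have "\<dots> \<le> max 0 (of_int (\<lfloor>z + L\<rfloor> - \<lceil>z - L\<rceil> + 1))" by simp
 also have "\<dots> \<le> 2 * L + 1" using assms(2) by linarith
 finally show "real (card X) \<le> 2 * L + 1" .
qed

text \<open>The sum is at most \<open>m\<close> times its largest term, and the q-th power of that
  term already occurs on the right. At \<open>q = 0\<close> the right side counts positive terms,
  since \<open>0 powr 0 = 0\<close>.\<close>

lemma powr_sum_le: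
 fixes g :: "'a \<Rightarrow> real"
 assumes "finite N" "real (card N) \<le> m" "0 \<le> q" "\<And>n. n \<in> N \<Longrightarrow> 0 \<le> g n"
 shows "(\<Sum>n\<in>N. g n) powr q \<le> m powr q * (\<Sum>n\<in>N. g n powr q)"
proof (cases "N = {}")
 case False
 define M where "M = Max (g ` N)"
 have "M \<in> g ` N" unfolding M_def using False assms(1) by (intro Max_in) auto
 then obtain n0 where n0: "n0 \<in> N" "g n0 = M" by auto
 have gM: "g n \<le> M" if "n \<in> N" for n using that assms(1) by (auto simp: M_def)
 have m0: "0 \<le> m" using assms(2) of_nat_0_le_iff order_trans by blast
 have "(\<Sum>n\<in>N. g n) \<le> real (card N) * M" using sum_bounded_above[of N g M] gM by simp
 also have "\<dots> \<le> m * M" using assms n0 by (intro mult_right_mono) auto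
 finally have "(\<Sum>n\<in>N. g n) powr q \<le> (m * M) powr q"
  using assms by (intro powr_mono2 sum_nonneg) auto
 also have "\<dots> = m powr q * g n0 powr q"
  using n0 assms m0 by (subst powr_mult) auto
 also have "\<dots> \<le> m powr q * (\<Sum>n\<in>N. g n powr q)"
  using n0 assms(1) by (intro mult_left_mono member_le_sum) auto
 finally show ?thesis .
qed simp

text \<open>Source of most comparisons of moments below: two families of masses are linked by a
  relation in which each index has at most \<open>m\<close> partners on one side and at most
  \<open>m'\<close> on the other. After \<open>powr_sum_le\<close>, exchanging the double sum counts
  each \<open>g n powr q\<close> at most \<open>m'\<close> times.\<close>

lemma moment_compare:
 fixes e :: "'j \<Rightarrow> real" and g :: "'n \<Rightarrow> real"
 assumes "finite A" "finite B" "0 \<le> q"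
  and N: "\<And>j. j \<in> A \<Longrightarrow> N j \<subseteq> B" "\<And>j. j \<in> A \<Longrightarrow> real (card (N j)) \<le> m"
  and N': "\<And>n. n \<in> B \<Longrightarrow> real (card {j \<in> A. n \<in> N j}) \<le> m'"
  and g: "\<And>n. n \<in> B \<Longrightarrow> 0 \<le> g n"
  and e: "\<And>j. j \<in> A \<Longrightarrow> 0 \<le> e j" "\<And>j. j \<in> A \<Longrightarrow> e j \<le> (\<Sum>n\<in>N j. g n)"
 shows "(\<Sum>j\<in>A. e j powr q) \<le> m powr q * m' * (\<Sum>n\<in>B. g n powr q)"
proof -
 have "(\<Sum>j\<in>A. e j powr q) \<le> (\<Sum>j\<in>A. m powr q * (\<Sum>n\<in>N j. g n powr q))"
 proof (rule sum_mono)
  fix j assume j: "j \<in> A"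
  have "e j powr q \<le> (\<Sum>n\<in>N j. g n) powr q"
   using e j assms(3) by (intro powr_mono2) auto
  also have "\<dots> \<le> m powr q * (\<Sum>n\<in>N j. g n powr q)"
   using N[OF j] g assms by (intro powr_sum_le) (auto intro: finite_subset)
  finally show "e j powr q \<le> m powr q * (\<Sum>n\<in>N j. g n powr q)" .
 qed
 also have "\<dots> = m powr q * (\<Sum>j\<in>A. \<Sum>n\<in>N j. g n powr q)"
  by (simp add: sum_distrib_left)
 also have "(\<Sum>j\<in>A. \<Sum>n\<in>N j. g n powr q) = (\<Sum>j\<in>A. \<Sum>n\<in>{n\<in>B. n \<in> N j}. g n powr q)"
  using N(1) by (intro sum.cong refl) blast+
 also have "\<dots> = (\<Sum>n\<in>B. \<Sum>j\<in>{j\<in>A. n \<in> N j}. g n powr q)"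
  by (rule sum.swap_restrict) fact+
 also have "\<dots> = (\<Sum>n\<in>B. real (card {j\<in>A. n \<in> N j}) * g n powr q)" by simp
 also have "\<dots> \<le> (\<Sum>n\<in>B. m' * g n powr q)"
  using N' by (intro sum_mono mult_right_mono) auto
 also have "\<dots> = m' * (\<Sum>n\<in>B. g n powr q)" by (simp add: sum_distrib_left)
 finally show ?thesis by (simp add: mult.assoc mult_left_mono)
qed

lemma powr_le_tangent:
 fixes y q :: real
 assumes "0 \<le> y" "0 \<le> q" "q \<le> 1"
 shows "y powr q \<le> 1 + q * (y - 1)"
proof (cases "y = 0")
 case False
 then show ?thesis
  using Youngs_inequality_0[of q "1 - q" y 1] assms by (simp add: algebra_simps)
qed (use assms in auto)

text \<open>Follows from the concave case with exponent \<open>1 / q\<close> at the point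
  \<open>y powr q\<close>.\<close>

lemma powr_ge_tangent:
 fixes y q :: real
 assumes "0 \<le> y" "1 \<le> q"
 shows "1 + q * (y - 1) \<le> y powr q"
proof -
 have "(y powr q) powr (1 / q) \<le> 1 + (1 / q) * (y powr q - 1)"
  using assms by (intro powr_le_tangent) auto
 then have "y \<le> 1 + (1 / q) * (y powr q - 1)" using assms by (simp add: powr_powr)
 then show ?thesis using assms by (simp add: field_simps)
qed

text \<open>Jensen's inequality for weights of arbitrary total, in convex and concave form. Both
  come from the tangent at the mean \<open>m\<close>: the weighted sum of the tangent values is the
  total weight \<open>P\<close>.\<close>

lemma powr_weighted_sum:
 fixes x w :: "'a \<Rightarrow> real"
 assumes "finite W" "\<And>a. a \<in> W \<Longrightarrow> 0 \<le> x a" "\<And>a. a \<in> W \<Longrightarrow> 0 < w a"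
 shows "1 \<le> q \<Longrightarrow> (\<Sum>a\<in>W. w a * x a) powr q
      \<le> (\<Sum>a\<in>W. w a) powr (q - 1) * (\<Sum>a\<in>W. w a * x a powr q)" (is "_ \<Longrightarrow> ?G1")
  and "0 \<le> q \<Longrightarrow> q \<le> 1 \<Longrightarrow> (\<Sum>a\<in>W. w a) powr (q - 1) * (\<Sum>a\<in>W. w a * x a powr q)
      \<le> (\<Sum>a\<in>W. w a * x a) powr q" (is "_ \<Longrightarrow> _ \<Longrightarrow> ?G2")
proof -
 define P where "P = (\<Sum>a\<in>W. w a)"
 define X where "X = (\<Sum>a\<in>W. w a * x a)"
 have *: "(1 \<le> q \<longrightarrow> ?G1) \<and> (0 \<le> q \<and> q \<le> 1 \<longrightarrow> ?G2)"
 proof (cases "X = 0")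
  case True
  then have "\<forall>a\<in>W. w a * x a = 0"
   using assms unfolding X_def by (subst (asm) sum_nonneg_eq_0_iff) (auto simp: less_imp_le)
  then have "\<forall>a\<in>W. x a = 0" using assms(3) by fastforce
  then show ?thesis by simp
 next
  case False
  have "X \<ge> 0" using assms unfolding X_def by (intro sum_nonneg) (auto simp: less_imp_le)
  then have X: "X > 0" using False by simp
  have "W \<noteq> {}" using False by (auto simp: X_def)
  then have P: "P > 0" unfolding P_def using assms by (intro sum_pos) auto
  define m where "m = X / P"
  have m: "m > 0" using X P by (simp add: m_def)
  have s: "(\<Sum>a\<in>W. w a * (1 + q * (x a / m - 1))) = P"
  proof -
   have "(\<Sum>a\<in>W. w a * (1 + q * (x a / m - 1))) = (\<Sum>a\<in>W. (1 - q) * w a + (q / m) * (w a * x a))"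
    by (intro sum.cong refl) (simp add: algebra_simps)
   also have "\<dots> = (1 - q) * P + (q / m) * X"
    by (simp add: sum.distrib sum_distrib_left P_def X_def)
   also have "\<dots> = P" using X P by (simp add: m_def field_simps)
   finally show ?thesis .
  qed
  have t: "(\<Sum>a\<in>W. w a * (x a / m) powr q) = (\<Sum>a\<in>W. w a * x a powr q) / m powr q"
   using m assms by (simp add: powr_divide sum_divide_distrib)
  have e: "P powr (q - 1) * m powr q = X powr q / P"
   using X P by (simp add: m_def powr_divide powr_diff)
  show ?thesis
  proof (intro conjI impI)
   assume q: "1 \<le> q"
   have "P \<le> (\<Sum>a\<in>W. w a * (x a / m) powr q)"
    unfolding s[symmetric] using q m assms
    by (intro sum_mono mult_left_mono powr_ge_tangent) (auto simp: less_imp_le)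
   then have "P * m powr q \<le> (\<Sum>a\<in>W. w a * x a powr q)" using m by (simp add: t field_simps)
   then have "P powr (q - 1) * (P * m powr q) \<le> P powr (q - 1) * (\<Sum>a\<in>W. w a * x a powr q)"
    by (intro mult_left_mono) auto
   moreover have "P powr (q - 1) * (P * m powr q) = X powr q"
    using e P by (simp add: field_simps)
   ultimately show ?G1 by (simp add: X_def P_def)
  next
   assume q: "0 \<le> q \<and> q \<le> 1"
   have "P \<ge> (\<Sum>a\<in>W. w a * (x a / m) powr q)"
    unfolding s[symmetric] using q m assms
    by (intro sum_mono mult_left_mono powr_le_tangent) (auto simp: less_imp_le)
   then have "P * m powr q \<ge> (\<Sum>a\<in>W. w a * x a powr q)" using m by (simp add: t field_simps)
   then have "P powr (q - 1) * (P * m powr q) \<ge> P powr (q - 1) * (\<Sum>a\<in>W. w a * x a powr q)"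
    by (intro mult_left_mono) auto
   moreover have "P powr (q - 1) * (P * m powr q) = X powr q"
    using e P by (simp add: field_simps)
   ultimately show ?G2 by (simp add: X_def P_def)
  qed
 qed
 show "1 \<le> q \<Longrightarrow> ?G1" "0 \<le> q \<Longrightarrow> q \<le> 1 \<Longrightarrow> ?G2" using * by auto
qed

subsection \<open>Words and cut sets\<close>

text \<open>The first letter acts last, so appending a letter at the end passes to a subpiece of the
  image of an invariant set.\<close>

fun wmap :: "('i \<Rightarrow> 'a \<Rightarrow> 'a) \<Rightarrow> 'i list \<Rightarrow> 'a \<Rightarrow> 'a" where
 "wmap S [] = id"
| "wmap S (i # w) = S i \<circ> wmap S w"

lemma wmap_append: "wmap S (v @ w) = wmap S v \<circ> wmap S w"
 by (induction v) (auto simp: fun_eq_iff)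

lemma word_prod_simps [simp]:
 "word_prod f [] = 1" "word_prod f (i # w) = f i * word_prod f w"
 "word_prod f (v @ w) = word_prod f v * word_prod f w"
 by (simp_all add: word_prod_def)

lemma word_prod_pos: "(\<And>i. i \<in> I \<Longrightarrow> 0 < f i) \<Longrightarrow> set w \<subseteq> I \<Longrightarrow> 0 < word_prod f w"
 by (induction w) auto

lemma word_prod_le:
 "(\<And>i. i \<in> I \<Longrightarrow> 0 < f i \<and> f i \<le> \<rho>) \<Longrightarrow> set w \<subseteq> I \<Longrightarrow> word_prod f w \<le> \<rho> ^ length w"
proof (induction w)
 case (Cons i w)
 then have "f i * word_prod f w \<le> \<rho> * \<rho> ^ length w"
  by (intro mult_mono) (auto simp: less_imp_le word_prod_pos[of I] intro: order_trans[of 0 "f i"])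
 then show ?case by simp
qed simp

lemma word_prod_ge:
 "(\<And>i. i \<in> I \<Longrightarrow> 0 < \<rho> \<and> \<rho> \<le> f i) \<Longrightarrow> set w \<subseteq> I \<Longrightarrow> \<rho> ^ length w \<le> word_prod f w"
proof (induction w)
 case (Cons i w)
 then have "0 < \<rho>" "\<rho> \<le> f i" "\<rho> ^ length w \<le> word_prod f w" by auto
 then have "\<rho> * \<rho> ^ length w \<le> f i * word_prod f w"
  by (intro mult_mono) auto
 then show ?case by simp
qed simp

lemma word_prod_mult: "word_prod (\<lambda>i. f i * g i) w = word_prod f w * word_prod g w"
 by (induction w) auto

lemma word_prod_powr:
 "(\<And>i. i \<in> I \<Longrightarrow> 0 < f i) \<Longrightarrow> set w \<subseteq> I \<Longrightarrow> word_prod (\<lambda>i. f i powr t) w = word_prod f w powr t"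
 by (induction w) (auto simp: powr_mult word_prod_pos less_imp_le)

lemma words_0 [simp]: "words I 0 = {[]}"
 by (auto simp: words_def)

lemma words_Suc: "words I (Suc k) = (\<lambda>(i, w). i # w) ` (I \<times> words I k)"
 by (auto simp: words_def length_Suc_conv image_iff)

lemma finite_words: "finite I \<Longrightarrow> finite (words I k)"
 by (induction k) (auto simp: words_Suc)

lemma sum_words_Suc: "(\<Sum>w\<in>words I (Suc k). h w) = (\<Sum>i\<in>I. \<Sum>w\<in>words I k. h (i # w))"
 by (simp add: words_Suc sum.reindex inj_on_def sum.cartesian_product case_prod_unfold)

lemma sum_word_prod: "(\<Sum>w\<in>words I k. word_prod g w) = (\<Sum>i\<in>I. g i :: real) ^ k"
 by (induction k) (auto simp: sum_words_Suc sum_distrib_left[symmetric] sum_distrib_right[symmetric])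

text \<open>\<open>Z\<close> consists of the words at which \<open>\<phi>\<close> first drops to \<open>\<delta>\<close>; completeness of \<open>Z\<close> is
 phrased through functions that are subadditive under one-letter extension, which covers both
 exact expansions (apply it to \<open>G\<close> and \<open>- G\<close>) and lower bounds.\<close>
definition is_cut :: "'i set \<Rightarrow> ('i list \<Rightarrow> real) \<Rightarrow> real \<Rightarrow> 'i list set \<Rightarrow> bool" where
 "is_cut I \<phi> \<delta> Z \<longleftrightarrow> finite Z \<and>
   (\<forall>w\<in>Z. set w \<subseteq> I \<and> \<phi> w \<le> \<delta> \<and> (\<forall>v z. w = v @ z \<longrightarrow> z \<noteq> [] \<longrightarrow> \<delta> < \<phi> v)) \<and>
   (\<forall>G :: 'i list \<Rightarrow> real. (\<forall>w. set w \<subseteq> I \<longrightarrow> G w \<le> (\<Sum>i\<in>I. G (w @ [i]))) \<longrightarrow> G [] \<le> sum G Z)"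

text \<open>Unfinished words are extended by one letter per round. An unfinished word of level
  \<open>n\<close> has length exactly \<open>n\<close>, so geometric decay of \<open>\<phi>\<close>
  ends the process, and the level reached is then a cut.\<close>

fun cut_level :: "'i set \<Rightarrow> ('i list \<Rightarrow> real) \<Rightarrow> real \<Rightarrow> nat \<Rightarrow> 'i list set" where
 "cut_level I \<phi> \<delta> 0 = {[]}"
| "cut_level I \<phi> \<delta> (Suc n) = {w \<in> cut_level I \<phi> \<delta> n. \<phi> w \<le> \<delta>} \<union>
   (\<lambda>(w, i). w @ [i]) ` ({w \<in> cut_level I \<phi> \<delta> n. \<delta> < \<phi> w} \<times> I)"

lemma cut_level_props:
 assumes "w \<in> cut_level I \<phi> \<delta> n"
 shows "set w \<subseteq> I \<and> length w \<le> n \<and> (\<phi> w \<le> \<delta> \<or> length w = n) \<and>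
   (\<forall>v z. w = v @ z \<longrightarrow> z \<noteq> [] \<longrightarrow> \<delta> < \<phi> v)"
 using assms
proof (induction n arbitrary: w)
 case (Suc n)
 from Suc.prems consider "w \<in> cut_level I \<phi> \<delta> n" "\<phi> w \<le> \<delta>"
  | u i where "w = u @ [i]" "u \<in> cut_level I \<phi> \<delta> n" "\<delta> < \<phi> u" "i \<in> I" by auto
 then show ?case
 proof cases
  case 1
  then show ?thesis using Suc.IH[of w] by auto
 next
  case 2
  have u: "set u \<subseteq> I" "length u = n" "\<forall>v z. u = v @ z \<longrightarrow> z \<noteq> [] \<longrightarrow> \<delta> < \<phi> v"
   using Suc.IH[OF 2(2)] 2(3) by auto
  have "\<delta> < \<phi> v" if "w = v @ z" "z \<noteq> []" for v z
  proof -
   from that 2(1) have "u = v @ butlast z"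
    by (metis butlast_append butlast_snoc)
   then show ?thesis using u(3) 2(3) by (cases "butlast z = []") auto
  qed
  then show ?thesis using u 2 by auto
 qed
qed simp

lemma finite_cut_level: "finite I \<Longrightarrow> finite (cut_level I \<phi> \<delta> n)"
 by (induction n) auto

lemma sum_cut_level:
 fixes G :: "'i list \<Rightarrow> real"
 assumes "finite I" "\<And>w. set w \<subseteq> I \<Longrightarrow> G w \<le> (\<Sum>i\<in>I. G (w @ [i]))"
 shows "G [] \<le> sum G (cut_level I \<phi> \<delta> n)"
proof (induction n)
 case (Suc n)
 let ?A = "{w \<in> cut_level I \<phi> \<delta> n. \<phi> w \<le> \<delta>}" and ?B = "{w \<in> cut_level I \<phi> \<delta> n. \<delta> < \<phi> w}"
 have fin: "finite (cut_level I \<phi> \<delta> n)" using assms finite_cut_level by blast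
 have "G [] \<le> sum G (cut_level I \<phi> \<delta> n)" by (rule Suc)
 also have "\<dots> = sum G ?A + sum G ?B"
  using fin by (subst sum.union_disjoint[symmetric]) (auto intro!: sum.cong)
 also have "sum G ?B \<le> (\<Sum>w\<in>?B. \<Sum>i\<in>I. G (w @ [i]))"
  using cut_level_props[of _ I \<phi> \<delta> n] by (intro sum_mono assms(2)) blast
 also have "\<dots> = sum G ((\<lambda>(w, i). w @ [i]) ` (?B \<times> I))"
  by (subst sum.reindex) (auto simp: inj_on_def sum.cartesian_product case_prod_unfold)
 also have "sum G ?A + \<dots> = sum G (cut_level I \<phi> \<delta> (Suc n))"
 proof -
  \<comment> \<open>Retained and extended words cannot coincide: an unfinished \<open>a\<close>
    already has length \<open>n\<close>, so \<open>a @ [b]\<close> is too long for level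
    \<open>n\<close>.\<close>
  have "?A \<inter> (\<lambda>(w, i). w @ [i]) ` (?B \<times> I) = {}"
  proof (rule ccontr)
   assume "\<not> ?thesis"
   then obtain a b where ab: "a @ [b] \<in> cut_level I \<phi> \<delta> n" "a \<in> cut_level I \<phi> \<delta> n" "\<delta> < \<phi> a"
    by auto
   have "length a = n" "length (a @ [b]) \<le> n"
    using cut_level_props[OF ab(1)] cut_level_props[OF ab(2)] ab(3) by auto
   then show False by simp
  qed
  then show ?thesis using fin assms(1) by (simp add: sum.union_disjoint)
 qed
 finally show ?case by simp
qed simp

lemma cut_exists:
 assumes "finite I" "\<And>w. set w \<subseteq> I \<Longrightarrow> \<phi> w \<le> \<rho> ^ length w" "0 \<le> \<rho>" "\<rho> < 1" "0 < \<delta>"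
 shows "\<exists>Z. is_cut I \<phi> \<delta> Z"
proof -
 obtain n where n: "\<rho> ^ n < \<delta>" using assms real_arch_pow_inv by blast
 have "is_cut I \<phi> \<delta> (cut_level I \<phi> \<delta> n)"
  unfolding is_cut_def
 proof (intro conjI ballI allI impI)
  fix w assume w: "w \<in> cut_level I \<phi> \<delta> n"
  note p = cut_level_props[OF w]
  show "set w \<subseteq> I" using p by blast
  show "\<phi> w \<le> \<delta>" using p assms(2)[of w] n by (cases "\<phi> w \<le> \<delta>") auto
 next
  fix w v z assume w: "w \<in> cut_level I \<phi> \<delta> n" "w = v @ z" "z \<noteq> []"
  then show "\<delta> < \<phi> v" using cut_level_props[OF w(1)] by blast
 next
  fix G :: "'a list \<Rightarrow> real"
  assume "\<forall>w. set w \<subseteq> I \<longrightarrow> G w \<le> (\<Sum>i\<in>I. G (w @ [i]))"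
  then show "G [] \<le> sum G (cut_level I \<phi> \<delta> n)"
   using assms(1) by (intro sum_cut_level) auto
 qed (use assms finite_cut_level in blast)
 then show ?thesis by blast
qed

lemma cut_sum:
 assumes "is_cut I \<phi> \<delta> Z" "\<And>w. set w \<subseteq> I \<Longrightarrow> G w = (\<Sum>i\<in>I. G (w @ [i]) :: real)"
 shows "sum G Z = G []"
proof (rule antisym)
 have *: "\<forall>H :: 'a list \<Rightarrow> real. (\<forall>w. set w \<subseteq> I \<longrightarrow> H w \<le> (\<Sum>i\<in>I. H (w @ [i]))) \<longrightarrow> H [] \<le> sum H Z"
  using assms(1) unfolding is_cut_def by blast
 from *[rule_format, of "\<lambda>w. - G w"] show "sum G Z \<le> G []"
  using assms(2) by (simp add: sum_negf)
 from *[rule_format, of G] show "G [] \<le> sum G Z" using assms(2) by simp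
qed

lemma cut_word:
 assumes "is_cut I \<phi> \<delta> Z" "w \<in> Z"
 shows "set w \<subseteq> I" "\<phi> w \<le> \<delta>" "w = v @ z \<Longrightarrow> z \<noteq> [] \<Longrightarrow> \<delta> < \<phi> v"
 using assms unfolding is_cut_def by blast+

text \<open>\<open>\<phi>\<close> exceeds \<delta> on proper prefixes and is at most \<delta> on the
  cut, so no word is a prefix of another. The first differing letter is what the open set condition
  acts on.\<close>

lemma cut_incomparable:
 assumes "is_cut I \<phi> \<delta> Z" "w \<in> Z" "w' \<in> Z" "w \<noteq> w'"
 obtains u a b v v' where "w = u @ a # v" "w' = u @ b # v'" "a \<noteq> b" "set u \<subseteq> I" "a \<in> I" "b \<in> I"
  "set v \<subseteq> I" "set v' \<subseteq> I"
proof -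
 have *: "\<not> prefix x y" if xy: "x \<in> Z" "y \<in> Z" "x \<noteq> y" for x y
 proof
  assume "prefix x y"
  then obtain z where "y = x @ z" "z \<noteq> []" using xy(3) unfolding prefix_def by fastforce
  then show False using cut_word(3)[OF assms(1) xy(2)] cut_word(2)[OF assms(1) xy(1)] by fastforce
 qed
 have "w \<parallel> w'" using *[OF assms(2,3,4)] *[OF assms(3,2)] assms(4) by (auto simp: parallel_def)
 then obtain as b bs c cs where "b \<noteq> c" "w = as @ b # bs" "w' = as @ c # cs"
  using parallel_decomp by blast
 moreover have "set w \<subseteq> I" "set w' \<subseteq> I" using assms unfolding is_cut_def by auto
 ultimately show ?thesis using that by auto
qed

text \<open>The last letter overshoots the threshold by at most the factor \<open>\<kappa>\<close>.
  The empty word has no last letter and is covered by \<open>\<phi> [] = 1\<close> and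
  \<open>\<delta> \<le> 1\<close>.\<close>

lemma cut_lower:
 assumes "is_cut I \<phi> \<delta> Z" "w \<in> Z" "\<phi> [] = 1" "\<delta> \<le> 1" "0 \<le> \<kappa>" "\<kappa> \<le> 1"
  and "\<And>v i. set v \<subseteq> I \<Longrightarrow> i \<in> I \<Longrightarrow> \<kappa> * \<phi> v \<le> \<phi> (v @ [i])"
 shows "\<kappa> * \<delta> \<le> \<phi> w"
proof (cases w rule: rev_cases)
 case Nil
 show ?thesis
 proof (cases "0 \<le> \<delta>")
  case True
  then show ?thesis using assms Nil by (simp add: mult_le_one)
 next
  case False
  then have "\<kappa> * \<delta> \<le> 0" using assms(5) by (simp add: mult_nonneg_nonpos)
  then show ?thesis using assms Nil by simp
 qed
next
 case (snoc v i)
 then have "\<delta> < \<phi> v" "set v \<subseteq> I" "i \<in> I" using cut_word(3)[OF assms(1,2), of v "[i]"] cut_word(1)[OF assms(1,2)] by auto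
 then have "\<kappa> * \<delta> \<le> \<kappa> * \<phi> v" using assms(5) by (intro mult_left_mono) auto
 then show ?thesis using assms(7)[of v i] snoc \<open>set v \<subseteq> I\<close> \<open>i \<in> I\<close> by auto
qed

lemma wmap_measurable:
 assumes "\<And>i. i \<in> I \<Longrightarrow> S i \<in> borel_measurable borel" "set w \<subseteq> I"
 shows "wmap S w \<in> borel_measurable borel"
 using assms(2)
proof (induction w)
 case (Cons i w)
 then have "wmap S w \<in> borel_measurable borel" "S i \<in> borel_measurable borel" using assms(1) by auto
 then show ?case by (simp only: wmap.simps) (rule measurable_comp)
qed (simp add: id_def)

lemma vimage_borel: "f \<in> borel_measurable borel \<Longrightarrow> A \<in> sets borel \<Longrightarrow> f -` A \<in> sets borel"
 using measurable_sets[of f borel borel A] by simp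

text \<open>The mass that \<open>w\<close> contributes to \<open>A\<close> is additive under
  one-letter extension by self-similarity, so completeness of the cut gives the expansion.\<close>

lemma measure_cut:
 fixes M :: "'a::topological_space measure"
 assumes "is_cut I \<phi> \<delta> Z" "A \<in> sets borel"
  and S: "\<And>i. i \<in> I \<Longrightarrow> S i \<in> borel_measurable borel"
  and M: "\<And>A. A \<in> sets borel \<Longrightarrow> measure M A = (\<Sum>i\<in>I. p i * measure M (S i -` A))"
 shows "measure M A = (\<Sum>w\<in>Z. word_prod p w * measure M (wmap S w -` A))"
proof -
 let ?G = "\<lambda>w. word_prod p w * measure M (wmap S w -` A)"
 have "sum ?G Z = ?G []"
 proof (rule cut_sum[OF assms(1)])
  fix w assume w: "set w \<subseteq> I"
  have "measure M (wmap S w -` A) = (\<Sum>i\<in>I. p i * measure M (S i -` (wmap S w -` A)))"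
   using wmap_measurable[of I S w, OF S w] assms(2) by (intro M vimage_borel)
  then show "?G w = (\<Sum>i\<in>I. ?G (w @ [i]))"
   by (simp add: sum_distrib_left wmap_append vimage_comp mult.assoc)
 qed
 then show ?thesis by simp
qed

subsection \<open>Growth exponents\<close>

text \<open>More than convergence of \<open>ln (f \<delta>) / (- ln \<delta>)\<close>: the bounds
  hold on all of \<open>{0<..1}\<close> with one constant per exponent, the form in which later
  estimates use them. The second clause also forces \<open>f\<close> to be positive there.\<close>

definition has_growth :: "(real \<Rightarrow> real) \<Rightarrow> real \<Rightarrow> bool" where
 "has_growth f s \<longleftrightarrow>
   (\<forall>t>s. \<exists>C>0. \<forall>\<delta>\<in>{0<..1}. f \<delta> \<le> C * \<delta> powr (- t)) \<and>
   (\<forall>t<s. \<exists>C>0. \<forall>\<delta>\<in>{0<..1}. C * \<delta> powr (- t) \<le> f \<delta>)"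

lemma has_growthD:
 assumes "has_growth f s"
 shows "s < t \<Longrightarrow> \<exists>C>0. \<forall>\<delta>\<in>{0<..1}. f \<delta> \<le> C * \<delta> powr (- t)"
  and "t < s \<Longrightarrow> \<exists>C>0. \<forall>\<delta>\<in>{0<..1}. C * \<delta> powr (- t) \<le> f \<delta>"
 using assms unfolding has_growth_def by blast+

lemma eventually_ln_small:
 assumes "0 < (e::real)"
 shows "eventually (\<lambda>\<delta>. \<delta> \<in> {0<..1} \<and> 0 < - ln \<delta> \<and> C \<le> e * (- ln \<delta>)) (at_right 0)"
proof -
 define r where "r = min (1 / 2) (exp (- (C / e)))"
 have r: "r > 0" by (simp add: r_def)
 have "eventually (\<lambda>\<delta>::real. 0 < \<delta> \<and> \<delta> < r) (at_right 0)"
  using r by (auto simp: eventually_at_right)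
 then show ?thesis
 proof eventually_elim
  case (elim \<delta>)
  then have d: "0 < \<delta>" "\<delta> < 1" "\<delta> \<le> exp (- (C / e))" by (auto simp: r_def)
  then have "ln \<delta> \<le> - (C / e)" by (metis exp_gt_zero ln_exp ln_le_cancel_iff)
  then have "C \<le> e * (- ln \<delta>)" using assms by (simp add: field_simps)
  then show ?case using d by auto
 qed
qed

text \<open>A factor \<open>\<delta> powr (-\<epsilon>)\<close> with arbitrarily small \<epsilon>
  does not change the exponent. This tolerance serves the case \<open>q < 1\<close>, where ball
  integrals and moments are compared only up to a logarithmic factor.\<close>

lemma growth_sandwich:
 assumes f: "has_growth f s"
  and g: "\<And>\<epsilon>. 0 < \<epsilon> \<Longrightarrow> \<exists>C>0. eventually (\<lambda>\<delta>. g \<delta> \<le> C * \<delta> powr (-\<epsilon>) * f \<delta> \<and>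
    f \<delta> \<le> C * \<delta> powr (-\<epsilon>) * g \<delta>) (at_right 0)"
 shows "((\<lambda>\<delta>. ln (g \<delta>) / (- ln \<delta>)) \<longlongrightarrow> s) (at_right 0)"
proof (rule tendstoI)
 fix e :: real assume e: "0 < e"
 define \<epsilon> where "\<epsilon> = e / 4"
 have \<epsilon>: "\<epsilon> > 0" using e by (simp add: \<epsilon>_def)
 obtain C where C: "C > 0" "eventually (\<lambda>\<delta>. g \<delta> \<le> C * \<delta> powr (-\<epsilon>) * f \<delta> \<and>
    f \<delta> \<le> C * \<delta> powr (-\<epsilon>) * g \<delta>) (at_right 0)" using g[OF \<epsilon>] by blast
 obtain C1 where C1: "C1 > 0" "\<forall>\<delta>\<in>{0<..1}. f \<delta> \<le> C1 * \<delta> powr (- (s + \<epsilon>))"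
  using has_growthD(1)[OF f, of "s + \<epsilon>"] \<epsilon> by auto
 obtain C2 where C2: "C2 > 0" "\<forall>\<delta>\<in>{0<..1}. C2 * \<delta> powr (- (s - \<epsilon>)) \<le> f \<delta>"
  using has_growthD(2)[OF f, of "s - \<epsilon>"] \<epsilon> by auto
 have ev1: "eventually (\<lambda>\<delta>. \<delta> \<in> {0<..1} \<and> 0 < - ln \<delta> \<and> ln (C * C1) \<le> \<epsilon> * (- ln \<delta>)) (at_right 0)"
  by (rule eventually_ln_small[OF \<epsilon>])
 have ev2: "eventually (\<lambda>\<delta>. \<delta> \<in> {0<..1} \<and> 0 < - ln \<delta> \<and> - ln (C2 / C) \<le> \<epsilon> * (- ln \<delta>)) (at_right 0)"
  by (rule eventually_ln_small[OF \<epsilon>])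
 show "eventually (\<lambda>\<delta>. dist (ln (g \<delta>) / (- ln \<delta>)) s < e) (at_right 0)"
  using C(2) ev1 ev2
 proof eventually_elim
  case (elim \<delta>)
  then have d: "0 < \<delta>" "\<delta> \<le> 1" and l: "0 < - ln \<delta>" by auto
  have "g \<delta> \<le> C * \<delta> powr (-\<epsilon>) * f \<delta>" using elim by simp
  also have "\<dots> \<le> C * \<delta> powr (-\<epsilon>) * (C1 * \<delta> powr (- (s + \<epsilon>)))"
   using C1 C d by (intro mult_left_mono) auto
  also have "\<dots> = (C * C1) * (\<delta> powr (-\<epsilon>) * \<delta> powr (- (s + \<epsilon>)))" by simp
  also have "\<delta> powr (-\<epsilon>) * \<delta> powr (- (s + \<epsilon>)) = \<delta> powr (- (s + 2 * \<epsilon>))"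
   by (subst powr_add[symmetric]) (rule arg_cong[where f = "(powr) \<delta>"], simp)
  finally have up: "g \<delta> \<le> (C * C1) * \<delta> powr (- (s + 2 * \<epsilon>))" .
  have "C2 * \<delta> powr (- (s - \<epsilon>)) \<le> C * \<delta> powr (-\<epsilon>) * g \<delta>"
   using C2(2) elim d by (meson greaterThanAtMost_iff order_trans)
  then have h1: "(C2 * \<delta> powr (- (s - \<epsilon>))) * (\<delta> powr \<epsilon> / C) \<le> C * \<delta> powr (-\<epsilon>) * g \<delta> * (\<delta> powr \<epsilon> / C)"
   using C by (intro mult_right_mono) auto
  have h2: "C * \<delta> powr (-\<epsilon>) * g \<delta> * (\<delta> powr \<epsilon> / C) = g \<delta>"
   using C d by (simp add: powr_minus field_simps)
  have h3: "(C2 * \<delta> powr (- (s - \<epsilon>))) * (\<delta> powr \<epsilon> / C) = (C2 / C) * \<delta> powr (- (s - 2 * \<epsilon>))"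
  proof -
   have "\<delta> powr (- (s - \<epsilon>)) * \<delta> powr \<epsilon> = \<delta> powr (- (s - 2 * \<epsilon>))"
    by (subst powr_add[symmetric]) (rule arg_cong[where f = "(powr) \<delta>"], simp)
   then show ?thesis by simp
  qed
  have lo: "(C2 / C) * \<delta> powr (- (s - 2 * \<epsilon>)) \<le> g \<delta>" using h1 unfolding h2 h3 .
  have pos: "0 < g \<delta>" using less_le_trans[OF _ lo, of 0] C C2 d by simp
  have "ln (g \<delta>) \<le> ln ((C * C1) * \<delta> powr (- (s + 2 * \<epsilon>)))" using up pos d C C1 by (subst ln_le_cancel_iff) auto
  also have "\<dots> = ln (C * C1) + (s + 2 * \<epsilon>) * (- ln \<delta>)" using C C1 d by (subst ln_mult_pos) (auto simp: ln_powr algebra_simps)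
  also have "\<dots> \<le> (s + 3 * \<epsilon>) * (- ln \<delta>)" using elim by (simp add: algebra_simps)
  finally have 1: "ln (g \<delta>) / (- ln \<delta>) \<le> s + 3 * \<epsilon>" unfolding pos_divide_le_eq[OF l] .
  have "(s - 3 * \<epsilon>) * (- ln \<delta>) \<le> ln (C2 / C) + (s - 2 * \<epsilon>) * (- ln \<delta>)" using elim by (simp add: algebra_simps)
  also have "\<dots> = ln ((C2 / C) * \<delta> powr (- (s - 2 * \<epsilon>)))" using C C2 d by (subst ln_mult_pos) (auto simp: ln_powr algebra_simps)
  also have "\<dots> \<le> ln (g \<delta>)" using lo pos d C C2 by (subst ln_le_cancel_iff) auto
  finally have 2: "s - 3 * \<epsilon> \<le> ln (g \<delta>) / (- ln \<delta>)" unfolding pos_le_divide_eq[OF l] .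
  have "\<bar>ln (g \<delta>) / (- ln \<delta>) - s\<bar> \<le> 3 * \<epsilon>" using 1 2 by linarith
  then show ?case using e by (simp add: dist_real_def \<epsilon>_def)
 qed
qed

lemma dyadic_floor:
 assumes "0 < (\<delta>::real)" "\<delta> \<le> 1"
 obtains n :: nat where "(1/2) ^ Suc n < \<delta>" "\<delta> \<le> (1/2) ^ n"
proof -
 obtain m where m: "(1/2) ^ m < \<delta>" using real_arch_pow_inv[of \<delta> "1/2"] assms by auto
 define n where "n = (LEAST m. (1/2) ^ m < \<delta>)"
 have n: "(1/2) ^ n < \<delta>" unfolding n_def using m by (rule LeastI)
 have "n \<noteq> 0" using n assms by (intro notI) simp
 then obtain k where k: "n = Suc k" by (cases n) auto
 have "\<not> (1/2) ^ k < \<delta>" using not_less_Least[of k "\<lambda>m. (1/2) ^ m < \<delta>"] k by (simp add: n_def)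
 then show ?thesis using that[of k] n k by auto
qed

lemma powr_ratio_bound:
 assumes "0 < (x::real)" "x \<le> y" "y \<le> K * x" "1 \<le> K"
 shows "x powr t \<le> K powr \<bar>t\<bar> * y powr t" "y powr t \<le> K powr \<bar>t\<bar> * x powr t"
proof -
 have y: "0 < y" using assms by linarith
 show "x powr t \<le> K powr \<bar>t\<bar> * y powr t"
 proof (cases "t \<ge> 0")
  case True
  have "x powr t \<le> 1 * y powr t" using assms True by (simp add: powr_mono2)
  also have "\<dots> \<le> K powr \<bar>t\<bar> * y powr t" using assms by (intro mult_right_mono ge_one_powr_ge_zero) auto
  finally show ?thesis .
 next
  case False
  have "(K * x) powr t \<le> y powr t" using assms False y by (intro powr_mono2') auto
  then have "K powr t * x powr t \<le> y powr t" using assms by (simp add: powr_mult)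
  then have "K powr (-t) * (K powr t * x powr t) \<le> K powr (-t) * y powr t" by (intro mult_left_mono) auto
  then show ?thesis using False assms by (simp add: powr_minus field_simps)
 qed
 show "y powr t \<le> K powr \<bar>t\<bar> * x powr t"
 proof (cases "t \<ge> 0")
  case True
  have "y powr t \<le> (K * x) powr t" using assms True y by (intro powr_mono2) auto
  then show ?thesis using True assms by (simp add: powr_mult)
 next
  case False
  have "y powr t \<le> 1 * x powr t" using assms False by (simp add: powr_mono2')
  also have "\<dots> \<le> K powr \<bar>t\<bar> * x powr t" using assms by (intro mult_right_mono ge_one_powr_ge_zero) auto
  finally show ?thesis .
 qed
qed

lemma bounded_initial:
 fixes h :: "nat \<Rightarrow> real"
 assumes "eventually (\<lambda>n. h n \<le> 1) sequentially"
 shows "\<exists>C>0. \<forall>n. h n \<le> C"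
proof -
 obtain N where N: "\<forall>n\<ge>N. h n \<le> 1" using assms by (auto simp: eventually_sequentially)
 define C where "C = Max (insert 1 (h ` {..N}))"
 have "h n \<le> C" for n
 proof (cases "n \<le> N")
  case True
  then show ?thesis unfolding C_def by (intro Max_ge) auto
 next
  case False
  then have "h n \<le> 1" using N by auto
  also have "1 \<le> C" unfolding C_def by (intro Max_ge) auto
  finally show ?thesis .
 qed
 moreover have "1 \<le> C" unfolding C_def by (intro Max_ge) auto
 ultimately show ?thesis by (intro exI[of _ C]) auto
qed

text \<open>Dyadic scales suffice because \<open>f\<close> changes boundedly under halving. The
  scales before the limit takes hold go into the constant, and \<open>ln 2\<close> appears because
  \<open>- ln ((1/2) ^ n) = n * ln 2\<close>.\<close>

lemma growth_from_dyadic: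
 assumes pos: "\<And>\<delta>. \<delta> \<in> {0<..1} \<Longrightarrow> 0 < f \<delta>" and K: "1 \<le> K"
  and cmp: "\<And>\<delta> \<delta>'. 0 < \<delta> \<Longrightarrow> \<delta> \<le> \<delta>' \<Longrightarrow> \<delta>' \<le> 2 * \<delta> \<Longrightarrow> \<delta>' \<le> 1 \<Longrightarrow>
   f \<delta> \<le> K * f \<delta>' \<and> f \<delta>' \<le> K * f \<delta>"
  and lim: "(\<lambda>n. ln (f ((1/2) ^ n)) / real n) \<longlonglongrightarrow> L"
 shows "has_growth f (L / ln 2)"
 unfolding has_growth_def
proof (intro conjI allI impI)
 have p2: "((1/2) ^ n) powr (-t) = exp (real n * (t * ln 2))" for n :: nat and t :: real
  by (simp add: powr_def ln_realpow ln_div)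
 {
  fix t assume "L / ln 2 < t"
  then have "L < t * ln 2" by (simp add: divide_less_eq)
  then have "eventually (\<lambda>n. ln (f ((1/2) ^ n)) / real n < t * ln 2) sequentially"
   using lim by (rule order_tendstoD(2)[rotated])
  then have "eventually (\<lambda>n. f ((1/2) ^ n) / ((1/2) ^ n) powr (-t) \<le> 1) sequentially"
   using eventually_gt_at_top[of 0]
  proof eventually_elim
   case (elim n)
   have fp: "0 < f ((1/2) ^ n)" by (rule pos) (simp add: power_le_one)
   have "ln (f ((1/2) ^ n)) \<le> real n * (t * ln 2)" using elim by (simp add: field_simps)
   then have "f ((1/2) ^ n) \<le> exp (real n * (t * ln 2))" using fp by (metis exp_le_cancel_iff exp_ln)
   then show ?case by (simp add: p2)
  qed
  from bounded_initial[OF this] obtain C where C: "C > 0" "\<And>n. f ((1/2) ^ n) / ((1/2) ^ n) powr (-t) \<le> C"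
   by auto
  have "f \<delta> \<le> (K * C * 2 powr \<bar>t\<bar>) * \<delta> powr (-t)" if d: "\<delta> \<in> {0<..1}" for \<delta>
  proof -
   obtain n where n: "(1/2) ^ Suc n < \<delta>" "\<delta> \<le> (1/2::real) ^ n"
    using dyadic_floor[of \<delta>] d unfolding greaterThanAtMost_iff by blast
   have "f \<delta> \<le> K * f ((1/2) ^ n)" using cmp[of \<delta> "(1/2) ^ n"] n d by (auto simp: power_le_one)
   also have "f ((1/2) ^ n) \<le> C * ((1/2) ^ n) powr (-t)" using C(2)[of n] by (simp add: divide_le_eq)
   also have "((1/2) ^ n) powr (-t) \<le> 2 powr \<bar>-t\<bar> * \<delta> powr (-t)"
    using n d by (intro powr_ratio_bound) auto
   finally show ?thesis using K C by (simp add: mult.assoc mult_left_mono)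
  qed
  then show "\<exists>C>0. \<forall>\<delta>\<in>{0<..1}. f \<delta> \<le> C * \<delta> powr (- t)"
   using K C by (intro exI[of _ "K * C * 2 powr \<bar>t\<bar>"]) auto
 }
 {
  fix t assume "t < L / ln 2"
  then have "t * ln 2 < L" by (simp add: less_divide_eq)
  then have "eventually (\<lambda>n. t * ln 2 < ln (f ((1/2) ^ n)) / real n) sequentially"
   using lim by (rule order_tendstoD(1)[rotated])
  then have "eventually (\<lambda>n. ((1/2) ^ n) powr (-t) / f ((1/2) ^ n) \<le> 1) sequentially"
   using eventually_gt_at_top[of 0]
  proof eventually_elim
   case (elim n)
   have fp: "0 < f ((1/2) ^ n)" by (rule pos) (simp add: power_le_one)
   have "real n * (t * ln 2) \<le> ln (f ((1/2) ^ n))" using elim by (simp add: field_simps)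
   then have "exp (real n * (t * ln 2)) \<le> f ((1/2) ^ n)" using fp by (metis exp_le_cancel_iff exp_ln)
   then show ?case using fp by (simp add: p2)
  qed
  from bounded_initial[OF this] obtain C where C: "C > 0" "\<And>n. ((1/2) ^ n) powr (-t) / f ((1/2) ^ n) \<le> C"
   by auto
  have "(1 / (K * C * 2 powr \<bar>t\<bar>)) * \<delta> powr (-t) \<le> f \<delta>" if d: "\<delta> \<in> {0<..1}" for \<delta>
  proof -
   obtain n where n: "(1/2) ^ Suc n < \<delta>" "\<delta> \<le> (1/2::real) ^ n"
    using dyadic_floor[of \<delta>] d unfolding greaterThanAtMost_iff by blast
   have fp: "0 < f ((1/2) ^ n)" by (rule pos) (simp add: power_le_one)
   have "\<delta> powr (-t) \<le> 2 powr \<bar>-t\<bar> * ((1/2) ^ n) powr (-t)"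
    using n d by (intro powr_ratio_bound) auto
   also have "((1/2) ^ n) powr (-t) \<le> C * f ((1/2) ^ n)" using C(2)[of n] fp by (simp add: divide_le_eq)
   also have "f ((1/2) ^ n) \<le> K * f \<delta>" using cmp[of \<delta> "(1/2) ^ n"] n d by (auto simp: power_le_one)
   finally have "\<delta> powr (-t) \<le> 2 powr \<bar>t\<bar> * (C * (K * f \<delta>))" using C by (simp add: mult_left_mono)
   then show ?thesis using K C by (simp add: field_simps)
  qed
  then show "\<exists>C>0. \<forall>\<delta>\<in>{0<..1}. C * \<delta> powr (- t) \<le> f \<delta>"
   using K C by (intro exI[of _ "1 / (K * C * 2 powr \<bar>t\<bar>)"]) auto
 }
qed

text \<open>Fekete's lemma: the limit is the infimum of \<open>b n / real n\<close> over
  \<open>n \<ge> 1\<close>, which is finite by the linear lower bound. Dividing \<open>n\<close>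
  with remainder by a near-optimal \<open>m\<close> costs only the bounded error
  \<open>D\<close>.\<close>

lemma fekete:
 fixes b :: "nat \<Rightarrow> real"
 assumes sub: "\<And>m n. b (m + n) \<le> b m + b n" and low: "\<And>n. - B * (real n + 1) \<le> b n" and "0 \<le> B"
 shows "\<exists>L. (\<lambda>n. b n / real n) \<longlonglongrightarrow> L"
proof -
 define X where "X = (\<lambda>n. b n / real n) ` {1..}"
 have bd: "bdd_below X"
 proof (rule bdd_belowI)
  fix x assume "x \<in> X"
  then obtain n where n: "n \<ge> 1" "x = b n / real n" by (auto simp: X_def)
  have "- (2 * B) * real n \<le> - B * (real n + 1)" using n assms(3) mult_left_mono[of 1 "real n" B] by (simp add: algebra_simps)
  also have "\<dots> \<le> b n" by (rule low)
  finally have "- (2 * B) * real n \<le> b n" .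
  then show "- (2 * B) \<le> x" using n by (simp only: n(2), subst pos_le_divide_eq) auto
 qed
 have "(\<lambda>n. b n / real n) \<longlonglongrightarrow> Inf X"
 proof (rule LIMSEQ_I)
  fix e :: real assume e: "0 < e"
  have "X \<noteq> {}" by (auto simp: X_def)
  then obtain x where "x \<in> X" "x < Inf X + e / 2" using cInf_lessD[of X "Inf X + e / 2"] e by auto
  then obtain m where m: "m \<ge> 1" "b m / real m < Inf X + e / 2" by (auto simp: X_def)
  define M where "M = Max (insert 0 (b ` {..m}))"
  have M: "b r \<le> M" if "r \<le> m" for r using that unfolding M_def by (intro Max_ge) auto
  have M0: "0 \<le> M" unfolding M_def by (intro Max_ge) auto
  have mult: "b (m * k + r) \<le> real k * b m + b r" for k r
  proof (induction k)
   case (Suc k)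
   have "b (m * Suc k + r) = b (m + (m * k + r))" by (simp add: algebra_simps)
   also have "\<dots> \<le> b m + b (m * k + r)" by (rule sub)
   also have "\<dots> \<le> b m + (real k * b m + b r)" using Suc by simp
   finally show ?case by (simp add: algebra_simps)
  qed simp
  define D where "D = \<bar>b m\<bar> + M"
  obtain N where N: "real N > 2 * D / e" using reals_Archimedean2 by blast
  show "\<exists>no. \<forall>n\<ge>no. norm (b n / real n - Inf X) < e"
  proof (intro exI allI impI)
   fix n assume n: "n \<ge> Suc N"
   then have n0: "real n > 0" by simp
   have "b n = b (m * (n div m) + n mod m)" by simp
   also have "\<dots> \<le> real (n div m) * b m + b (n mod m)" by (rule mult)
   also have "b (n mod m) \<le> M" using m by (intro M) (simp add: less_imp_le)
   finally have 1: "b n \<le> real (n div m) * b m + M" by simp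
   have nn: "real n = real (n div m) * real m + real (n mod m)"
    by (metis div_mult_mod_eq of_nat_add of_nat_mult)
   have q1: "real (n div m) * b m = (real n / real m) * b m - real (n mod m) * (b m / real m)"
    using m nn by (simp add: field_simps)
   have "- (real (n mod m) * (b m / real m)) \<le> \<bar>b m\<bar>"
   proof -
    have "\<bar>real (n mod m) * (b m / real m)\<bar> = (real (n mod m) / real m) * \<bar>b m\<bar>" using m by (simp add: abs_mult)
    also have "\<dots> \<le> 1 * \<bar>b m\<bar>" using m by (intro mult_right_mono) (auto simp: divide_le_eq less_imp_le)
    finally show ?thesis by linarith
   qed
   then have 2: "b n \<le> (real n / real m) * b m + D" using 1 unfolding D_def q1 by linarith
   have "b n / real n \<le> b m / real m + D / real n" using 2 n0 m by (simp add: field_simps)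
   also have "D / real n < e / 2"
   proof -
    have "2 * D / e < real n" using N n by linarith
    then show ?thesis using e n0 by (simp add: field_simps)
   qed
   finally have "b n / real n < Inf X + e" using m by linarith
   moreover have "Inf X \<le> b n / real n" using bd n by (intro cInf_lower) (auto simp: X_def)
   ultimately show "norm (b n / real n - Inf X) < e" by simp
  qed
 qed
 then show ?thesis by blast
qed

subsection \<open>Supports and coverings\<close>

lemma (in prob_space) prob_le_sum_cover:
 assumes "A \<in> events" "K \<in> events" "prob K = 1" "finite N" "\<And>n. n \<in> N \<Longrightarrow> B n \<in> events"
  "A \<inter> K \<subseteq> (\<Union>n\<in>N. B n)"
 shows "prob A \<le> (\<Sum>n\<in>N. prob (B n))"
proof -
 have "prob A = prob (A \<inter> K)"
  using assms prob_compl[of K] by (intro measure_eq_AE) (auto simp: prob_eq_1)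
 also have "\<dots> \<le> prob (\<Union>n\<in>N. B n)" using assms by (intro finite_measure_mono) auto
 also have "\<dots> \<le> (\<Sum>n\<in>N. prob (B n))" using assms by (intro finite_measure_subadditive_finite) auto
 finally show ?thesis .
qed

lemma (in prob_space) prob_disjoint_carrier:
 assumes "A \<in> events" "K \<in> events" "prob K = 1" "A \<inter> K = {}"
 shows "prob A = 0"
 using prob_le_sum_cover[of A K "{} :: nat set" "\<lambda>_. A"] assms by (simp add: measure_le_0_iff)

lemma closed_measure_support: "closed (measure_support (M :: 'a::topological_space measure))"
proof -
 have "- measure_support M = \<Union>{U. open U \<and> emeasure M U = 0}"
  by (auto simp: measure_support_def zero_less_iff_neq_zero)
 then have "open (- measure_support M)" by (auto intro: open_Union)
 then show ?thesis by (simp add: closed_def)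
qed

text \<open>By Lindelof the union of all open null sets is a countable union of such sets, hence
  null.\<close>

lemma measure_support_null:
 fixes M :: "'a::second_countable_topology measure"
 assumes "sets M = sets borel"
 shows "emeasure M (- measure_support M) = 0"
proof -
 define F where "F = {U :: 'a set. open U \<and> emeasure M U = 0}"
 obtain F' where F': "F' \<subseteq> F" "countable F'" "\<Union>F' = \<Union>F" using Lindelof[of F] by (auto simp: F_def)
 have "- measure_support M = \<Union>F"
  by (auto simp: F_def measure_support_def zero_less_iff_neq_zero)
 also have "\<dots> = (\<Union>U\<in>F'. U)" using F' by simp
 finally have eq: "- measure_support M = (\<Union>U\<in>F'. U)" .
 have "(\<Union>U\<in>F'. U) \<in> null_sets M"
  using F' assms by (intro null_sets_UN') (auto simp: F_def null_sets_def)
 then show ?thesis unfolding eq by auto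
qed

lemma prob_measure_support:
 fixes M :: "'a::second_countable_topology measure"
 assumes "prob_space M" "sets M = sets borel"
 shows "measure M (measure_support M) = 1"
proof -
 interpret prob_space M by fact
 have s: "space M = UNIV" using sets_eq_imp_space_eq[OF assms(2)] by simp
 have "measure_support M \<in> events" using closed_measure_support[of M] assms by (metis borel_closed)
 then have "prob (space M - measure_support M) = 1 - prob (measure_support M)" by (rule prob_compl)
 moreover have "prob (space M - measure_support M) = 0"
  using measure_support_null[OF assms(2)] s by (simp add: measure_def Compl_eq_Diff_UNIV)
 ultimately show ?thesis by simp
qed

lemma measure_support_subset:
 fixes M :: "'a::topological_space measure"
 assumes "prob_space M" "sets M = sets borel" "closed K" "measure M K = 1"
 shows "measure_support M \<subseteq> K"
proof
 interpret prob_space M by fact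
 fix x assume x: "x \<in> measure_support M"
 show "x \<in> K"
 proof (rule ccontr)
  assume "x \<notin> K"
  then have "emeasure M (- K) > 0" using x assms(3) by (auto simp: measure_support_def)
  moreover have "prob (- K) = 0"
   using assms by (intro prob_disjoint_carrier[of _ K]) (auto simp: borel_closed borel_open)
  ultimately show False by (simp add: emeasure_eq_measure)
 qed
qed

subsection \<open>Meshes of the line\<close>

definition mesh :: "real \<Rightarrow> int \<Rightarrow> real set" where
 "mesh \<delta> n = {of_int n * \<delta> ..< (of_int n + 1) * \<delta>}"

lemma mesh_borel [measurable, simp]: "mesh \<delta> n \<in> sets borel"
 by (simp add: mesh_def)

lemma mesh_iff: "0 < \<delta> \<Longrightarrow> x \<in> mesh \<delta> n \<longleftrightarrow> n = \<lfloor>x / \<delta>\<rfloor>"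
 unfolding mesh_def by (auto simp: floor_eq_iff field_simps eq_commute[of n])

lemma mesh_close:
 assumes "0 < \<delta>" "x \<in> mesh \<delta> n" "x' \<in> mesh \<delta> n'"
 shows "\<bar>x - x'\<bar> \<le> D \<Longrightarrow> \<bar>real_of_int n - of_int n'\<bar> \<le> D / \<delta> + 1"
  and "\<bar>x - x'\<bar> \<le> (\<bar>real_of_int n - of_int n'\<bar> + 1) * \<delta>"
proof -
 have n: "n = \<lfloor>x / \<delta>\<rfloor>" "n' = \<lfloor>x' / \<delta>\<rfloor>" using assms by (simp_all add: mesh_iff)
 {
  assume "\<bar>x - x'\<bar> \<le> D"
  then have "\<bar>x / \<delta> - x' / \<delta>\<bar> \<le> D / \<delta>" using assms(1) by (simp add: diff_divide_distrib[symmetric] divide_right_mono)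
  then show "\<bar>real_of_int n - of_int n'\<bar> \<le> D / \<delta> + 1" unfolding n by linarith
 }
 have "\<bar>x / \<delta> - x' / \<delta>\<bar> \<le> \<bar>real_of_int n - of_int n'\<bar> + 1" unfolding n by linarith
 then show "\<bar>x - x'\<bar> \<le> (\<bar>real_of_int n - of_int n'\<bar> + 1) * \<delta>"
  using assms(1) by (simp add: diff_divide_distrib[symmetric] pos_divide_le_eq)
qed

lemma card_int_diam:
 fixes X :: "int set"
 assumes "\<And>j j'. j \<in> X \<Longrightarrow> j' \<in> X \<Longrightarrow> \<bar>of_int j - of_int j'\<bar> \<le> (L::real)" "0 \<le> L"
 shows "finite X" "real (card X) \<le> 2 * L + 1"
proof -
 have "\<exists>z. \<forall>j\<in>X. \<bar>of_int j - z\<bar> \<le> L"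
 proof (cases "X = {}")
  case False
  then obtain j0 where "j0 \<in> X" by blast
  then show ?thesis using assms(1) by (intro exI[of _ "of_int j0"]) auto
 qed simp
 then show "finite X" "real (card X) \<le> 2 * L + 1" using card_int_window[of X _ L] assms(2) by blast+
qed

text \<open>At \<open>q = 0\<close> this counts the charged cells, so box counting is a special case
  of moment growth.\<close>

definition moment :: "real measure \<Rightarrow> real \<Rightarrow> real \<Rightarrow> real" where
 "moment \<nu> q \<delta> = (\<Sum>n | 0 < measure \<nu> (mesh \<delta> n). measure \<nu> (mesh \<delta> n) powr q)"

lemma moment_eq:
 assumes "finite B" "{n. 0 < measure \<nu> (mesh \<delta> n)} \<subseteq> B"
 shows "moment \<nu> q \<delta> = (\<Sum>n\<in>B. measure \<nu> (mesh \<delta> n) powr q)"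
 unfolding moment_def using assms
 by (intro sum.mono_neutral_left) (auto simp: not_less measure_le_0_iff)

lemma moment_nonneg: "0 \<le> moment \<nu> q \<delta>"
 unfolding moment_def by (intro sum_nonneg) auto

locale bounded_prob = prob_space \<nu> for \<nu> :: "real measure" +
 fixes a b :: real
 assumes sets_borel: "sets \<nu> = sets borel" and carrier: "measure \<nu> {a..b} = 1"
begin

abbreviation "mass \<delta> n \<equiv> measure \<nu> (mesh \<delta> n)"

lemma ab: "a \<le> b"
proof (rule ccontr)
 assume "\<not> a \<le> b"
 then have "{a..b} = {}" by simp
 then show False using carrier by (metis measure_empty zero_neq_one)
qed

definition window :: "real \<Rightarrow> int set" where
 "window \<delta> = {n. mesh \<delta> n \<inter> {a..b} \<noteq> {}}"

lemma window:
 assumes "0 < \<delta>"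
 shows "finite (window \<delta>)" "real (card (window \<delta>)) \<le> 2 * ((b - a) / \<delta> + 1) + 1"
proof -
 have "\<bar>of_int n - of_int n'\<bar> \<le> (b - a) / \<delta> + (1::real)" if n: "n \<in> window \<delta>" "n' \<in> window \<delta>" for n n'
 proof -
  from n obtain x x' where "x \<in> mesh \<delta> n" "x' \<in> mesh \<delta> n'" "x \<in> {a..b}" "x' \<in> {a..b}"
   unfolding window_def by blast
  then show ?thesis by (intro mesh_close(1)[OF assms, of x n x' n' "b - a"]) auto
 qed
 then show "finite (window \<delta>)" "real (card (window \<delta>)) \<le> 2 * ((b - a) / \<delta> + 1) + 1"
  using card_int_diam[of "window \<delta>" "(b - a) / \<delta> + 1"] ab assms by auto
qed

lemma pos_meets: "A \<in> sets borel \<Longrightarrow> 0 < measure \<nu> A \<Longrightarrow> A \<inter> {a..b} \<noteq> {}"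
 using prob_disjoint_carrier[of A "{a..b}"] carrier sets_borel by force

lemma pos_window: "{n. 0 < mass \<delta> n} \<subseteq> window \<delta>"
 using pos_meets[of "mesh \<delta> _"] by (auto simp: window_def)

lemma moment_window: "0 < \<delta> \<Longrightarrow> moment \<nu> q \<delta> = (\<Sum>n\<in>window \<delta>. mass \<delta> n powr q)"
 by (intro moment_eq window pos_window)

lemma le_sum_cover:
 assumes "A \<in> sets borel" "finite N" "\<And>n. n \<in> N \<Longrightarrow> B n \<in> sets borel" "A \<inter> {a..b} \<subseteq> (\<Union>n\<in>N. B n)"
 shows "measure \<nu> A \<le> (\<Sum>n\<in>N. measure \<nu> (B n))"
 using prob_le_sum_cover[of A "{a..b}" N B] assms carrier sets_borel by auto

text \<open>\<open>R n k\<close> says that some point of \<open>{a..b}\<close> lies in the k-th cell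
  of side \<delta> and is mapped into the n-th cell of side \<eta>. As \<open>c * \<delta>\<close>
  and \<eta> agree up to the factor \<open>L\<close>, the partners of a fixed cell have indices that
  differ by at most \<open>L + 1\<close>, which leaves at most \<open>2 * L + 3\<close> of them on
  either side.\<close>

lemma affine_compare:
 assumes f: "f = (\<lambda>x. e * x + u)" and c: "\<bar>e\<bar> = c" "0 < c" and pos: "0 < \<eta>" "0 < \<delta>"
  and L: "0 \<le> L" "c * \<delta> \<le> L * \<eta>" "\<eta> \<le> L * (c * \<delta>)" and q: "0 \<le> q" and B: "finite B"
 shows "(\<Sum>n\<in>B. measure \<nu> (f -` mesh \<eta> n) powr q) \<le> (2 * L + 3) powr q * (2 * L + 3) * moment \<nu> q \<delta>"
  and "{n. f -` mesh \<eta> n \<inter> {a..b} \<noteq> {}} \<subseteq> B \<Longrightarrow>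
   moment \<nu> q \<delta> \<le> (2 * L + 3) powr q * (2 * L + 3) * (\<Sum>n\<in>B. measure \<nu> (f -` mesh \<eta> n) powr q)"
proof -
 define R where "R = (\<lambda>n k. \<exists>x\<in>{a..b}. f x \<in> mesh \<eta> n \<and> x \<in> mesh \<delta> k)"
 have fm: "f \<in> borel_measurable borel" unfolding f by simp
 have fb: "f -` mesh \<eta> n \<in> sets borel" for n using vimage_borel[OF fm] by simp
 have fd: "\<bar>f x - f x'\<bar> = c * \<bar>x - x'\<bar>" for x x'
  proof -
  have "f x - f x' = e * (x - x')" by (simp add: f algebra_simps)
  then show ?thesis using c by (simp add: abs_mult)
 qed
 have cnt1: "finite {k. R n k}" "real (card {k. R n k}) \<le> 2 * L + 3" for n
 proof -
  have "\<bar>real_of_int k - of_int k'\<bar> \<le> L + 1" if kk: "k \<in> {k. R n k}" "k' \<in> {k. R n k}" for k k'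
  proof -
   from kk obtain x x' where x: "f x \<in> mesh \<eta> n" "x \<in> mesh \<delta> k" "f x' \<in> mesh \<eta> n" "x' \<in> mesh \<delta> k'"
    by (auto simp: R_def)
   have "c * \<bar>x - x'\<bar> \<le> \<eta>" using mesh_close(2)[OF pos(1) x(1,3)] fd by simp
   also have "\<dots> \<le> c * (L * \<delta>)" using L by (simp add: mult_ac)
   finally have "\<bar>x - x'\<bar> \<le> L * \<delta>" using c(2) by simp
   from mesh_close(1)[OF pos(2) x(2,4) this] show ?thesis using pos by simp
  qed
  from card_int_diam[of "{k. R n k}" "L + 1", OF this] L
  show "finite {k. R n k}" "real (card {k. R n k}) \<le> 2 * L + 3" by auto
 qed
 have cnt2: "finite {n. R n k}" "real (card {n. R n k}) \<le> 2 * L + 3" for k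
 proof -
  have "\<bar>real_of_int n - of_int n'\<bar> \<le> L + 1" if kk: "n \<in> {n. R n k}" "n' \<in> {n. R n k}" for n n'
  proof -
   from kk obtain x x' where x: "f x \<in> mesh \<eta> n" "x \<in> mesh \<delta> k" "f x' \<in> mesh \<eta> n'" "x' \<in> mesh \<delta> k"
    by (auto simp: R_def)
   have "\<bar>x - x'\<bar> \<le> \<delta>" using mesh_close(2)[OF pos(2) x(2,4)] by simp
   then have "c * \<bar>x - x'\<bar> \<le> c * \<delta>" using c(2) by (intro mult_left_mono) auto
   then have "\<bar>f x - f x'\<bar> \<le> L * \<eta>" using L(2) by (simp add: fd)
   from mesh_close(1)[OF pos(1) x(1,3) this] show ?thesis using pos by simp
  qed
  from card_int_diam[of "{n. R n k}" "L + 1", OF this] L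
  show "finite {n. R n k}" "real (card {n. R n k}) \<le> 2 * L + 3" by auto
 qed
 have Rw: "k \<in> window \<delta>" if "R n k" for n k using that by (auto simp: R_def window_def)
 have ex: "\<exists>k. x \<in> mesh \<delta> k" "\<exists>k. f x \<in> mesh \<eta> k" for x using pos by (simp_all add: mesh_iff)
 show "(\<Sum>n\<in>B. measure \<nu> (f -` mesh \<eta> n) powr q) \<le> (2 * L + 3) powr q * (2 * L + 3) * moment \<nu> q \<delta>"
  unfolding moment_window[OF pos(2)]
 proof (rule moment_compare[where N = "\<lambda>n. {k. R n k}"])
  fix k
  have "card {j \<in> B. k \<in> {k. R j k}} \<le> card {n. R n k}" by (intro card_mono cnt2) auto
  then show "real (card {j \<in> B. k \<in> {k. R j k}}) \<le> 2 * L + 3" using cnt2(2)[of k] by linarith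
 next
  fix n
  show "measure \<nu> (f -` mesh \<eta> n) \<le> (\<Sum>k\<in>{k. R n k}. mass \<delta> k)"
   using cnt1 ex fb by (intro le_sum_cover) (fastforce simp: R_def)+
 qed (use B q window pos Rw cnt1 in auto)
 assume sub: "{n. f -` mesh \<eta> n \<inter> {a..b} \<noteq> {}} \<subseteq> B"
 have RB: "n \<in> B" if "R n k" for n k using that sub by (auto simp: R_def)
 show "moment \<nu> q \<delta> \<le> (2 * L + 3) powr q * (2 * L + 3) * (\<Sum>n\<in>B. measure \<nu> (f -` mesh \<eta> n) powr q)"
  unfolding moment_window[OF pos(2)]
 proof (rule moment_compare[where N = "\<lambda>k. {n. R n k}"])
  fix n
  have "card {k \<in> window \<delta>. n \<in> {n. R n k}} \<le> card {k. R n k}" by (intro card_mono cnt1) auto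
  then show "real (card {k \<in> window \<delta>. n \<in> {n. R n k}}) \<le> 2 * L + 3" using cnt1(2)[of n] by linarith
 next
  fix k
  show "mass \<delta> k \<le> (\<Sum>n\<in>{n. R n k}. measure \<nu> (f -` mesh \<eta> n))"
   using cnt2 ex fb by (intro le_sum_cover) (fastforce simp: R_def)+
 qed (use B q window pos RB cnt2 in auto)
qed

lemma scale_compare:
 assumes "0 < \<delta>" "\<delta> \<le> \<delta>'" "\<delta>' \<le> L * \<delta>" "1 \<le> L" "0 \<le> q"
 shows "moment \<nu> q \<delta> \<le> (2 * L + 3) powr q * (2 * L + 3) * moment \<nu> q \<delta>'"
  and "moment \<nu> q \<delta>' \<le> (2 * L + 3) powr q * (2 * L + 3) * moment \<nu> q \<delta>"
proof -
 have p: "0 < \<delta>'" using assms by linarith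
 have L: "\<delta> \<le> L * \<delta>'" "\<delta>' \<le> L * \<delta>" using assms mult_mono[of 1 L \<delta> \<delta>'] by auto
 have s: "{n. (\<lambda>x::real. 1 * x + 0) -` mesh \<delta> n \<inter> {a..b} \<noteq> {}} \<subseteq> window \<delta>"
  by (auto simp: window_def)
 note 1 = affine_compare[OF refl _ _ assms(1) p, of 1 1 L q "window \<delta>" 0]
 show "moment \<nu> q \<delta> \<le> (2 * L + 3) powr q * (2 * L + 3) * moment \<nu> q \<delta>'"
  using 1(1) L assms window by (simp add: moment_window)
 show "moment \<nu> q \<delta>' \<le> (2 * L + 3) powr q * (2 * L + 3) * moment \<nu> q \<delta>"
  using 1(2) L assms window s by (simp add: moment_window[OF assms(1)])
qed

lemma sum_mesh:
 assumes "0 < \<delta>"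
 shows "(\<Sum>n\<in>window \<delta>. mass \<delta> n) = 1"
proof -
 have "(\<Sum>n\<in>window \<delta>. mass \<delta> n) = measure \<nu> (\<Union>n\<in>window \<delta>. mesh \<delta> n)"
  using assms window sets_borel
  by (intro finite_measure_finite_Union[symmetric]) (auto simp: disjoint_family_on_def mesh_iff)
 also have "\<dots> = 1"
 proof -
  have "measure \<nu> {a..b} \<le> measure \<nu> (\<Union>n\<in>window \<delta>. mesh \<delta> n)"
  proof (intro finite_measure_mono)
   show "{a..b} \<subseteq> (\<Union>n\<in>window \<delta>. mesh \<delta> n)"
   proof
    fix x assume "x \<in> {a..b}"
    moreover have "x \<in> mesh \<delta> \<lfloor>x / \<delta>\<rfloor>" using assms by (simp add: mesh_iff)
    ultimately show "x \<in> (\<Union>n\<in>window \<delta>. mesh \<delta> n)" unfolding window_def by blast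
   qed
  qed (use assms window sets_borel in \<open>auto intro!: sets.finite_UN\<close>)
  then show ?thesis using carrier prob_le_1 by (metis antisym)
 qed
 finally show ?thesis .
qed

text \<open>Every summand is at most 1, and by pigeonhole some cell has mass at least
  \<open>1 / N\<close>. These polynomial bounds provide the linear bounds on logarithms that
  Fekete's lemma asks for.\<close>

lemma moment_bounds:
 assumes "0 < \<delta>" "0 \<le> q"
 defines "N \<equiv> 2 * ((b - a) / \<delta> + 1) + 1"
 shows "moment \<nu> q \<delta> \<le> N" "N powr (- q) \<le> moment \<nu> q \<delta>"
proof -
 have N: "real (card (window \<delta>)) \<le> N" "3 \<le> N" using window assms ab by (auto simp: N_def)
 have "moment \<nu> q \<delta> \<le> (\<Sum>n\<in>window \<delta>. 1)"
  unfolding moment_window[OF assms(1)] using assms by (intro sum_mono powr_le1) auto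
 then show "moment \<nu> q \<delta> \<le> N" using N by simp
 have "\<exists>n\<in>window \<delta>. 1 / N \<le> mass \<delta> n"
 proof (rule ccontr)
  assume *: "\<not> ?thesis"
  have "window \<delta> \<noteq> {}" using sum_mesh[OF assms(1)] by auto
  then have "(\<Sum>n\<in>window \<delta>. mass \<delta> n) < (\<Sum>n\<in>window \<delta>. 1 / N)"
   using * window assms by (intro sum_strict_mono) auto
  also have "\<dots> \<le> 1" using N by simp
  finally show False using sum_mesh[OF assms(1)] by simp
 qed
 then obtain n where n: "n \<in> window \<delta>" "1 / N \<le> mass \<delta> n" by blast
 have "N powr (-q) = (1 / N) powr q" using N by (simp add: powr_minus_divide powr_divide)
 also have "\<dots> \<le> mass \<delta> n powr q" using n N assms by (intro powr_mono2) auto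
 also have "\<dots> \<le> moment \<nu> q \<delta>"
  unfolding moment_window[OF assms(1)] using n window assms by (intro member_le_sum) auto
 finally show "N powr (- q) \<le> moment \<nu> q \<delta>" .
qed

lemma moment_pos: "0 < \<delta> \<Longrightarrow> 0 \<le> q \<Longrightarrow> 0 < moment \<nu> q \<delta>"
 using moment_bounds(2)[of \<delta> q] ab by (smt (verit) divide_nonneg_pos powr_gt_zero)

end

section \<open>Self-similar measures on the line: existence of moment exponents\<close>

lemma is_cut_finite: "is_cut I \<phi> \<delta> Z \<Longrightarrow> finite Z"
 by (simp add: is_cut_def)

text \<open>The images of the maps may overlap, as they do for projections of a separated planar
  system. This is why words have to be grouped by position below.\<close>

locale self_similar = bounded_prob \<nu> a b for \<nu> a b +
 fixes I :: "'i set" and f :: "'i \<Rightarrow> real \<Rightarrow> real" and c p :: "'i \<Rightarrow> real"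
 assumes fin: "finite I" and ne: "I \<noteq> {}"
  and c: "\<And>i. i \<in> I \<Longrightarrow> 0 < c i" "\<And>i. i \<in> I \<Longrightarrow> c i < 1"
  and p: "\<And>i. i \<in> I \<Longrightarrow> 0 < p i" "(\<Sum>i\<in>I. p i) = 1"
  and aff: "\<And>i. i \<in> I \<Longrightarrow> \<exists>e u. \<bar>e\<bar> = c i \<and> f i = (\<lambda>x. e * x + u)"
  and inv: "\<And>i x. i \<in> I \<Longrightarrow> x \<in> {a..b} \<Longrightarrow> f i x \<in> {a..b}"
  and self_sim: "\<And>A. A \<in> sets borel \<Longrightarrow> measure \<nu> A = (\<Sum>i\<in>I. p i * measure \<nu> (f i -` A))"
begin

abbreviation "cw \<equiv> word_prod c"
abbreviation "pw \<equiv> word_prod p"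

lemma aff_word: "set w \<subseteq> I \<Longrightarrow> \<exists>e u. \<bar>e\<bar> = cw w \<and> wmap f w = (\<lambda>x. e * x + u)"
proof (induction w)
 case Nil
 then show ?case by (intro exI[of _ 1] exI[of _ 0]) auto
next
 case (Cons i w)
 then obtain e u where eu: "\<bar>e\<bar> = cw w" "wmap f w = (\<lambda>x. e * x + u)" by auto
 obtain e' u' where eu': "\<bar>e'\<bar> = c i" "f i = (\<lambda>x. e' * x + u')" using aff[of i] Cons.prems by auto
 show ?case using eu eu'
  by (intro exI[of _ "e' * e"] exI[of _ "e' * u + u'"]) (auto simp: abs_mult fun_eq_iff algebra_simps)
qed

lemma inv_word: "set w \<subseteq> I \<Longrightarrow> x \<in> {a..b} \<Longrightarrow> wmap f w x \<in> {a..b}"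
proof (induction w)
 case (Cons i w)
 then show ?case using inv[of i "wmap f w x"] by auto
qed simp

lemma word_borel: "set w \<subseteq> I \<Longrightarrow> wmap f w \<in> borel_measurable borel"
 using aff_word[of w] by auto

lemma word_vimage_borel [simp]: "set w \<subseteq> I \<Longrightarrow> A \<in> sets borel \<Longrightarrow> wmap f w -` A \<in> sets borel"
 using word_borel vimage_borel by blast

lemma word_dist:
 assumes "set w \<subseteq> I"
 shows "\<bar>wmap f w x - wmap f w y\<bar> = cw w * \<bar>x - y\<bar>"
proof -
 obtain e u where eu: "\<bar>e\<bar> = cw w" "wmap f w = (\<lambda>x. e * x + u)" using aff_word[OF assms] by auto
 have "wmap f w x - wmap f w y = e * (x - y)" by (simp add: eu algebra_simps)
 then show ?thesis using eu by (simp add: abs_mult)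
qed

definition \<kappa> :: real where "\<kappa> = Min (c ` I)"

lemma \<kappa>: "0 < \<kappa>" "\<kappa> < 1" "\<And>i. i \<in> I \<Longrightarrow> \<kappa> \<le> c i"
proof -
 have "\<kappa> \<in> c ` I" unfolding \<kappa>_def using fin ne by (intro Min_in) auto
 then show "0 < \<kappa>" "\<kappa> < 1" using c by auto
 show "\<And>i. i \<in> I \<Longrightarrow> \<kappa> \<le> c i" unfolding \<kappa>_def using fin by auto
qed

lemma cut_at:
 assumes "0 < r" "r \<le> 1"
 obtains Z where "is_cut I (cw) r Z" "finite Z"
  "\<And>w. w \<in> Z \<Longrightarrow> set w \<subseteq> I" "\<And>w. w \<in> Z \<Longrightarrow> cw w \<le> r" "\<And>w. w \<in> Z \<Longrightarrow> \<kappa> * r \<le> cw w"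
  "\<And>A. A \<in> sets borel \<Longrightarrow> measure \<nu> A = (\<Sum>w\<in>Z. pw w * measure \<nu> (wmap f w -` A))"
  "\<And>w. w \<in> Z \<Longrightarrow> 0 < pw w" "(\<Sum>w\<in>Z. pw w) = 1"
proof -
 define \<rho> where "\<rho> = Max (c ` I)"
 have "\<rho> \<in> c ` I" unfolding \<rho>_def using fin ne by (intro Max_in) auto
 then have \<rho>: "0 \<le> \<rho>" "\<rho> < 1" using c by (auto intro: less_imp_le)
 have "c i \<le> \<rho>" if "i \<in> I" for i using that fin unfolding \<rho>_def by auto
 then have "cw w \<le> \<rho> ^ length w" if "set w \<subseteq> I" for w
  using that c by (intro word_prod_le[of I]) auto
 from cut_exists[OF fin this \<rho> assms(1)] obtain Z where Z: "is_cut I (cw) r Z" by auto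
 show ?thesis
 proof (rule that[OF Z])
  show "finite Z" using Z by (rule is_cut_finite)
  show "\<And>w. w \<in> Z \<Longrightarrow> set w \<subseteq> I" "\<And>w. w \<in> Z \<Longrightarrow> cw w \<le> r" using cut_word[OF Z] by auto
  show "\<kappa> * r \<le> cw w" if "w \<in> Z" for w
  proof (rule cut_lower[OF Z that])
   fix v i assume "set v \<subseteq> I" "i \<in> I"
   then show "\<kappa> * cw v \<le> cw (v @ [i])"
    using \<kappa> word_prod_pos[of I c v] c by (simp add: mult.commute mult_left_mono)
  qed (use \<kappa> assms in auto)
  show "measure \<nu> A = (\<Sum>w\<in>Z. pw w * measure \<nu> (wmap f w -` A))" if "A \<in> sets borel" for A
  proof (rule measure_cut[OF Z that _ self_sim])
   fix i assume "i \<in> I" then show "f i \<in> borel_measurable borel" using aff[of i] by auto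
  qed
  from this[of UNIV] show "(\<Sum>w\<in>Z. pw w) = 1"
   using prob_space sets_eq_imp_space_eq[OF sets_borel] by simp
  show "\<And>w. w \<in> Z \<Longrightarrow> 0 < pw w" using cut_word[OF Z] p by (intro word_prod_pos[of I]) auto
 qed
qed

text \<open>Under a word of ratio about \<open>r\<close> the measure at scale \<delta> becomes a
  piece at scale \<open>\<delta> * r\<close>. Since pieces overlap, words are collected into groups
  \<open>W j\<close> by the cell of side \<open>r\<close> that contains the image of
  \<open>a\<close>. Jensen inside a group compares the q-th power of its mass with a weighted mean
  over its words, and its direction decides the outcome: submultiplicative for
  \<open>q \<ge> 1\<close>, supermultiplicative for \<open>q \<le> 1\<close>.\<close>

lemma moment_mult:
 assumes q: "0 \<le> q"
 shows "\<exists>C\<ge>1. \<forall>r\<in>{0<..1}. \<forall>\<delta>\<in>{0<..1}.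
   (1 \<le> q \<longrightarrow> moment \<nu> q (\<delta> * r) \<le> C * (moment \<nu> q \<delta> * moment \<nu> q r)) \<and>
   (q \<le> 1 \<longrightarrow> moment \<nu> q \<delta> * moment \<nu> q r \<le> C * moment \<nu> q (\<delta> * r))"
proof -
 define L0 where "L0 = 2 * (1 / \<kappa>) + 3"
 define C0 where "C0 = L0 powr q * L0"
 define M1 where "M1 = 2 * ((b - a) + 1) + 1"
 define C1 where "C1 = M1 powr q * M1"
 \<comment> \<open>Groups that reach a common cell have base points within
   \<open>r * (2 * (b - a) + 1)\<close>: one image length from either group plus the cell. The
   indices of their cells therefore differ by at most \<open>2 * (b - a) + 2\<close>.\<close>
 define M where "M = 2 * (2 * (b - a) + 2) + 1"
 define C where "C = M powr q * M * C0 * C1"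
 have ge: "1 \<le> L0" "1 \<le> M1" "1 \<le> M" using \<kappa> ab by (auto simp: L0_def M1_def M_def)
 then have ge': "1 \<le> C0" "1 \<le> C1" "1 \<le> M powr q"
  using q by (auto simp: C0_def C1_def ge_one_powr_ge_zero intro!: mult_ge1_I)
 have main: "(1 \<le> q \<longrightarrow> moment \<nu> q (\<delta> * r) \<le> C * (moment \<nu> q \<delta> * moment \<nu> q r)) \<and>
   (q \<le> 1 \<longrightarrow> moment \<nu> q \<delta> * moment \<nu> q r \<le> C * moment \<nu> q (\<delta> * r))"
  if r: "0 < r" "r \<le> 1" and d: "0 < \<delta>" "\<delta> \<le> 1" for r \<delta>
 proof -
  obtain Z where Z: "finite Z" "\<And>w. w \<in> Z \<Longrightarrow> set w \<subseteq> I" "\<And>w. w \<in> Z \<Longrightarrow> cw w \<le> r"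
   "\<And>w. w \<in> Z \<Longrightarrow> \<kappa> * r \<le> cw w"
   "\<And>A. A \<in> sets borel \<Longrightarrow> measure \<nu> A = (\<Sum>w\<in>Z. pw w * measure \<nu> (wmap f w -` A))"
   "\<And>w. w \<in> Z \<Longrightarrow> 0 < pw w"
   by (rule cut_at[OF r]) blast
  define \<eta> where "\<eta> = \<delta> * r"
  have \<eta>: "0 < \<eta>" using r d by (simp add: \<eta>_def)
  define J where "J w = \<lfloor>wmap f w a / r\<rfloor>" for w
  define W where "W j = {w \<in> Z. J w = j}" for j
  define P where "P j = (\<Sum>w\<in>W j. pw w)" for j
  define T where "T w n = measure \<nu> (wmap f w -` mesh \<eta> n)" for w n
  define N where "N n j = (\<Sum>w\<in>W j. pw w * T w n)" for n j
  \<comment> \<open>Moment of the group masses. It is comparable to the moment at scale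
    \<open>r\<close>, because a word moves all of \<open>{a..b}\<close> into cells near the one of
    its base point.\<close>
  define QQ where "QQ = (\<Sum>j\<in>J ` Z. P j powr q)"
  define B where "B = window \<eta>"
  have finB: "finite B" using window \<eta> by (simp add: B_def)
  have WZ: "W j \<subseteq> Z" "finite (W j)" for j using Z(1) by (auto simp: W_def)
  have pW: "0 \<le> pw w" "w \<in> Z" if "w \<in> W j" for w j
   using that Z(6)[of w] by (auto simp: W_def)
  have T0: "0 \<le> T w n" for w n by (simp add: T_def)
  have P0: "0 < P j" if "j \<in> J ` Z" for j
   unfolding P_def using that WZ Z(6) by (intro sum_pos) (auto simp: W_def)
  have N0: "0 \<le> N n j" for n j
   unfolding N_def using subsetD[OF WZ(1)] Z(6) T0 by (intro sum_nonneg mult_nonneg_nonneg) (blast intro: less_imp_le)+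
  have a: "a \<in> {a..b}" using ab by simp
  have Jmesh: "wmap f w a \<in> mesh r (J w)" for w using r by (simp add: mesh_iff J_def)
  have near: "\<bar>wmap f w x - wmap f w a\<bar> \<le> r * (b - a)" if "w \<in> Z" "x \<in> {a..b}" for w x
  proof -
   have "\<bar>wmap f w x - wmap f w a\<bar> = cw w * \<bar>x - a\<bar>" using Z that by (intro word_dist) auto
   also have "\<dots> \<le> r * (b - a)" using Z(3)[OF that(1)] that r by (intro mult_mono) auto
   finally show ?thesis .
  qed
  have Tpos: "\<exists>x\<in>{a..b}. wmap f w x \<in> mesh \<eta> n" if "w \<in> Z" "0 < T w n" for w n
   using pos_meets[of "wmap f w -` mesh \<eta> n"] that Z(2) unfolding T_def by auto
  have split: "mass \<eta> n = (\<Sum>j\<in>J ` Z. N n j)" for n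
  proof -
   have "mass \<eta> n = (\<Sum>w\<in>Z. pw w * T w n)" unfolding T_def by (rule Z(5)) simp
   also have "\<dots> = (\<Sum>j\<in>J ` Z. N n j)" unfolding N_def W_def using Z(1) by (rule sum.image_gen)
   finally show ?thesis .
  qed
  \<comment> \<open>A word of the cut has ratio between \<open>\<kappa> * r\<close> and
    \<open>r\<close>, so at scale \<open>\<eta>\<close> its piece looks like the whole measure at
    scale \<delta>, up to the factor \<open>1 / \<kappa>\<close>.\<close>
  have TW: "(\<Sum>n\<in>B. T w n powr q) \<le> C0 * moment \<nu> q \<delta>" "moment \<nu> q \<delta> \<le> C0 * (\<Sum>n\<in>B. T w n powr q)"
   if wZ: "w \<in> Z" for w
  proof -
   obtain e u where eu: "\<bar>e\<bar> = cw w" "wmap f w = (\<lambda>x. e * x + u)" using aff_word Z(2) wZ by blast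
   have k: "0 < cw w" using Z(2) that c by (intro word_prod_pos[of I]) auto
   have l1: "cw w * \<delta> \<le> 1 / \<kappa> * \<eta>"
   proof -
    have "cw w * \<delta> \<le> 1 * \<eta>" using Z(3)[OF that] d by (simp add: \<eta>_def mult.commute)
    also have "\<dots> \<le> 1 / \<kappa> * \<eta>" using \<kappa> \<eta> by (intro mult_right_mono) auto
    finally show ?thesis .
   qed
   have l2: "\<eta> \<le> 1 / \<kappa> * (cw w * \<delta>)"
   proof -
    have "\<kappa> * \<eta> \<le> cw w * \<delta>" using mult_right_mono[OF Z(4)[OF that], of \<delta>] d by (simp add: \<eta>_def mult_ac)
    then show ?thesis using \<kappa> by (simp add: field_simps)
   qed
   have sub: "{n. wmap f w -` mesh \<eta> n \<inter> {a..b} \<noteq> {}} \<subseteq> B"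
    using inv_word[of w] Z(2) that by (fastforce simp: B_def window_def)
   have k0: "0 \<le> 1 / \<kappa>" using \<kappa> by simp
   note * = affine_compare[OF eu(2,1) k \<eta> d(1) k0 l1 l2 q finB]
   show "(\<Sum>n\<in>B. T w n powr q) \<le> C0 * moment \<nu> q \<delta>" using *(1) by (simp add: T_def C0_def L0_def)
   show "moment \<nu> q \<delta> \<le> C0 * (\<Sum>n\<in>B. T w n powr q)" using *(2)[OF sub] by (simp add: T_def C0_def L0_def)
  qed
  have Mcard: "finite {j \<in> J ` Z. 0 < N n j}" "real (card {j \<in> J ` Z. 0 < N n j}) \<le> M" for n
  proof -
   have "\<bar>of_int j - of_int j'\<bar> \<le> 2 * (b - a) + 2"
    if jj: "j \<in> {j \<in> J ` Z. 0 < N n j}" "j' \<in> {j \<in> J ` Z. 0 < N n j}" for j j'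
   proof -
    have ex: "\<exists>w\<in>Z. J w = j \<and> (\<exists>x\<in>{a..b}. wmap f w x \<in> mesh \<eta> n)" if "0 < N n j" for j
    proof -
     have "\<exists>w\<in>W j. 0 < T w n"
     proof (rule ccontr)
      assume "\<not> ?thesis"
      then have "\<forall>w\<in>W j. T w n = 0" using T0 by (metis less_eq_real_def)
      then show False using that by (simp add: N_def)
     qed
     then show ?thesis using Tpos by (auto simp: W_def)
    qed
    obtain w x where w: "w \<in> Z" "J w = j" "x \<in> {a..b}" "wmap f w x \<in> mesh \<eta> n" using ex jj by blast
    obtain w' x' where w': "w' \<in> Z" "J w' = j'" "x' \<in> {a..b}" "wmap f w' x' \<in> mesh \<eta> n" using ex jj by blast
    have "\<bar>wmap f w x - wmap f w' x'\<bar> \<le> \<eta>" using mesh_close(2)[OF \<eta> w(4) w'(4)] by simp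
    also have "\<eta> \<le> 1 * r" using d r unfolding \<eta>_def by (intro mult_right_mono) auto
    finally have "\<bar>wmap f w a - wmap f w' a\<bar> \<le> r * (2 * (b - a) + 1)"
     using near[OF w(1,3)] near[OF w'(1,3)] by (simp add: algebra_simps)
    from mesh_close(1)[OF r(1) Jmesh Jmesh this] show ?thesis using r w w' by (simp add: add.commute)
   qed
   from card_int_diam[of "{j \<in> J ` Z. 0 < N n j}", OF this] ab
   show "finite {j \<in> J ` Z. 0 < N n j}" "real (card {j \<in> J ` Z. 0 < N n j}) \<le> M" by (auto simp: M_def)
  qed
  have QQ: "QQ \<le> C1 * moment \<nu> q r" "moment \<nu> q r \<le> C1 * QQ"
  proof -
   let ?near = "\<lambda>(n::int) (j::int). \<bar>real_of_int n - real_of_int j\<bar> \<le> (b - a) + 1"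
   have nearJ: "?near n (J w)" if "w \<in> Z" "x \<in> {a..b}" "wmap f w x \<in> mesh r n" for w x n
    using mesh_close(1)[OF r(1) that(3) Jmesh near[OF that(1,2)]] r by simp
   have card1: "finite {n \<in> X. ?near n j}" "real (card {n \<in> X. ?near n j}) \<le> M1"
    "finite {n \<in> X. ?near j n}" "real (card {n \<in> X. ?near j n}) \<le> M1" for X j
   proof -
    have 1: "\<bar>real_of_int n - real_of_int j\<bar> \<le> (b - a) + 1" if "n \<in> {n \<in> X. ?near n j}" for n using that by auto
    from card_int_window[of "{n \<in> X. ?near n j}", OF this] ab
    show "finite {n \<in> X. ?near n j}" "real (card {n \<in> X. ?near n j}) \<le> M1" by (auto simp: M1_def)
    then show "finite {n \<in> X. ?near j n}" "real (card {n \<in> X. ?near j n}) \<le> M1"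
     by (simp_all add: abs_minus_commute)
   qed
   show "QQ \<le> C1 * moment \<nu> q r"
    unfolding moment_window[OF r(1)] QQ_def C1_def
   proof (rule moment_compare[where N = "\<lambda>j. {n \<in> window r. ?near n j}"])
    fix j assume j: "j \<in> J ` Z"
    let ?U = "\<Union>n\<in>{n \<in> window r. ?near n j}. mesh r n"
    have Ub: "?U \<in> sets borel" using card1 by (intro sets.finite_UN) auto
    have "P j = (\<Sum>w\<in>W j. pw w * measure \<nu> (wmap f w -` ?U))"
     unfolding P_def
    proof (rule sum.cong[OF refl])
     fix w assume w: "w \<in> W j"
     then have wZ: "w \<in> Z" "J w = j" by (auto simp: W_def)
     have "{a..b} \<subseteq> wmap f w -` ?U"
     proof
      fix x assume x: "x \<in> {a..b}"
      define n where "n = \<lfloor>wmap f w x / r\<rfloor>"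
      have n: "wmap f w x \<in> mesh r n" using r by (simp add: mesh_iff n_def)
      moreover have "n \<in> window r" using n inv_word[of w x] Z(2) wZ x by (auto simp: window_def)
      ultimately show "x \<in> wmap f w -` ?U" using nearJ[OF wZ(1) x n] wZ by auto
     qed
     then have "measure \<nu> {a..b} \<le> measure \<nu> (wmap f w -` ?U)"
      using Z(2) wZ Ub sets_borel by (intro finite_measure_mono) auto
     then have "measure \<nu> (wmap f w -` ?U) = 1" using carrier prob_le_1[of "wmap f w -` ?U"] by linarith
     then show "pw w = pw w * measure \<nu> (wmap f w -` ?U)" by simp
    qed
    also have "\<dots> \<le> (\<Sum>w\<in>Z. pw w * measure \<nu> (wmap f w -` ?U))"
     using WZ Z(1) by (intro sum_mono2) (auto simp: less_imp_le[OF Z(6)])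
    also have "\<dots> = measure \<nu> ?U" by (rule Z(5)[symmetric]) (rule Ub)
    also have "\<dots> \<le> (\<Sum>n\<in>{n \<in> window r. ?near n j}. mass r n)"
     using card1 sets_borel by (intro finite_measure_subadditive_finite) auto
    finally show "P j \<le> (\<Sum>n\<in>{n \<in> window r. ?near n j}. mass r n)" .
   next
    fix n
    have "{j \<in> J ` Z. n \<in> {n \<in> window r. ?near n j}} \<subseteq> {j \<in> J ` Z. ?near n j}" by auto
    then have "card {j \<in> J ` Z. n \<in> {n \<in> window r. ?near n j}} \<le> card {j \<in> J ` Z. ?near n j}"
     using card1 by (intro card_mono) auto
    then show "real (card {j \<in> J ` Z. n \<in> {n \<in> window r. ?near n j}}) \<le> M1" using card1(4)[of "J ` Z" n] by linarith
   qed (use Z(1) window r q card1 P0 in \<open>auto intro: less_imp_le\<close>)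
   show "moment \<nu> q r \<le> C1 * QQ"
    unfolding moment_window[OF r(1)] QQ_def C1_def
   proof (rule moment_compare[where N = "\<lambda>n. {j \<in> J ` Z. ?near n j}"])
    fix n assume n: "n \<in> window r"
    have "mass r n = (\<Sum>w\<in>Z. pw w * measure \<nu> (wmap f w -` mesh r n))" by (rule Z(5)) simp
    also have "\<dots> \<le> (\<Sum>w\<in>Z. if ?near n (J w) then pw w else 0)"
    proof (rule sum_mono)
     fix w assume w: "w \<in> Z"
     show "pw w * measure \<nu> (wmap f w -` mesh r n) \<le> (if ?near n (J w) then pw w else 0)"
     proof (cases "0 < measure \<nu> (wmap f w -` mesh r n)")
      case True
      then obtain x where "x \<in> {a..b}" "wmap f w x \<in> mesh r n"
       using pos_meets[OF word_vimage_borel[OF Z(2)[OF w] mesh_borel] True] by blast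
      then have "?near n (J w)" using nearJ[OF w] by blast
      then show ?thesis using Z(6)[OF w] prob_le_1 by (simp add: mult_left_le)
     next
      case False
      then have "measure \<nu> (wmap f w -` mesh r n) = 0" by (simp add: not_less measure_le_0_iff)
      then show ?thesis using Z(6)[OF w] by simp
     qed
    qed
    also have "\<dots> = (\<Sum>j\<in>J ` Z. \<Sum>w\<in>W j. if ?near n (J w) then pw w else 0)"
     unfolding W_def using Z(1) by (rule sum.image_gen)
    also have "\<dots> = (\<Sum>j\<in>J ` Z. if ?near n j then P j else 0)"
     by (intro sum.cong refl) (auto simp: W_def P_def)
    also have "\<dots> = (\<Sum>j\<in>{j \<in> J ` Z. ?near n j}. P j)"
     using Z(1) by (intro sum.inter_filter[symmetric]) auto
    finally show "mass r n \<le> (\<Sum>j\<in>{j \<in> J ` Z. ?near n j}. P j)" .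
   next
    fix j
    have "{n \<in> window r. j \<in> {j \<in> J ` Z. ?near n j}} \<subseteq> {n \<in> window r. ?near n j}" by auto
    then have "card {n \<in> window r. j \<in> {j \<in> J ` Z. ?near n j}} \<le> card {n \<in> window r. ?near n j}"
     using card1 by (intro card_mono) auto
    then show "real (card {n \<in> window r. j \<in> {j \<in> J ` Z. ?near n j}}) \<le> M1" using card1(2)[of "window r" j] by linarith
   qed (use Z(1) window r q card1 P0 in \<open>auto intro: less_imp_le\<close>)
  qed
  \<comment> \<open>Exchanging sums shows that \<open>Y\<close> is comparable to
    \<open>moment \<nu> q \<delta> * QQ\<close> for every \<open>q \<ge> 0\<close>. Only its
    comparison with the moment at \<open>\<eta>\<close> uses Jensen and depends on the sign of
    \<open>q - 1\<close>.\<close>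
  define Y where "Y = (\<Sum>n\<in>B. \<Sum>j\<in>J ` Z. P j powr (q - 1) * (\<Sum>w\<in>W j. pw w * T w n powr q))"
  have Y: "Y = (\<Sum>j\<in>J ` Z. P j powr (q - 1) * (\<Sum>w\<in>W j. pw w * (\<Sum>n\<in>B. T w n powr q)))"
   unfolding Y_def by (subst sum.swap, intro sum.cong refl, subst sum_distrib_left[symmetric],
     subst sum.swap, simp add: sum_distrib_left)
  have PP: "P j powr (q - 1) * P j = P j powr q" if "j \<in> J ` Z" for j
   using P0[OF that] by (simp add: powr_diff)
  have NP1: "N n j powr q \<le> P j powr (q - 1) * (\<Sum>w\<in>W j. pw w * T w n powr q)" if "1 \<le> q" for n j
   unfolding N_def P_def using that T0 pW(2) Z(6) by (intro powr_weighted_sum(1)[OF WZ(2)]) blast+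
  have NP2: "P j powr (q - 1) * (\<Sum>w\<in>W j. pw w * T w n powr q) \<le> N n j powr q" if "q \<le> 1" for n j
   unfolding N_def P_def using that q T0 pW(2) Z(6) by (intro powr_weighted_sum(2)[OF WZ(2)]) blast+
  have PS: "P j powr (q - 1) * (\<Sum>w\<in>W j. pw w * K) = K * P j powr q" if j: "j \<in> J ` Z" for j K
  proof -
   have "(\<Sum>w\<in>W j. pw w * K) = P j * K" by (simp add: P_def sum_distrib_right)
   then have "P j powr (q - 1) * (\<Sum>w\<in>W j. pw w * K) = (P j powr (q - 1) * P j) * K" by simp
   then show ?thesis unfolding PP[OF j] by simp
  qed
  have md: "0 \<le> moment \<nu> q \<delta>" "0 \<le> moment \<nu> q r" "0 \<le> moment \<nu> q \<eta>" by (rule moment_nonneg)+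
  have QQ0: "0 \<le> QQ" unfolding QQ_def by (intro sum_nonneg) auto
  have Y1: "Y \<le> C0 * moment \<nu> q \<delta> * QQ"
  proof -
   have "Y \<le> (\<Sum>j\<in>J ` Z. P j powr (q - 1) * (\<Sum>w\<in>W j. pw w * (C0 * moment \<nu> q \<delta>)))"
    unfolding Y using TW(1) by (intro sum_mono mult_left_mono) (auto intro: pW)
   also have "\<dots> = (\<Sum>j\<in>J ` Z. C0 * moment \<nu> q \<delta> * P j powr q)"
    by (intro sum.cong refl PS)
   finally show ?thesis by (simp add: QQ_def sum_distrib_left)
  qed
  have Y2: "moment \<nu> q \<delta> * QQ \<le> C0 * Y"
  proof -
   have "moment \<nu> q \<delta> * QQ = (\<Sum>j\<in>J ` Z. P j powr (q - 1) * (\<Sum>w\<in>W j. pw w * moment \<nu> q \<delta>))"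
    unfolding QQ_def by (subst sum_distrib_left, intro sum.cong refl PS[symmetric])
   also have "\<dots> \<le> (\<Sum>j\<in>J ` Z. P j powr (q - 1) * (\<Sum>w\<in>W j. pw w * (C0 * (\<Sum>n\<in>B. T w n powr q))))"
    using TW(2) by (intro sum_mono mult_left_mono) (auto intro: pW)
   also have "\<dots> = C0 * Y" unfolding Y by (simp add: sum_distrib_left mult_ac)
   finally show ?thesis .
  qed
  have case1: "moment \<nu> q \<eta> \<le> C * (moment \<nu> q \<delta> * moment \<nu> q r)" if q1: "1 \<le> q"
  proof -
   have "moment \<nu> q \<eta> = (\<Sum>n\<in>B. mass \<eta> n powr q)" unfolding B_def by (rule moment_window[OF \<eta>])
   also have "\<dots> \<le> (\<Sum>n\<in>B. M powr q * (\<Sum>j\<in>J ` Z. P j powr (q - 1) * (\<Sum>w\<in>W j. pw w * T w n powr q)))"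
   proof (rule sum_mono)
    fix n
    have "mass \<eta> n = (\<Sum>j\<in>{j \<in> J ` Z. 0 < N n j}. N n j)"
     unfolding split using Z(1) N0 by (intro sum.mono_neutral_right) (auto simp: not_less intro: antisym)
    then have "mass \<eta> n powr q \<le> M powr q * (\<Sum>j\<in>{j \<in> J ` Z. 0 < N n j}. N n j powr q)"
     using powr_sum_le[OF Mcard q N0] by simp
    also have "\<dots> \<le> M powr q * (\<Sum>j\<in>J ` Z. N n j powr q)"
     using Z(1) by (intro mult_left_mono sum_mono2) auto
    also have "\<dots> \<le> M powr q * (\<Sum>j\<in>J ` Z. P j powr (q - 1) * (\<Sum>w\<in>W j. pw w * T w n powr q))"
     by (intro mult_left_mono sum_mono NP1[OF q1]) auto
    finally show "mass \<eta> n powr q \<le> \<dots>" .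
   qed
   also have "\<dots> = M powr q * Y" by (simp add: Y_def sum_distrib_left)
   also have "\<dots> \<le> M powr q * (C0 * moment \<nu> q \<delta> * (C1 * moment \<nu> q r))"
   proof (intro mult_left_mono order_trans[OF Y1])
    show "QQ \<le> C1 * moment \<nu> q r" by (rule QQ)
   qed (use ge' md in auto)
   also have "\<dots> = 1 * (M powr q * C0 * C1 * (moment \<nu> q \<delta> * moment \<nu> q r))" by simp
   also have "\<dots> \<le> M * (M powr q * C0 * C1 * (moment \<nu> q \<delta> * moment \<nu> q r))"
    using ge ge' md by (intro mult_right_mono mult_nonneg_nonneg) auto
   finally show ?thesis by (simp add: C_def mult_ac)
  qed
  have case2: "moment \<nu> q \<delta> * moment \<nu> q r \<le> C * moment \<nu> q \<eta>" if q1: "q \<le> 1"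
  proof -
   have "Y \<le> (\<Sum>n\<in>B. M * mass \<eta> n powr q)"
    unfolding Y_def
   proof (rule sum_mono)
    fix n
    have "(\<Sum>j\<in>J ` Z. P j powr (q - 1) * (\<Sum>w\<in>W j. pw w * T w n powr q)) \<le> (\<Sum>j\<in>J ` Z. N n j powr q)"
     by (intro sum_mono NP2[OF q1])
    also have "\<dots> = (\<Sum>j\<in>{j \<in> J ` Z. 0 < N n j}. N n j powr q)"
     using Z(1) N0 by (intro sum.mono_neutral_right) (auto simp: not_less intro: antisym)
    also have "\<dots> \<le> (\<Sum>j\<in>{j \<in> J ` Z. 0 < N n j}. mass \<eta> n powr q)"
    proof (intro sum_mono powr_mono2)
     fix j assume "j \<in> {j \<in> J ` Z. 0 < N n j}"
     then show "N n j \<le> mass \<eta> n" unfolding split using Z(1) N0 by (intro member_le_sum) auto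
    qed (use N0 q in auto)
    also have "\<dots> \<le> M * mass \<eta> n powr q" using Mcard(2)[of n] by (simp add: mult_right_mono)
    finally show "(\<Sum>j\<in>J ` Z. P j powr (q - 1) * (\<Sum>w\<in>W j. pw w * T w n powr q)) \<le> \<dots>" .
   qed
   also have "\<dots> = M * moment \<nu> q \<eta>" by (simp add: B_def moment_window[OF \<eta>] sum_distrib_left)
   finally have Y3: "Y \<le> M * moment \<nu> q \<eta>" .
   have "moment \<nu> q \<delta> * moment \<nu> q r \<le> moment \<nu> q \<delta> * (C1 * QQ)" using QQ md by (intro mult_left_mono) auto
   also have "\<dots> = C1 * (moment \<nu> q \<delta> * QQ)" by simp
   also have "\<dots> \<le> C1 * (C0 * (M * moment \<nu> q \<eta>))"
    using Y2 Y3 ge' by (intro mult_left_mono order_trans[OF Y2]) auto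
   also have "\<dots> = 1 * (M * C0 * C1 * moment \<nu> q \<eta>)" by simp
   also have "\<dots> \<le> M powr q * (M * C0 * C1 * moment \<nu> q \<eta>)"
    using ge ge' md by (intro mult_right_mono mult_nonneg_nonneg) auto
   finally show ?thesis by (simp add: C_def mult_ac)
  qed
  show ?thesis using case1 case2 by (simp add: \<eta>_def)
 qed
 show ?thesis
 proof (intro exI[of _ C] conjI ballI)
  show "1 \<le> C" unfolding C_def using ge ge' by (intro mult_ge1_I) auto
 qed (use main in auto)
qed

text \<open>The multiplicative constant becomes additive under the logarithm and is absorbed by a
  shift: \<open>ln (m n) + ln C\<close> is subadditive for \<open>q \<ge> 1\<close>, and
  \<open>ln C - ln (m n)\<close> for \<open>q < 1\<close>.\<close>

lemma growth_exists:
 assumes q: "0 \<le> q"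
 shows "\<exists>s. has_growth (moment \<nu> q) s"
proof -
 obtain C where C: "C \<ge> 1" "\<And>r \<delta>. r \<in> {0<..1} \<Longrightarrow> \<delta> \<in> {0<..1} \<Longrightarrow>
   (1 \<le> q \<longrightarrow> moment \<nu> q (\<delta> * r) \<le> C * (moment \<nu> q \<delta> * moment \<nu> q r)) \<and>
   (q \<le> 1 \<longrightarrow> moment \<nu> q \<delta> * moment \<nu> q r \<le> C * moment \<nu> q (\<delta> * r))"
  using moment_mult[OF q] by blast
 define m where "m n = moment \<nu> q ((1/2) ^ n)" for n
 have mpos: "0 < m n" for n unfolding m_def using q by (intro moment_pos) auto
 have pw: "(1/2::real) ^ n \<in> {0<..1}" for n by (simp add: power_le_one)
 have m1: "m (k + n) \<le> C * (m k * m n)" if "1 \<le> q" for k n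
  using C(2)[OF pw[of n] pw[of k]] that by (simp add: m_def power_add)
 have m2: "m k * m n \<le> C * m (k + n)" if "q \<le> 1" for k n
  using C(2)[OF pw[of n] pw[of k]] that by (simp add: m_def power_add)
 define D where "D = ln 2 + ln (2 * (b - a) + 3)"
 have D0: "0 \<le> ln (2 * (b - a) + 3)" using ab by simp
 then have D: "0 \<le> D" by (simp add: D_def)
 have npos: "0 \<le> x \<Longrightarrow> 0 < 2 * (x + 1) + 1" for x :: real by simp
 have lnN: "ln (2 * ((b - a) / (1/2) ^ n + 1) + 1) \<le> D * (real n + 1)" for n
 proof -
  have "2 * ((b - a) / (1/2) ^ n + 1) + 1 = 2 * (b - a) * 2 ^ n + 3 * (1::real)" by (simp add: power_one_over field_simps)
  also have "\<dots> \<le> 2 * (b - a) * 2 ^ n + 3 * 2 ^ n" by (intro add_left_mono mult_left_mono) auto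
  also have "\<dots> = (2 * (b - a) + 3) * 2 ^ n" by (simp add: algebra_simps)
  finally have "ln (2 * ((b - a) / (1/2) ^ n + 1) + 1) \<le> ln ((2 * (b - a) + 3) * 2 ^ n)"
  proof (subst ln_le_cancel_iff)
   have "0 \<le> (b - a) / (1/2) ^ n" using ab by simp
   then show "0 < 2 * ((b - a) / (1/2) ^ n + 1) + 1" by (rule npos)
  qed (use ab in auto)
  also have "\<dots> = ln (2 * (b - a) + 3) + real n * ln 2" using ab by (subst ln_mult_pos) (auto simp: ln_realpow)
  also have "\<dots> \<le> D * (real n + 1)" unfolding D_def using D0 by (simp add: algebra_simps)
  finally show ?thesis .
 qed
 have up: "ln (m n) \<le> D * (real n + 1)" for n
 proof -
  have "ln (m n) \<le> ln (2 * ((b - a) / (1/2) ^ n + 1) + 1)"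
   using moment_bounds(1)[of "(1/2) ^ n" q] mpos[of n] q unfolding m_def by (subst ln_le_cancel_iff) auto
  then show ?thesis using lnN[of n] by linarith
 qed
 have lo: "- (q * D) * (real n + 1) \<le> ln (m n)" for n
 proof -
  define N where "N = 2 * ((b - a) / (1/2) ^ n + 1) + 1"
  have "0 \<le> (b - a) / (1/2) ^ n" using ab by simp
  then have N: "0 < N" unfolding N_def by (rule npos)
  have "ln (N powr (-q)) \<le> ln (m n)"
   using moment_bounds(2)[of "(1/2) ^ n" q] mpos[of n] q N unfolding m_def N_def by (subst ln_le_cancel_iff) auto
  moreover have "q * ln N \<le> q * (D * (real n + 1))" using lnN[of n] q unfolding N_def by (intro mult_left_mono)
  ultimately show ?thesis using N by (simp add: ln_powr)
 qed
 have lnC: "0 \<le> ln C" using C by simp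
 have lnC': "(\<lambda>n. ln C / real n) \<longlonglongrightarrow> 0" by real_asymp
 have "\<exists>L. (\<lambda>n. ln (m n) / real n) \<longlonglongrightarrow> L"
 proof (cases "1 \<le> q")
  case True
  have "\<exists>L. (\<lambda>n. (ln (m n) + ln C) / real n) \<longlonglongrightarrow> L"
  proof (rule fekete[where B = "q * D"])
   fix k n
   have "ln (m (k + n)) \<le> ln (C * (m k * m n))" using m1[OF True] mpos C by (subst ln_le_cancel_iff) auto
   also have "\<dots> = ln C + ln (m k) + ln (m n)" using mpos C by (simp add: ln_mult_pos)
   finally show "ln (m (k + n)) + ln C \<le> ln (m k) + ln C + (ln (m n) + ln C)" by simp
   show "- (q * D) * (real n + 1) \<le> ln (m n) + ln C" using lo[of n] lnC by linarith
  qed (use q D in auto)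
  then obtain L where "(\<lambda>n. (ln (m n) + ln C) / real n) \<longlonglongrightarrow> L" by blast
  from tendsto_diff[OF this lnC'] show ?thesis by (auto simp: add_divide_distrib)
 next
  case False
  have "\<exists>L. (\<lambda>n. (ln C - ln (m n)) / real n) \<longlonglongrightarrow> L"
  proof (rule fekete[where B = "D"])
   fix k n
   have "ln (m k * m n) \<le> ln (C * m (k + n))" using m2[of k n] False mpos C by (subst ln_le_cancel_iff) auto
   also have "\<dots> = ln C + ln (m (k + n))" using mpos C by (simp add: ln_mult_pos)
   finally show "ln C - ln (m (k + n)) \<le> ln C - ln (m k) + (ln C - ln (m n))" using mpos by (simp add: ln_mult_pos)
   show "- D * (real n + 1) \<le> ln C - ln (m n)" using up[of n] lnC by simp
  qed (use D in auto)
  then obtain L where "(\<lambda>n. (ln C - ln (m n)) / real n) \<longlonglongrightarrow> L" by blast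
  from tendsto_diff[OF lnC' this] show ?thesis by (auto simp: diff_divide_distrib)
 qed
 then obtain L where L: "(\<lambda>n. ln (m n) / real n) \<longlonglongrightarrow> L" by blast
 have "has_growth (moment \<nu> q) (L / ln 2)"
 proof (rule growth_from_dyadic)
  show "1 \<le> (2 * 2 + 3) powr q * (2 * 2 + 3 :: real)" using q by (intro mult_ge1_I ge_one_powr_ge_zero) auto
  show "(\<lambda>n. ln (moment \<nu> q ((1/2) ^ n)) / real n) \<longlonglongrightarrow> L" using L by (simp add: m_def)
 qed (use q moment_pos scale_compare[of _ _ 2 q] in auto)
 then show ?thesis by blast
qed

end

section \<open>Ball integrals against mesh moments on the line\<close>

context bounded_prob
begin

definition block :: "real \<Rightarrow> int \<Rightarrow> int set" where
 "block \<delta> n = {n - 1..n + 1} \<inter> window \<delta>"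

definition block_mass :: "real \<Rightarrow> int \<Rightarrow> real" where
 "block_mass \<delta> n = (\<Sum>k\<in>block \<delta> n. mass \<delta> k)"

definition ball_integral :: "real \<Rightarrow> real \<Rightarrow> real" where
 "ball_integral q \<delta> = (LINT x:measure_support \<nu>|\<nu>. measure \<nu> (cball x \<delta>) powr (q - 1))"

lemma block: "finite (block \<delta> n)" "card (block \<delta> n) \<le> 3" "block \<delta> n \<subseteq> window \<delta>"
proof -
 show "finite (block \<delta> n)" "block \<delta> n \<subseteq> window \<delta>" by (auto simp: block_def)
 have "card (block \<delta> n) \<le> card {n - 1..n + 1}" unfolding block_def by (intro card_mono) auto
 then show "card (block \<delta> n) \<le> 3" by simp
qed

lemma block_cover:
 assumes "0 < \<delta>" "x \<in> mesh \<delta> n" "\<bar>x - y\<bar> \<le> \<delta>" "y \<in> {a..b}"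
 shows "y \<in> (\<Union>k\<in>block \<delta> n. mesh \<delta> k)"
proof -
 define k where "k = \<lfloor>y / \<delta>\<rfloor>"
 have k: "y \<in> mesh \<delta> k" using assms by (simp add: k_def mesh_iff)
 have n: "n = \<lfloor>x / \<delta>\<rfloor>" using assms by (simp add: mesh_iff)
 have "\<bar>x / \<delta> - y / \<delta>\<bar> \<le> 1" using assms by (simp add: diff_divide_distrib[symmetric])
 then have "k \<in> {n - 1..n + 1}" unfolding k_def n by (simp, linarith)
 moreover have "k \<in> window \<delta>" using k assms(4) unfolding window_def by blast
 ultimately show ?thesis using k unfolding block_def by blast
qed

lemma cball_mass:
 assumes "0 < \<delta>" "x \<in> mesh \<delta> n"
 shows "mass \<delta> n \<le> measure \<nu> (cball x \<delta>)" "measure \<nu> (cball x \<delta>) \<le> block_mass \<delta> n"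
proof -
 have "mesh \<delta> n \<subseteq> cball x \<delta>"
 proof
  fix y assume "y \<in> mesh \<delta> n"
  then have "\<bar>x - y\<bar> \<le> \<delta>" using mesh_close(2)[OF assms(1,2), of y n] by simp
  then show "y \<in> cball x \<delta>" by (simp add: dist_real_def)
 qed
 then show "mass \<delta> n \<le> measure \<nu> (cball x \<delta>)"
  using sets_borel by (intro finite_measure_mono) auto
 show "measure \<nu> (cball x \<delta>) \<le> block_mass \<delta> n"
  unfolding block_mass_def
 proof (rule le_sum_cover)
  show "cball x \<delta> \<inter> {a..b} \<subseteq> (\<Union>k\<in>block \<delta> n. mesh \<delta> k)"
   using block_cover[OF assms] by (auto simp: dist_real_def)
 qed (use block in auto)
qed

lemma cball_measurable: "(\<lambda>x. measure \<nu> (cball x \<delta>)) \<in> borel_measurable borel"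
proof -
 let ?Q = "{z::real \<times> real. dist (fst z) (snd z) \<le> \<delta>}"
 have "closed ?Q" by (intro closed_Collect_le continuous_intros)
 then have "?Q \<in> sets (borel \<Otimes>\<^sub>M borel)" by (subst borel_prod) (rule borel_closed)
 also have "sets (borel \<Otimes>\<^sub>M borel) = sets (borel \<Otimes>\<^sub>M \<nu>)"
  by (intro sets_pair_measure_cong refl sets_borel[symmetric])
 finally have "(\<lambda>x. emeasure \<nu> (Pair x -` ?Q)) \<in> borel_measurable borel" by (rule measurable_emeasure_Pair)
 moreover have "Pair x -` ?Q = cball x \<delta>" for x by auto
 ultimately show ?thesis by (simp add: measure_def)
qed

text \<open>Almost every point of the carrier lies in a charged cell, so bounds on charged cells
  trap the integrand between two step functions on the mesh.\<close>

lemma ball_integral_bounds: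
 assumes d: "0 < \<delta>"
  and h: "\<And>n x. 0 < mass \<delta> n \<Longrightarrow> x \<in> mesh \<delta> n \<Longrightarrow>
   h1 n \<le> measure \<nu> (cball x \<delta>) powr (q - 1) \<and> measure \<nu> (cball x \<delta>) powr (q - 1) \<le> h2 n"
 shows "(\<Sum>n\<in>window \<delta>. mass \<delta> n * h1 n) \<le> ball_integral q \<delta>"
  and "ball_integral q \<delta> \<le> (\<Sum>n\<in>window \<delta>. mass \<delta> n * h2 n)"
proof -
 define g where "g x = indicator (measure_support \<nu>) x *\<^sub>R measure \<nu> (cball x \<delta>) powr (q - 1)" for x
 define S where "S h x = (\<Sum>n\<in>window \<delta>. indicator (mesh \<delta> n) x * h n)" for h :: "int \<Rightarrow> real" and x
 have sp: "space \<nu> = UNIV" using sets_eq_imp_space_eq[OF sets_borel] by simp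
 have supp: "measure_support \<nu> \<in> sets borel" using closed_measure_support[of \<nu>] by (rule borel_closed)
 have ae1: "AE x in \<nu>. x \<in> measure_support \<nu>"
  using prob_measure_support[OF prob_space_axioms sets_borel] supp sets_borel by (subst (asm) prob_eq_1) auto
 have ae2: "AE x in \<nu>. x \<in> {a..b}" using carrier sets_borel by (subst (asm) prob_eq_1) auto
 have ae3: "AE x in \<nu>. \<forall>n\<in>window \<delta>. x \<in> mesh \<delta> n \<longrightarrow> 0 < mass \<delta> n"
 proof (rule AE_finite_allI)
  fix n
  show "AE x in \<nu>. x \<in> mesh \<delta> n \<longrightarrow> 0 < mass \<delta> n"
  proof (cases "0 < mass \<delta> n")
   case False
   then have "mass \<delta> n = 0" by (simp add: not_less measure_le_0_iff)
   then have "AE x in \<nu>. x \<notin> mesh \<delta> n" using sets_borel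
    by (intro AE_not_in) (auto simp: null_sets_def emeasure_eq_measure)
   then show ?thesis by eventually_elim auto
  qed simp
 qed (use window d in auto)
 have S: "S h x = h n" if "x \<in> mesh \<delta> n" "x \<in> {a..b}" for h x n
 proof -
  have "n \<in> window \<delta>" using that by (auto simp: window_def)
  then have "S h x = (\<Sum>k\<in>window \<delta>. if k = n then h k else 0)"
   unfolding S_def using that d by (intro sum.cong refl) (auto simp: indicator_def mesh_iff)
  then show ?thesis using \<open>n \<in> window \<delta>\<close> window d by simp
 qed
 have ae: "AE x in \<nu>. S h1 x \<le> g x \<and> g x \<le> S h2 x"
  using ae1 ae2 ae3
 proof eventually_elim
  case (elim x)
  define n where "n = \<lfloor>x / \<delta>\<rfloor>"
  have n: "x \<in> mesh \<delta> n" using d by (simp add: mesh_iff n_def)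
  then have "n \<in> window \<delta>" using elim by (auto simp: window_def)
  then have "0 < mass \<delta> n" using elim n by auto
  then show ?case using S[OF n elim(2)] h[OF _ n] elim(1) by (simp add: g_def)
 qed
 have Sint: "integrable \<nu> (S h)" "integral\<^sup>L \<nu> (S h) = (\<Sum>n\<in>window \<delta>. mass \<delta> n * h n)" for h
 proof -
  have mi: "mesh \<delta> n \<in> events" for n using sets_borel by simp
  have ii: "integrable \<nu> (\<lambda>x. indicator (mesh \<delta> n) x * h n)" for n
   using mi[of n] by (intro integrable_mult_left integrable_real_indicator) (auto simp: emeasure_eq_measure)
  have iv: "(LINT x|\<nu>. indicator (mesh \<delta> n) x * h n) = mass \<delta> n * h n" for n
   using sp by simp
  show "integrable \<nu> (S h)" unfolding S_def by (intro Bochner_Integration.integrable_sum ii)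
  show "integral\<^sup>L \<nu> (S h) = (\<Sum>n\<in>window \<delta>. mass \<delta> n * h n)"
   unfolding S_def by (subst Bochner_Integration.integral_sum) (simp_all only: ii iv)
 qed
 have gm: "g \<in> borel_measurable \<nu>"
 proof -
  note [measurable] = cball_measurable[of \<delta>] supp
  show ?thesis unfolding g_def by (subst measurable_cong_sets[OF sets_borel refl]) measurable
 qed
 have gi: "integrable \<nu> g"
 proof (rule integrable_const_bound[OF _ gm])
  show "AE x in \<nu>. norm (g x) \<le> (\<Sum>n\<in>window \<delta>. \<bar>h2 n\<bar>)"
   using ae
  proof eventually_elim
   case (elim x)
   have "norm (g x) = g x" by (simp add: g_def)
   also have "\<dots> \<le> S h2 x" using elim by simp
   also have "\<dots> \<le> (\<Sum>n\<in>window \<delta>. \<bar>h2 n\<bar>)"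
    unfolding S_def by (intro sum_mono) (auto simp: indicator_def)
   finally show ?case .
  qed
 qed
 have T: "ball_integral q \<delta> = integral\<^sup>L \<nu> g"
  by (simp add: ball_integral_def set_lebesgue_integral_def g_def[abs_def])
 show "(\<Sum>n\<in>window \<delta>. mass \<delta> n * h1 n) \<le> ball_integral q \<delta>"
  unfolding T Sint(2)[symmetric] using ae by (intro integral_mono_AE Sint gi) auto
 show "ball_integral q \<delta> \<le> (\<Sum>n\<in>window \<delta>. mass \<delta> n * h2 n)"
  unfolding T Sint(2)[symmetric] using ae by (intro integral_mono_AE Sint gi) auto
qed

lemma sum_mass_powr:
 "(\<Sum>n\<in>A. mass \<delta> n * mass \<delta> n powr (q - 1)) = (\<Sum>n\<in>A. mass \<delta> n powr q)"
proof (intro sum.cong refl)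
 fix n
 show "mass \<delta> n * mass \<delta> n powr (q - 1) = mass \<delta> n powr q"
  by (cases "mass \<delta> n = 0") (auto simp: powr_diff)
qed

lemma mass_le_block:
 assumes "0 < \<delta>"
 shows "mass \<delta> n \<le> block_mass \<delta> n"
 using cball_mass[OF assms, of "of_int n * \<delta>" n] assms by (simp add: mesh_def)

lemma ball_integral_ge_one:
 assumes "0 < \<delta>" "1 \<le> q"
 shows "moment \<nu> q \<delta> \<le> ball_integral q \<delta>" "ball_integral q \<delta> \<le> 3 powr q * 3 * moment \<nu> q \<delta>"
proof -
 have h: "mass \<delta> n powr (q - 1) \<le> measure \<nu> (cball x \<delta>) powr (q - 1) \<and>
   measure \<nu> (cball x \<delta>) powr (q - 1) \<le> block_mass \<delta> n powr (q - 1)" if "x \<in> mesh \<delta> n" for n x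
  using cball_mass[OF assms(1) that] assms(2) by (auto intro!: powr_mono2)
 note * = ball_integral_bounds[of \<delta> "\<lambda>n. mass \<delta> n powr (q - 1)" q "\<lambda>n. block_mass \<delta> n powr (q - 1)",
   OF assms(1) h]
 show "moment \<nu> q \<delta> \<le> ball_integral q \<delta>"
  using *(1) by (simp add: moment_window[OF assms(1)] sum_mass_powr)
 have bn: "0 \<le> block_mass \<delta> n" for n unfolding block_mass_def by (intro sum_nonneg) auto
 have "ball_integral q \<delta> \<le> (\<Sum>n\<in>window \<delta>. mass \<delta> n * block_mass \<delta> n powr (q - 1))" by (rule *(2))
 also have "\<dots> \<le> (\<Sum>n\<in>window \<delta>. block_mass \<delta> n powr q)"
 proof (rule sum_mono)
  fix n
  have "mass \<delta> n * block_mass \<delta> n powr (q - 1) \<le> block_mass \<delta> n * block_mass \<delta> n powr (q - 1)"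
   using mass_le_block[OF assms(1)] by (intro mult_right_mono) auto
  also have "\<dots> = block_mass \<delta> n powr q"
   using bn[of n] by (cases "block_mass \<delta> n = 0") (auto simp: powr_diff)
  finally show "mass \<delta> n * block_mass \<delta> n powr (q - 1) \<le> block_mass \<delta> n powr q" .
 qed
 also have "\<dots> \<le> 3 powr q * 3 * moment \<nu> q \<delta>"
  unfolding moment_window[OF assms(1)]
 proof (rule moment_compare[where N = "block \<delta>"])
  fix k
  have "{j \<in> window \<delta>. k \<in> block \<delta> j} \<subseteq> {k - 1..k + 1}" by (auto simp: block_def)
  then have "card {j \<in> window \<delta>. k \<in> block \<delta> j} \<le> card {k - 1..k + 1}" by (intro card_mono) auto
  then show "real (card {j \<in> window \<delta>. k \<in> block \<delta> j}) \<le> 3" by simp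
 next
  fix j show "real (card (block \<delta> j)) \<le> 3" using block(2)[of \<delta> j] by simp
 qed (use window assms block bn in \<open>auto simp: block_mass_def\<close>)
 finally show "ball_integral q \<delta> \<le> 3 powr q * 3 * moment \<nu> q \<delta>" .
qed

text \<open>For \<open>q < 1\<close> the power is decreasing, so the lower bound is weak where a
  light cell sits beside a heavy one: the ball sees the heavy neighbour. The next lemmas control
  this loss.\<close>

lemma ball_integral_le_one:
 assumes "0 < \<delta>" "q \<le> 1"
 shows "ball_integral q \<delta> \<le> moment \<nu> q \<delta>"
  "(\<Sum>n\<in>window \<delta>. mass \<delta> n * block_mass \<delta> n powr (q - 1)) \<le> ball_integral q \<delta>"
proof -
 have h: "block_mass \<delta> n powr (q - 1) \<le> measure \<nu> (cball x \<delta>) powr (q - 1) \<and>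
   measure \<nu> (cball x \<delta>) powr (q - 1) \<le> mass \<delta> n powr (q - 1)"
  if "0 < mass \<delta> n" "x \<in> mesh \<delta> n" for n x
  using cball_mass[OF assms(1) that(2)] that(1) assms(2) by (auto intro!: powr_mono2')
 note * = ball_integral_bounds[of \<delta> "\<lambda>n. block_mass \<delta> n powr (q - 1)" q "\<lambda>n. mass \<delta> n powr (q - 1)",
   OF assms(1) h]
 show "ball_integral q \<delta> \<le> moment \<nu> q \<delta>"
  using *(2) by (simp add: moment_window[OF assms(1)] sum_mass_powr)
 show "(\<Sum>n\<in>window \<delta>. mass \<delta> n * block_mass \<delta> n powr (q - 1)) \<le> ball_integral q \<delta>"
  by (rule *(1))
qed

text \<open>If the block around a mesh interval is much heavier than the interval, one of its neighbours
 has at least twice the mass, so a walk towards heavier neighbours stops after \<open>L\<close> steps.\<close>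
lemma heavy_chain:
 assumes "0 < \<delta>" "n \<in> window \<delta>" "(1/2) ^ L \<le> mass \<delta> n"
 shows "\<exists>k\<in>window \<delta>. \<bar>k - n\<bar> \<le> int L \<and> block_mass \<delta> k \<le> 5 * mass \<delta> k \<and>
  mass \<delta> n \<le> mass \<delta> k"
 using assms(2,3)
proof (induction L arbitrary: n)
 case 0
 have "block_mass \<delta> n \<le> (\<Sum>k\<in>window \<delta>. mass \<delta> k)"
  unfolding block_mass_def using window assms(1) block by (intro sum_mono2) auto
 then have "block_mass \<delta> n \<le> 5 * mass \<delta> n" using sum_mesh[OF assms(1)] 0 by simp
 then show ?case using 0 by (intro bexI[of _ n]) auto
next
 case (Suc L)
 show ?case
 proof (cases "block_mass \<delta> n \<le> 5 * mass \<delta> n")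
  case True
  then show ?thesis using Suc.prems by (intro bexI[of _ n]) auto
 next
  case False
  have "\<exists>k\<in>block \<delta> n. 5 / 3 * mass \<delta> n \<le> mass \<delta> k"
  proof (rule ccontr)
   assume "\<not> ?thesis"
   then have "block_mass \<delta> n \<le> real (card (block \<delta> n)) * (5 / 3 * mass \<delta> n)"
    unfolding block_mass_def by (intro sum_bounded_above) (auto simp: not_le less_imp_le)
   also have "\<dots> \<le> 3 * (5 / 3 * mass \<delta> n)"
    using block(2)[of \<delta> n] by (intro mult_right_mono) auto
   finally show False using False by simp
  qed
  \<comment> \<open>The threshold 5 is \<open>1 + 2 * 2\<close>: the cell itself and two neighbours
    of less than twice its mass.\<close>
  have "\<exists>k\<in>block \<delta> n. 2 * mass \<delta> n \<le> mass \<delta> k"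
  proof (rule ccontr)
   assume *: "\<not> ?thesis"
   have nb: "n \<in> block \<delta> n" using Suc.prems by (simp add: block_def)
   have "block_mass \<delta> n = mass \<delta> n + (\<Sum>k\<in>block \<delta> n - {n}. mass \<delta> k)"
    unfolding block_mass_def using block(1) nb by (rule sum.remove)
   also have "(\<Sum>k\<in>block \<delta> n - {n}. mass \<delta> k) \<le>
     real (card (block \<delta> n - {n})) * (2 * mass \<delta> n)"
    using * by (intro sum_bounded_above) (auto simp: not_le less_imp_le)
   also have "\<dots> \<le> 2 * (2 * mass \<delta> n)"
    using block[of \<delta> n] nb by (intro mult_right_mono) (auto simp: card_Diff_singleton)
   finally show False using False by simp
  qed
  then obtain k where k: "k \<in> block \<delta> n" "2 * mass \<delta> n \<le> mass \<delta> k" by blast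
  have "(1/2) ^ L \<le> mass \<delta> k" using Suc.prems(2) k(2) by simp
  moreover have "k \<in> window \<delta>" using k(1) block(3) by blast
  ultimately obtain k' where k': "k' \<in> window \<delta>" "\<bar>k' - k\<bar> \<le> int L"
   "block_mass \<delta> k' \<le> 5 * mass \<delta> k'" "mass \<delta> k \<le> mass \<delta> k'"
   using Suc.IH by blast
  have "\<bar>k' - n\<bar> \<le> int (Suc L)" using k'(2) k(1) by (auto simp: block_def)
  moreover have "mass \<delta> n \<le> mass \<delta> k" using k(2) measure_nonneg[of \<nu> "mesh \<delta> n"] by linarith
  ultimately show ?thesis using k' by (intro bexI[of _ k']) auto
 qed
qed

text \<open>Each charged cell is sent to a cell of at least its mass, at most \<open>L + 1\<close>
  steps away, whose block weighs at most five times as much; few cells share a target. The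
  hypothesis concerns blocks because a single charged cell may carry arbitrarily little mass.
  Starting from the heaviest cell of the block costs the factor 3 and one more step.\<close>

lemma moment_le_ball_integral:
 assumes d: "0 < \<delta>" and q: "0 \<le> q" "q \<le> 1"
  and L: "\<And>n. 0 < mass \<delta> n \<Longrightarrow> 3 * (1/2) ^ L \<le> block_mass \<delta> n"
 shows "moment \<nu> q \<delta> \<le> (2 * (real L + 1) + 1) * 5 powr (1 - q) * ball_integral q \<delta>"
proof -
 define B where "B = {n. 0 < mass \<delta> n}"
 define G where "G = {k \<in> window \<delta>. block_mass \<delta> k \<le> 5 * mass \<delta> k}"
 have fin: "finite B" "finite G"
  using finite_subset[OF pos_window window(1)[OF d]] window(1)[OF d] by (auto simp: B_def G_def)
 have "\<exists>k\<in>G. \<bar>k - n\<bar> \<le> int L + 1 \<and> mass \<delta> n \<le> mass \<delta> k" if n: "n \<in> B" for n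
 proof -
  have nw: "n \<in> window \<delta>" using n pos_window by (auto simp: B_def)
  have nb: "n \<in> block \<delta> n" using nw by (simp add: block_def)
  define M where "M = Max ((\<lambda>k. mass \<delta> k) ` block \<delta> n)"
  have "M \<in> (\<lambda>k. mass \<delta> k) ` block \<delta> n"
   unfolding M_def using block(1) nb by (intro Max_in) auto
  then obtain m where m: "m \<in> block \<delta> n" "mass \<delta> m = M" by auto
  have M: "mass \<delta> k \<le> M" if "k \<in> block \<delta> n" for k
   using that block(1) unfolding M_def by auto
  have "block_mass \<delta> n \<le> real (card (block \<delta> n)) * M"
   unfolding block_mass_def using M by (intro sum_bounded_above)
  also have "\<dots> \<le> 3 * M" using block(2)[of \<delta> n] m(2) by (intro mult_right_mono) auto
  finally have "(1/2) ^ L \<le> M" using L[of n] n by (simp add: B_def)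
  moreover have "m \<in> window \<delta>" using m block(3) by blast
  ultimately obtain k where k: "k \<in> window \<delta>" "\<bar>k - m\<bar> \<le> int L"
   "block_mass \<delta> k \<le> 5 * mass \<delta> k" "mass \<delta> m \<le> mass \<delta> k"
   using heavy_chain[OF d, of m L] m(2) by blast
  have "\<bar>k - n\<bar> \<le> int L + 1" using k(2) m(1) by (auto simp: block_def)
  then show ?thesis using k M[OF nb] m(2) by (intro bexI[of _ k]) (auto simp: G_def)
 qed
 then obtain \<sigma> where \<sigma>: "\<And>n. n \<in> B \<Longrightarrow> \<sigma> n \<in> G" "\<And>n. n \<in> B \<Longrightarrow> \<bar>\<sigma> n - n\<bar> \<le> int L + 1"
  "\<And>n. n \<in> B \<Longrightarrow> mass \<delta> n \<le> mass \<delta> (\<sigma> n)" by metis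
 have "(\<Sum>n\<in>B. mass \<delta> n powr q) \<le> 1 powr q * (2 * (real L + 1) + 1) * (\<Sum>k\<in>G. mass \<delta> k powr q)"
 proof (rule moment_compare[where N = "\<lambda>n. {\<sigma> n}"])
  fix k
  have "\<bar>real_of_int j - of_int k\<bar> \<le> real L + 1" if "j \<in> {j \<in> B. k \<in> {\<sigma> j}}" for j
   using that \<sigma>(2)[of j] by auto
  from card_int_window(2)[of "{j \<in> B. k \<in> {\<sigma> j}}", OF this]
  show "real (card {j \<in> B. k \<in> {\<sigma> j}}) \<le> 2 * (real L + 1) + 1" by simp
 qed (use fin q \<sigma> in auto)
 also have "(\<Sum>k\<in>G. mass \<delta> k powr q) \<le>
   (\<Sum>k\<in>G. 5 powr (1 - q) * (mass \<delta> k * block_mass \<delta> k powr (q - 1)))"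
 proof (rule sum_mono)
  fix k assume k: "k \<in> G"
  show "mass \<delta> k powr q \<le> 5 powr (1 - q) * (mass \<delta> k * block_mass \<delta> k powr (q - 1))"
  proof (cases "mass \<delta> k = 0")
   case False
   then have m0: "0 < mass \<delta> k" by (simp add: less_le)
   then have b0: "0 < block_mass \<delta> k" using mass_le_block[OF d, of k] by linarith
   have "(5 * mass \<delta> k) powr (q - 1) \<le> block_mass \<delta> k powr (q - 1)"
    using k q b0 by (intro powr_mono2') (auto simp: G_def)
   then have "5 powr (q - 1) * mass \<delta> k powr (q - 1) \<le> block_mass \<delta> k powr (q - 1)"
    using m0 by (simp add: powr_mult)
   then have "5 powr (1 - q) * (5 powr (q - 1) * mass \<delta> k powr (q - 1)) \<le>
     5 powr (1 - q) * block_mass \<delta> k powr (q - 1)" by (intro mult_left_mono) auto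
   moreover have "5 powr (1 - q) * 5 powr (q - 1) = (1::real)" by (simp add: powr_add[symmetric])
   ultimately have "mass \<delta> k powr (q - 1) \<le> 5 powr (1 - q) * block_mass \<delta> k powr (q - 1)"
    by (simp add: mult.assoc[symmetric])
   then have "mass \<delta> k * mass \<delta> k powr (q - 1) \<le>
     mass \<delta> k * (5 powr (1 - q) * block_mass \<delta> k powr (q - 1))"
    using m0 by (intro mult_left_mono) auto
   moreover have "mass \<delta> k * mass \<delta> k powr (q - 1) = mass \<delta> k powr q"
    using m0 by (simp add: powr_diff)
   ultimately show ?thesis by (simp add: mult_ac)
  qed simp
 qed
 also have "\<dots> = 5 powr (1 - q) * (\<Sum>k\<in>G. mass \<delta> k * block_mass \<delta> k powr (q - 1))"
  by (simp add: sum_distrib_left)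
 also have "(\<Sum>k\<in>G. mass \<delta> k * block_mass \<delta> k powr (q - 1)) \<le>
   (\<Sum>k\<in>window \<delta>. mass \<delta> k * block_mass \<delta> k powr (q - 1))"
  using window d by (intro sum_mono2) (auto simp: G_def)
 also have "\<dots> \<le> ball_integral q \<delta>" by (rule ball_integral_le_one[OF d q(2)])
 finally have "(\<Sum>n\<in>B. mass \<delta> n powr q) \<le>
   1 powr q * (2 * (real L + 1) + 1) * (5 powr (1 - q) * ball_integral q \<delta>)"
  by (simp add: mult_left_mono)
 then show ?thesis by (simp add: moment_def B_def mult.assoc)
qed

end

context self_similar
begin

text \<open>A charged cell is met by the image of \<open>{a..b}\<close> under some word of the cut
  at \<open>\<delta> / s\<close>. That image fits into the block, which therefore carries at least
  the weight of the word. With \<open>A\<close> such that \<open>c i powr A \<le> p i\<close>, this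
  weight is at least a fixed power of \<delta> up to a constant.\<close>

lemma block_mass_lower:
 "\<exists>A\<ge>0. \<exists>C>0. \<forall>\<delta>\<in>{0<..1}. \<forall>n. 0 < mass \<delta> n \<longrightarrow> C * \<delta> powr A \<le> block_mass \<delta> n"
proof -
 define A where "A = Max (insert 0 ((\<lambda>i. ln (p i) / ln (c i)) ` I))"
 have A0: "0 \<le> A" unfolding A_def using fin by (intro Max_ge) auto
 have "c i powr A \<le> p i" if "i \<in> I" for i
 proof -
  have lc: "ln (c i) < 0" using c[OF that] by simp
  have "ln (p i) / ln (c i) \<le> A" unfolding A_def using fin that by (intro Max_ge) auto
  then have "A * ln (c i) \<le> ln (p i)" using lc by (simp add: neg_divide_le_eq)
  then have "exp (A * ln (c i)) \<le> exp (ln (p i))" by simp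
  then show ?thesis using c[OF that] p(1)[OF that] by (simp add: powr_def)
 qed
 then have cp: "cw w powr A \<le> pw w" if "set w \<subseteq> I" for w
  using that
 proof (induction w)
  case (Cons i w)
  then have "c i powr A * cw w powr A \<le> p i * pw w"
   using p(1) by (intro mult_mono) (auto intro: less_imp_le)
  then show ?case using Cons.prems c word_prod_pos[of I c w] by (simp add: powr_mult)
 qed simp
 \<comment> \<open>Makes \<open>r = \<delta> / s\<close> satisfy both
   \<open>r * (b - a) \<le> \<delta>\<close> and \<open>r \<le> 1\<close>.\<close>
 define s where "s = b - a + 1"
 have s: "1 \<le> s" using ab by (simp add: s_def)
 show ?thesis
 proof (rule exI[of _ A], rule conjI[OF A0], rule exI[of _ "(\<kappa> / s) powr A"], intro conjI ballI allI impI)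
  show "0 < (\<kappa> / s) powr A" using \<kappa> s by simp
  fix \<delta> n assume d: "\<delta> \<in> {0<..1}" and n: "0 < mass \<delta> n"
  define r where "r = \<delta> / s"
  have r: "0 < r" "r \<le> 1" "r * (b - a) \<le> \<delta>"
  proof -
   show "0 < r" "r \<le> 1" using d s by (auto simp: r_def divide_le_eq)
   have "r * (b - a) \<le> r * s" using \<open>0 < r\<close> by (intro mult_left_mono) (auto simp: s_def)
   then show "r * (b - a) \<le> \<delta>" using s by (simp add: r_def)
  qed
  obtain Z where Z: "finite Z" "\<And>w. w \<in> Z \<Longrightarrow> set w \<subseteq> I" "\<And>w. w \<in> Z \<Longrightarrow> cw w \<le> r"
   "\<And>w. w \<in> Z \<Longrightarrow> \<kappa> * r \<le> cw w"
   "\<And>A. A \<in> sets borel \<Longrightarrow> measure \<nu> A = (\<Sum>w\<in>Z. pw w * measure \<nu> (wmap f w -` A))"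
   "\<And>w. w \<in> Z \<Longrightarrow> 0 < pw w"
   by (rule cut_at[OF r(1,2)]) blast
  have "\<exists>w\<in>Z. measure \<nu> (wmap f w -` mesh \<delta> n) \<noteq> 0"
  proof (rule ccontr)
   assume "\<not> ?thesis"
   then have "mass \<delta> n = 0" using Z(5)[of "mesh \<delta> n"] by simp
   then show False using n by simp
  qed
  then obtain w where w: "w \<in> Z" "0 < measure \<nu> (wmap f w -` mesh \<delta> n)" by (auto simp: zero_less_measure_iff)
  then obtain x where x: "x \<in> {a..b}" "wmap f w x \<in> mesh \<delta> n"
   using pos_meets[OF word_vimage_borel[OF Z(2)[OF w(1)] mesh_borel] w(2)] by blast
  let ?U = "\<Union>k\<in>block \<delta> n. mesh \<delta> k"
  have Ub: "?U \<in> sets borel" using block by (intro sets.finite_UN) auto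
  have "{a..b} \<subseteq> wmap f w -` ?U"
  proof
   fix y assume y: "y \<in> {a..b}"
   have "\<bar>wmap f w x - wmap f w y\<bar> = cw w * \<bar>x - y\<bar>" using Z w by (intro word_dist) auto
   also have "\<dots> \<le> r * (b - a)" using Z(3)[OF w(1)] x y r by (intro mult_mono) auto
   finally have "\<bar>wmap f w x - wmap f w y\<bar> \<le> \<delta>" using r by linarith
   then show "y \<in> wmap f w -` ?U"
    using block_cover[of \<delta> "wmap f w x" n "wmap f w y"] x y d inv_word[of w y] Z(2)[OF w(1)] by auto
  qed
  then have "measure \<nu> {a..b} \<le> measure \<nu> (wmap f w -` ?U)"
   using Z(2) w Ub sets_borel by (intro finite_measure_mono) auto
  then have one: "measure \<nu> (wmap f w -` ?U) = 1" using carrier prob_le_1[of "wmap f w -` ?U"] by linarith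
  have "(\<kappa> / s) powr A * \<delta> powr A = (\<kappa> * r) powr A"
   using \<kappa> s d by (simp add: r_def powr_mult[symmetric])
  also have "\<dots> \<le> cw w powr A" using Z(4)[OF w(1)] \<kappa> r A0 by (intro powr_mono2) auto
  also have "\<dots> \<le> pw w * measure \<nu> (wmap f w -` ?U)" using cp[OF Z(2)[OF w(1)]] one by simp
  also have "\<dots> \<le> (\<Sum>w\<in>Z. pw w * measure \<nu> (wmap f w -` ?U))"
   using w(1) Z(1,6) by (intro member_le_sum) (auto simp: less_imp_le)
  also have "\<dots> = measure \<nu> ?U" by (rule Z(5)[symmetric]) (rule Ub)
  also have "\<dots> \<le> block_mass \<delta> n"
   unfolding block_mass_def using block sets_borel by (intro finite_measure_subadditive_finite) auto
  finally show "(\<kappa> / s) powr A * \<delta> powr A \<le> block_mass \<delta> n" .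
 qed
qed

text \<open>The number \<open>L\<close> of doublings that lead from the smallest block mass to 1 is
  of order \<open>- ln \<delta>\<close>, which \<open>\<delta> powr (-\<epsilon>)\<close>
  dominates.\<close>

lemma moment_le_ball_integral_powr:
 assumes q: "0 \<le> q" "q \<le> 1" and e: "0 < \<epsilon>"
 shows "\<exists>C>0. \<forall>\<delta>\<in>{0<..1}. moment \<nu> q \<delta> \<le> C * \<delta> powr (-\<epsilon>) * ball_integral q \<delta>"
proof -
 obtain A C where A: "0 \<le> A" "0 < C"
  "\<And>\<delta> n. \<delta> \<in> {0<..1} \<Longrightarrow> 0 < mass \<delta> n \<Longrightarrow> C * \<delta> powr A \<le> block_mass \<delta> n"
  using block_mass_lower by blast
 define D where "D = 2 * (\<bar>log 2 (3 / C)\<bar> + 2) + 1 + 2 * (A / (ln 2 * \<epsilon>))"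
 have D: "0 < D" using A e unfolding D_def by (intro add_pos_nonneg) auto
 show ?thesis
 proof (intro exI[of _ "D * 5 powr (1 - q)"] conjI ballI)
  show "0 < D * 5 powr (1 - q)" using D by simp
  fix \<delta> :: real assume d: "\<delta> \<in> {0<..1}"
  define x where "x = log 2 (3 / (C * \<delta> powr A))"
  define L where "L = nat \<lceil>x\<rceil>"
  have L1: "3 * (1/2) ^ L \<le> C * \<delta> powr A"
  proof -
   have "x \<le> real L" by (simp add: L_def, linarith)
   then have "2 powr x \<le> 2 powr real L" by simp
   then have "3 / (C * \<delta> powr A) \<le> 2 ^ L" using A(2) d by (simp add: x_def powr_realpow)
   then show ?thesis using A(2) d by (simp add: field_simps power_one_over)
  qed
  have L2: "real L \<le> \<bar>x\<bar> + 1" unfolding L_def by linarith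
  have lnd: "- ln \<delta> \<le> \<delta> powr (-\<epsilon>) / \<epsilon>"
   using ln_powr_bound[of "1 / \<delta>" \<epsilon>] d e by (simp add: ln_div powr_divide powr_minus_divide)
  have d1: "1 \<le> \<delta> powr (-\<epsilon>)" using d e powr_mono'[of "-\<epsilon>" 0 \<delta>] by simp
  have "x = log 2 (3 / C) + A * (- ln \<delta>) / ln 2"
   using A(2) d by (simp add: x_def log_def ln_div ln_mult_pos ln_powr field_simps)
  moreover have "0 \<le> A * (- ln \<delta>) / ln 2" using A d by (auto intro!: mult_nonneg_nonpos divide_nonpos_nonneg)
  ultimately have "\<bar>x\<bar> \<le> \<bar>log 2 (3 / C)\<bar> + A * (- ln \<delta>) / ln 2" by linarith
  also have "A * (- ln \<delta>) / ln 2 \<le> A * (\<delta> powr (-\<epsilon>) / \<epsilon>) / ln 2"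
   using lnd A by (intro divide_right_mono mult_left_mono) auto
  finally have x: "\<bar>x\<bar> \<le> \<bar>log 2 (3 / C)\<bar> + A / (ln 2 * \<epsilon>) * \<delta> powr (-\<epsilon>)" by (simp add: mult_ac)
  have aux: "l \<le> ax + 1 \<Longrightarrow> ax \<le> al + k \<Longrightarrow> 2 * (l + 1) + 1 \<le> (2 * (al + 2) + 1) * 1 + 2 * k"
   for l ax al k :: real by simp
  define K where "K = A / (ln 2 * \<epsilon>) * \<delta> powr (-\<epsilon>)"
  have "2 * (real L + 1) + 1 \<le> (2 * (\<bar>log 2 (3 / C)\<bar> + 2) + 1) * 1 + 2 * K"
   using L2 x unfolding K_def[symmetric] by (rule aux)
  also have "\<dots> \<le> (2 * (\<bar>log 2 (3 / C)\<bar> + 2) + 1) * \<delta> powr (-\<epsilon>) + 2 * K"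
   using d1 by (intro add_right_mono mult_left_mono) auto
  also have "\<dots> = D * \<delta> powr (-\<epsilon>)" by (simp add: D_def K_def algebra_simps)
  finally have LD: "2 * (real L + 1) + 1 \<le> D * \<delta> powr (-\<epsilon>)" .
  have "3 * (1/2) ^ L \<le> block_mass \<delta> n" if "0 < mass \<delta> n" for n
   using A(3)[OF d that] L1 by linarith
  then have "moment \<nu> q \<delta> \<le> (2 * (real L + 1) + 1) * 5 powr (1 - q) * ball_integral q \<delta>"
   using d q by (intro moment_le_ball_integral) auto
  also have "\<dots> \<le> (D * \<delta> powr (-\<epsilon>)) * 5 powr (1 - q) * ball_integral q \<delta>"
  proof (intro mult_right_mono LD)
   show "0 \<le> ball_integral q \<delta>"
    unfolding ball_integral_def set_lebesgue_integral_def by (intro Bochner_Integration.integral_nonneg) auto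
  qed auto
  finally show "moment \<nu> q \<delta> \<le> D * 5 powr (1 - q) * \<delta> powr (-\<epsilon>) * ball_integral q \<delta>" by (simp add: mult_ac)
 qed
qed

text \<open>Settles that the limit defining the spectrum exists and turns it into power bounds for
  moments. From here on the spectra enter only through this statement.\<close>

theorem Lq_spectrum_growth:
 assumes q: "0 \<le> q"
 shows "has_growth (moment \<nu> q) (Lq_spectrum \<nu> q)"
proof -
 obtain s where s: "has_growth (moment \<nu> q) s" using growth_exists[OF q] by blast
 have "((\<lambda>\<delta>. ln (ball_integral q \<delta>) / (- ln \<delta>)) \<longlongrightarrow> s) (at_right 0)"
 proof (rule growth_sandwich[OF s])
  fix \<epsilon> :: real assume e: "0 < \<epsilon>"
  have ev: "eventually (\<lambda>\<delta>::real. \<delta> \<in> {0<..1}) (at_right 0)"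
   using eventually_ln_small[of 1 0] by (auto elim: eventually_mono)
  have d1: "1 \<le> \<delta> powr (-\<epsilon>)" if "\<delta> \<in> {0<..1}" for \<delta> :: real
   using that e powr_mono'[of "-\<epsilon>" 0 \<delta>] by simp
  have bi0: "0 \<le> ball_integral q \<delta>" for \<delta>
   unfolding ball_integral_def set_lebesgue_integral_def by (intro Bochner_Integration.integral_nonneg) auto
  show "\<exists>C>0. eventually (\<lambda>\<delta>. ball_integral q \<delta> \<le> C * \<delta> powr (-\<epsilon>) * moment \<nu> q \<delta> \<and>
    moment \<nu> q \<delta> \<le> C * \<delta> powr (-\<epsilon>) * ball_integral q \<delta>) (at_right 0)"
  proof (cases "1 \<le> q")
   case True
   let ?C = "3 powr q * 3 :: real"
   have C1: "1 \<le> ?C" using q by (intro mult_ge1_I ge_one_powr_ge_zero) auto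
   show ?thesis
   proof (intro exI[of _ ?C] conjI eventually_mono[OF ev])
    fix \<delta> :: real assume d: "\<delta> \<in> {0<..1}"
    have k: "?C * 1 \<le> ?C * \<delta> powr (-\<epsilon>)" using d1[OF d] by (intro mult_left_mono) auto
    have m1: "?C * 1 * moment \<nu> q \<delta> \<le> (?C * \<delta> powr (-\<epsilon>)) * moment \<nu> q \<delta>"
     using k moment_nonneg by (intro mult_right_mono) auto
    have m2: "1 * ball_integral q \<delta> \<le> (?C * \<delta> powr (-\<epsilon>)) * ball_integral q \<delta>"
     using mult_ge1_I[OF C1 d1[OF d]] bi0 by (intro mult_right_mono) auto
    show "ball_integral q \<delta> \<le> ?C * \<delta> powr (-\<epsilon>) * moment \<nu> q \<delta>"
     by (rule order_trans[OF ball_integral_ge_one(2) order_trans[OF _ m1]]) (use d True in auto)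
    show "moment \<nu> q \<delta> \<le> ?C * \<delta> powr (-\<epsilon>) * ball_integral q \<delta>"
     by (rule order_trans[OF ball_integral_ge_one(1) order_trans[OF _ m2]]) (use d True in auto)
   qed simp
  next
   case False
   then obtain C where C: "0 < C" "\<And>\<delta>. \<delta> \<in> {0<..1} \<Longrightarrow> moment \<nu> q \<delta> \<le> C * \<delta> powr (-\<epsilon>) * ball_integral q \<delta>"
    using moment_le_ball_integral_powr[OF q _ e] by auto
   define C' where "C' = max 1 C"
   show ?thesis
   proof (intro exI[of _ C'] conjI eventually_mono[OF ev])
    show "0 < C'" by (simp add: C'_def)
    fix \<delta> :: real assume d: "\<delta> \<in> {0<..1}"
    have "1 * 1 \<le> C' * \<delta> powr (-\<epsilon>)" using d1[OF d] by (intro mult_mono) (auto simp: C'_def)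
    then have "1 * moment \<nu> q \<delta> \<le> C' * \<delta> powr (-\<epsilon>) * moment \<nu> q \<delta>"
     using moment_nonneg by (intro mult_right_mono) auto
    then show "ball_integral q \<delta> \<le> C' * \<delta> powr (-\<epsilon>) * moment \<nu> q \<delta>"
     using ball_integral_le_one(1)[of \<delta> q] d False by auto
    have "C * \<delta> powr (-\<epsilon>) * ball_integral q \<delta> \<le> C' * \<delta> powr (-\<epsilon>) * ball_integral q \<delta>"
     using bi0 by (intro mult_right_mono) (auto simp: C'_def)
    then show "moment \<nu> q \<delta> \<le> C' * \<delta> powr (-\<epsilon>) * ball_integral q \<delta>" using C(2)[OF d] by linarith
   qed
  qed
 qed
 then have "Lq_spectrum \<nu> q = s"
  unfolding Lq_spectrum_def ball_integral_def by (intro tendsto_Lim) auto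
 then show ?thesis using s by simp
qed

end

subsection \<open>Box-like self-affine measures in the plane\<close>

abbreviation cell :: "real \<Rightarrow> int \<times> int \<Rightarrow> (real \<times> real) set" where
 "cell \<delta> Q \<equiv> mesh \<delta> (fst Q) \<times> mesh \<delta> (snd Q)"

lemma cell_borel [simp]: "cell \<delta> Q \<in> sets borel"
 by (metis borel_Times mesh_borel)

definition moment2 :: "(real \<times> real) measure \<Rightarrow> real \<Rightarrow> real \<Rightarrow> real" where
 "moment2 \<mu> q \<delta> = (\<Sum>Q | 0 < measure \<mu> (cell \<delta> Q). measure \<mu> (cell \<delta> Q) powr q)"

lemma moment2_eq:
 assumes "finite B" "{Q. 0 < measure \<mu> (cell \<delta> Q)} \<subseteq> B"
 shows "moment2 \<mu> q \<delta> = (\<Sum>Q\<in>B. measure \<mu> (cell \<delta> Q) powr q)"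
 unfolding moment2_def using assms
 by (intro sum.mono_neutral_left) (auto simp: not_less measure_le_0_iff)

text \<open>Turns disjoint intervals into distinct lattice points. The half step
  \<open>l / 2\<close> makes the first lattice point beyond \<open>max \<alpha> (t - l)\<close> fall
  strictly inside the interval and stay within \<open>l\<close> of \<open>t\<close>.\<close>

lemma lattice_point:
 fixes e u C a b l t :: real
 assumes f: "f = (\<lambda>x. e * x + u)" "\<bar>e\<bar> = C" "0 < C" and ab: "a < b"
  and l: "0 < l" "l \<le> C * (b - a)" and t: "t \<in> f ` {a..b}"
 shows "\<exists>j::int. of_int j * (l / 2) \<in> f ` {a<..<b} \<and> \<bar>of_int j * (l / 2) - t\<bar> \<le> l"
proof -
 define \<alpha> \<beta> where "\<alpha> = min (f a) (f b)" and "\<beta> = max (f a) (f b)"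
 have e: "e \<noteq> 0" using f(2,3) by (metis abs_zero less_irrefl)
 have img: "y \<in> f ` {a<..<b}" if "\<alpha> < y" "y < \<beta>" for y
 proof
  show "y = f ((y - u) / e)" using e by (simp add: f)
  show "(y - u) / e \<in> {a<..<b}"
  proof (cases "e > 0")
   case True
   then have "f a < f b" using ab by (simp add: f)
   then show ?thesis using that True by (simp add: \<alpha>_def \<beta>_def f field_simps)
  next
   case False
   then have "e < 0" using e by simp
   then have "f b < f a" using ab by (simp add: f)
   then show ?thesis using that \<open>e < 0\<close> by (simp add: \<alpha>_def \<beta>_def f field_simps)
  qed
 qed
 have "\<beta> - \<alpha> = \<bar>f b - f a\<bar>" by (simp add: \<alpha>_def \<beta>_def)
 also have "\<dots> = \<bar>e * (b - a)\<bar>" by (simp add: f algebra_simps)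
 also have "\<dots> = C * (b - a)" using f ab by (simp add: abs_mult)
 finally have len: "l \<le> \<beta> - \<alpha>" using l by simp
 have t: "\<alpha> \<le> t" "t \<le> \<beta>"
 proof -
  obtain x where x: "a \<le> x" "x \<le> b" "t = e * x + u" using t by (auto simp: f)
  have "e * a \<le> e * x \<and> e * x \<le> e * b \<or> e * b \<le> e * x \<and> e * x \<le> e * a"
   using x by (cases "e \<ge> 0") (auto intro: mult_left_mono mult_left_mono_neg)
  then show "\<alpha> \<le> t" "t \<le> \<beta>" using x by (auto simp: \<alpha>_def \<beta>_def f)
 qed
 define \<alpha>' where "\<alpha>' = max \<alpha> (t - l)"
 define j where "j = \<lfloor>\<alpha>' / (l / 2)\<rfloor> + 1"
 have j: "\<alpha>' < of_int j * (l / 2)" "of_int j * (l / 2) \<le> \<alpha>' + l / 2"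
 proof -
  have "\<alpha>' / (l / 2) < of_int j" "of_int j \<le> \<alpha>' / (l / 2) + 1" unfolding j_def by linarith+
  then show "\<alpha>' < of_int j * (l / 2)" "of_int j * (l / 2) \<le> \<alpha>' + l / 2"
   using l by (simp_all add: field_simps)
 qed
 define y where "y = of_int j * (l / 2)"
 have "\<alpha> < y" "y < \<beta>" "\<bar>y - t\<bar> \<le> l"
  using j len t l unfolding y_def[symmetric] \<alpha>'_def by (cases "\<alpha> \<ge> t - l"; force)+
 then show ?thesis using img[of y] unfolding y_def by blast
qed

locale planar = prob_space \<mu> for \<mu> :: "(real \<times> real) measure" +
 fixes I :: "'i set" and S :: "'i \<Rightarrow> real \<times> real \<Rightarrow> real \<times> real" and p c d :: "'i \<Rightarrow> real"
  and a b a' b' :: real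
 assumes sets_borel: "sets \<mu> = sets borel"
  and fin: "finite I" and ne: "I \<noteq> {}"
  and c: "\<And>i. i \<in> I \<Longrightarrow> 0 < c i" "\<And>i. i \<in> I \<Longrightarrow> c i < 1"
  and d: "\<And>i. i \<in> I \<Longrightarrow> 0 < d i" "\<And>i. i \<in> I \<Longrightarrow> d i < 1"
  and diag: "\<And>i. i \<in> I \<Longrightarrow> diagonal_affine (c i) (d i) (S i)"
  and p: "\<And>i. i \<in> I \<Longrightarrow> 0 < p i" "(\<Sum>i\<in>I. p i) = 1"
  and self_sim: "\<And>A. A \<in> sets borel \<Longrightarrow> measure \<mu> A = (\<Sum>i\<in>I. p i * measure \<mu> (S i -` A))"
  and ab: "a < b" "a' < b'"
  and into: "\<And>i. i \<in> I \<Longrightarrow> S i ` ({a<..<b} \<times> {a'<..<b'}) \<subseteq> {a<..<b} \<times> {a'<..<b'}"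
  and osc: "disjoint_family_on (\<lambda>i. S i ` ({a<..<b} \<times> {a'<..<b'})) I"
begin

abbreviation "cw \<equiv> word_prod c"
abbreviation "dw \<equiv> word_prod d"
abbreviation "pw \<equiv> word_prod p"
abbreviation "wmass w \<delta> Q \<equiv> prob (wmap S w -` cell \<delta> Q)"
abbreviation "\<psi> t t' \<equiv> psi p c d (\<lambda>_. t) (\<lambda>_. t')"

abbreviation "R \<equiv> {a<..<b} \<times> {a'<..<b'}"
abbreviation "K \<equiv> {a..b} \<times> {a'..b'}"

definition f where "f i x = fst (S i (x, 0))"
definition g where "g i y = snd (S i (0, y))"

lemma space_UNIV: "space \<mu> = UNIV"
 using sets_eq_imp_space_eq[OF sets_borel] by simp

lemma f_aff: "i \<in> I \<Longrightarrow> \<exists>e u. \<bar>e\<bar> = c i \<and> f i = (\<lambda>x. e * x + u)"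
 and g_aff: "i \<in> I \<Longrightarrow> \<exists>e u. \<bar>e\<bar> = d i \<and> g i = (\<lambda>x. e * x + u)"
 and S_eq: "i \<in> I \<Longrightarrow> S i z = (f i (fst z), g i (snd z))"
proof -
 assume i: "i \<in> I"
 obtain e e' u v where e: "e \<in> {1, -1}" "e' \<in> {1, -1}"
  and S: "S i = (\<lambda>(x, y). (e * c i * x + u, e' * d i * y + v))"
  using diag[OF i] unfolding diagonal_affine_def by blast
 show "\<exists>e u. \<bar>e\<bar> = c i \<and> f i = (\<lambda>x. e * x + u)"
  using e c[OF i] by (intro exI[of _ "e * c i"] exI[of _ u]) (auto simp: f_def S fun_eq_iff)
 show "\<exists>e u. \<bar>e\<bar> = d i \<and> g i = (\<lambda>x. e * x + u)"
  using e d[OF i] by (intro exI[of _ "e' * d i"] exI[of _ v]) (auto simp: g_def S fun_eq_iff)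
 show "S i z = (f i (fst z), g i (snd z))" by (simp add: f_def g_def S split: prod.split)
qed

lemma S_borel: "i \<in> I \<Longrightarrow> S i \<in> borel_measurable borel"
 and S_cont: "i \<in> I \<Longrightarrow> continuous_on UNIV (S i)"
proof -
 assume i: "i \<in> I"
 have "S i = (\<lambda>z. (f i (fst z), g i (snd z)))" using S_eq[OF i] by auto
 moreover have "continuous_on UNIV (\<lambda>z. (f i (fst z), g i (snd z)))"
  using f_aff[OF i] g_aff[OF i] by (auto intro!: continuous_intros)
 ultimately show "continuous_on UNIV (S i)" by simp
 then show "S i \<in> borel_measurable borel" by (rule borel_measurable_continuous_onI)
qed

lemma S_K: "i \<in> I \<Longrightarrow> S i ` K \<subseteq> K"
proof -
 assume i: "i \<in> I"
 have cl: "closure R = K" using ab by (simp add: closure_Times)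
 have "S i ` closure R \<subseteq> K"
 proof (rule image_closure_subset)
  show "continuous_on (closure R) (S i)" using S_cont[OF i] continuous_on_subset by blast
  show "closed K" by (intro closed_Times) auto
  show "S i ` R \<subseteq> K" using into[OF i] by force
 qed
 then show ?thesis unfolding cl .
qed

lemma f_inv: "i \<in> I \<Longrightarrow> x \<in> {a..b} \<Longrightarrow> f i x \<in> {a..b}"
 and g_inv: "i \<in> I \<Longrightarrow> y \<in> {a'..b'} \<Longrightarrow> g i y \<in> {a'..b'}"
proof -
 assume i: "i \<in> I"
 have *: "(f i x, g i y) \<in> K" if "x \<in> {a..b}" "y \<in> {a'..b'}" for x y
  using S_K[OF i] S_eq[OF i, of "(x, y)"] that by force
 show "x \<in> {a..b} \<Longrightarrow> f i x \<in> {a..b}" using *[of x a'] ab by auto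
 show "y \<in> {a'..b'} \<Longrightarrow> g i y \<in> {a'..b'}" using *[of a y] ab by auto
qed

text \<open>The measure is given by self-similarity alone, so that it lives on \<open>K\<close> has
  to be derived. The maps contract towards the invariant \<open>K\<close>, whence
  \<open>prob (U t) \<le> prob (U (\<rho> * t))\<close> for the enlargement \<open>U t\<close> of
  \<open>K\<close>. Large enlargements have mass near 1, and iteration carries this mass into every
  small one.\<close>

lemma measure_K: "measure \<mu> K = 1"
proof -
 define \<rho> where "\<rho> = Max (c ` I \<union> d ` I)"
 have "\<rho> \<in> c ` I \<union> d ` I" unfolding \<rho>_def using fin ne by (intro Max_in) auto
 then have \<rho>: "0 < \<rho>" "\<rho> < 1" using c d by auto
 have \<rho>': "c i \<le> \<rho>" "d i \<le> \<rho>" if "i \<in> I" for i using that fin unfolding \<rho>_def by auto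
 define U where "U t = {a - t..b + t} \<times> {a' - t..b' + t}" for t
 have Ub: "U t \<in> sets borel" for t unfolding U_def by (intro borel_closed closed_Times) auto
 have near: "h x \<in> {\<alpha> - \<rho> * t..\<beta> + \<rho> * t}"
  if h: "h = (\<lambda>x. e * x + u)" "\<bar>e\<bar> \<le> \<rho>" "\<And>x. x \<in> {\<alpha>..\<beta>} \<Longrightarrow> h x \<in> {\<alpha>..\<beta>}" "\<alpha> \<le> \<beta>"
   and x: "x \<in> {\<alpha> - t..\<beta> + t}" and t: "0 \<le> t" for h :: "real \<Rightarrow> real" and e u \<alpha> \<beta> x t
 proof -
  define x0 where "x0 = max \<alpha> (min x \<beta>)"
  have x0: "x0 \<in> {\<alpha>..\<beta>}" "\<bar>x - x0\<bar> \<le> t" using x t h(4) by (auto simp: x0_def)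
  have "h x - h x0 = e * (x - x0)" by (simp add: h algebra_simps)
  then have "\<bar>h x - h x0\<bar> = \<bar>e\<bar> * \<bar>x - x0\<bar>" by (simp add: abs_mult)
  also have "\<dots> \<le> \<rho> * t" using x0 h(2) t \<rho> by (intro mult_mono) auto
  finally show ?thesis using h(3)[OF x0(1)] by auto
 qed
 have SU: "U t \<subseteq> S i -` U (\<rho> * t)" if i: "i \<in> I" and t: "0 \<le> t" for i t
 proof
  fix z assume z: "z \<in> U t"
  obtain e u where eu: "\<bar>e\<bar> = c i" "f i = (\<lambda>x. e * x + u)" using f_aff[OF i] by auto
  obtain e' u' where eu': "\<bar>e'\<bar> = d i" "g i = (\<lambda>x. e' * x + u')" using g_aff[OF i] by auto
  have "f i (fst z) \<in> {a - \<rho> * t..b + \<rho> * t}"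
   using z \<rho>'[OF i] eu(1) ab t by (intro near[OF eu(2) _ f_inv[OF i]]) (auto simp: U_def)
  moreover have "g i (snd z) \<in> {a' - \<rho> * t..b' + \<rho> * t}"
   using z \<rho>'[OF i] eu'(1) ab t by (intro near[OF eu'(2) _ g_inv[OF i]]) (auto simp: U_def)
  ultimately show "z \<in> S i -` U (\<rho> * t)" by (simp add: S_eq[OF i] U_def)
 qed
 have step: "prob (U t) \<le> prob (U (\<rho> * t))" if t: "0 \<le> t" for t
 proof -
  have "prob (U t) = (\<Sum>i\<in>I. p i * prob (U t))" using p by (simp add: sum_distrib_right[symmetric])
  also have "\<dots> \<le> (\<Sum>i\<in>I. p i * prob (S i -` U (\<rho> * t)))"
   using SU t p vimage_borel[OF S_borel Ub] sets_borel
   by (intro sum_mono mult_left_mono finite_measure_mono) (auto intro: less_imp_le)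
  also have "\<dots> = prob (U (\<rho> * t))" by (rule self_sim[symmetric]) (rule Ub)
  finally show ?thesis .
 qed
 have iter: "prob (U t) \<le> prob (U (\<rho> ^ n * t))" if t: "0 \<le> t" for t n
 proof (induction n)
  case (Suc n)
  then show ?case using step[of "\<rho> ^ n * t"] \<rho> t by (simp add: mult.assoc)
 qed simp
 have U1: "prob (U t) = 1" if t: "0 < t" for t
 proof -
  have lim: "(\<lambda>n. prob (U (real n))) \<longlonglongrightarrow> prob (\<Union>n. U (real n))"
   using Ub sets_borel by (intro finite_Lim_measure_incseq) (auto simp: incseq_def U_def)
  have "(\<Union>n. U (real n)) = UNIV"
  proof -
   have "\<exists>n. (x, y) \<in> U (real n)" for x y
   proof -
    obtain n where "real n > \<bar>x\<bar> + \<bar>y\<bar> + \<bar>a\<bar> + \<bar>b\<bar> + \<bar>a'\<bar> + \<bar>b'\<bar>" using reals_Archimedean2 by blast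
    then show ?thesis by (intro exI[of _ n]) (auto simp: U_def)
   qed
   then show ?thesis by auto
  qed
  then have lim1: "(\<lambda>n. prob (U (real n))) \<longlonglongrightarrow> 1" using lim prob_space space_UNIV by simp
  have "prob (U (real m)) \<le> prob (U t)" for m
  proof -
   obtain n where n: "\<rho> ^ n < t / (real m + 1)" using real_arch_pow_inv[of "t / (real m + 1)" \<rho>] \<rho> t by auto
   have "\<rho> ^ n * real m \<le> \<rho> ^ n * (real m + 1)" using \<rho> by (intro mult_left_mono) auto
   also have "\<dots> \<le> t" using n by (simp add: field_simps)
   finally have "U (\<rho> ^ n * real m) \<subseteq> U t" by (auto simp: U_def)
   then have "prob (U (\<rho> ^ n * real m)) \<le> prob (U t)" using Ub sets_borel by (intro finite_measure_mono) auto
   then show ?thesis using iter[of "real m" n] by simp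
  qed
  then have "1 \<le> prob (U t)" using lim1 by (intro LIMSEQ_le_const2[OF lim1]) auto
  then show ?thesis using prob_le_1[of "U t"] by linarith
 qed
 have "AE z in \<mu>. z \<in> U (1 / (real n + 1))" for n
  using U1[of "1 / (real n + 1)"] prob_eq_1[of "U (1 / (real n + 1))"] Ub sets_borel by auto
 then have "AE z in \<mu>. \<forall>n. z \<in> U (1 / (real n + 1))" by (simp add: AE_all_countable)
 then have "AE z in \<mu>. z \<in> K"
 proof eventually_elim
  case (elim z)
  have le: "x \<le> y" if "\<And>n. x \<le> y + 1 / (real n + 1)" for x y :: real
  proof (rule field_le_epsilon)
   fix e :: real assume "0 < e"
   then obtain n where "1 / (real n + 1) < e" using reals_Archimedean[of e] by (auto simp: inverse_eq_divide add.commute)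
   then show "x \<le> y + e" using that[of n] by linarith
  qed
  have "a \<le> fst z + 1 / (real n + 1) \<and> fst z \<le> b + 1 / (real n + 1) \<and>
    a' \<le> snd z + 1 / (real n + 1) \<and> snd z \<le> b' + 1 / (real n + 1)" for n
   using elim[rule_format, of n] by (auto simp: U_def mem_Times_iff)
  then have "a \<le> fst z" "fst z \<le> b" "a' \<le> snd z" "snd z \<le> b'" by (blast intro: le)+
  then show ?case by (simp add: mem_Times_iff)
 qed
 moreover have "K \<in> events" using sets_borel by (auto intro!: borel_closed closed_Times)
 ultimately show ?thesis by (simp add: prob_eq_1)
qed

definition \<nu>1 where "\<nu>1 = distr \<mu> borel fst"
definition \<nu>2 where "\<nu>2 = distr \<mu> borel snd"

lemma fst_measurable [measurable]: "fst \<in> borel_measurable \<mu>"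
 and snd_measurable [measurable]: "snd \<in> borel_measurable \<mu>"
 by (simp_all add: measurable_cong_sets[OF sets_borel refl] borel_measurable_continuous_onI continuous_on_fst continuous_on_snd continuous_on_id)

lemma \<nu>1_measure: "A \<in> sets borel \<Longrightarrow> measure \<nu>1 A = measure \<mu> (fst -` A)"
 by (simp add: \<nu>1_def measure_distr space_UNIV)

lemma \<nu>2_measure: "A \<in> sets borel \<Longrightarrow> measure \<nu>2 A = measure \<mu> (snd -` A)"
 by (simp add: \<nu>2_def measure_distr space_UNIV)

lemma K_borel: "K \<in> sets borel"
 by (intro borel_closed closed_Times) auto

sublocale X: self_similar \<nu>1 a b I f c p
proof -
 interpret N: prob_space \<nu>1 unfolding \<nu>1_def by (rule prob_space_distr) measurable
 have "prob K \<le> prob (fst -` {a..b})"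
  using measurable_sets[OF fst_measurable, of "{a..b}"] space_UNIV by (intro finite_measure_mono) auto
 then have "prob (fst -` {a..b}) = 1" using measure_K prob_le_1[of "fst -` {a..b}"] by linarith
 then have one: "measure \<nu>1 {a..b} = 1" by (simp add: \<nu>1_measure)
 show "self_similar \<nu>1 a b I f c p"
 proof (unfold_locales)
  show "sets \<nu>1 = sets borel" by (simp add: \<nu>1_def)
  fix A :: "real set" assume A: "A \<in> sets borel"
  have fA: "(fst -` A :: (real \<times> real) set) \<in> sets borel" if "A \<in> sets borel" for A :: "real set"
   using measurable_sets[OF fst_measurable that] space_UNIV sets_borel by simp
  have "measure \<nu>1 A = (\<Sum>i\<in>I. p i * prob (S i -` (fst -` A)))"
   using A by (simp add: \<nu>1_measure self_sim[OF fA])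
  also have "\<dots> = (\<Sum>i\<in>I. p i * measure \<nu>1 (f i -` A))"
  proof (intro sum.cong refl)
   fix i assume i: "i \<in> I"
   have "f i -` A \<in> sets borel" using f_aff[OF i] A by (intro vimage_borel) auto
   moreover have "S i -` (fst -` A) = fst -` (f i -` A)" using S_eq[OF i] by auto
   ultimately show "p i * prob (S i -` (fst -` A)) = p i * measure \<nu>1 (f i -` A)"
    by (simp add: \<nu>1_measure)
  qed
  finally show "measure \<nu>1 A = (\<Sum>i\<in>I. p i * measure \<nu>1 (f i -` A))" .
 qed (use one fin ne c p f_aff f_inv in auto)
qed

sublocale Y: self_similar \<nu>2 a' b' I g d p
proof -
 interpret N: prob_space \<nu>2 unfolding \<nu>2_def by (rule prob_space_distr) measurable
 have "prob K \<le> prob (snd -` {a'..b'})"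
  using measurable_sets[OF snd_measurable, of "{a'..b'}"] space_UNIV by (intro finite_measure_mono) auto
 then have "prob (snd -` {a'..b'}) = 1" using measure_K prob_le_1[of "snd -` {a'..b'}"] by linarith
 then have one: "measure \<nu>2 {a'..b'} = 1" by (simp add: \<nu>2_measure)
 show "self_similar \<nu>2 a' b' I g d p"
 proof (unfold_locales)
  show "sets \<nu>2 = sets borel" by (simp add: \<nu>2_def)
  fix A :: "real set" assume A: "A \<in> sets borel"
  have fA: "(snd -` A :: (real \<times> real) set) \<in> sets borel" if "A \<in> sets borel" for A :: "real set"
   using measurable_sets[OF snd_measurable that] space_UNIV sets_borel by simp
  have "measure \<nu>2 A = (\<Sum>i\<in>I. p i * prob (S i -` (snd -` A)))"
   using A by (simp add: \<nu>2_measure self_sim[OF fA])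
  also have "\<dots> = (\<Sum>i\<in>I. p i * measure \<nu>2 (g i -` A))"
  proof (intro sum.cong refl)
   fix i assume i: "i \<in> I"
   have "g i -` A \<in> sets borel" using g_aff[OF i] A by (intro vimage_borel) auto
   moreover have "S i -` (snd -` A) = snd -` (g i -` A)" using S_eq[OF i] by auto
   ultimately show "p i * prob (S i -` (snd -` A)) = p i * measure \<nu>2 (g i -` A)"
    by (simp add: \<nu>2_measure)
  qed
  finally show "measure \<nu>2 A = (\<Sum>i\<in>I. p i * measure \<nu>2 (g i -` A))" .
 qed (use one fin ne d p g_aff g_inv in auto)
qed

lemma word_eq: "set w \<subseteq> I \<Longrightarrow> wmap S w z = (wmap f w (fst z), wmap g w (snd z))"
proof (induction w)
 case (Cons i w)
 then show ?case using S_eq[of i "wmap S w z"] by simp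
qed simp

lemma word_K: "set w \<subseteq> I \<Longrightarrow> z \<in> K \<Longrightarrow> wmap S w z \<in> K"
proof (induction w)
 case (Cons i w)
 then have "wmap S w z \<in> K" "i \<in> I" by auto
 then show ?case using S_K[of i] by auto
qed simp

lemma word_R: "set w \<subseteq> I \<Longrightarrow> z \<in> R \<Longrightarrow> wmap S w z \<in> R"
proof (induction w)
 case (Cons i w)
 then have "wmap S w z \<in> R" "i \<in> I" by auto
 then show ?case using into[of i] by auto
qed simp

lemma wpos: "set w \<subseteq> I \<Longrightarrow> 0 < cw w" "set w \<subseteq> I \<Longrightarrow> 0 < dw w"
 "set w \<subseteq> I \<Longrightarrow> 0 < pw w"
 using c d p by (auto intro!: word_prod_pos[of I])

lemma word_inj: "set w \<subseteq> I \<Longrightarrow> inj (wmap S w)"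
proof (rule injI)
 fix z z' assume w: "set w \<subseteq> I" and eq: "wmap S w z = wmap S w z'"
 have "cw w * \<bar>fst z - fst z'\<bar> = 0" "dw w * \<bar>snd z - snd z'\<bar> = 0"
  using eq X.word_dist[OF w, of "fst z" "fst z'"] Y.word_dist[OF w, of "snd z" "snd z'"]
  by (simp_all add: word_eq[OF w])
 then show "z = z'" using wpos[OF w] by (simp add: prod_eq_iff)
qed

lemma rect_disjoint:
 assumes "w = u @ x # v" "w' = u @ y # v'" "x \<noteq> y" "set w \<subseteq> I" "set w' \<subseteq> I"
 shows "wmap S w ` R \<inter> wmap S w' ` R = {}"
proof (rule ccontr)
 assume "\<not> ?thesis"
 then obtain z z' where z: "z \<in> R" "z' \<in> R" "wmap S w z = wmap S w' z'" by blast
 have "wmap S u (S x (wmap S v z)) = wmap S u (S y (wmap S v' z'))"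
  using z(3) by (simp add: assms(1,2) wmap_append)
 moreover have "inj (wmap S u)" using assms by (intro word_inj) auto
 ultimately have "S x (wmap S v z) = S y (wmap S v' z')" by (rule injD[rotated])
 moreover have "wmap S v z \<in> R" "wmap S v' z' \<in> R" using word_R z assms by auto
 ultimately have "S x (wmap S v z) \<in> S x ` R \<inter> S y ` R" by (metis IntI imageI)
 moreover have "S x ` R \<inter> S y ` R = {}"
  using osc assms by (intro disjoint_family_onD[OF osc]) auto
 ultimately show False by blast
qed

text \<open>Each image of \<open>R\<close> contains a point of a lattice with steps
  \<open>l1 / 2\<close> and \<open>l2 / 2\<close> near the given centre, and disjoint images contain
  different points. So the lattice points in a box are counted instead of the rectangles.\<close>

lemma multiplicity:
 assumes V: "finite V" "\<And>w. w \<in> V \<Longrightarrow> set w \<subseteq> I"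
  and disj: "\<And>w w'. w \<in> V \<Longrightarrow> w' \<in> V \<Longrightarrow> w \<noteq> w' \<Longrightarrow> wmap S w ` R \<inter> wmap S w' ` R = {}"
  and l: "0 < l1" "0 < l2" "\<And>w. w \<in> V \<Longrightarrow> l1 \<le> cw w * (b - a)"
   "\<And>w. w \<in> V \<Longrightarrow> l2 \<le> dw w * (b' - a')"
  and near: "\<And>w. w \<in> V \<Longrightarrow> \<exists>z\<in>K. \<bar>fst (wmap S w z) - xc\<bar> \<le> r1 \<and> \<bar>snd (wmap S w z) - yc\<bar> \<le> r2"
  and r: "0 \<le> r1" "0 \<le> r2"
 shows "real (card V) \<le> (4 * (r1 / l1 + 1) + 1) * (4 * (r2 / l2 + 1) + 1)"
proof -
 have "\<exists>jk::int \<times> int. (of_int (fst jk) * (l1 / 2), of_int (snd jk) * (l2 / 2)) \<in> wmap S w ` R \<and>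
   \<bar>of_int (fst jk) * (l1 / 2) - xc\<bar> \<le> r1 + l1 \<and> \<bar>of_int (snd jk) * (l2 / 2) - yc\<bar> \<le> r2 + l2"
  if w: "w \<in> V" for w
 proof -
  have wI: "set w \<subseteq> I" using V w by auto
  obtain z where z: "z \<in> K" "\<bar>wmap f w (fst z) - xc\<bar> \<le> r1" "\<bar>wmap g w (snd z) - yc\<bar> \<le> r2"
   using near[OF w] by (auto simp: word_eq[OF wI])
  obtain e u where eu: "\<bar>e\<bar> = cw w" "wmap f w = (\<lambda>x. e * x + u)" using X.aff_word[OF wI] by auto
  obtain e' u' where eu': "\<bar>e'\<bar> = dw w" "wmap g w = (\<lambda>x. e' * x + u')" using Y.aff_word[OF wI] by auto
  have im: "wmap f w (fst z) \<in> wmap f w ` {a..b}" "wmap g w (snd z) \<in> wmap g w ` {a'..b'}" using z(1) by auto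
  obtain j where j: "of_int j * (l1 / 2) \<in> wmap f w ` {a<..<b}" "\<bar>of_int j * (l1 / 2) - wmap f w (fst z)\<bar> \<le> l1"
   using lattice_point[OF eu(2,1) wpos(1)[OF wI] ab(1) l(1) l(3)[OF w] im(1)] by blast
  obtain k where k: "of_int k * (l2 / 2) \<in> wmap g w ` {a'<..<b'}" "\<bar>of_int k * (l2 / 2) - wmap g w (snd z)\<bar> \<le> l2"
   using lattice_point[OF eu'(2,1) wpos(2)[OF wI] ab(2) l(2) l(4)[OF w] im(2)] by blast
  obtain x y where xy: "x \<in> {a<..<b}" "y \<in> {a'<..<b'}" "of_int j * (l1 / 2) = wmap f w x" "of_int k * (l2 / 2) = wmap g w y"
   using j(1) k(1) by blast
  have "(of_int j * (l1 / 2), of_int k * (l2 / 2)) = wmap S w (x, y)" using xy by (simp add: word_eq[OF wI])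
  then have "(of_int j * (l1 / 2), of_int k * (l2 / 2)) \<in> wmap S w ` R" using xy by blast
  moreover have "\<bar>of_int j * (l1 / 2) - xc\<bar> \<le> r1 + l1" "\<bar>of_int k * (l2 / 2) - yc\<bar> \<le> r2 + l2"
   using j k z by linarith+
  ultimately show ?thesis by (intro exI[of _ "(j, k)"]) auto
 qed
 then obtain \<sigma> :: "'i list \<Rightarrow> int \<times> int" where
  \<sigma>: "\<And>w. w \<in> V \<Longrightarrow> (of_int (fst (\<sigma> w)) * (l1 / 2), of_int (snd (\<sigma> w)) * (l2 / 2)) \<in> wmap S w ` R"
   "\<And>w. w \<in> V \<Longrightarrow> \<bar>of_int (fst (\<sigma> w)) * (l1 / 2) - xc\<bar> \<le> r1 + l1"
   "\<And>w. w \<in> V \<Longrightarrow> \<bar>of_int (snd (\<sigma> w)) * (l2 / 2) - yc\<bar> \<le> r2 + l2"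
  by metis
 have inj: "inj_on \<sigma> V"
 proof (rule inj_onI)
  fix w w' assume "w \<in> V" "w' \<in> V" "\<sigma> w = \<sigma> w'"
  then show "w = w'" using \<sigma>(1)[of w] \<sigma>(1)[of w'] disj[of w w'] by auto
 qed
 define A where "A = {j::int. \<bar>of_int j * (l1 / 2) - xc\<bar> \<le> r1 + l1}"
 define B where "B = {j::int. \<bar>of_int j * (l2 / 2) - yc\<bar> \<le> r2 + l2}"
 have cnt: "finite {j::int. \<bar>of_int j * (l / 2) - x\<bar> \<le> r + l}"
  "real (card {j::int. \<bar>of_int j * (l / 2) - x\<bar> \<le> r + l}) \<le> 4 * (r / l + 1) + 1"
  if "0 < l" "0 \<le> r" for l x r :: real
 proof -
  have *: "\<bar>of_int j - x / (l / 2)\<bar> \<le> 2 * (r / l + 1)" if "j \<in> {j::int. \<bar>of_int j * (l / 2) - x\<bar> \<le> r + l}" for j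
  proof -
   have "of_int j - x / (l / 2) = (of_int j * (l / 2) - x) / (l / 2)" using \<open>0 < l\<close> by (simp add: field_simps)
   then have "\<bar>of_int j - x / (l / 2)\<bar> = \<bar>(of_int j * (l / 2) - x) / (l / 2)\<bar>" by simp
   also have "\<dots> = \<bar>of_int j * (l / 2) - x\<bar> / \<bar>l / 2\<bar>" by (rule abs_divide)
   also have "\<dots> = \<bar>of_int j * (l / 2) - x\<bar> / (l / 2)" using \<open>0 < l\<close> by simp
   also have "\<dots> \<le> (r + l) / (l / 2)" using that \<open>0 < l\<close> by (intro divide_right_mono) auto
   also have "\<dots> = 2 * (r / l + 1)" using \<open>0 < l\<close> by (simp add: field_simps)
   finally show ?thesis .
  qed
  have "0 \<le> 2 * (r / l + 1)" using that by simp
  from card_int_window[of "{j::int. \<bar>of_int j * (l / 2) - x\<bar> \<le> r + l}", OF * this] show "finite {j::int. \<bar>of_int j * (l / 2) - x\<bar> \<le> r + l}"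
   "real (card {j::int. \<bar>of_int j * (l / 2) - x\<bar> \<le> r + l}) \<le> 4 * (r / l + 1) + 1" by auto
 qed
 have "\<sigma> ` V \<subseteq> A \<times> B"
  unfolding A_def B_def by (intro image_subsetI, subst mem_Times_iff) (use \<sigma>(2,3) in simp)
 then have "card (\<sigma> ` V) \<le> card (A \<times> B)"
  using cnt[OF l(1) r(1)] cnt[OF l(2) r(2)] by (intro card_mono) (auto simp: A_def B_def)
 then have "card V \<le> card A * card B" by (simp add: card_image[OF inj] card_cartesian_product)
 then have "real (card V) \<le> real (card A) * real (card B)" by (metis of_nat_le_iff of_nat_mult)
 also have "\<dots> \<le> (4 * (r1 / l1 + 1) + 1) * (4 * (r2 / l2 + 1) + 1)"
  using cnt(2)[OF l(1) r(1), of xc] cnt(2)[OF l(2) r(2), of yc] r l unfolding A_def B_def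
  by (intro mult_mono) auto
 finally show ?thesis .
qed

end

section \<open>Planar moments against sums of psi over cuts\<close>

context bounded_prob
begin

text \<open>The relative scales \<open>\<delta> / cw w\<close> and \<open>\<delta> / dw w\<close>
  arising from a cut can exceed 1, though only up to \<open>1 / \<kappa>2\<close>. Power bounds are
  therefore carried from \<open>{0<..1}\<close> to bounded larger scales.\<close>

lemma moment_extend:
 assumes "0 \<le> q" "1 \<le> L"
 shows "\<exists>C>0. \<forall>\<eta>\<in>{0<..1}. moment \<nu> q \<eta> \<le> C * \<eta> powr (-t) \<Longrightarrow>
   \<exists>C>0. \<forall>\<eta>\<in>{0<..L}. moment \<nu> q \<eta> \<le> C * \<eta> powr (-t)"
  and "\<exists>C>0. \<forall>\<eta>\<in>{0<..1}. C * \<eta> powr (-t) \<le> moment \<nu> q \<eta> \<Longrightarrow>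
   \<exists>C>0. \<forall>\<eta>\<in>{0<..L}. C * \<eta> powr (-t) \<le> moment \<nu> q \<eta>"
proof -
 define k where "k = (2 * L + 3) powr q * (2 * L + 3)"
 have k: "1 \<le> k" unfolding k_def using assms by (intro mult_ge1_I ge_one_powr_ge_zero) auto
 have Lt: "1 \<le> L powr \<bar>t\<bar>" using assms by (intro ge_one_powr_ge_zero) auto
 have cmp: "moment \<nu> q 1 \<le> k * moment \<nu> q \<eta>" "moment \<nu> q \<eta> \<le> k * moment \<nu> q 1"
  "1 \<le> L powr \<bar>t\<bar> * \<eta> powr (-t)" "\<eta> powr (-t) \<le> L powr \<bar>t\<bar>" if "1 \<le> \<eta>" "\<eta> \<le> L" for \<eta>
  using scale_compare[of 1 \<eta> L q] powr_ratio_bound[of 1 \<eta> L "-t"] that assms by (auto simp: k_def)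
 {
  assume "\<exists>C>0. \<forall>\<eta>\<in>{0<..1}. moment \<nu> q \<eta> \<le> C * \<eta> powr (-t)"
  then obtain C where C: "C > 0" "\<And>\<eta>. \<eta> \<in> {0<..1} \<Longrightarrow> moment \<nu> q \<eta> \<le> C * \<eta> powr (-t)" by blast
  have "moment \<nu> q \<eta> \<le> k * C * L powr \<bar>t\<bar> * \<eta> powr (-t)" if h: "\<eta> \<in> {0<..L}" for \<eta>
  proof (cases "\<eta> \<le> 1")
   case True
   have "1 * (C * \<eta> powr (-t)) \<le> (k * L powr \<bar>t\<bar>) * (C * \<eta> powr (-t))"
    using C k Lt by (intro mult_right_mono mult_ge1_I) auto
   then show ?thesis using C(2)[of \<eta>] True h by (simp add: mult_ac)
  next
   case False
   have "moment \<nu> q \<eta> \<le> k * moment \<nu> q 1" using cmp False h by auto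
   also have "\<dots> \<le> k * (C * 1)" using C(2)[of 1] k by (intro mult_left_mono) auto
   also have "\<dots> \<le> k * (C * (L powr \<bar>t\<bar> * \<eta> powr (-t)))" using cmp(3)[of \<eta>] False h k C by (intro mult_left_mono) auto
   finally show ?thesis by (simp add: mult_ac)
  qed
  then show "\<exists>C>0. \<forall>\<eta>\<in>{0<..L}. moment \<nu> q \<eta> \<le> C * \<eta> powr (-t)"
   using C k assms by (intro exI[of _ "k * C * L powr \<bar>t\<bar>"]) auto
 }
 {
  assume "\<exists>C>0. \<forall>\<eta>\<in>{0<..1}. C * \<eta> powr (-t) \<le> moment \<nu> q \<eta>"
  then obtain C where C: "C > 0" "\<And>\<eta>. \<eta> \<in> {0<..1} \<Longrightarrow> C * \<eta> powr (-t) \<le> moment \<nu> q \<eta>" by blast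
  have "C / (k * L powr \<bar>t\<bar>) * \<eta> powr (-t) \<le> moment \<nu> q \<eta>" if h: "\<eta> \<in> {0<..L}" for \<eta>
  proof -
   have "C * \<eta> powr (-t) \<le> (k * L powr \<bar>t\<bar>) * moment \<nu> q \<eta>"
   proof (cases "\<eta> \<le> 1")
    case True
    have "1 * moment \<nu> q \<eta> \<le> (k * L powr \<bar>t\<bar>) * moment \<nu> q \<eta>"
     using k Lt moment_nonneg by (intro mult_right_mono mult_ge1_I) auto
    then show ?thesis using C(2)[of \<eta>] True h by auto
   next
    case False
    have "C * \<eta> powr (-t) \<le> C * L powr \<bar>t\<bar>" using cmp(4)[of \<eta>] False h C by (intro mult_left_mono) auto
    also have "\<dots> \<le> moment \<nu> q 1 * L powr \<bar>t\<bar>" using C(2)[of 1] by (intro mult_right_mono) auto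
    also have "\<dots> \<le> k * moment \<nu> q \<eta> * L powr \<bar>t\<bar>" using cmp(1)[of \<eta>] False h by (intro mult_right_mono) auto
    finally show ?thesis by (simp add: mult_ac)
   qed
   moreover have "0 < k * L powr \<bar>t\<bar>" using k Lt by (intro mult_pos_pos) linarith+
   ultimately show ?thesis by (simp add: pos_divide_le_eq mult_ac)
  qed
  then show "\<exists>C>0. \<forall>\<eta>\<in>{0<..L}. C * \<eta> powr (-t) \<le> moment \<nu> q \<eta>"
   using C k assms by (intro exI[of _ "C / (k * L powr \<bar>t\<bar>)"]) auto
 }
qed

end

text \<open>Converts a power bound for a projection at the relative scale
  \<open>\<delta> / C\<close> into the weight of the rectangle: the short side \<open>D\<close> is
  comparable to \<delta>, so the leftover power of \<delta> may be written as a power of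
  \<open>D\<close>.\<close>

lemma rescale_powr:
 assumes "0 < \<delta>" "0 < D" "0 < C" "D \<le> \<delta>" "\<delta> \<le> L * D" "1 \<le> (L::real)"
 shows "(\<delta> / C) powr (-t) \<le> L powr \<bar>s - t\<bar> * (\<delta> powr (-s) * (C powr t * D powr (s - t)))"
  and "\<delta> powr (-s) * (C powr t * D powr (s - t)) \<le> L powr \<bar>s - t\<bar> * (\<delta> / C) powr (-t)"
proof -
 have e: "(\<delta> / C) powr (-t) = \<delta> powr (-s) * (C powr t * \<delta> powr (s - t))"
 proof -
  have "\<delta> powr (-s) * \<delta> powr (s - t) = \<delta> powr (-t)" by (simp add: powr_add[symmetric])
  then show ?thesis using assms by (simp add: powr_divide powr_minus field_simps)
 qed
 note r = powr_ratio_bound[OF assms(2,4,5,6), of "s - t"]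
 have "\<delta> powr (-s) * (C powr t * \<delta> powr (s - t)) \<le> \<delta> powr (-s) * (C powr t * (L powr \<bar>s - t\<bar> * D powr (s - t)))"
  using r by (intro mult_left_mono) auto
 then show "(\<delta> / C) powr (-t) \<le> L powr \<bar>s - t\<bar> * (\<delta> powr (-s) * (C powr t * D powr (s - t)))"
  unfolding e by (simp add: mult_ac)
 have "\<delta> powr (-s) * (C powr t * D powr (s - t)) \<le> \<delta> powr (-s) * (C powr t * (L powr \<bar>s - t\<bar> * \<delta> powr (s - t)))"
  using r by (intro mult_left_mono) auto
 then show "\<delta> powr (-s) * (C powr t * D powr (s - t)) \<le> L powr \<bar>s - t\<bar> * (\<delta> / C) powr (-t)"
  unfolding e by (simp add: mult_ac)
qed

lemma mult_le_rearrange: "x \<le> A * (B * Y) \<Longrightarrow> 0 \<le> P \<Longrightarrow> P * x \<le> A * B * (P * (Y :: real))"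
 using mult_left_mono[of x "A * (B * Y)" P] by (simp add: mult_ac)

lemma meets_iff: "A \<inter> B \<noteq> {} \<longleftrightarrow> (\<exists>z. z \<in> A \<and> z \<in> B)"
 by blast

context planar
begin

lemma K_events: "K \<in> events"
 using K_borel sets_borel by simp

text \<open>A thin strip seen by \<open>T\<close> at scale \<open>\<delta>\<close>: only the coordinate \<open>X\<close> is resolved, so planar
 moments reduce to those of the projection \<open>X\<close>.\<close>
lemma strip_compare:
 fixes X Y :: "real \<times> real \<Rightarrow> real" and \<nu> :: "real measure"
 assumes \<nu>: "bounded_prob \<nu> \<alpha> \<beta>" "\<And>A. A \<in> sets borel \<Longrightarrow> measure \<nu> A = prob (X -` A)" "\<And>z. z \<in> K \<Longrightarrow> X z \<in> {\<alpha>..\<beta>}"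
  and meas: "X \<in> borel_measurable borel" "Y \<in> borel_measurable borel" "T \<in> borel_measurable borel"
  and T1: "\<And>z z'. \<bar>X (T z) - X (T z')\<bar> = C * \<bar>X z - X z'\<bar>" "0 < C"
  and T2: "\<And>z z'. z \<in> K \<Longrightarrow> z' \<in> K \<Longrightarrow> \<bar>Y (T z) - Y (T z')\<bar> \<le> H * \<delta>" "0 \<le> H"
  and d: "0 < \<delta>" and q: "0 \<le> q" and B: "finite B"
 defines "E \<equiv> \<lambda>Q. {z. X (T z) \<in> mesh \<delta> (fst Q) \<and> Y (T z) \<in> mesh \<delta> (snd Q)}"
  and "M \<equiv> 5 * (2 * (H + 1) + 1)"
 shows "(\<Sum>Q\<in>B. prob (E Q) powr q) \<le> M powr q * M * moment \<nu> q (\<delta> / C)"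
  and "{Q. E Q \<inter> K \<noteq> {}} \<subseteq> B \<Longrightarrow> moment \<nu> q (\<delta> / C) \<le> M powr q * M * (\<Sum>Q\<in>B. prob (E Q) powr q)"
proof -
 interpret N: bounded_prob \<nu> \<alpha> \<beta> by fact
 define \<eta> where "\<eta> = \<delta> / C"
 have \<eta>: "0 < \<eta>" "C * \<eta> = \<delta>" using d T1(2) by (auto simp: \<eta>_def)
 define Rl where "Rl Q k \<longleftrightarrow> (\<exists>z\<in>K. z \<in> E Q \<and> X z \<in> mesh \<eta> k)" for Q k
 have E: "E Q \<in> sets borel" for Q
 proof -
  have "E Q = (X \<circ> T) -` mesh \<delta> (fst Q) \<inter> (Y \<circ> T) -` mesh \<delta> (snd Q)" by (auto simp: E_def)
  then show ?thesis using meas by (simp add: vimage_borel measurable_comp sets.Int)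
 qed
 have Xm: "X -` mesh \<eta> k \<in> sets borel" for k using vimage_borel[OF meas(1)] by simp
 have mom: "moment \<nu> q \<eta> = (\<Sum>k\<in>N.window \<eta>. prob (X -` mesh \<eta> k) powr q)"
  by (simp add: N.moment_window[OF \<eta>(1)] \<nu>(2))
 have ex: "\<exists>k. X z \<in> mesh \<eta> k" "\<exists>Q. z \<in> E Q" for z
 proof -
  show "\<exists>k. X z \<in> mesh \<eta> k" using \<eta> by (simp add: mesh_iff)
  show "\<exists>Q. z \<in> E Q" using d
   by (intro exI[of _ "(\<lfloor>X (T z) / \<delta>\<rfloor>, \<lfloor>Y (T z) / \<delta>\<rfloor>)"]) (simp add: E_def mesh_iff)
 qed
 have cnt1: "finite {k. Rl Q k}" "real (card {k. Rl Q k}) \<le> 5" for Q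
 proof -
  have "\<bar>real_of_int k - of_int k'\<bar> \<le> 2" if kk: "k \<in> {k. Rl Q k}" "k' \<in> {k. Rl Q k}" for k k'
  proof -
   from kk obtain z z' where z: "z \<in> E Q" "X z \<in> mesh \<eta> k" "z' \<in> E Q" "X z' \<in> mesh \<eta> k'"
    unfolding Rl_def by blast
   have "C * \<bar>X z - X z'\<bar> \<le> C * \<eta>"
    using mesh_close(2)[OF d, of "X (T z)" "fst Q" "X (T z')" "fst Q"] z T1(1)[of z z'] \<eta>(2) by (simp add: E_def)
   then have "\<bar>X z - X z'\<bar> \<le> \<eta>" using T1(2) by simp
   from mesh_close(1)[OF \<eta>(1) z(2,4) this] show ?thesis using \<eta> by simp
  qed
  from card_int_diam[of "{k. Rl Q k}" 2, OF this]
  show "finite {k. Rl Q k}" "real (card {k. Rl Q k}) \<le> 5" by auto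
 qed
 \<comment> \<open>In the resolved direction the indices differ by at most 2, in the thin direction
   by at most \<open>H + 1\<close>; the product of the two counts is \<open>M\<close>.\<close>
 have cnt2: "finite {Q. Rl Q k}" "real (card {Q. Rl Q k}) \<le> M" for k
 proof -
  have "\<bar>real_of_int m - of_int m'\<bar> \<le> 2" if mm: "m \<in> fst ` {Q. Rl Q k}" "m' \<in> fst ` {Q. Rl Q k}" for m m'
  proof -
   from mm obtain n n' z z' where z: "z \<in> E (m, n)" "X z \<in> mesh \<eta> k" "z' \<in> E (m', n')" "X z' \<in> mesh \<eta> k"
    unfolding Rl_def by auto
   have "\<bar>X z - X z'\<bar> \<le> \<eta>" using mesh_close(2)[OF \<eta>(1) z(2,4)] by simp
   then have "C * \<bar>X z - X z'\<bar> \<le> C * \<eta>" using T1(2) by (intro mult_left_mono) auto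
   then have "\<bar>X (T z) - X (T z')\<bar> \<le> \<delta>" using T1(1) \<eta>(2) by simp
   from mesh_close(1)[OF d _ _ this, of m m'] z d show ?thesis by (simp add: E_def)
  qed
  from card_int_diam[of "fst ` {Q. Rl Q k}" 2, OF this]
  have A: "finite (fst ` {Q. Rl Q k})" "real (card (fst ` {Q. Rl Q k})) \<le> 5" by auto
  have "\<bar>real_of_int n - of_int n'\<bar> \<le> H + 1" if mm: "n \<in> snd ` {Q. Rl Q k}" "n' \<in> snd ` {Q. Rl Q k}" for n n'
  proof -
   from mm obtain m m' z z' where z: "z \<in> E (m, n)" "z \<in> K" "z' \<in> E (m', n')" "z' \<in> K"
    unfolding Rl_def by auto
   from mesh_close(1)[OF d _ _ T2(1)[OF z(2,4)], of n n'] z d show ?thesis by (simp add: E_def)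
  qed
  from card_int_diam[of "snd ` {Q. Rl Q k}" "H + 1", OF this] T2(2)
  have A': "finite (snd ` {Q. Rl Q k})" "real (card (snd ` {Q. Rl Q k})) \<le> 2 * (H + 1) + 1" by auto
  have sub: "{Q. Rl Q k} \<subseteq> fst ` {Q. Rl Q k} \<times> snd ` {Q. Rl Q k}" by (auto simp: mem_Times_iff image_iff)
  then show "finite {Q. Rl Q k}" using A A' by (meson finite_SigmaI finite_subset)
  have "card {Q. Rl Q k} \<le> card (fst ` {Q. Rl Q k} \<times> snd ` {Q. Rl Q k})"
   using A A' sub by (intro card_mono) auto
  then have "real (card {Q. Rl Q k}) \<le> real (card (fst ` {Q. Rl Q k})) * real (card (snd ` {Q. Rl Q k}))"
   by (metis card_cartesian_product of_nat_le_iff of_nat_mult)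
  also have "\<dots> \<le> M" unfolding M_def using A A' T2(2) by (intro mult_mono) auto
  finally show "real (card {Q. Rl Q k}) \<le> M" .
 qed
 have M5: "5 \<le> M" using T2(2) by (simp add: M_def)
 have Rw: "k \<in> N.window \<eta>" if "Rl Q k" for Q k
  using that \<nu>(3) unfolding Rl_def N.window_def by blast
 show "(\<Sum>Q\<in>B. prob (E Q) powr q) \<le> M powr q * M * moment \<nu> q (\<delta> / C)"
  unfolding \<eta>_def[symmetric] mom
 proof (rule moment_compare[where N = "\<lambda>Q. {k. Rl Q k}"])
  fix k
  have "card {j \<in> B. k \<in> {k. Rl j k}} \<le> card {Q. Rl Q k}" by (intro card_mono cnt2) auto
  then show "real (card {j \<in> B. k \<in> {k. Rl j k}}) \<le> M" using cnt2(2)[of k] by linarith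
 next
  fix Q
  show "prob (E Q) \<le> (\<Sum>k\<in>{k. Rl Q k}. prob (X -` mesh \<eta> k))"
  proof (rule prob_le_sum_cover[OF _ K_events measure_K])
   show "E Q \<inter> K \<subseteq> (\<Union>k\<in>{k. Rl Q k}. X -` mesh \<eta> k)" using ex(1) unfolding Rl_def by fast
  qed (use E Xm cnt1 sets_borel in auto)
  show "real (card {k. Rl Q k}) \<le> M" using cnt1(2)[of Q] M5 by linarith
 qed (use B q N.window[OF \<eta>(1)] Rw in auto)
 assume sub: "{Q. E Q \<inter> K \<noteq> {}} \<subseteq> B"
 show "moment \<nu> q (\<delta> / C) \<le> M powr q * M * (\<Sum>Q\<in>B. prob (E Q) powr q)"
  unfolding \<eta>_def[symmetric] mom
 proof (rule moment_compare[where N = "\<lambda>k. {Q. Rl Q k}"])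
  fix Q
  have "card {j \<in> N.window \<eta>. Q \<in> {Q. Rl Q j}} \<le> card {k. Rl Q k}" by (intro card_mono cnt1) auto
  then show "real (card {j \<in> N.window \<eta>. Q \<in> {Q. Rl Q j}}) \<le> M" using cnt1(2)[of Q] M5 by linarith
 next
  fix k
  show "prob (X -` mesh \<eta> k) \<le> (\<Sum>Q\<in>{Q. Rl Q k}. prob (E Q))"
  proof (rule prob_le_sum_cover[OF _ K_events measure_K])
   show "X -` mesh \<eta> k \<inter> K \<subseteq> (\<Union>Q\<in>{Q. Rl Q k}. E Q)" using ex(2) unfolding Rl_def by fast
  qed (use E Xm cnt2 sets_borel in auto)
  show "{Q. Rl Q k} \<subseteq> B" using sub unfolding Rl_def by blast
 qed (use B q N.window[OF \<eta>(1)] cnt2 in auto)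
qed

definition H where "H = max (b - a) (b' - a')"
definition MS where "MS q = (5 * (2 * (H + 1) + 1)) powr q * (5 * (2 * (H + 1) + 1))"

lemma H_pos: "0 < H" using ab by (simp add: H_def)

lemma MS_pos: "0 < MS q"
 unfolding MS_def using H_pos by (intro mult_pos_pos) auto

lemma word_strip:
 assumes w: "set w \<subseteq> I" and \<delta>: "0 < \<delta>" and q: "0 \<le> q" and B: "finite B"
 shows "dw w \<le> \<delta> \<Longrightarrow> (\<Sum>Q\<in>B. wmass w \<delta> Q powr q) \<le> MS q * moment \<nu>1 q (\<delta> / cw w)"
  and "dw w \<le> \<delta> \<Longrightarrow> {Q. wmap S w -` cell \<delta> Q \<inter> K \<noteq> {}} \<subseteq> B \<Longrightarrow>
   moment \<nu>1 q (\<delta> / cw w) \<le> MS q * (\<Sum>Q\<in>B. wmass w \<delta> Q powr q)"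
  and "cw w \<le> \<delta> \<Longrightarrow> (\<Sum>Q\<in>B. wmass w \<delta> Q powr q) \<le> MS q * moment \<nu>2 q (\<delta> / dw w)"
  and "cw w \<le> \<delta> \<Longrightarrow> {Q. wmap S w -` cell \<delta> Q \<inter> K \<noteq> {}} \<subseteq> B \<Longrightarrow>
   moment \<nu>2 q (\<delta> / dw w) \<le> MS q * (\<Sum>Q\<in>B. wmass w \<delta> Q powr q)"
proof -
 have Tm: "wmap S w \<in> borel_measurable borel" using wmap_measurable[of I S w] S_borel w by blast
 have fm: "(fst :: real \<times> real \<Rightarrow> real) \<in> borel_measurable borel" "(snd :: real \<times> real \<Rightarrow> real) \<in> borel_measurable borel"
  by (auto intro!: borel_measurable_continuous_onI continuous_intros)
 have d1: "\<bar>fst (wmap S w z) - fst (wmap S w z')\<bar> = cw w * \<bar>fst z - fst z'\<bar>" for z z'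
  by (simp add: word_eq[OF w] X.word_dist[OF w])
 have d2: "\<bar>snd (wmap S w z) - snd (wmap S w z')\<bar> = dw w * \<bar>snd z - snd z'\<bar>" for z z'
  by (simp add: word_eq[OF w] Y.word_dist[OF w])
 have H0: "0 \<le> H" using H_pos by simp
 {
  assume le: "dw w \<le> \<delta>"
  have t2: "\<bar>snd (wmap S w z) - snd (wmap S w z')\<bar> \<le> H * \<delta>" if "z \<in> K" "z' \<in> K" for z z'
  proof -
   have "\<bar>snd z - snd z'\<bar> \<le> H" using that by (auto simp: H_def)
   then have "dw w * \<bar>snd z - snd z'\<bar> \<le> \<delta> * H" using le \<delta> by (intro mult_mono) auto
   then show ?thesis unfolding d2 by (simp add: mult.commute)
  qed
  have cellE: "{z. fst (wmap S w z) \<in> mesh \<delta> (fst Q) \<and> snd (wmap S w z) \<in> mesh \<delta> (snd Q)} = wmap S w -` cell \<delta> Q" for Q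
   by (auto simp: mem_Times_iff)
  note st = strip_compare[OF X.bounded_prob_axioms \<nu>1_measure _ fm Tm d1 wpos(1)[OF w] t2 H0 \<delta> q, unfolded cellE MS_def[symmetric]]
  show "(\<Sum>Q\<in>B. wmass w \<delta> Q powr q) \<le> MS q * moment \<nu>1 q (\<delta> / cw w)"
   by (rule st(1)) (use B in auto)
  show "moment \<nu>1 q (\<delta> / cw w) \<le> MS q * (\<Sum>Q\<in>B. wmass w \<delta> Q powr q)"
   if "{Q. wmap S w -` cell \<delta> Q \<inter> K \<noteq> {}} \<subseteq> B"
   by (rule st(2)) (use B that in auto)
 }
 {
  assume le: "cw w \<le> \<delta>"
  have t2: "\<bar>fst (wmap S w z) - fst (wmap S w z')\<bar> \<le> H * \<delta>" if "z \<in> K" "z' \<in> K" for z z'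
  proof -
   have "\<bar>fst z - fst z'\<bar> \<le> H" using that by (auto simp: H_def)
   then have "cw w * \<bar>fst z - fst z'\<bar> \<le> \<delta> * H" using le \<delta> by (intro mult_mono) auto
   then show ?thesis unfolding d1 by (simp add: mult.commute)
  qed
  \<comment> \<open>Now the second coordinate is the resolved one, so cells are read with their
    indices exchanged.\<close>
  have cellE: "{z. snd (wmap S w z) \<in> mesh \<delta> (fst Q) \<and> fst (wmap S w z) \<in> mesh \<delta> (snd Q)} = wmap S w -` cell \<delta> (prod.swap Q)" for Q
   by (auto simp: mem_Times_iff)
  have sw: "(\<Sum>Q\<in>prod.swap ` B. wmass w \<delta> (prod.swap Q) powr q) = (\<Sum>Q\<in>B. wmass w \<delta> Q powr q)"
   by (subst sum.reindex) (auto simp: inj_on_def)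
  note st = strip_compare[OF Y.bounded_prob_axioms \<nu>2_measure _ fm(2,1) Tm d2 wpos(2)[OF w] t2 H0 \<delta> q, unfolded cellE MS_def[symmetric]]
  show "(\<Sum>Q\<in>B. wmass w \<delta> Q powr q) \<le> MS q * moment \<nu>2 q (\<delta> / dw w)"
   unfolding sw[symmetric] by (rule st(1)) (use B in auto)
  show "moment \<nu>2 q (\<delta> / dw w) \<le> MS q * (\<Sum>Q\<in>B. wmass w \<delta> Q powr q)"
   if sub: "{Q. wmap S w -` cell \<delta> Q \<inter> K \<noteq> {}} \<subseteq> B"
   unfolding sw[symmetric]
  proof (rule st(2))
   show "{Q. wmap S w -` cell \<delta> (prod.swap Q) \<inter> K \<noteq> {}} \<subseteq> prod.swap ` B"
   proof
    fix Q assume "Q \<in> {Q. wmap S w -` cell \<delta> (prod.swap Q) \<inter> K \<noteq> {}}"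
    then have "prod.swap Q \<in> B" using sub by blast
    then show "Q \<in> prod.swap ` B" by (metis image_eqI swap_swap)
   qed
  qed (use B in auto)
 }
qed

definition window2 where "window2 \<delta> = X.window \<delta> \<times> Y.window \<delta>"

lemma window2: "0 < \<delta> \<Longrightarrow> finite (window2 \<delta>)" "{Q. cell \<delta> Q \<inter> K \<noteq> {}} \<subseteq> window2 \<delta>"
proof -
 show "0 < \<delta> \<Longrightarrow> finite (window2 \<delta>)" using X.window Y.window by (simp add: window2_def)
 show "{Q. cell \<delta> Q \<inter> K \<noteq> {}} \<subseteq> window2 \<delta>"
 proof
  fix Q assume "Q \<in> {Q. cell \<delta> Q \<inter> K \<noteq> {}}"
  then obtain z where "z \<in> cell \<delta> Q" "z \<in> K" by blast
  then show "Q \<in> window2 \<delta>" unfolding window2_def X.window_def Y.window_def by (auto simp: mem_Times_iff)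
 qed
qed

lemma prob_pos_meets: "A \<in> sets borel \<Longrightarrow> 0 < prob A \<Longrightarrow> \<exists>z\<in>K. z \<in> A"
 using prob_disjoint_carrier[of A K] measure_K sets_borel K_events by force

lemma moment2_window: "0 < \<delta> \<Longrightarrow> moment2 \<mu> q \<delta> = (\<Sum>Q\<in>window2 \<delta>. prob (cell \<delta> Q) powr q)"
proof (rule moment2_eq)
 show "{Q. 0 < prob (cell \<delta> Q)} \<subseteq> window2 \<delta>"
 proof
  fix Q assume "Q \<in> {Q. 0 < prob (cell \<delta> Q)}"
  then have "Q \<in> {Q. cell \<delta> Q \<inter> K \<noteq> {}}" using prob_pos_meets[of "cell \<delta> Q"] by auto
  then show "Q \<in> window2 \<delta>" using window2(2) by blast
 qed
qed (rule window2)

lemma word_cell_window: "set w \<subseteq> I \<Longrightarrow> {Q. wmap S w -` cell \<delta> Q \<inter> K \<noteq> {}} \<subseteq> window2 \<delta>"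
proof
 fix Q assume w: "set w \<subseteq> I" and h: "Q \<in> {Q. wmap S w -` cell \<delta> Q \<inter> K \<noteq> {}}"
 have "\<exists>z. z \<in> wmap S w -` cell \<delta> Q \<and> z \<in> K" using h unfolding mem_Collect_eq meets_iff .
 then obtain z where "wmap S w z \<in> cell \<delta> Q" "z \<in> K" by (metis vimageE)
 then have "cell \<delta> Q \<inter> K \<noteq> {}" using word_K[OF w] meets_iff[of "cell \<delta> Q" K] by metis
 then show "Q \<in> window2 \<delta>" using window2(2) by blast
qed

definition \<kappa>2 where "\<kappa>2 = min X.\<kappa> Y.\<kappa>"

lemma \<kappa>2: "0 < \<kappa>2" "\<kappa>2 < 1"
 using X.\<kappa> Y.\<kappa> by (auto simp: \<kappa>2_def)

definition \<phi> where "\<phi> w = min (cw w) (dw w)"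

lemma cut2_exists: "0 < \<delta> \<Longrightarrow> \<exists>Z. is_cut I \<phi> \<delta> Z"
proof -
 assume \<delta>: "0 < \<delta>"
 define \<rho> where "\<rho> = Max (c ` I)"
 have "\<rho> \<in> c ` I" unfolding \<rho>_def using fin ne by (intro Max_in) auto
 then have \<rho>: "0 \<le> \<rho>" "\<rho> < 1" using c by (auto intro: less_imp_le)
 have "c i \<le> \<rho>" if "i \<in> I" for i using that fin unfolding \<rho>_def by auto
 then have "cw w \<le> \<rho> ^ length w" if "set w \<subseteq> I" for w
  using that c by (intro word_prod_le[of I]) auto
 then have "\<phi> w \<le> \<rho> ^ length w" if "set w \<subseteq> I" for w using that by (fastforce simp: \<phi>_def)
 then show ?thesis using cut_exists[OF fin _ \<rho> \<delta>] by blast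
qed

lemma cut2:
 assumes Z: "is_cut I \<phi> \<delta> Z" and \<delta>: "0 < \<delta>" "\<delta> \<le> 1"
 shows "finite Z" "\<And>w. w \<in> Z \<Longrightarrow> set w \<subseteq> I" "\<And>w. w \<in> Z \<Longrightarrow> \<phi> w \<le> \<delta>" "\<And>w. w \<in> Z \<Longrightarrow> \<kappa>2 * \<delta> \<le> \<phi> w"
  "\<And>A. A \<in> sets borel \<Longrightarrow> prob A = (\<Sum>w\<in>Z. pw w * prob (wmap S w -` A))"
  "\<And>w w'. w \<in> Z \<Longrightarrow> w' \<in> Z \<Longrightarrow> w \<noteq> w' \<Longrightarrow> wmap S w ` R \<inter> wmap S w' ` R = {}"
proof -
 show "finite Z" using Z by (rule is_cut_finite)
 show "\<And>w. w \<in> Z \<Longrightarrow> set w \<subseteq> I" "\<And>w. w \<in> Z \<Longrightarrow> \<phi> w \<le> \<delta>" using cut_word[OF Z] by auto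
 show "\<kappa>2 * \<delta> \<le> \<phi> w" if "w \<in> Z" for w
 proof (rule cut_lower[OF Z that])
  fix v i assume v: "set v \<subseteq> I" "i \<in> I"
  have "\<kappa>2 * cw v \<le> cw (v @ [i])"
   using X.\<kappa>(3)[OF v(2)] wpos(1)[OF v(1)] by (simp add: \<kappa>2_def mult.commute mult_left_mono)
  moreover have "\<kappa>2 * dw v \<le> dw (v @ [i])"
   using Y.\<kappa>(3)[OF v(2)] wpos(2)[OF v(1)] by (simp add: \<kappa>2_def mult.commute mult_left_mono)
  moreover have "\<kappa>2 * \<phi> v \<le> \<kappa>2 * cw v" "\<kappa>2 * \<phi> v \<le> \<kappa>2 * dw v"
   using \<kappa>2 by (auto intro!: mult_left_mono simp: \<phi>_def)
  ultimately show "\<kappa>2 * \<phi> v \<le> \<phi> (v @ [i])" unfolding \<phi>_def[of "v @ [i]"] by linarith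
 qed (use \<kappa>2 \<delta> in \<open>auto simp: \<phi>_def\<close>)
 show "prob A = (\<Sum>w\<in>Z. pw w * prob (wmap S w -` A))" if "A \<in> sets borel" for A
  by (rule measure_cut[OF Z that S_borel self_sim])
 show "wmap S w ` R \<inter> wmap S w' ` R = {}" if "w \<in> Z" "w' \<in> Z" "w \<noteq> w'" for w w'
  using cut_incomparable[OF Z that] rect_disjoint cut_word(1)[OF Z] that by metis
qed

text \<open>The bound of \<open>multiplicity\<close> for a cut by the short side: both sides of each
  rectangle are at least \<open>\<kappa>2 * \<delta>\<close> times those of \<open>R\<close>, and
  the rectangles lie within \<delta> of a corner of the cell.\<close>

definition MR where "MR = (4 * (1 / (\<kappa>2 * (b - a)) + 1) + 1) * (4 * (1 / (\<kappa>2 * (b' - a')) + 1) + 1)"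

lemma MR_ge: "1 \<le> MR"
proof -
 have "0 \<le> 1 / (\<kappa>2 * (b - a))" "0 \<le> 1 / (\<kappa>2 * (b' - a'))" using \<kappa>2 ab by auto
 moreover have "0 \<le> x \<Longrightarrow> 1 \<le> 4 * (x + 1) + 1" for x :: real by simp
 ultimately show ?thesis unfolding MR_def by (intro mult_ge1_I) blast+
qed

lemma cut2_multiplicity:
 assumes Z: "is_cut I \<phi> \<delta> Z" and \<delta>: "0 < \<delta>" "\<delta> \<le> 1"
 shows "real (card {w \<in> Z. 0 < wmass w \<delta> Q}) \<le> MR"
proof -
 define V where "V = {w \<in> Z. 0 < wmass w \<delta> Q}"
 note cz = cut2[OF Z \<delta>]
 have "real (card V) \<le> (4 * (\<delta> / (\<kappa>2 * \<delta> * (b - a)) + 1) + 1) * (4 * (\<delta> / (\<kappa>2 * \<delta> * (b' - a')) + 1) + 1)"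
 proof (rule multiplicity[where xc = "of_int (fst Q) * \<delta>" and yc = "of_int (snd Q) * \<delta>"])
  fix w assume w: "w \<in> V"
  then have wI: "set w \<subseteq> I" and wZ: "w \<in> Z" using cz by (auto simp: V_def)
  show "set w \<subseteq> I" by fact
  have "\<kappa>2 * \<delta> \<le> cw w" "\<kappa>2 * \<delta> \<le> dw w" using cz(4)[OF wZ] by (auto simp: \<phi>_def)
  then show "\<kappa>2 * \<delta> * (b - a) \<le> cw w * (b - a)" "\<kappa>2 * \<delta> * (b' - a') \<le> dw w * (b' - a')"
   using ab by (auto intro!: mult_right_mono)
  have "wmap S w -` cell \<delta> Q \<in> sets borel" using wmap_measurable[of I S w] S_borel wI by (intro vimage_borel) auto
  from prob_pos_meets[OF this] w have "\<exists>z\<in>K. z \<in> wmap S w -` cell \<delta> Q" unfolding V_def mem_Collect_eq by metis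
  then obtain z where z: "z \<in> K" "wmap S w z \<in> cell \<delta> Q" by (metis vimageE)
  then have m: "fst (wmap S w z) \<in> mesh \<delta> (fst Q)" "snd (wmap S w z) \<in> mesh \<delta> (snd Q)" by (auto simp: mem_Times_iff)
  have "of_int m * \<delta> \<in> mesh \<delta> m" for m using \<delta> by (simp add: mesh_def)
  then have "\<bar>fst (wmap S w z) - of_int (fst Q) * \<delta>\<bar> \<le> \<delta>" "\<bar>snd (wmap S w z) - of_int (snd Q) * \<delta>\<bar> \<le> \<delta>"
   using mesh_close(2)[OF \<delta>(1) m(1), of "of_int (fst Q) * \<delta>" "fst Q"] mesh_close(2)[OF \<delta>(1) m(2), of "of_int (snd Q) * \<delta>" "snd Q"]
   by auto
  then show "\<exists>z\<in>K. \<bar>fst (wmap S w z) - of_int (fst Q) * \<delta>\<bar> \<le> \<delta> \<and> \<bar>snd (wmap S w z) - of_int (snd Q) * \<delta>\<bar> \<le> \<delta>"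
   using z(1) by blast
 qed (use cz ab \<kappa>2 \<delta> in \<open>auto simp: V_def\<close>)
 also have "\<dots> = MR" using \<delta> by (simp add: MR_def)
 finally show ?thesis by (simp add: V_def)
qed

lemma psi_cases:
 assumes "set w \<subseteq> I"
 shows "dw w \<le> cw w \<Longrightarrow> \<psi> t1 t2 s q w =
   pw w powr q * (cw w powr t1 * dw w powr (s - t1))"
  "cw w < dw w \<Longrightarrow> \<psi> t1 t2 s q w =
   pw w powr q * (dw w powr t2 * cw w powr (s - t2))"
 by (simp_all add: psi_def Let_def)

lemma word_rescale:
 assumes Z: "is_cut I \<phi> \<delta> Z" and \<delta>: "0 < \<delta>" "\<delta> \<le> 1" and w: "w \<in> Z"
 defines "L \<equiv> 1 / \<kappa>2"
 shows "dw w \<le> cw w \<Longrightarrow> dw w \<le> \<delta> \<and> \<delta> \<le> L * dw w \<and> \<delta> / cw w \<in> {0<..L}"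
  "cw w \<le> dw w \<Longrightarrow> cw w \<le> \<delta> \<and> \<delta> \<le> L * cw w \<and> \<delta> / dw w \<in> {0<..L}"
proof -
 note cz = cut2[OF Z \<delta>]
 have pos: "0 < cw w" "0 < dw w" using wpos cz(2)[OF w] by auto
 have *: "D \<le> \<delta> \<and> \<delta> \<le> L * D \<and> \<delta> / C \<in> {0<..L}" if "D \<le> \<delta>" "\<kappa>2 * \<delta> \<le> D" "D \<le> C" "0 < D" for C D
 proof -
  have 1: "\<delta> \<le> L * D" using that \<kappa>2 by (simp add: L_def field_simps)
  also have "\<dots> \<le> L * C" using that \<kappa>2 by (intro mult_left_mono) (auto simp: L_def)
  finally have "\<delta> / C \<le> L" using that by (simp add: pos_divide_le_eq)
  then show ?thesis using 1 that \<delta> by auto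
 qed
 show "dw w \<le> cw w \<Longrightarrow> dw w \<le> \<delta> \<and> \<delta> \<le> L * dw w \<and> \<delta> / cw w \<in> {0<..L}"
  using cz(3,4)[OF w] pos by (intro *) (auto simp: \<phi>_def)
 show "cw w \<le> dw w \<Longrightarrow> cw w \<le> \<delta> \<and> \<delta> \<le> L * cw w \<and> \<delta> / dw w \<in> {0<..L}"
  using cz(3,4)[OF w] pos by (intro *) (auto simp: \<phi>_def)
qed

text \<open>A word resolves only its long side at scale \<delta>, so its planar moment is that of a
  projection at a relative scale, which \<open>rescale_powr\<close> writes as psi. At most
  \<open>MR\<close> words reach one cell, so the q-th powers of the contributions may be added. The
  bound \<open>W\<close> is uniform over finite sets of words because the cut varies with
  \<delta>.\<close>

theorem moment2_upper:
 assumes q: "0 \<le> q"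
  and up1: "\<exists>C>0. \<forall>\<eta>\<in>{0<..1}. moment \<nu>1 q \<eta> \<le> C * \<eta> powr (-t1)"
  and up2: "\<exists>C>0. \<forall>\<eta>\<in>{0<..1}. moment \<nu>2 q \<eta> \<le> C * \<eta> powr (-t2)"
  and fin_sum: "\<And>Z. finite Z \<Longrightarrow> (\<forall>w\<in>Z. set w \<subseteq> I) \<Longrightarrow> (\<Sum>w\<in>Z. \<psi> t1 t2 s q w) \<le> W"
 shows "\<exists>C>0. \<forall>\<delta>\<in>{0<..1}. moment2 \<mu> q \<delta> \<le> C * \<delta> powr (-s)"
proof -
 define L where "L = 1 / \<kappa>2"
 have L: "1 \<le> L" using \<kappa>2 by (simp add: L_def)
 obtain C1 where C1: "C1 > 0" "\<And>\<eta>. \<eta> \<in> {0<..L} \<Longrightarrow> moment \<nu>1 q \<eta> \<le> C1 * \<eta> powr (-t1)"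
  using X.moment_extend(1)[OF q L up1] by blast
 obtain C2 where C2: "C2 > 0" "\<And>\<eta>. \<eta> \<in> {0<..L} \<Longrightarrow> moment \<nu>2 q \<eta> \<le> C2 * \<eta> powr (-t2)"
  using Y.moment_extend(1)[OF q L up2] by blast
 define D1 D2 where "D1 = C1 * L powr \<bar>s - t1\<bar>" and "D2 = C2 * L powr \<bar>s - t2\<bar>"
 have D: "0 < D1" "0 < D2" using C1 C2 L by (auto simp: D1_def D2_def)
 define D where "D = MS q * (D1 + D2)"
 have D0: "0 < D" using D MS_pos by (auto simp: D_def)
 have main: "moment2 \<mu> q \<delta> \<le> (MR powr q * D * (\<bar>W\<bar> + 1)) * \<delta> powr (-s)" if \<delta>: "\<delta> \<in> {0<..1}" for \<delta>
 proof -
  have d: "0 < \<delta>" "\<delta> \<le> 1" using \<delta> by auto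
  obtain Z where Z: "is_cut I \<phi> \<delta> Z" using cut2_exists[OF d(1)] by blast
  note cz = cut2[OF Z d]
  have word: "pw w powr q * (\<Sum>Q\<in>window2 \<delta>. wmass w \<delta> Q powr q)
    \<le> D * \<delta> powr (-s) * \<psi> t1 t2 s q w" if w: "w \<in> Z" for w
  proof (cases "dw w \<le> cw w")
   case True
   note wr = word_rescale(1)[OF Z d w True, folded L_def]
   have wI: "set w \<subseteq> I" using cz w by auto
   have "(\<Sum>Q\<in>window2 \<delta>. wmass w \<delta> Q powr q) \<le> MS q * moment \<nu>1 q (\<delta> / cw w)"
    using wr wI d q window2 by (intro word_strip(1)) auto
   also have "moment \<nu>1 q (\<delta> / cw w) \<le> C1 * (\<delta> / cw w) powr (-t1)" using wr by (intro C1) auto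
   also have "(\<delta> / cw w) powr (-t1) \<le> L powr \<bar>s - t1\<bar> * (\<delta> powr (-s) * (cw w powr t1 * dw w powr (s - t1)))"
    using wr d wpos[OF wI] L by (intro rescale_powr) auto
   finally have "(\<Sum>Q\<in>window2 \<delta>. wmass w \<delta> Q powr q) \<le>
     MS q * D1 * (\<delta> powr (-s) * (cw w powr t1 * dw w powr (s - t1)))"
    using MS_pos[of q] C1(1) by (simp add: D1_def mult.assoc mult_left_mono)
   also have "\<dots> \<le> D * (\<delta> powr (-s) * (cw w powr t1 * dw w powr (s - t1)))"
    using D MS_pos[of q] by (intro mult_right_mono) (auto simp: D_def)
   finally show ?thesis unfolding psi_cases(1)[OF wI True]
    by (intro mult_le_rearrange) auto
  next
   case False
   then have le: "cw w \<le> dw w" "cw w < dw w" by auto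
   note wr = word_rescale(2)[OF Z d w le(1), folded L_def]
   have wI: "set w \<subseteq> I" using cz w by auto
   have "(\<Sum>Q\<in>window2 \<delta>. wmass w \<delta> Q powr q) \<le> MS q * moment \<nu>2 q (\<delta> / dw w)"
    using wr wI d q window2 by (intro word_strip(3)) auto
   also have "moment \<nu>2 q (\<delta> / dw w) \<le> C2 * (\<delta> / dw w) powr (-t2)" using wr by (intro C2) auto
   also have "(\<delta> / dw w) powr (-t2) \<le> L powr \<bar>s - t2\<bar> * (\<delta> powr (-s) * (dw w powr t2 * cw w powr (s - t2)))"
    using wr d wpos[OF wI] L by (intro rescale_powr) auto
   finally have "(\<Sum>Q\<in>window2 \<delta>. wmass w \<delta> Q powr q) \<le>
     MS q * D2 * (\<delta> powr (-s) * (dw w powr t2 * cw w powr (s - t2)))"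
    using MS_pos[of q] C2(1) by (simp add: D2_def mult.assoc mult_left_mono)
   also have "\<dots> \<le> D * (\<delta> powr (-s) * (dw w powr t2 * cw w powr (s - t2)))"
    using D MS_pos[of q] by (intro mult_right_mono) (auto simp: D_def)
   finally show ?thesis unfolding psi_cases(2)[OF wI le(2)]
    by (intro mult_le_rearrange) auto
  qed
  have "moment2 \<mu> q \<delta> = (\<Sum>Q\<in>window2 \<delta>. prob (cell \<delta> Q) powr q)" by (rule moment2_window[OF d(1)])
  also have "\<dots> \<le> (\<Sum>Q\<in>window2 \<delta>. MR powr q * (\<Sum>w\<in>Z. pw w powr q * wmass w \<delta> Q powr q))"
  proof (rule sum_mono)
   fix Q
   let ?V = "{w \<in> Z. 0 < wmass w \<delta> Q}"
   have pw: "0 \<le> pw w" if "w \<in> Z" for w using wpos(3) cz(2)[OF that] by (auto intro: less_imp_le)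
   have "prob (cell \<delta> Q) = (\<Sum>w\<in>Z. pw w * wmass w \<delta> Q)" by (rule cz(5)) simp
   also have "\<dots> = (\<Sum>w\<in>?V. pw w * wmass w \<delta> Q)"
    using cz(1) by (intro sum.mono_neutral_right) (auto simp: not_less measure_le_0_iff)
   finally have "prob (cell \<delta> Q) powr q \<le> MR powr q * (\<Sum>w\<in>?V. (pw w * wmass w \<delta> Q) powr q)"
    using powr_sum_le[OF _ cut2_multiplicity[OF Z d] q, of Q "\<lambda>w. pw w * wmass w \<delta> Q"] cz(1) pw by simp
   also have "(\<Sum>w\<in>?V. (pw w * wmass w \<delta> Q) powr q) =
     (\<Sum>w\<in>?V. pw w powr q * wmass w \<delta> Q powr q)"
    by (intro sum.cong refl powr_mult)
   also have "\<dots> \<le> (\<Sum>w\<in>Z. pw w powr q * wmass w \<delta> Q powr q)"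
    using cz(1) by (intro sum_mono2) auto
   finally show "prob (cell \<delta> Q) powr q \<le> MR powr q * (\<Sum>w\<in>Z. pw w powr q * wmass w \<delta> Q powr q)"
    by (simp add: mult_left_mono)
  qed
  also have "\<dots> = MR powr q * (\<Sum>w\<in>Z. pw w powr q * (\<Sum>Q\<in>window2 \<delta>. wmass w \<delta> Q powr q))"
   by (simp add: sum_distrib_left, subst sum.swap, rule refl)
  also have "\<dots> \<le> MR powr q * (\<Sum>w\<in>Z. D * \<delta> powr (-s) * \<psi> t1 t2 s q w)"
   by (intro mult_left_mono sum_mono word) auto
  also have "\<dots> = MR powr q * (D * \<delta> powr (-s) * (\<Sum>w\<in>Z. \<psi> t1 t2 s q w))"
   by (simp add: sum_distrib_left)
  also have "\<dots> \<le> MR powr q * (D * \<delta> powr (-s) * (\<bar>W\<bar> + 1))"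
  proof (intro mult_left_mono)
   show "(\<Sum>w\<in>Z. \<psi> t1 t2 s q w) \<le> \<bar>W\<bar> + 1" using fin_sum[of Z] cz by fastforce
  qed (use D0 in auto)
  finally show ?thesis by (simp add: mult_ac)
 qed
 show ?thesis using main D0 MR_ge by (intro exI[of _ "MR powr q * D * (\<bar>W\<bar> + 1)"]) auto
qed

lemma prob_word_le:
 assumes "set w \<subseteq> I" "A \<in> sets borel"
 shows "pw w * prob (wmap S w -` A) \<le> prob A"
 using assms
proof (induction w arbitrary: A)
 case (Cons i w)
 have i: "i \<in> I" "set w \<subseteq> I" using Cons.prems by auto
 have B: "S i -` A \<in> sets borel" using vimage_borel[OF S_borel[OF i(1)] Cons.prems(2)] .
 have "pw (i # w) * prob (wmap S (i # w) -` A) = p i * (pw w * prob (wmap S w -` (S i -` A)))"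
  by (simp add: vimage_comp mult.assoc)
 also have "\<dots> \<le> p i * prob (S i -` A)"
  using Cons.IH[OF i(2) B] p(1)[OF i(1)] by (intro mult_left_mono) auto
 also have "\<dots> \<le> (\<Sum>i\<in>I. p i * prob (S i -` A))"
  using i(1) fin by (intro member_le_sum) (auto simp: less_imp_le[OF p(1)])
 also have "\<dots> = prob A" using self_sim[OF Cons.prems(2)] by simp
 finally show ?case .
qed simp

lemma word_vimage_borel: "set w \<subseteq> I \<Longrightarrow> A \<in> sets borel \<Longrightarrow> wmap S w -` A \<in> sets borel"
 using vimage_borel wmap_measurable[of I S w] S_borel by blast

text \<open>At \<open>q = 0\<close> a cell charged by one word is charged by the whole measure, and
  at most \<open>MR\<close> words claim the same cell, so the counts of single words add up to a
  lower bound.\<close>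

theorem moment2_lower:
 assumes lo1: "\<exists>C>0. \<forall>\<eta>\<in>{0<..1}. C * \<eta> powr (-t1) \<le> moment \<nu>1 0 \<eta>"
  and lo2: "\<exists>C>0. \<forall>\<eta>\<in>{0<..1}. C * \<eta> powr (-t2) \<le> moment \<nu>2 0 \<eta>"
 shows "\<exists>C>0. \<forall>\<delta>\<in>{0<..1}. \<forall>Z. is_cut I \<phi> \<delta> Z \<longrightarrow>
   C * \<delta> powr (-s) * (\<Sum>w\<in>Z. \<psi> t1 t2 s 0 w) \<le> moment2 \<mu> 0 \<delta>"
proof -
 define L where "L = 1 / \<kappa>2"
 have L: "1 \<le> L" using \<kappa>2 by (simp add: L_def)
 obtain C1 where C1: "C1 > 0" "\<And>\<eta>. \<eta> \<in> {0<..L} \<Longrightarrow> C1 * \<eta> powr (-t1) \<le> moment \<nu>1 0 \<eta>"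
  using X.moment_extend(2)[OF order_refl L lo1] by blast
 obtain C2 where C2: "C2 > 0" "\<And>\<eta>. \<eta> \<in> {0<..L} \<Longrightarrow> C2 * \<eta> powr (-t2) \<le> moment \<nu>2 0 \<eta>"
  using Y.moment_extend(2)[OF order_refl L lo2] by blast
 define D1 D2 where "D1 = C1 / L powr \<bar>s - t1\<bar>" and "D2 = C2 / L powr \<bar>s - t2\<bar>"
 have D: "0 < D1" "0 < D2" using C1 C2 L by (auto simp: D1_def D2_def)
 define D where "D = min D1 D2 / (MS 0 * MR)"
 have D0: "0 < D" using D MS_pos[of 0] MR_ge by (auto simp: D_def)
 have main: "D * \<delta> powr (-s) * (\<Sum>w\<in>Z. \<psi> t1 t2 s 0 w) \<le> moment2 \<mu> 0 \<delta>"
  if \<delta>: "\<delta> \<in> {0<..1}" and Z: "is_cut I \<phi> \<delta> Z" for \<delta> Z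
 proof -
  have d: "0 < \<delta>" "\<delta> \<le> 1" using \<delta> by auto
  note cz = cut2[OF Z d]
  have word: "min D1 D2 * \<delta> powr (-s) * \<psi> t1 t2 s 0 w \<le>
    MS 0 * (\<Sum>Q\<in>window2 \<delta>. wmass w \<delta> Q powr 0)" if w: "w \<in> Z" for w
  proof (cases "dw w \<le> cw w")
   case True
   note wr = word_rescale(1)[OF Z d w True, folded L_def]
   have wI: "set w \<subseteq> I" using cz w by auto
   let ?A = "\<delta> powr (-s) * (cw w powr t1 * dw w powr (s - t1))"
   have "min D1 D2 * ?A \<le> D1 * ?A" by (intro mult_right_mono) auto
   also have "?A \<le> L powr \<bar>s - t1\<bar> * (\<delta> / cw w) powr (-t1)"
    using wr d wpos[OF wI] L by (intro rescale_powr) auto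
   also have "D1 * (L powr \<bar>s - t1\<bar> * (\<delta> / cw w) powr (-t1)) = C1 * (\<delta> / cw w) powr (-t1)"
    using L by (simp add: D1_def)
   also have "\<dots> \<le> moment \<nu>1 0 (\<delta> / cw w)" using wr by (intro C1) auto
   also have "\<dots> \<le> MS 0 * (\<Sum>Q\<in>window2 \<delta>. wmass w \<delta> Q powr 0)"
    using wr wI d window2 by (intro word_strip(2) word_cell_window) auto
   finally show ?thesis using D wpos[OF wI] unfolding psi_cases(1)[OF wI True] by (simp add: mult.assoc)
  next
   case False
   then have le: "cw w \<le> dw w" "cw w < dw w" by auto
   note wr = word_rescale(2)[OF Z d w le(1), folded L_def]
   have wI: "set w \<subseteq> I" using cz w by auto
   let ?A = "\<delta> powr (-s) * (dw w powr t2 * cw w powr (s - t2))"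
   have "min D1 D2 * ?A \<le> D2 * ?A" by (intro mult_right_mono) auto
   also have "?A \<le> L powr \<bar>s - t2\<bar> * (\<delta> / dw w) powr (-t2)"
    using wr d wpos[OF wI] L by (intro rescale_powr) auto
   also have "D2 * (L powr \<bar>s - t2\<bar> * (\<delta> / dw w) powr (-t2)) = C2 * (\<delta> / dw w) powr (-t2)"
    using L by (simp add: D2_def)
   also have "\<dots> \<le> moment \<nu>2 0 (\<delta> / dw w)" using wr by (intro C2) auto
   also have "\<dots> \<le> MS 0 * (\<Sum>Q\<in>window2 \<delta>. wmass w \<delta> Q powr 0)"
    using wr wI d window2 by (intro word_strip(4) word_cell_window) auto
   finally show ?thesis using D wpos[OF wI] unfolding psi_cases(2)[OF wI le(2)] by (simp add: mult.assoc)
  qed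
  have "min D1 D2 * \<delta> powr (-s) * (\<Sum>w\<in>Z. \<psi> t1 t2 s 0 w) \<le>
    (\<Sum>w\<in>Z. MS 0 * (\<Sum>Q\<in>window2 \<delta>. wmass w \<delta> Q powr 0))"
   unfolding sum_distrib_left by (intro sum_mono order_trans[OF word]) (auto simp: sum_distrib_left)
  also have "\<dots> = MS 0 * (\<Sum>w\<in>Z. \<Sum>Q\<in>window2 \<delta>. wmass w \<delta> Q powr 0)"
   by (simp add: sum_distrib_left)
  also have "(\<Sum>w\<in>Z. \<Sum>Q\<in>window2 \<delta>. wmass w \<delta> Q powr 0) =
    (\<Sum>Q\<in>window2 \<delta>. \<Sum>w\<in>Z. wmass w \<delta> Q powr 0)" by (rule sum.swap)
  also have "\<dots> \<le> (\<Sum>Q\<in>window2 \<delta>. MR * prob (cell \<delta> Q) powr 0)"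
  proof (rule sum_mono)
   fix Q
   let ?V = "{w \<in> Z. 0 < wmass w \<delta> Q}"
   have "(\<Sum>w\<in>Z. wmass w \<delta> Q powr 0) = (\<Sum>w\<in>?V. wmass w \<delta> Q powr 0)"
    using cz(1) by (intro sum.mono_neutral_right) (auto simp: not_less measure_le_0_iff)
   also have "\<dots> = real (card ?V)" by simp
   also have "\<dots> \<le> MR * prob (cell \<delta> Q) powr 0"
   proof (cases "?V = {}")
    case False
    then obtain w where w: "w \<in> Z" "0 < wmass w \<delta> Q" by blast
    then have "0 < pw w * wmass w \<delta> Q" using wpos(3) cz(2) by simp
    also have "\<dots> \<le> prob (cell \<delta> Q)" using cz(2) w by (intro prob_word_le) auto
    finally show ?thesis using cut2_multiplicity[OF Z d, of Q] by simp
   next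
    case True
    then have "real (card ?V) = 0" by (simp only: card.empty of_nat_0)
    moreover have "0 \<le> MR * prob (cell \<delta> Q) powr 0" using MR_ge by (intro mult_nonneg_nonneg) auto
    ultimately show ?thesis by linarith
   qed
   finally show "(\<Sum>w\<in>Z. wmass w \<delta> Q powr 0) \<le> MR * prob (cell \<delta> Q) powr 0" .
  qed
  also have "\<dots> = MR * moment2 \<mu> 0 \<delta>" by (simp add: moment2_window[OF d(1)] sum_distrib_left)
  finally have "min D1 D2 * \<delta> powr (-s) * (\<Sum>w\<in>Z. \<psi> t1 t2 s 0 w) \<le> (MS 0 * MR) * moment2 \<mu> 0 \<delta>"
   using MS_pos[of 0] by (simp add: mult.assoc mult_left_mono)
  moreover have "0 < MS 0 * MR" using MS_pos[of 0] MR_ge by (intro mult_pos_pos) linarith+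
  ultimately show ?thesis by (simp add: D_def pos_divide_le_eq mult_ac)
 qed
 show ?thesis using main D0 by blast
qed

section \<open>Counting rectangles of prescribed side lengths\<close>

lemma words_disjoint:
 assumes "w \<in> words I k" "w' \<in> words I k" "w \<noteq> w'"
 shows "wmap S w ` R \<inter> wmap S w' ` R = {}"
proof -
 have "w \<parallel> w'" using assms by (intro not_equal_is_parallel) (auto simp: words_def)
 then obtain as b bs c cs where "b \<noteq> c" "w = as @ b # bs" "w' = as @ c # cs"
  using parallel_decomp by blast
 then show ?thesis using assms rect_disjoint[of w as b bs w' c cs] by (auto simp: words_def)
qed

text \<open>Each word is assigned a pair of charged cells, one of either projection, whose product
  its rectangle meets. Rectangles of distinct words of equal length are disjoint and their sides are
  comparable to the cells, so boundedly many words share a pair.\<close>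

lemma card_dyadic_words:
 fixes m n k :: nat
 defines "W \<equiv> {w \<in> words I k. (1/2) ^ Suc m < cw w \<and> cw w \<le> (1/2) ^ m \<and>
   (1/2) ^ Suc n < dw w \<and> dw w \<le> (1/2) ^ n}"
 shows "real (card W) \<le> (4 * (2 / (b - a) + 1) + 1) * (4 * (2 / (b' - a') + 1) + 1) *
  (moment \<nu>1 0 ((1/2) ^ m) * moment \<nu>2 0 ((1/2) ^ n))"
proof -
 define M where "M = (4 * (2 / (b - a) + 1) + 1) * (4 * (2 / (b' - a') + 1) + 1)"
 define d1 d2 :: real where "d1 = (1/2) ^ m" and "d2 = (1/2) ^ n"
 have dpos: "0 < d1" "0 < d2" by (simp_all add: d1_def d2_def)
 define A where "A = {i. 0 < measure \<nu>1 (mesh d1 i)}"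
 define B where "B = {j. 0 < measure \<nu>2 (mesh d2 j)}"
 have finAB: "finite A" "finite B"
  using finite_subset[OF X.pos_window X.window(1)[OF dpos(1)]] finite_subset[OF Y.pos_window Y.window(1)[OF dpos(2)]]
  by (simp_all add: A_def B_def)
 have finW: "finite W" unfolding W_def using finite_words[OF fin] by simp
 have ex: "\<exists>ij\<in>A \<times> B. \<exists>z\<in>K. wmap S w z \<in> mesh d1 (fst ij) \<times> mesh d2 (snd ij)" if w: "w \<in> W" for w
 proof -
  have wI: "set w \<subseteq> I" using w by (auto simp: W_def words_def)
  let ?N = "X.window d1 \<times> Y.window d2"
  have cb: "mesh d1 (fst ij) \<times> mesh d2 (snd ij) \<in> sets borel" for ij by (metis borel_Times mesh_borel)
  have cover: "UNIV \<inter> K \<subseteq> (\<Union>ij\<in>?N. wmap S w -` (mesh d1 (fst ij) \<times> mesh d2 (snd ij)))"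
  proof
   fix z assume "z \<in> UNIV \<inter> K"
   then have z: "wmap S w z \<in> K" using word_K[OF wI] by auto
   define i j where "i = \<lfloor>fst (wmap S w z) / d1\<rfloor>" and "j = \<lfloor>snd (wmap S w z) / d2\<rfloor>"
   have ij: "fst (wmap S w z) \<in> mesh d1 i" "snd (wmap S w z) \<in> mesh d2 j"
    using dpos by (simp_all add: mesh_iff i_def j_def)
   moreover have "i \<in> X.window d1" "j \<in> Y.window d2"
    using ij z unfolding X.window_def Y.window_def by (auto simp: mem_Times_iff)
   ultimately show "z \<in> (\<Union>ij\<in>?N. wmap S w -` (mesh d1 (fst ij) \<times> mesh d2 (snd ij)))"
    by (intro UN_I[of "(i, j)"]) (auto simp: mem_Times_iff)
  qed
  have "prob UNIV \<le> (\<Sum>ij\<in>?N. prob (wmap S w -` (mesh d1 (fst ij) \<times> mesh d2 (snd ij))))"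
   using X.window(1)[OF dpos(1)] Y.window(1)[OF dpos(2)] word_vimage_borel[OF wI cb] sets_borel
   by (intro prob_le_sum_cover[OF _ K_events measure_K _ _ cover]) auto
  then have "\<exists>ij\<in>?N. prob (wmap S w -` (mesh d1 (fst ij) \<times> mesh d2 (snd ij))) \<noteq> 0"
   using prob_space space_UNIV by (metis (no_types, lifting) not_one_le_zero sum.neutral)
  then obtain ij where ij: "0 < prob (wmap S w -` (mesh d1 (fst ij) \<times> mesh d2 (snd ij)))"
   by (auto simp: zero_less_measure_iff)
  have "0 < pw w * prob (wmap S w -` (mesh d1 (fst ij) \<times> mesh d2 (snd ij)))" using ij wpos(3)[OF wI] by simp
  also have "\<dots> \<le> prob (mesh d1 (fst ij) \<times> mesh d2 (snd ij))" by (rule prob_word_le[OF wI cb])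
  finally have pos: "0 < prob (mesh d1 (fst ij) \<times> mesh d2 (snd ij))" .
  have "prob (mesh d1 (fst ij) \<times> mesh d2 (snd ij)) \<le> prob (fst -` mesh d1 (fst ij))"
   using measurable_sets[OF fst_measurable, of "mesh d1 (fst ij)"] space_UNIV by (intro finite_measure_mono) auto
  moreover have "prob (mesh d1 (fst ij) \<times> mesh d2 (snd ij)) \<le> prob (snd -` mesh d2 (snd ij))"
   using measurable_sets[OF snd_measurable, of "mesh d2 (snd ij)"] space_UNIV by (intro finite_measure_mono) auto
  ultimately have "ij \<in> A \<times> B" using pos by (auto simp: A_def B_def \<nu>1_measure \<nu>2_measure mem_Times_iff)
  moreover have "\<exists>z\<in>K. z \<in> wmap S w -` (mesh d1 (fst ij) \<times> mesh d2 (snd ij))"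
   by (rule prob_pos_meets[OF word_vimage_borel[OF wI cb] ij])
  ultimately show ?thesis by (metis vimageE)
 qed
 obtain \<sigma> where \<sigma>: "\<And>w. w \<in> W \<Longrightarrow> \<sigma> w \<in> A \<times> B"
  "\<And>w. w \<in> W \<Longrightarrow> \<exists>z\<in>K. wmap S w z \<in> mesh d1 (fst (\<sigma> w)) \<times> mesh d2 (snd (\<sigma> w))"
  using bchoice[of W "\<lambda>w ij. ij \<in> A \<times> B \<and> (\<exists>z\<in>K. wmap S w z \<in> mesh d1 (fst ij) \<times> mesh d2 (snd ij))"] ex by metis
 have fiber: "real (card {w \<in> W. \<sigma> w = ij}) \<le> M" for ij
 proof -
  have "real (card {w \<in> W. \<sigma> w = ij}) \<le> (4 * (d1 / (d1 / 2 * (b - a)) + 1) + 1) * (4 * (d2 / (d2 / 2 * (b' - a')) + 1) + 1)"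
  proof (rule multiplicity[where xc = "of_int (fst ij) * d1" and yc = "of_int (snd ij) * d2"])
   fix w assume w: "w \<in> {w \<in> W. \<sigma> w = ij}"
   show "set w \<subseteq> I" using w by (auto simp: W_def words_def)
   have "d1 / 2 \<le> cw w" "d2 / 2 \<le> dw w" using w by (auto simp: W_def d1_def d2_def)
   then show "d1 / 2 * (b - a) \<le> cw w * (b - a)" "d2 / 2 * (b' - a') \<le> dw w * (b' - a')"
    using ab by (auto intro!: mult_right_mono)
   have "\<exists>z\<in>K. wmap S w z \<in> mesh d1 (fst ij) \<times> mesh d2 (snd ij)" using \<sigma>(2)[of w] w by auto
   then obtain z where z: "z \<in> K" "fst (wmap S w z) \<in> mesh d1 (fst ij)" "snd (wmap S w z) \<in> mesh d2 (snd ij)"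
    by (metis mem_Times_iff)
   have "of_int i * d1 \<in> mesh d1 i" "of_int i * d2 \<in> mesh d2 i" for i using dpos by (simp_all add: mesh_def)
   then have "\<bar>fst (wmap S w z) - of_int (fst ij) * d1\<bar> \<le> d1" "\<bar>snd (wmap S w z) - of_int (snd ij) * d2\<bar> \<le> d2"
    using mesh_close(2)[OF dpos(1) z(2), of "of_int (fst ij) * d1" "fst ij"]
     mesh_close(2)[OF dpos(2) z(3), of "of_int (snd ij) * d2" "snd ij"] by auto
   then show "\<exists>z\<in>K. \<bar>fst (wmap S w z) - of_int (fst ij) * d1\<bar> \<le> d1 \<and> \<bar>snd (wmap S w z) - of_int (snd ij) * d2\<bar> \<le> d2"
    using z(1) by blast
  next
   fix w w' assume "w \<in> {w \<in> W. \<sigma> w = ij}" "w' \<in> {w \<in> W. \<sigma> w = ij}" "w \<noteq> w'"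
   then show "wmap S w ` R \<inter> wmap S w' ` R = {}" by (intro words_disjoint[of _ k]) (auto simp: W_def)
  qed (use finW ab dpos in auto)
  also have "\<dots> = M" using dpos by (simp add: M_def)
  finally show ?thesis .
 qed
 have eqW: "W = (\<Union>ij\<in>A \<times> B. {w \<in> W. \<sigma> w = ij})"
 proof (intro equalityI subsetI)
  fix w assume "w \<in> W"
  then show "w \<in> (\<Union>ij\<in>A \<times> B. {w \<in> W. \<sigma> w = ij})" using \<sigma>(1) by (intro UN_I[of "\<sigma> w"]) auto
 qed auto
 have "card W \<le> (\<Sum>ij\<in>A \<times> B. card {w \<in> W. \<sigma> w = ij})"
  by (subst eqW, rule card_UN_le) (use finAB in simp)
 then have "real (card W) \<le> (\<Sum>ij\<in>A \<times> B. real (card {w \<in> W. \<sigma> w = ij}))"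
  unfolding of_nat_sum[symmetric] of_nat_le_iff .
 also have "\<dots> \<le> (\<Sum>ij\<in>A \<times> B. M)" by (intro sum_mono fiber)
 also have "\<dots> = M * (real (card A) * real (card B))" by (simp add: card_cartesian_product)
 also have "real (card A) = moment \<nu>1 0 d1" by (simp add: moment_def A_def)
 also have "real (card B) = moment \<nu>2 0 d2" by (simp add: moment_def B_def)
 finally show ?thesis by (simp add: M_def d1_def d2_def)
qed

text \<open>If the sum \<open>s\<close> exceeded 1, its k-th power, a sum over words of length
  \<open>k\<close>, would grow exponentially. The words fall into at most
  \<open>(L * k + 1)\<^sup>2\<close> dyadic classes of side lengths, and counting by projections
  bounds each class by \<open>A * y ^ k\<close> with \<open>y < s\<close>. A polynomial number of
  classes cannot make up the difference.\<close>

theorem sum_box_dims_le_one: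
 assumes g1: "has_growth (moment \<nu>1 0) D1" and g2: "has_growth (moment \<nu>2 0) D2"
 shows "(\<Sum>i\<in>I. c i powr D1 * d i powr D2) \<le> 1"
proof (rule ccontr)
 define s where "s = (\<Sum>i\<in>I. c i powr D1 * d i powr D2)"
 assume "\<not> ?thesis"
 then have s: "1 < s" by (simp add: s_def)
 obtain L where L: "(1/2) ^ L < \<kappa>2" using real_arch_pow_inv[of \<kappa>2 "1/2"] \<kappa>2 by auto
 \<comment> \<open>Chosen such that \<open>ln y = ln s * (real L / (2 * (real L + 1)))\<close> for
   the \<open>y\<close> below, hence \<open>y < s\<close>.\<close>
 define \<epsilon> where "\<epsilon> = ln s / (4 * ln 2 * (real L + 1))"
 have e: "0 < \<epsilon>" unfolding \<epsilon>_def using s by (intro divide_pos_pos mult_pos_pos) auto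
 obtain C1 where C1: "C1 > 0" "\<And>\<eta>. \<eta> \<in> {0<..1} \<Longrightarrow> moment \<nu>1 0 \<eta> \<le> C1 * \<eta> powr (-(D1 + \<epsilon>))"
  using has_growthD(1)[OF g1, of "D1 + \<epsilon>"] e by auto
 obtain C2 where C2: "C2 > 0" "\<And>\<eta>. \<eta> \<in> {0<..1} \<Longrightarrow> moment \<nu>2 0 \<eta> \<le> C2 * \<eta> powr (-(D2 + \<epsilon>))"
  using has_growthD(1)[OF g2, of "D2 + \<epsilon>"] e by auto
 define M where "M = (4 * (2 / (b - a) + 1) + 1) * (4 * (2 / (b' - a') + 1) + 1)"
 have M: "0 < M"
 proof -
  have "0 < 2 / (b - a)" "0 < 2 / (b' - a')" using ab by auto
  moreover have "0 < x \<Longrightarrow> 0 < 4 * (x + 1) + 1" for x :: real by simp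
  ultimately show ?thesis unfolding M_def by (intro mult_pos_pos) blast+
 qed
 define A where "A = M * (2 powr \<bar>D1\<bar> * C1) * (2 powr \<bar>D2\<bar> * C2)"
 have A: "0 < A" using M C1 C2 by (simp add: A_def)
 define y where "y = (2::real) powr (2 * \<epsilon> * real L)"
 have y: "0 < y" "y < s"
 proof -
  show "0 < y" by (simp add: y_def)
  have "ln y = ln s * (real L / (2 * (real L + 1)))" by (simp add: y_def ln_powr \<epsilon>_def)
  also have "\<dots> < ln s * 1" using s by (intro mult_strict_left_mono) (auto simp: divide_less_eq)
  finally show "y < s" using \<open>0 < y\<close> s by (simp add: ln_less_cancel_iff)
 qed
 have bound: "s ^ k \<le> (real (L * k) + 1)\<^sup>2 * (A * y ^ k)" for k
 proof -
  define W where "W mn = {w \<in> words I k. (1/2) ^ Suc (fst mn) < cw w \<and> cw w \<le> (1/2) ^ (fst mn) \<and>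
   (1/2) ^ Suc (snd mn) < dw w \<and> dw w \<le> (1/2) ^ (snd mn)}" for mn :: "nat \<times> nat"
  have finW: "finite (W mn)" for mn unfolding W_def using finite_words[OF fin] by simp
  \<comment> \<open>Sides of a word of length \<open>k\<close> are at least
    \<open>\<kappa>2 ^ k\<close>, hence at least \<open>(1/2) ^ (L * k)\<close>, which bounds the
    dyadic exponents by \<open>L * k\<close>.\<close>
  have cover: "words I k \<subseteq> (\<Union>mn\<in>{..L * k} \<times> {..L * k}. W mn)"
  proof
   fix w assume w: "w \<in> words I k"
   then have wI: "set w \<subseteq> I" and len: "length w = k" by (auto simp: words_def)
   have kc: "\<kappa>2 ^ k \<le> cw w" "\<kappa>2 ^ k \<le> dw w"
    using word_prod_ge[of I \<kappa>2 c w] word_prod_ge[of I \<kappa>2 d w] wI len \<kappa>2 X.\<kappa>(3) Y.\<kappa>(3)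
    by (auto simp: \<kappa>2_def min_le_iff_disj)
   have le1: "cw w \<le> 1" "dw w \<le> 1"
    using word_prod_le[of I c 1 w] word_prod_le[of I d 1 w] wI c(1) d(1) less_imp_le[OF c(2)] less_imp_le[OF d(2)] by auto
   have "(1/2) ^ (L * k) \<le> \<kappa>2 ^ k" using L unfolding power_mult by (intro power_mono) auto
   then have lo: "(1/2) ^ (L * k) \<le> cw w" "(1/2) ^ (L * k) \<le> dw w" using kc by linarith+
   obtain m where m: "(1/2) ^ Suc m < cw w" "cw w \<le> (1/2) ^ m"
    using dyadic_floor[OF wpos(1)[OF wI] le1(1)] by blast
   obtain n where n: "(1/2) ^ Suc n < dw w" "dw w \<le> (1/2) ^ n"
    using dyadic_floor[OF wpos(2)[OF wI] le1(2)] by blast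
   have "m \<le> L * k" "n \<le> L * k"
    using order_trans[OF lo(1) m(2)] order_trans[OF lo(2) n(2)] by (simp_all add: power_decreasing_iff)
   then show "w \<in> (\<Union>mn\<in>{..L * k} \<times> {..L * k}. W mn)"
    using w m n by (intro UN_I[of "(m, n)"]) (auto simp: W_def)
  qed
  have percell: "(\<Sum>w\<in>W mn. cw w powr D1 * dw w powr D2) \<le> A * y ^ k"
   if mn: "mn \<in> {..L * k} \<times> {..L * k}" for mn
  proof -
   define d1 d2 :: real where "d1 = (1/2) ^ (fst mn)" and "d2 = (1/2) ^ (snd mn)"
   have dd: "d1 \<in> {0<..1}" "d2 \<in> {0<..1}" by (simp_all add: d1_def d2_def power_le_one)
   have "(\<Sum>w\<in>W mn. cw w powr D1 * dw w powr D2) \<le>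
     (\<Sum>w\<in>W mn. (2 powr \<bar>D1\<bar> * d1 powr D1) * (2 powr \<bar>D2\<bar> * d2 powr D2))"
   proof (intro sum_mono mult_mono)
    fix w assume w: "w \<in> W mn"
    then have wI: "set w \<subseteq> I" by (auto simp: W_def words_def)
    show "cw w powr D1 \<le> 2 powr \<bar>D1\<bar> * d1 powr D1"
     using w wpos[OF wI] by (intro powr_ratio_bound(1)) (auto simp: W_def d1_def)
    show "dw w powr D2 \<le> 2 powr \<bar>D2\<bar> * d2 powr D2"
     using w wpos[OF wI] by (intro powr_ratio_bound(1)) (auto simp: W_def d2_def)
   qed auto
   also have "\<dots> = real (card (W mn)) * ((2 powr \<bar>D1\<bar> * d1 powr D1) * (2 powr \<bar>D2\<bar> * d2 powr D2))" by simp
   also have "real (card (W mn)) \<le> M * (moment \<nu>1 0 d1 * moment \<nu>2 0 d2)"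
    using card_dyadic_words[of k "fst mn" "snd mn"] by (simp add: W_def M_def d1_def d2_def)
   also have "moment \<nu>1 0 d1 * moment \<nu>2 0 d2 \<le> (C1 * d1 powr (-(D1 + \<epsilon>))) * (C2 * d2 powr (-(D2 + \<epsilon>)))"
    using C1 C2 dd moment_nonneg by (intro mult_mono) auto
   finally have "(\<Sum>w\<in>W mn. cw w powr D1 * dw w powr D2) \<le>
     M * ((C1 * d1 powr (-(D1 + \<epsilon>))) * (C2 * d2 powr (-(D2 + \<epsilon>)))) * ((2 powr \<bar>D1\<bar> * d1 powr D1) * (2 powr \<bar>D2\<bar> * d2 powr D2))"
    using M by (simp add: mult_left_mono mult_right_mono)
   also have "\<dots> = A * ((d1 powr (-(D1 + \<epsilon>)) * d1 powr D1) * (d2 powr (-(D2 + \<epsilon>)) * d2 powr D2))"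
    by (simp add: A_def)
   also have "d1 powr (-(D1 + \<epsilon>)) * d1 powr D1 = d1 powr (-\<epsilon>)" by (simp add: powr_add[symmetric])
   also have "d2 powr (-(D2 + \<epsilon>)) * d2 powr D2 = d2 powr (-\<epsilon>)" by (simp add: powr_add[symmetric])
   also have "A * (d1 powr (-\<epsilon>) * d2 powr (-\<epsilon>)) \<le> A * y ^ k"
   proof (intro mult_left_mono)
    have dp: "((1/2) ^ n) powr (-\<epsilon>) = 2 powr (\<epsilon> * real n)" for n :: nat
     by (simp add: powr_def ln_realpow ln_div)
    have "d1 powr (-\<epsilon>) * d2 powr (-\<epsilon>) = 2 powr (\<epsilon> * real (fst mn) + \<epsilon> * real (snd mn))"
     unfolding d1_def d2_def dp by (simp add: powr_add)
    also have "\<dots> \<le> 2 powr (2 * \<epsilon> * real L * real k)"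
    proof -
     have "real (fst mn) \<le> real L * real k" "real (snd mn) \<le> real L * real k"
      using mn by (auto simp: mem_Times_iff simp flip: of_nat_mult)
     then have "\<epsilon> * real (fst mn) + \<epsilon> * real (snd mn) \<le> \<epsilon> * (real L * real k) + \<epsilon> * (real L * real k)"
      using e by (intro add_mono mult_left_mono) auto
     then show ?thesis by simp
    qed
    also have "\<dots> = y ^ k" by (simp add: y_def powr_powr powr_realpow[symmetric])
    finally show "d1 powr (-\<epsilon>) * d2 powr (-\<epsilon>) \<le> y ^ k" .
   qed (use A in simp)
   finally show ?thesis .
  qed
  have "s ^ k = (\<Sum>w\<in>words I k. word_prod (\<lambda>i. c i powr D1 * d i powr D2) w)"
   unfolding s_def by (rule sum_word_prod[symmetric])
  also have "\<dots> = (\<Sum>w\<in>words I k. cw w powr D1 * dw w powr D2)"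
   using c d by (intro sum.cong refl) (auto simp: word_prod_mult words_def word_prod_powr[of I])
  also have "\<dots> \<le> (\<Sum>w\<in>(\<Union>mn\<in>{..L * k} \<times> {..L * k}. W mn). cw w powr D1 * dw w powr D2)"
   using finW cover by (intro sum_mono2) auto
  also have "\<dots> \<le> (\<Sum>mn\<in>{..L * k} \<times> {..L * k}. \<Sum>w\<in>W mn. cw w powr D1 * dw w powr D2)"
  proof -
   have "sum g (\<Union>i\<in>A. B i) \<le> (\<Sum>i\<in>A. sum g (B i))"
    if "finite A" "\<And>i. finite (B i)" "\<And>x. 0 \<le> g x" for A :: "(nat \<times> nat) set" and B :: "nat \<times> nat \<Rightarrow> 'i list set" and g :: "'i list \<Rightarrow> real"
    using that(1)
   proof (induction A rule: finite_induct)
    case (insert i A)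
    have "sum g (B i \<union> (\<Union>i\<in>A. B i)) \<le> sum g (B i) + sum g (\<Union>i\<in>A. B i)"
     using that insert.hyps by (subst sum_Un) (auto intro!: sum_nonneg)
    then show ?case using insert by simp
   qed simp
   then show ?thesis using finW by simp
  qed
  also have "\<dots> \<le> (\<Sum>mn\<in>{..L * k} \<times> {..L * k}. A * y ^ k)" by (intro sum_mono percell)
  also have "\<dots> = (real (L * k) + 1)\<^sup>2 * (A * y ^ k)" by (simp add: card_cartesian_product power2_eq_square algebra_simps)
  finally show ?thesis .
 qed
 define r where "r = s / y"
 have r: "1 < r" using y by (simp add: r_def)
 have "(\<lambda>k. (real k + 1)\<^sup>2 / r ^ k) \<longlonglongrightarrow> 0" using r by real_asymp
 from tendsto_mult_left[OF this, of "(real L + 1)\<^sup>2 * A"]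
 have "(\<lambda>k. (real L + 1)\<^sup>2 * A * ((real k + 1)\<^sup>2 / r ^ k)) \<longlonglongrightarrow> 0" by simp
 then have "eventually (\<lambda>k. (real L + 1)\<^sup>2 * A * ((real k + 1)\<^sup>2 / r ^ k) < 1) sequentially"
  by (rule order_tendstoD) simp
 then obtain k where k: "(real L + 1)\<^sup>2 * A * ((real k + 1)\<^sup>2 / r ^ k) < 1" by (auto simp: eventually_sequentially)
 have "real L * real k + 1 \<le> (real L + 1) * (real k + 1)" by (simp add: algebra_simps)
 then have "(real L * real k + 1)\<^sup>2 \<le> ((real L + 1) * (real k + 1))\<^sup>2" by (intro power_mono) auto
 then have "(real L * real k + 1)\<^sup>2 * A \<le> ((real L + 1) * (real k + 1))\<^sup>2 * A" using A by (intro mult_right_mono) auto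
 also have "\<dots> = (real L + 1)\<^sup>2 * A * (real k + 1)\<^sup>2" by (simp add: power_mult_distrib)
 also have "\<dots> < r ^ k" using k r by (simp add: divide_less_eq)
 finally have "(real L * real k + 1)\<^sup>2 * A < r ^ k" .
 then have "(real L * real k + 1)\<^sup>2 * A * y ^ k < r ^ k * y ^ k" using y by (intro mult_strict_right_mono) auto
 also have "r ^ k * y ^ k = s ^ k" using y by (simp add: r_def power_divide)
 finally show False using bound[of k] by (simp add: mult.assoc)
qed

end

subsection \<open>Separated sets, packing and Hausdorff dimension\<close>

definition separated :: "real \<Rightarrow> 'a::metric_space set \<Rightarrow> bool" where
 "separated \<delta> X \<longleftrightarrow> (\<forall>x\<in>X. \<forall>y\<in>X. x \<noteq> y \<longrightarrow> \<delta> < dist x y)"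

lemma separatedI: "(\<And>x y. x \<in> X \<Longrightarrow> y \<in> X \<Longrightarrow> x \<noteq> y \<Longrightarrow> \<delta> < dist x y) \<Longrightarrow> separated \<delta> X"
 by (simp add: separated_def)

text \<open>An upper box dimension bound with a constant. Separated sets are used in place of covers
  because they pass easily to closures and expanding images, and because they are themselves
  packings by balls of equal radius.\<close>

definition sep_bound :: "'a::metric_space set \<Rightarrow> real \<Rightarrow> bool" where
 "sep_bound A t \<longleftrightarrow> (\<exists>C>0. \<exists>\<delta>0>0. \<forall>\<delta> X. 0 < \<delta> \<longrightarrow> \<delta> \<le> \<delta>0 \<longrightarrow> finite X \<longrightarrow> X \<subseteq> A \<longrightarrow>
   separated \<delta> X \<longrightarrow> real (card X) \<le> C * \<delta> powr (-t))"

lemma sep_boundI: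
 assumes "0 < C" "0 < \<delta>0" "\<And>\<delta> X. 0 < \<delta> \<Longrightarrow> \<delta> \<le> \<delta>0 \<Longrightarrow> finite X \<Longrightarrow> X \<subseteq> A \<Longrightarrow>
  (\<And>x y. x \<in> X \<Longrightarrow> y \<in> X \<Longrightarrow> x \<noteq> y \<Longrightarrow> \<delta> < dist x y) \<Longrightarrow> real (card X) \<le> C * \<delta> powr (-t)"
 shows "sep_bound A t"
 unfolding sep_bound_def separated_def using assms by (intro exI[of _ C] exI[of _ \<delta>0] conjI allI impI) auto

lemma sep_bound_subset:
 assumes "sep_bound B t" "A \<subseteq> B"
 shows "sep_bound A t"
 using assms unfolding sep_bound_def by (meson subset_trans)

text \<open>In a finite set the strict inequalities \<open>\<delta> < dist x y\<close> leave a
  common slack, so its points can be moved into \<open>A\<close> without losing separation. This is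
  why separation is defined by a strict inequality.\<close>

lemma sep_bound_closure:
 assumes "sep_bound A t"
 shows "sep_bound (closure A) t"
proof -
 obtain C \<delta>0 where C: "0 < C" "0 < \<delta>0" "\<And>\<delta> X. 0 < \<delta> \<Longrightarrow> \<delta> \<le> \<delta>0 \<Longrightarrow> finite X \<Longrightarrow> X \<subseteq> A \<Longrightarrow>
  separated \<delta> X \<Longrightarrow> real (card X) \<le> C * \<delta> powr (-t)"
  using assms unfolding sep_bound_def by metis
 show ?thesis
 proof (rule sep_boundI[OF C(1,2)])
  fix \<delta> X assume d: "0 < \<delta>" "\<delta> \<le> \<delta>0" and X: "finite X" "X \<subseteq> closure A"
   and sep: "\<And>x y. x \<in> X \<Longrightarrow> y \<in> X \<Longrightarrow> x \<noteq> y \<Longrightarrow> \<delta> < dist x y"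
  define P where "P = {(x, y) \<in> X \<times> X. x \<noteq> y}"
  define e where "e = Min (insert 1 ((\<lambda>(x, y). dist x y - \<delta>) ` P)) / 2"
  have finP: "finite P" unfolding P_def using X(1) by (auto intro: finite_subset[of _ "X \<times> X"])
  have "Min (insert 1 ((\<lambda>(x, y). dist x y - \<delta>) ` P)) \<in> insert 1 ((\<lambda>(x, y). dist x y - \<delta>) ` P)"
   using finP by (intro Min_in) auto
  then have e: "0 < e" using sep by (auto simp: e_def P_def)
  have e2: "2 * e \<le> dist x y - \<delta>" if "x \<in> X" "y \<in> X" "x \<noteq> y" for x y
  proof -
   have "Min (insert 1 ((\<lambda>(x, y). dist x y - \<delta>) ` P)) \<le> dist x y - \<delta>"
    using finP that by (intro Min_le) (auto simp: P_def intro!: image_eqI[of _ _ "(x, y)"])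
   then show ?thesis by (simp add: e_def)
  qed
  have "\<forall>x\<in>X. \<exists>a\<in>A. dist a x < e" using X(2) e by (meson closure_approachable subsetD)
  then obtain \<sigma> where \<sigma>: "\<And>x. x \<in> X \<Longrightarrow> \<sigma> x \<in> A" "\<And>x. x \<in> X \<Longrightarrow> dist (\<sigma> x) x < e" by metis
  have far: "\<delta> < dist (\<sigma> x) (\<sigma> y)" if xy: "x \<in> X" "y \<in> X" "x \<noteq> y" for x y
  proof -
   have "dist x y \<le> dist (\<sigma> x) x + (dist (\<sigma> x) (\<sigma> y) + dist (\<sigma> y) y)"
    by (metis dist_commute dist_triangle_le add_left_mono dist_triangle order_trans)
   then show ?thesis using e2[OF xy] \<sigma>(2)[OF xy(1)] \<sigma>(2)[OF xy(2)] by linarith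
  qed
  have inj: "inj_on \<sigma> X"
  proof (rule inj_onI, rule ccontr)
   fix x y assume "x \<in> X" "y \<in> X" "\<sigma> x = \<sigma> y" "x \<noteq> y"
   then show False using far[of x y] d by simp
  qed
  have "real (card (\<sigma> ` X)) \<le> C * \<delta> powr (-t)"
  proof (rule C(3)[OF d _ _ separatedI])
   fix u v assume "u \<in> \<sigma> ` X" "v \<in> \<sigma> ` X" "u \<noteq> v"
   then show "\<delta> < dist u v" using far by auto
  qed (use X \<sigma> in auto)
  then show "real (card X) \<le> C * \<delta> powr (-t)" by (simp add: card_image[OF inj])
 qed
qed

text \<open>Used with a word map from the support into an open piece of itself: a bound for the
  piece then holds for the whole support.\<close>

lemma sep_bound_expand:
 assumes B: "sep_bound B t" and f: "f ` A \<subseteq> B" "0 < c" "\<And>x y. x \<in> A \<Longrightarrow> y \<in> A \<Longrightarrow> c * dist x y \<le> dist (f x) (f y)"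
 shows "sep_bound A t"
proof -
 obtain C \<delta>0 where C: "0 < C" "0 < \<delta>0" "\<And>\<delta> X. 0 < \<delta> \<Longrightarrow> \<delta> \<le> \<delta>0 \<Longrightarrow> finite X \<Longrightarrow> X \<subseteq> B \<Longrightarrow>
  separated \<delta> X \<Longrightarrow> real (card X) \<le> C * \<delta> powr (-t)"
  using B unfolding sep_bound_def by metis
 show ?thesis
 proof (rule sep_boundI[of "C * c powr (-t)" "\<delta>0 / c"])
  show "0 < C * c powr (-t)" "0 < \<delta>0 / c" using C f by auto
  fix \<delta> X assume d: "0 < \<delta>" "\<delta> \<le> \<delta>0 / c" and X: "finite X" "X \<subseteq> A"
   and sep: "\<And>x y. x \<in> X \<Longrightarrow> y \<in> X \<Longrightarrow> x \<noteq> y \<Longrightarrow> \<delta> < dist x y"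
  have far: "c * \<delta> < dist (f x) (f y)" if "x \<in> X" "y \<in> X" "x \<noteq> y" for x y
  proof -
   have "c * \<delta> < c * dist x y" using sep[OF that] f(2) by simp
   also have "\<dots> \<le> dist (f x) (f y)" using X that by (intro f(3)) auto
   finally show ?thesis .
  qed
  have cd: "0 < c * \<delta>" using d f by simp
  have inj: "inj_on f X"
  proof (rule inj_onI, rule ccontr)
   fix x y assume "x \<in> X" "y \<in> X" "f x = f y" "x \<noteq> y"
   then show False using far[of x y] cd by simp
  qed
  have "real (card (f ` X)) \<le> C * (c * \<delta>) powr (-t)"
  proof (rule C(3)[OF cd _ _ _ separatedI])
   show "c * \<delta> \<le> \<delta>0" using d f by (simp add: field_simps)
   fix u v assume "u \<in> f ` X" "v \<in> f ` X" "u \<noteq> v"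
   then show "c * \<delta> < dist u v" using far by auto
  qed (use X f in auto)
  then show "real (card X) \<le> C * c powr (-t) * \<delta> powr (-t)"
   using f d by (simp add: card_image[OF inj] powr_mult)
 qed
qed

lemma maximal_separated:
 assumes M: "\<And>X. finite X \<Longrightarrow> X \<subseteq> A \<Longrightarrow> separated \<eta> X \<Longrightarrow> real (card X) \<le> M" and \<eta>: "0 < \<eta>"
 shows "\<exists>X. finite X \<and> X \<subseteq> A \<and> separated \<eta> X \<and> A \<subseteq> (\<Union>x\<in>X. cball x \<eta>)"
proof -
 define P where "P n \<longleftrightarrow> (\<exists>X. finite X \<and> X \<subseteq> A \<and> separated \<eta> X \<and> card X = n)" for n
 have P0: "P 0" by (auto simp: P_def separated_def intro!: exI[of _ "{}"])
 have Pb: "n \<le> nat \<lceil>M\<rceil>" if Pn: "P n" for n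
 proof -
  obtain X where X: "finite X" "X \<subseteq> A" "separated \<eta> X" "card X = n" using Pn unfolding P_def by blast
  then show ?thesis using M[OF X(1-3)] by linarith
 qed
 define N where "N = (GREATEST n. P n)"
 have "P N" unfolding N_def using P0 Pb by (rule GreatestI_nat)
 then obtain X where X: "finite X" "X \<subseteq> A" "separated \<eta> X" "card X = N" unfolding P_def by blast
 have "A \<subseteq> (\<Union>x\<in>X. cball x \<eta>)"
 proof
  fix y assume y: "y \<in> A"
  show "y \<in> (\<Union>x\<in>X. cball x \<eta>)"
  proof (rule ccontr)
   assume "\<not> ?thesis"
   then have far: "\<forall>x\<in>X. \<eta> < dist x y" by (auto simp: not_le)
   then have "y \<notin> X" using \<eta> by fastforce
   then have "P (Suc N)" unfolding P_def using X y far
    by (intro exI[of _ "insert y X"]) (auto simp: dist_commute separated_def)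
   then have "Suc N \<le> N" unfolding N_def using Pb by (rule Greatest_le_nat)
   then show False by simp
  qed
 qed
 then show ?thesis using X by blast
qed

text \<open>A maximal \<eta>-separated set yields a cover by balls of diameter
  \<open>2 * \<eta>\<close> whose s-sum is at most a constant times
  \<open>\<eta> powr (s - t)\<close>, which tends to 0.\<close>

lemma sep_bound_hausdorff:
 fixes A :: "'a::euclidean_space set"
 assumes A: "sep_bound A t" and s: "t < s" "0 < s" and \<delta>: "0 < \<delta>"
 shows "hausdorff_premeasure s \<delta> A = 0"
proof -
 obtain C \<delta>0 where C: "0 < C" "0 < \<delta>0" "\<And>\<delta> X. 0 < \<delta> \<Longrightarrow> \<delta> \<le> \<delta>0 \<Longrightarrow> finite X \<Longrightarrow> X \<subseteq> A \<Longrightarrow>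
  separated \<delta> X \<Longrightarrow> real (card X) \<le> C * \<delta> powr (-t)"
  using A unfolding sep_bound_def by metis
 have "hausdorff_premeasure s \<delta> A \<le> 0 + ennreal \<epsilon>" if \<epsilon>: "0 < \<epsilon>" for \<epsilon>
 proof -
  have "((\<lambda>\<eta>. C * 2 powr s * \<eta> powr (s - t)) \<longlongrightarrow> C * 2 powr s * 0) (at_right 0)"
   using s by (intro tendsto_intros tendsto_zero_powrI[where b = "s - t"]) (auto intro!: eventually_mono[OF eventually_at_right_less[of 0]])
  then have "eventually (\<lambda>\<eta>. C * 2 powr s * \<eta> powr (s - t) < \<epsilon>) (at_right 0)"
   using \<epsilon> by (auto dest: order_tendstoD)
  moreover have "eventually (\<lambda>\<eta>::real. 0 < \<eta> \<and> \<eta> < min \<delta>0 (\<delta> / 2)) (at_right 0)"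
   using C \<delta> by (auto simp: eventually_at_right[of 0 1] intro!: exI[of _ "min \<delta>0 (\<delta> / 2)"])
  ultimately have "eventually (\<lambda>\<eta>. C * 2 powr s * \<eta> powr (s - t) < \<epsilon> \<and> 0 < \<eta> \<and> \<eta> < min \<delta>0 (\<delta> / 2)) (at_right 0)"
   by eventually_elim auto
  then obtain \<eta> where \<eta>: "C * 2 powr s * \<eta> powr (s - t) < \<epsilon>" "0 < \<eta>" "\<eta> < \<delta>0" "2 * \<eta> < \<delta>"
   by (auto dest!: eventually_happens)
  have bound: "real (card X) \<le> C * \<eta> powr (-t)" if "finite X" "X \<subseteq> A" "separated \<eta> X" for X
   using C(3)[of \<eta> X] that \<eta> by auto
  obtain X where X: "finite X" "X \<subseteq> A" "separated \<eta> X" and cover: "A \<subseteq> (\<Union>x\<in>X. cball x \<eta>)"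
   using maximal_separated[OF _ \<eta>(2), of A "C * \<eta> powr (-t)"] bound by metis
  define N where "N = card X"
  obtain xs where xs: "set xs = X" "distinct xs" using X(1) finite_distinct_list by blast
  have len: "length xs = N" using xs distinct_card by (fastforce simp: N_def)
  define U where "U n = (if n < N then cball (xs ! n) \<eta> else {})" for n
  have U: "U \<in> {U. A \<subseteq> (\<Union>n. U n) \<and> (\<forall>n. bounded (U n) \<and> diameter (U n) \<le> \<delta>)}"
  proof (intro CollectI conjI allI)
   show "A \<subseteq> (\<Union>n. U n)"
   proof
    fix y assume "y \<in> A"
    then obtain x where "x \<in> X" "y \<in> cball x \<eta>" using cover by blast
    then obtain n where "n < N" "xs ! n = x" using xs(1) len by (metis in_set_conv_nth)
    then show "y \<in> (\<Union>n. U n)" using \<open>y \<in> cball x \<eta>\<close> by (intro UN_I[of n]) (auto simp: U_def)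
   qed
   fix n show "bounded (U n)" by (simp add: U_def)
   show "diameter (U n) \<le> \<delta>" using \<eta> \<delta> by (simp add: U_def)
  qed
  have "hausdorff_premeasure s \<delta> A \<le> (\<Sum>n. ennreal (diam_pow s (U n)))"
   unfolding hausdorff_premeasure_def by (rule INF_lower[OF U])
  also have "\<dots> = (\<Sum>n<N. ennreal (diam_pow s (U n)))"
   by (rule suminf_finite) (auto simp: U_def diam_pow_def)
  also have "\<dots> = (\<Sum>n<N. ennreal ((2 * \<eta>) powr s))"
   using \<eta> s by (intro sum.cong refl) (auto simp: U_def diam_pow_def)
  also have "\<dots> = ennreal (real N * (2 * \<eta>) powr s)" by (simp add: ennreal_mult ennreal_of_nat_eq_real_of_nat)
  also have "\<dots> \<le> ennreal \<epsilon>"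
  proof (rule ennreal_leI)
   have "real N \<le> C * \<eta> powr (-t)" using bound[OF X] by (simp add: N_def)
   then have "real N * (2 * \<eta>) powr s \<le> C * \<eta> powr (-t) * (2 * \<eta>) powr s" by (intro mult_right_mono) auto
   also have "\<dots> = C * 2 powr s * (\<eta> powr (-t) * \<eta> powr s)" using \<eta> by (simp add: powr_mult)
   also have "\<eta> powr (-t) * \<eta> powr s = \<eta> powr (s - t)" by (simp add: powr_add[symmetric])
   finally show "real N * (2 * \<eta>) powr s \<le> \<epsilon>" using \<eta>(1) by linarith
  qed
  finally show ?thesis by simp
 qed
 then have "hausdorff_premeasure s \<delta> A \<le> 0" by (rule ennreal_le_epsilon)
 then show ?thesis by simp
qed

lemma hausdorff_measure_UN:
 fixes E :: "'a::metric_space set"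
 assumes E: "E \<subseteq> (\<Union>n::nat. A n)" and z: "\<And>n \<delta>. 0 < \<delta> \<Longrightarrow> hausdorff_premeasure s \<delta> (A n) = 0"
 shows "hausdorff_measure s E = 0"
proof -
 have "hausdorff_premeasure s \<delta> E \<le> 0" if \<delta>: "0 < \<delta>" for \<delta>
 proof (rule ennreal_le_epsilon)
  fix \<epsilon> :: real assume \<epsilon>: "0 < \<epsilon>"
  have "\<exists>U. A n \<subseteq> (\<Union>k. U k) \<and> (\<forall>k. bounded (U k) \<and> diameter (U k) \<le> \<delta>) \<and>
    (\<Sum>k. ennreal (diam_pow s (U k))) \<le> ennreal (\<epsilon> * (1/2) ^ Suc n)" for n
  proof -
   have "hausdorff_premeasure s \<delta> (A n) < ennreal (\<epsilon> * (1/2) ^ Suc n)" using z[OF \<delta>] \<epsilon> by simp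
   then show ?thesis unfolding hausdorff_premeasure_def INF_less_iff by (auto intro: less_imp_le)
  qed
  then obtain U where U: "\<And>n. A n \<subseteq> (\<Union>k. U n k)" "\<And>n k. bounded (U n k) \<and> diameter (U n k) \<le> \<delta>"
   "\<And>n. (\<Sum>k. ennreal (diam_pow s (U n k))) \<le> ennreal (\<epsilon> * (1/2) ^ Suc n)" by metis
  define V where "V i = case_prod U (prod_decode i)" for i
  have V: "V \<in> {U. E \<subseteq> (\<Union>n. U n) \<and> (\<forall>n. bounded (U n) \<and> diameter (U n) \<le> \<delta>)}"
  proof (intro CollectI conjI allI)
   show "E \<subseteq> (\<Union>i. V i)"
   proof
    fix x assume "x \<in> E"
    then obtain n k where "x \<in> U n k" using E U(1) by blast
    then have "x \<in> V (prod_encode (n, k))" by (simp add: V_def)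
    then show "x \<in> (\<Union>i. V i)" by blast
   qed
  qed (use U(2) in \<open>auto simp: V_def split: prod.split\<close>)
  have "hausdorff_premeasure s \<delta> E \<le> (\<Sum>i. ennreal (diam_pow s (V i)))"
   unfolding hausdorff_premeasure_def by (rule INF_lower[OF V])
  also have "\<dots> = (\<Sum>i. (\<lambda>(n, k). ennreal (diam_pow s (U n k))) (prod_decode i))"
   by (simp add: V_def case_prod_unfold)
  also have "\<dots> = (\<Sum>n. \<Sum>k. ennreal (diam_pow s (U n k)))" by (rule suminf_ennreal_2dimen) simp
  also have "\<dots> \<le> (\<Sum>n. ennreal (\<epsilon> * (1/2) ^ Suc n))" by (intro suminf_le U(3)) auto
  also have "\<dots> = ennreal \<epsilon>"
  proof (rule suminf_ennreal_eq)
   show "(\<lambda>n. \<epsilon> * (1/2) ^ Suc n) sums \<epsilon>" using sums_mult[OF power_half_series, of \<epsilon>] by simp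
  qed (use \<epsilon> in simp)
  finally show "hausdorff_premeasure s \<delta> E \<le> 0 + ennreal \<epsilon>" by simp
 qed
 then show ?thesis unfolding hausdorff_measure_def by (auto intro!: antisym SUP_least)
qed

lemma sep_bound_hausdorff_dim:
 fixes E :: "'a::euclidean_space set"
 assumes "E \<subseteq> (\<Union>n::nat. A n)" "\<And>n. sep_bound (A n) t" "0 \<le> t"
 shows "hausdorff_dim E \<le> ereal t"
proof (rule ereal_le_epsilon2)
 fix e :: real assume e: "0 < e"
 have "hausdorff_measure (t + e) E = 0"
  using assms(3) e by (intro hausdorff_measure_UN[OF assms(1)] sep_bound_hausdorff[OF assms(2)]) auto
 then show "hausdorff_dim E \<le> ereal t + ereal e"
  unfolding hausdorff_dim_def using assms e by (intro Inf_lower) auto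
qed

text \<open>Otherwise the point dividing the segment from \<open>x\<close> to \<open>y\<close> in
  the ratio \<open>r : r'\<close> lies in both balls.\<close>

lemma cball_disjoint_dist:
 fixes x y :: "'a::real_normed_vector"
 assumes "cball x r \<inter> cball y r' = {}" "0 < r" "0 < r'"
 shows "r + r' < dist x y"
proof (rule ccontr)
 assume "\<not> ?thesis"
 then have le: "norm (y - x) \<le> r + r'" by (simp add: dist_norm norm_minus_commute)
 define z where "z = x + (r / (r + r')) *\<^sub>R (y - x)"
 have "dist x z = (r / (r + r')) * norm (y - x)" using assms by (simp add: z_def dist_norm)
 also have "\<dots> \<le> (r / (r + r')) * (r + r')" using assms le by (intro mult_left_mono) auto
 finally have 1: "z \<in> cball x r" using assms by simp
 have "y - z = (1 - r / (r + r')) *\<^sub>R (y - x)" by (simp add: z_def algebra_simps)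
 also have "1 - r / (r + r') = r' / (r + r')" using assms by (simp add: field_simps)
 finally have "dist y z = (r' / (r + r')) * norm (y - x)" using assms by (simp add: dist_norm)
 also have "\<dots> \<le> (r' / (r + r')) * (r + r')" using assms le by (intro mult_left_mono) auto
 finally have "z \<in> cball y r'" using assms by simp
 then show False using 1 assms by auto
qed

text \<open>The balls of a packing are sorted by dyadic size of the radius. Centres on level
  \<open>k\<close> are \<open>(1/2) ^ k\<close>-separated, since the sum of two radii exceeds this
  number, so the level contributes at most \<open>C * 2 powr s * \<theta> ^ k\<close>; the geometric
  tail from \<open>k0\<close> on is small.\<close>

lemma sep_bound_packing:
 fixes A :: "'a::euclidean_space set"
 assumes A: "sep_bound A t" and s: "t < s" "0 \<le> s"
 shows "packing_premeasure s A = 0"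
proof -
 obtain C \<delta>0 where C: "0 < C" "0 < \<delta>0" "\<And>\<delta> X. 0 < \<delta> \<Longrightarrow> \<delta> \<le> \<delta>0 \<Longrightarrow> finite X \<Longrightarrow> X \<subseteq> A \<Longrightarrow>
  separated \<delta> X \<Longrightarrow> real (card X) \<le> C * \<delta> powr (-t)"
  using A unfolding sep_bound_def by metis
 define \<theta> where "\<theta> = (1/2) powr (s - t)"
 have \<theta>: "0 < \<theta>" "\<theta> < 1" using s powr01_less_one[of "1/2" "s - t"] by (auto simp: \<theta>_def)
 define D where "D = C * 2 powr s / (1 - \<theta>)"
 have D: "0 < D" using C \<theta> by (simp add: D_def)
 have "packing_premeasure s A \<le> 0 + ennreal \<epsilon>" if \<epsilon>: "0 < \<epsilon>" for \<epsilon>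
 proof -
  obtain k1 where k1: "\<theta> ^ k1 < \<epsilon> / D" using real_arch_pow_inv[of "\<epsilon> / D" \<theta>] \<theta> \<epsilon> D by auto
  obtain k2 where k2: "(1/2) ^ k2 < \<delta>0" using real_arch_pow_inv[of \<delta>0 "1/2"] C by auto
  define k0 where "k0 = max k1 k2"
  have k0: "(1/2) ^ k0 \<le> \<delta>0" "D * \<theta> ^ k0 \<le> \<epsilon>"
  proof -
   have "(1/2::real) ^ k0 \<le> (1/2) ^ k2" by (intro power_decreasing) (auto simp: k0_def)
   then show "(1/2) ^ k0 \<le> \<delta>0" using k2 by linarith
   have "\<theta> ^ k0 \<le> \<theta> ^ k1" using \<theta> by (intro power_decreasing) (auto simp: k0_def)
   then have "\<theta> ^ k0 \<le> \<epsilon> / D" using k1 by linarith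
   then show "D * \<theta> ^ k0 \<le> \<epsilon>" using D by (simp add: field_simps)
  qed
  have "packing_premeasure_at s ((1/2) ^ k0) A \<le> ennreal \<epsilon>"
   unfolding packing_premeasure_at_def
  proof (rule SUP_least)
   fix B :: "('a \<times> real) set"
   assume "B \<in> {B. countable B \<and> B \<subseteq> A \<times> {0<..(1/2) ^ k0} \<and> disjoint_family_on (\<lambda>(x, r). cball x r) B}"
   then have B: "B \<subseteq> A \<times> {0<..(1/2) ^ k0}" "disjoint_family_on (\<lambda>(x, r). cball x r) B" by auto
   have "(\<Sum>\<^sub>\<infinity>(x, r)\<in>B. ennreal ((2 * r) powr s)) = (SUP F\<in>{F. finite F \<and> F \<subseteq> B}. \<Sum>(x, r)\<in>F. ennreal ((2 * r) powr s))"
    by (rule nonneg_infsum_complete) auto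
   also have "\<dots> \<le> ennreal \<epsilon>"
   proof (rule SUP_least)
    fix F assume "F \<in> {F. finite F \<and> F \<subseteq> B}"
    then have F: "finite F" "F \<subseteq> B" by auto
    have Fr: "fst z \<in> A" "0 < snd z" "snd z \<le> (1/2) ^ k0" if "z \<in> F" for z
     using F B that by (auto simp: mem_Times_iff dest!: subsetD)
    have "\<exists>n. (1/2) ^ Suc n < snd z \<and> snd z \<le> (1/2) ^ n" if z: "z \<in> F" for z
    proof -
     have "snd z \<le> 1" using Fr(3)[OF z] power_le_one[of "1/2::real" k0] by simp
     then show ?thesis using dyadic_floor[of "snd z"] Fr(2)[OF z] by metis
    qed
    then obtain \<kappa> where \<kappa>: "\<And>z. z \<in> F \<Longrightarrow> (1/2) ^ Suc (\<kappa> z) < snd z" "\<And>z. z \<in> F \<Longrightarrow> snd z \<le> (1/2) ^ \<kappa> z" by metis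
    have \<kappa>ge: "k0 \<le> \<kappa> z" if z: "z \<in> F" for z
    proof -
     have "(1/2::real) ^ Suc (\<kappa> z) < (1/2) ^ k0" using \<kappa>(1)[OF z] Fr(3)[OF z] by linarith
     then have "k0 < Suc (\<kappa> z)" by (subst (asm) power_strict_decreasing_iff) auto
     then show ?thesis by simp
    qed
    have level: "(\<Sum>z\<in>{z \<in> F. \<kappa> z = k}. (2 * snd z) powr s) \<le> C * 2 powr s * \<theta> ^ k" if k: "k \<in> \<kappa> ` F" for k
    proof -
     let ?G = "{z \<in> F. \<kappa> z = k}"
     define h :: real where "h = (1/2) ^ k"
     have h: "0 < h" "h \<le> \<delta>0"
     proof -
      have "k0 \<le> k" using k \<kappa>ge by auto
      then have "h \<le> (1/2) ^ k0" unfolding h_def by (intro power_decreasing) auto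
      then show "h \<le> \<delta>0" using k0 by linarith
     qed (simp add: h_def)
     have sep: "h < dist (fst z) (fst z')" if z: "z \<in> ?G" "z' \<in> ?G" "z \<noteq> z'" for z z'
     proof -
      have "cball (fst z) (snd z) \<inter> cball (fst z') (snd z') = {}"
       using disjoint_family_onD[OF B(2), of z z'] z F by (auto simp: case_prod_unfold)
      then have "snd z + snd z' < dist (fst z) (fst z')" using z Fr by (intro cball_disjoint_dist) auto
      moreover have "h / 2 < snd z" "h / 2 < snd z'" using \<kappa>(1)[of z] \<kappa>(1)[of z'] z by (auto simp: h_def)
      ultimately show ?thesis by linarith
     qed
     have inj: "inj_on fst ?G"
     proof (rule inj_onI, rule ccontr)
      fix z z' assume "z \<in> ?G" "z' \<in> ?G" "fst z = fst z'" "z \<noteq> z'"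
      then show False using sep[of z z'] h by simp
     qed
     have "real (card (fst ` ?G)) \<le> C * h powr (-t)"
     proof (rule C(3)[OF h _ _ separatedI])
      fix x y assume "x \<in> fst ` ?G" "y \<in> fst ` ?G" "x \<noteq> y"
      then show "h < dist x y" using sep by blast
     qed (use F Fr in auto)
     then have card: "real (card ?G) \<le> C * h powr (-t)" by (simp add: card_image[OF inj])
     have "(\<Sum>z\<in>?G. (2 * snd z) powr s) \<le> (\<Sum>z\<in>?G. (2 * h) powr s)"
      using \<kappa>(2) Fr s by (intro sum_mono powr_mono2) (auto simp: h_def less_imp_le)
     also have "\<dots> = real (card ?G) * (2 * h) powr s" by simp
     also have "\<dots> \<le> C * h powr (-t) * (2 * h) powr s" using card by (intro mult_right_mono) auto
     also have "\<dots> = C * 2 powr s * (h powr (-t) * h powr s)" using h by (simp add: powr_mult)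
     also have "h powr (-t) * h powr s = h powr (s - t)" by (simp add: powr_add[symmetric])
     also have "h powr (s - t) = \<theta> ^ k" by (simp add: h_def \<theta>_def powr_realpow[symmetric] powr_powr mult.commute)
     finally show ?thesis .
    qed
    have "(\<Sum>(x, r)\<in>F. (2 * r) powr s) = (\<Sum>z\<in>F. (2 * snd z) powr s)" by (simp add: case_prod_unfold)
    also have "\<dots> = (\<Sum>k\<in>\<kappa> ` F. \<Sum>z\<in>{z \<in> F. \<kappa> z = k}. (2 * snd z) powr s)" using F(1) by (rule sum.image_gen)
    also have "\<dots> \<le> (\<Sum>k\<in>\<kappa> ` F. C * 2 powr s * \<theta> ^ k)" by (intro sum_mono level)
    also have "\<dots> = C * 2 powr s * (\<Sum>k\<in>\<kappa> ` F. \<theta> ^ k)" by (simp add: sum_distrib_left)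
    also have "\<dots> \<le> C * 2 powr s * (\<theta> ^ k0 / (1 - \<theta>))"
    proof (intro mult_left_mono)
     define N where "N = Max (insert k0 (\<kappa> ` F))"
     have "\<kappa> ` F \<subseteq> {k0..N}" using \<kappa>ge F(1) by (auto simp: N_def)
     then have "(\<Sum>k\<in>\<kappa> ` F. \<theta> ^ k) \<le> (\<Sum>k\<in>{k0..N}. \<theta> ^ k)" using \<theta> by (intro sum_mono2) auto
     also have "\<dots> = (\<theta> ^ k0 - \<theta> ^ Suc N) / (1 - \<theta>)"
     proof -
      have "k0 \<le> N" unfolding N_def using F(1) by (intro Max_ge) auto
      then show ?thesis using \<theta> sum_gp[of \<theta> k0 N] by simp
     qed
     also have "\<dots> \<le> \<theta> ^ k0 / (1 - \<theta>)" using \<theta> by (intro divide_right_mono) auto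
     finally show "(\<Sum>k\<in>\<kappa> ` F. \<theta> ^ k) \<le> \<theta> ^ k0 / (1 - \<theta>)" .
    qed (use C in simp)
    also have "\<dots> \<le> \<epsilon>" using k0(2) by (simp add: D_def)
    finally have "ennreal (\<Sum>(x, r)\<in>F. (2 * r) powr s) \<le> ennreal \<epsilon>" by (rule ennreal_leI)
    then show "(\<Sum>(x, r)\<in>F. ennreal ((2 * r) powr s)) \<le> ennreal \<epsilon>"
     by (subst (asm) sum_ennreal[symmetric]) (auto simp: case_prod_unfold)
   qed
   finally show "(\<Sum>\<^sub>\<infinity>(x, r)\<in>B. ennreal ((2 * r) powr s)) \<le> ennreal \<epsilon>" .
  qed
  moreover have "packing_premeasure s A \<le> packing_premeasure_at s ((1/2) ^ k0) A"
   unfolding packing_premeasure_def by (intro INF_lower) auto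
  ultimately show ?thesis by simp
 qed
 then have "packing_premeasure s A \<le> 0" by (rule ennreal_le_epsilon)
 then show ?thesis by simp
qed

lemma packing_dim_le:
 fixes E :: "'a::euclidean_space set"
 assumes "E \<subseteq> (\<Union>n::nat. A n)" "\<And>n. sep_bound (A n) t" "0 \<le> t"
 shows "packing_dim E \<le> ereal t"
proof (rule ereal_le_epsilon2)
 fix e :: real assume e: "0 < e"
 have "packing_measure (t + e) E \<le> (\<Sum>n. packing_premeasure (t + e) (A n))"
  unfolding packing_measure_def using assms(1) by (intro INF_lower) auto
 also have "\<dots> = 0"
 proof -
  have "packing_premeasure (t + e) (A n) = 0" for n
   using assms(3) e by (intro sep_bound_packing[OF assms(2)]) auto
  then show ?thesis by simp
 qed
 finally have "packing_measure (t + e) E = 0" by simp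
 then show "packing_dim E \<le> ereal t + ereal e"
  unfolding packing_dim_def using assms e by (intro Inf_lower) auto
qed

text \<open>An \<eta>-separated set is the set of centres of a packing with radius
  \<open>\<eta> / 2\<close>, so a finite premeasure bounds its cardinality.\<close>

lemma packing_premeasure_sep_bound:
 fixes A :: "'a::euclidean_space set"
 assumes "packing_premeasure s A < \<infinity>"
 shows "sep_bound A s"
proof -
 obtain \<delta> where \<delta>: "0 < \<delta>" "packing_premeasure_at s \<delta> A < \<infinity>"
  using assms unfolding packing_premeasure_def INF_less_iff by auto
 then obtain M where M: "0 \<le> M" "packing_premeasure_at s \<delta> A = ennreal M"
  by (cases "packing_premeasure_at s \<delta> A") auto
 show ?thesis
 proof (rule sep_boundI[of "M + 1" \<delta>])
  fix \<eta> X assume \<eta>: "0 < \<eta>" "\<eta> \<le> \<delta>" and X: "finite X" "X \<subseteq> A"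
   and sep: "\<And>x y. x \<in> X \<Longrightarrow> y \<in> X \<Longrightarrow> x \<noteq> y \<Longrightarrow> \<eta> < dist x y"
  define B where "B = (\<lambda>x. (x, \<eta> / 2)) ` X"
  have dis: "cball x (\<eta> / 2) \<inter> cball y (\<eta> / 2) = {}" if "x \<in> X" "y \<in> X" "x \<noteq> y" for x y
  proof (rule ccontr)
   assume "\<not> ?thesis"
   then obtain z where "dist x z \<le> \<eta> / 2" "dist y z \<le> \<eta> / 2" by auto
   then have "dist x y \<le> \<eta>" using dist_triangle2[of x y z] by linarith
   then show False using sep[OF that] by simp
  qed
  have "B \<in> {B. countable B \<and> B \<subseteq> A \<times> {0<..\<delta>} \<and> disjoint_family_on (\<lambda>(x, r). cball x r) B}"
   using X \<eta> dis by (auto simp: B_def disjoint_family_on_def countable_finite)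
  then have "(\<Sum>\<^sub>\<infinity>(x, r)\<in>B. ennreal ((2 * r) powr s)) \<le> packing_premeasure_at s \<delta> A"
   unfolding packing_premeasure_at_def by (rule SUP_upper)
  moreover have "(\<Sum>\<^sub>\<infinity>(x, r)\<in>B. ennreal ((2 * r) powr s)) = (\<Sum>(x, r)\<in>B. ennreal ((2 * r) powr s))"
   using X by (intro infsum_finite) (simp add: B_def)
  moreover have "\<dots> = (\<Sum>x\<in>X. ennreal (\<eta> powr s))"
   unfolding B_def by (subst sum.reindex) (auto simp: inj_on_def)
  moreover have "\<dots> = ennreal (real (card X) * \<eta> powr s)" by (simp add: ennreal_mult ennreal_of_nat_eq_real_of_nat)
  ultimately have "real (card X) * \<eta> powr s \<le> M" using M by (simp add: ennreal_le_iff)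
  then have "real (card X) \<le> M * \<eta> powr (-s)" using \<eta> by (simp add: powr_minus field_simps)
  also have "\<dots> \<le> (M + 1) * \<eta> powr (-s)" by (intro mult_right_mono) auto
  finally show "real (card X) \<le> (M + 1) * \<eta> powr (-s)" .
 qed (use M \<delta> in auto)
qed

lemma packing_measure_zero_cover:
 fixes E :: "'a::euclidean_space set"
 assumes "packing_measure s E = 0"
 obtains A :: "nat \<Rightarrow> 'a set" where "E \<subseteq> (\<Union>n. A n)" "\<And>n. sep_bound (A n) s"
proof -
 have "packing_measure s E < 1" using assms by simp
 then obtain A where A: "E \<subseteq> (\<Union>n. A n)" "(\<Sum>n. packing_premeasure s (A n)) < 1"
  unfolding packing_measure_def INF_less_iff by auto
 have "packing_premeasure s (A n) < \<infinity>" for n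
 proof -
  have "packing_premeasure s (A n) \<le> (\<Sum>n. packing_premeasure s (A n))"
   using sum_le_suminf[of "\<lambda>n. packing_premeasure s (A n)" "{n}"] by simp
  also have "\<dots> < \<infinity>" using A(2) by (rule less_trans) simp
  finally show ?thesis .
 qed
 then show ?thesis using that[OF A(1)] packing_premeasure_sep_bound by blast
qed

lemma hausdorff_le_packing_dim:
 fixes E :: "'a::euclidean_space set"
 shows "hausdorff_dim E \<le> packing_dim E"
 unfolding packing_dim_def
proof (rule Inf_greatest)
 fix z assume "z \<in> {ereal s |s. 0 \<le> s \<and> packing_measure s E = 0}"
 then obtain s where s: "z = ereal s" "0 \<le> s" "packing_measure s E = 0" by blast
 obtain A :: "nat \<Rightarrow> 'a set" where "E \<subseteq> (\<Union>n. A n)" "\<And>n. sep_bound (A n) s"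
  using packing_measure_zero_cover[OF s(3)] by blast
 then show "hausdorff_dim E \<le> z" unfolding s(1) using s(2) by (rule sep_bound_hausdorff_dim)
qed

text \<open>If the packing measure vanishes, countably many sets with \<open>sep_bound\<close> cover
  the closed set, and so do their closures. By Baire one closure contains a non-empty relatively
  open piece, which then has the bound as well.\<close>

lemma packing_dim_ge_baire:
 fixes F :: "'a::euclidean_space set"
 assumes F: "closed F" "F \<noteq> {}"
  and U: "\<And>s U. s < v \<Longrightarrow> open U \<Longrightarrow> U \<inter> F \<noteq> {} \<Longrightarrow> \<not> sep_bound (U \<inter> F) s"
 shows "ereal v \<le> packing_dim F"
 unfolding packing_dim_def
proof (rule Inf_greatest)
 fix z assume "z \<in> {ereal s |s. 0 \<le> s \<and> packing_measure s F = 0}"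
 then obtain s where s: "z = ereal s" "packing_measure s F = 0" by blast
 obtain A :: "nat \<Rightarrow> 'a set" where A: "F \<subseteq> (\<Union>n. A n)" "\<And>n. sep_bound (A n) s"
  using packing_measure_zero_cover[OF s(2)] by blast
 have "v \<le> s"
 proof (rule ccontr)
  assume "\<not> v \<le> s"
  then have sv: "s < v" by simp
  define G where "G = range (\<lambda>n. F \<inter> closure (A n))"
  have cm: "completely_metrizable_space (top_of_set F)"
   using F(1) by (intro completely_metrizable_space_closedin completely_metrizable_space_euclidean) auto
  have "top_of_set F interior_of \<Union>G = {}"
  proof (rule Baire_category_alt)
   fix T assume "T \<in> G"
   then obtain n where T: "T = F \<inter> closure (A n)" by (auto simp: G_def)
   have "top_of_set F interior_of T = {}"
   proof (rule ccontr)
    assume ne: "\<not> ?thesis"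
    have "openin (top_of_set F) (top_of_set F interior_of T)" by (rule openin_interior_of)
    then obtain U where U': "open U" "top_of_set F interior_of T = F \<inter> U" unfolding openin_open by blast
    have "F \<inter> U \<subseteq> closure (A n)" using U'(2) interior_of_subset[of "top_of_set F" T] T by auto
    then have "sep_bound (U \<inter> F) s"
     using sep_bound_subset[OF sep_bound_closure[OF A(2)], of "U \<inter> F" n] by blast
    then show False using U[OF sv U'(1)] ne U'(2) by auto
   qed
   moreover have "closedin (top_of_set F) T" unfolding T by (intro closedin_closed_Int closed_closure)
   ultimately show "closedin (top_of_set F) T \<and> top_of_set F interior_of T = {}" by simp
  qed (use cm in \<open>auto simp: G_def\<close>)
  moreover have "\<Union>G = F"
  proof (intro equalityI subsetI)
   fix x assume x: "x \<in> F"
   then obtain n where "x \<in> A n" using A(1) by blast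
   then have "x \<in> F \<inter> closure (A n)" using x closure_subset by blast
   then show "x \<in> \<Union>G" unfolding G_def by blast
  qed (auto simp: G_def)
  moreover have "top_of_set F interior_of F = F"
   using interior_of_topspace[of "top_of_set F"] unfolding topspace_euclidean_subtopology .
  ultimately show False using F(2) by metis
 qed
 then show "ereal v \<le> z" by (simp add: s(1))
qed

section \<open>Box and packing dimension of the support\<close>

lemma growth_tendsto:
 assumes "has_growth g s"
 shows "((\<lambda>\<delta>. ln (g \<delta>) / (- ln \<delta>)) \<longlongrightarrow> s) (at_right 0)"
proof (rule growth_sandwich[OF assms])
 fix \<epsilon> :: real assume e: "0 < \<epsilon>"
 obtain C where C: "C > 0" "\<And>\<delta>. \<delta> \<in> {0<..1} \<Longrightarrow> C * \<delta> powr (- (s - 1)) \<le> g \<delta>"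
  using has_growthD(2)[OF assms, of "s - 1"] by auto
 have ev: "eventually (\<lambda>\<delta>::real. \<delta> \<in> {0<..1}) (at_right 0)"
  using eventually_ln_small[of 1 0] by (auto elim: eventually_mono)
 show "\<exists>C>0. eventually (\<lambda>\<delta>. g \<delta> \<le> C * \<delta> powr (-\<epsilon>) * g \<delta> \<and> g \<delta> \<le> C * \<delta> powr (-\<epsilon>) * g \<delta>) (at_right 0)"
 proof (intro exI[of _ 1] conjI eventually_mono[OF ev])
  fix \<delta> :: real assume d: "\<delta> \<in> {0<..1}"
  have "0 \<le> C * \<delta> powr (- (s - 1))" using C by simp
  also have "\<dots> \<le> g \<delta>" by (rule C(2)[OF d])
  finally have g: "0 \<le> g \<delta>" .
  have "1 \<le> \<delta> powr (-\<epsilon>)" using d e powr_mono'[of "-\<epsilon>" 0 \<delta>] by simp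
  then have "1 * g \<delta> \<le> 1 * \<delta> powr (-\<epsilon>) * g \<delta>" using g by (intro mult_right_mono) auto
  then show "g \<delta> \<le> 1 * \<delta> powr (-\<epsilon>) * g \<delta>" "g \<delta> \<le> 1 * \<delta> powr (-\<epsilon>) * g \<delta>" by simp_all
 qed simp
qed

lemma has_growth_sandwich:
 assumes f: "has_growth f s" and k: "0 < k" "k \<le> 1"
  and g: "\<And>\<delta>. \<delta> \<in> {0<..1} \<Longrightarrow> g \<delta> \<le> f (k * \<delta>)" "\<And>\<delta>. \<delta> \<in> {0<..1} \<Longrightarrow> f \<delta> \<le> M * g \<delta>" and M: "0 < M"
 shows "has_growth g s"
 unfolding has_growth_def
proof (intro conjI allI impI)
 fix t assume "s < t"
 then obtain C where C: "C > 0" "\<And>\<delta>. \<delta> \<in> {0<..1} \<Longrightarrow> f \<delta> \<le> C * \<delta> powr (-t)"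
  using has_growthD(1)[OF f] by blast
 show "\<exists>C>0. \<forall>\<delta>\<in>{0<..1}. g \<delta> \<le> C * \<delta> powr (-t)"
 proof (intro exI[of _ "C * k powr (-t)"] conjI ballI)
  fix \<delta> :: real assume d: "\<delta> \<in> {0<..1}"
  have "k * \<delta> \<in> {0<..1}" using d k by (auto simp: mult_le_one)
  then have "g \<delta> \<le> C * (k * \<delta>) powr (-t)" using g(1)[OF d] C(2)[of "k * \<delta>"] by linarith
  then show "g \<delta> \<le> C * k powr (-t) * \<delta> powr (-t)" using k d by (simp add: powr_mult)
 qed (use C k in simp)
next
 fix t assume "t < s"
 then obtain C where C: "C > 0" "\<And>\<delta>. \<delta> \<in> {0<..1} \<Longrightarrow> C * \<delta> powr (-t) \<le> f \<delta>"
  using has_growthD(2)[OF f] by blast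
 show "\<exists>C>0. \<forall>\<delta>\<in>{0<..1}. C * \<delta> powr (-t) \<le> g \<delta>"
 proof (intro exI[of _ "C / M"] conjI ballI)
  fix \<delta> :: real assume d: "\<delta> \<in> {0<..1}"
  have "C * \<delta> powr (-t) \<le> M * g \<delta>" using C(2)[OF d] g(2)[OF d] by linarith
  then show "C / M * \<delta> powr (-t) \<le> g \<delta>" using M by (simp add: field_simps)
 qed (use C M in simp)
qed

lemma dist_prod_le: "dist z z' \<le> \<bar>fst z - fst z'\<bar> + \<bar>snd z - snd (z' :: real \<times> real)\<bar>"
 unfolding dist_prod_def dist_real_def by (rule sqrt_sum_squares_le_sum_abs[THEN order_trans]) simp

lemma dist_prod_ge: "\<bar>fst z - fst z'\<bar> \<le> dist z (z' :: real \<times> real)" "\<bar>snd z - snd z'\<bar> \<le> dist z z'"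
 using dist_fst_le[of z z'] dist_snd_le[of z z'] by (simp_all add: dist_real_def)

text \<open>Five by five, because \<open>mesh_close\<close> bounds the index difference of points at
  distance at most \<delta> by 2.\<close>

definition nbhd :: "int \<times> int \<Rightarrow> (int \<times> int) set" where
 "nbhd Q = {fst Q - 2..fst Q + 2} \<times> {snd Q - 2..snd Q + 2}"

lemma nbhd: "finite (nbhd Q)" "card (nbhd Q) = 25" "Q' \<in> nbhd Q \<longleftrightarrow> Q \<in> nbhd Q'"
 by (auto simp: nbhd_def card_cartesian_product mem_Times_iff)

definition cell_index :: "real \<Rightarrow> real \<times> real \<Rightarrow> int \<times> int" where
 "cell_index \<delta> z = (\<lfloor>fst z / \<delta>\<rfloor>, \<lfloor>snd z / \<delta>\<rfloor>)"

lemma cell_index: "0 < \<delta> \<Longrightarrow> z \<in> cell \<delta> Q \<longleftrightarrow> Q = cell_index \<delta> z"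
 by (auto simp: cell_index_def mesh_iff mem_Times_iff prod_eq_iff)

lemma nbhd_close:
 assumes "0 < \<delta>" "dist z z' \<le> \<delta>"
 shows "cell_index \<delta> z' \<in> nbhd (cell_index \<delta> z)"
proof -
 have z: "z \<in> cell \<delta> (cell_index \<delta> z)" "z' \<in> cell \<delta> (cell_index \<delta> z')" using assms by (simp_all add: cell_index)
 have "\<bar>fst z - fst z'\<bar> \<le> \<delta>" "\<bar>snd z - snd z'\<bar> \<le> \<delta>" using dist_prod_ge[of z z'] assms by linarith+
 then have "\<bar>real_of_int (fst (cell_index \<delta> z)) - of_int (fst (cell_index \<delta> z'))\<bar> \<le> 2"
  "\<bar>real_of_int (snd (cell_index \<delta> z)) - of_int (snd (cell_index \<delta> z'))\<bar> \<le> 2"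
  using mesh_close(1)[OF assms(1), of "fst z" "fst (cell_index \<delta> z)" "fst z'" "fst (cell_index \<delta> z')" \<delta>]
   mesh_close(1)[OF assms(1), of "snd z" "snd (cell_index \<delta> z)" "snd z'" "snd (cell_index \<delta> z')" \<delta>] z assms
  by (simp_all add: mem_Times_iff)
 then show ?thesis by (auto simp: nbhd_def mem_Times_iff)
qed

context planar
begin

definition F where "F = measure_support \<mu>"

lemma F_closed: "closed F"
 unfolding F_def by (rule closed_measure_support)

lemma F_prob: "prob F = 1"
 unfolding F_def by (rule prob_measure_support[OF prob_space_axioms sets_borel])

lemma F_sub_K: "F \<subseteq> K"
 unfolding F_def
 by (rule measure_support_subset[OF prob_space_axioms sets_borel _ measure_K]) (intro closed_Times closed_atLeastAtMost)

lemma F_events: "F \<in> events"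
 using F_closed sets_borel by (simp add: borel_closed)

lemma F_ne: "F \<noteq> {}"
 using F_prob by auto

lemma F_pos: "z \<in> F \<Longrightarrow> open U \<Longrightarrow> z \<in> U \<Longrightarrow> 0 < prob U"
 unfolding F_def measure_support_def by (simp add: emeasure_eq_measure)

lemma pos_meets_F: "A \<in> sets borel \<Longrightarrow> 0 < prob A \<Longrightarrow> \<exists>z\<in>F. z \<in> A"
 using prob_disjoint_carrier[of A F] F_prob F_events sets_borel by force

text \<open>By \<open>prob_word_le\<close> a neighbourhood of the image point has at least
  \<open>pw w\<close> times the mass of its preimage, which is a neighbourhood of
  \<open>z\<close>.\<close>

lemma word_F: "set w \<subseteq> I \<Longrightarrow> z \<in> F \<Longrightarrow> wmap S w z \<in> F"
proof -
 assume w: "set w \<subseteq> I" and z: "z \<in> F"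
 show ?thesis
  unfolding F_def measure_support_def
 proof (intro CollectI allI impI)
  fix U :: "(real \<times> real) set" assume U: "open U \<and> wmap S w z \<in> U"
  have cont: "continuous_on UNIV (wmap S w)"
   using w
  proof (induction w)
   case (Cons i w)
   then show ?case using S_cont[of i] by (auto intro!: continuous_on_compose2[of UNIV "S i" UNIV "wmap S w"] simp: comp_def)
  qed (simp add: id_def continuous_on_id)
  have "open (wmap S w -` U)" using U cont by (simp add: open_vimage)
  then have "0 < prob (wmap S w -` U)" using F_pos[OF z] U by auto
  then have "0 < pw w * prob (wmap S w -` U)" using wpos(3)[OF w] by simp
  also have "\<dots> \<le> prob U" using U by (intro prob_word_le[OF w]) auto
  finally show "0 < emeasure \<mu> U" by (simp add: emeasure_eq_measure)
 qed
qed

definition P where "P \<delta> = {Q. 0 < prob (cell \<delta> Q)}"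

lemma P_window: "P \<delta> \<subseteq> window2 \<delta>"
proof
 fix Q assume "Q \<in> P \<delta>"
 then have "Q \<in> {Q. cell \<delta> Q \<inter> K \<noteq> {}}" using prob_pos_meets[of "cell \<delta> Q"] by (auto simp: P_def)
 then show "Q \<in> window2 \<delta>" using window2(2) by blast
qed

lemma P_finite: "0 < \<delta> \<Longrightarrow> finite (P \<delta>)"
 using finite_subset[OF P_window window2(1)] .

lemma moment2_P: "moment2 \<mu> q \<delta> = (\<Sum>Q\<in>P \<delta>. prob (cell \<delta> Q) powr q)"
 by (simp add: moment2_def P_def)

lemma moment2_zero: "moment2 \<mu> 0 \<delta> = real (card (P \<delta>))"
 by (simp add: moment2_def P_def)

lemma ball_le_nbhd:
 assumes "0 < \<delta>"
 shows "prob (cball z \<delta>) \<le> (\<Sum>Q\<in>nbhd (cell_index \<delta> z). prob (cell \<delta> Q))"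
proof (rule prob_le_sum_cover[OF _ K_events measure_K])
 show "cball z \<delta> \<inter> K \<subseteq> (\<Union>Q\<in>nbhd (cell_index \<delta> z). cell \<delta> Q)"
 proof
  fix z' assume "z' \<in> cball z \<delta> \<inter> K"
  then have "dist z z' \<le> \<delta>" by simp
  from nbhd_close[OF assms this] show "z' \<in> (\<Union>Q\<in>nbhd (cell_index \<delta> z). cell \<delta> Q)"
   using cell_index[OF assms, of z' "cell_index \<delta> z'"] by blast
 qed
qed (use nbhd sets_borel in auto)

lemma covering_le:
 assumes \<delta>: "0 < \<delta>"
 shows "real (covering_number (10 * \<delta>) F) \<le> moment2 \<mu> 0 \<delta>"
proof -
 \<comment> \<open>A point of the support may lie in an uncharged cell, yet its five by five block
   contains a charged one. Each charged cell is therefore enlarged by two cells on every side; side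
   length \<open>5 * \<delta>\<close> gives diameter at most \<open>10 * \<delta>\<close>.\<close>
 define box where "box Q = {of_int (fst Q - 2) * \<delta>..of_int (fst Q + 3) * \<delta>} \<times> {of_int (snd Q - 2) * \<delta>..of_int (snd Q + 3) * \<delta>}" for Q :: "int \<times> int"
 have cov: "F \<subseteq> \<Union>(box ` P \<delta>)"
 proof
  fix z assume z: "z \<in> F"
  have "0 < prob (ball z \<delta>)" using F_pos[OF z, of "ball z \<delta>"] \<delta> by simp
  also have "\<dots> \<le> prob (cball z \<delta>)" using sets_borel by (intro finite_measure_mono) auto
  also have "\<dots> \<le> (\<Sum>Q\<in>nbhd (cell_index \<delta> z). prob (cell \<delta> Q))" by (rule ball_le_nbhd[OF \<delta>])
  finally have "\<exists>Q\<in>nbhd (cell_index \<delta> z). prob (cell \<delta> Q) \<noteq> 0" by (metis (no_types, lifting) less_irrefl sum.neutral)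
  then obtain Q where Q: "Q \<in> nbhd (cell_index \<delta> z)" "Q \<in> P \<delta>" by (auto simp: P_def zero_less_measure_iff)
  have zc: "z \<in> cell \<delta> (cell_index \<delta> z)" using \<delta> by (simp add: cell_index)
  have *: "x \<in> {of_int (m - 2) * \<delta>..of_int (m + 3) * \<delta>}" if "x \<in> mesh \<delta> n" "n \<in> {m - 2..m + 2}" for x m n
  proof -
   have "of_int (m - 2) * \<delta> \<le> of_int n * \<delta>" "of_int (n + 1) * \<delta> \<le> of_int (m + 3) * \<delta>"
    using that \<delta> by (intro mult_right_mono, auto)+
   then show ?thesis using that by (auto simp: mesh_def)
  qed
  have "z \<in> box Q" unfolding box_def mem_Times_iff fst_conv snd_conv
   using zc Q(1) nbhd(3)[of Q "cell_index \<delta> z"]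
   by (intro conjI *[of _ "fst (cell_index \<delta> z)"] *[of _ "snd (cell_index \<delta> z)"]) (auto simp: mem_Times_iff nbhd_def)
  then show "z \<in> \<Union>(box ` P \<delta>)" using Q(2) by blast
 qed
 have bd: "bounded (box Q) \<and> diameter (box Q) \<le> 10 * \<delta>" for Q
 proof
  show "bounded (box Q)" unfolding box_def by (intro bounded_Times) auto
  show "diameter (box Q) \<le> 10 * \<delta>"
  proof (rule diameter_le)
   fix z z' assume "z \<in> box Q" "z' \<in> box Q"
   then have "\<bar>fst z - fst z'\<bar> \<le> 5 * \<delta>" "\<bar>snd z - snd z'\<bar> \<le> 5 * \<delta>"
    by (auto simp: box_def mem_Times_iff algebra_simps)
   then show "norm (z - z') \<le> 10 * \<delta>" using dist_prod_le[of z z'] by (simp add: dist_norm)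
  qed (use \<delta> in auto)
 qed
 have "covering_number (10 * \<delta>) F \<le> card (box ` P \<delta>)"
  unfolding covering_number_def
  using cov bd P_finite[OF \<delta>] by (intro cInf_lower) auto
 also have "\<dots> \<le> card (P \<delta>)" by (rule card_image_le[OF P_finite[OF \<delta>]])
 finally show ?thesis by (simp add: moment2_zero)
qed

lemma covering_attained:
 assumes \<delta>: "0 < \<delta>"
 obtains \<U> where "finite \<U>" "F \<subseteq> \<Union>\<U>" "\<And>U. U \<in> \<U> \<Longrightarrow> bounded U \<and> diameter U \<le> \<delta>" "covering_number \<delta> F = card \<U>"
proof -
 let ?X = "{card \<U> |\<U>. finite \<U> \<and> F \<subseteq> \<Union>\<U> \<and> (\<forall>U\<in>\<U>. bounded U \<and> diameter U \<le> \<delta>)}"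
 have "compact F" using F_closed F_sub_K compact_Times[of "{a..b}" "{a'..b'}"] closed_subset compact_Int_closed
  by (metis compact_Icc inf.absorb_iff2)
 then obtain X where X: "finite X" "F \<subseteq> (\<Union>x\<in>X. ball x (\<delta> / 2))"
  using seq_compact_imp_totally_bounded[OF compact_imp_seq_compact] \<delta> by (metis half_gt_zero)
 have "card ((\<lambda>x. ball x (\<delta> / 2)) ` X) \<in> ?X"
 proof (intro CollectI exI conjI refl ballI)
  fix U assume "U \<in> (\<lambda>x. ball x (\<delta> / 2)) ` X"
  then obtain x where x: "U = ball x (\<delta> / 2)" by blast
  show "bounded U" unfolding x by simp
  show "diameter U \<le> \<delta>" unfolding x using \<delta> by simp
 qed (use X in auto)
 then have "?X \<noteq> {}" by blast
 then have "covering_number \<delta> F \<in> ?X" unfolding covering_number_def by (rule Inf_nat_def1)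
 then show ?thesis using that by blast
qed

text \<open>A set of diameter at most \<delta> meets only cells of a single five by five block,
  hence the 25.\<close>

lemma moment2_le_covering:
 assumes \<delta>: "0 < \<delta>"
 shows "moment2 \<mu> 0 \<delta> \<le> 25 * real (covering_number \<delta> F)"
proof -
 obtain \<U> where U: "finite \<U>" "F \<subseteq> \<Union>\<U>" "\<And>U. U \<in> \<U> \<Longrightarrow> bounded U \<and> diameter U \<le> \<delta>" "covering_number \<delta> F = card \<U>"
  using covering_attained[OF \<delta>] by blast
 define V where "V U = {Q. cell \<delta> Q \<inter> U \<noteq> {}}" for U
 have V: "finite (V U)" "card (V U) \<le> 25" if U': "U \<in> \<U>" for U
 proof -
  have "V U \<subseteq> nbhd (cell_index \<delta> (SOME z. z \<in> U))"
  proof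
   fix Q assume "Q \<in> V U"
   then obtain z where z: "z \<in> cell \<delta> Q" "z \<in> U" by (auto simp: V_def)
   define z0 where "z0 = (SOME z. z \<in> U)"
   have "z0 \<in> U" unfolding z0_def using z(2) by (rule someI)
   then have "dist z0 z \<le> diameter U" using U(3)[OF U'] z(2) by (intro diameter_bounded_bound) auto
   then have "dist z0 z \<le> \<delta>" using U(3)[OF U'] by linarith
   from nbhd_close[OF \<delta> this] show "Q \<in> nbhd (cell_index \<delta> (SOME z. z \<in> U))"
    using z(1) \<delta> by (simp add: cell_index z0_def)
  qed
  then show "finite (V U)" "card (V U) \<le> 25"
   using finite_subset[OF _ nbhd(1)] card_mono[OF nbhd(1)] nbhd(2) by metis+
 qed
 have "P \<delta> \<subseteq> (\<Union>U\<in>\<U>. V U)"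
 proof
  fix Q assume "Q \<in> P \<delta>"
  then obtain z where "z \<in> F" "z \<in> cell \<delta> Q" using pos_meets_F[of "cell \<delta> Q"] unfolding P_def by auto
  then show "Q \<in> (\<Union>U\<in>\<U>. V U)" using U(2) unfolding V_def by blast
 qed
 then have "card (P \<delta>) \<le> card (\<Union>U\<in>\<U>. V U)" using U(1) V by (intro card_mono) auto
 also have "\<dots> \<le> (\<Sum>U\<in>\<U>. card (V U))" using U(1) by (rule card_UN_le)
 also have "\<dots> \<le> (\<Sum>U\<in>\<U>. 25)" by (intro sum_mono V)
 finally show ?thesis by (simp add: moment2_zero U(4))
qed

lemma covering_growth: "has_growth (moment2 \<mu> 0) v \<Longrightarrow> has_growth (\<lambda>\<delta>. real (covering_number \<delta> F)) v"
proof (erule has_growth_sandwich[where k = "1 / 10" and M = 25])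
 fix \<delta> :: real assume d: "\<delta> \<in> {0<..1}"
 show "real (covering_number \<delta> F) \<le> moment2 \<mu> 0 (1 / 10 * \<delta>)" using covering_le[of "1 / 10 * \<delta>"] d by simp
 show "moment2 \<mu> 0 \<delta> \<le> 25 * real (covering_number \<delta> F)" using moment2_le_covering[of \<delta>] d by simp
qed auto

theorem box_dim: "has_growth (moment2 \<mu> 0) v \<Longrightarrow> has_box_dim F v"
 unfolding has_box_dim_def by (rule growth_tendsto[OF covering_growth])

lemma P_nonempty: "0 < \<delta> \<Longrightarrow> P \<delta> \<noteq> {}"
proof
 assume \<delta>: "0 < \<delta>" and e: "P \<delta> = {}"
 have "0 < prob (ball z \<delta>)" if "z \<in> F" for z using F_pos[OF that, of "ball z \<delta>"] \<delta> by simp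
 then obtain z where z: "0 < prob (ball z \<delta>)" using F_ne by blast
 also have "\<dots> \<le> prob (cball z \<delta>)" using sets_borel by (intro finite_measure_mono) auto
 also have "\<dots> \<le> (\<Sum>Q\<in>nbhd (cell_index \<delta> z). prob (cell \<delta> Q))" by (rule ball_le_nbhd[OF \<delta>])
 also have "\<dots> = 0" using e by (intro sum.neutral) (auto simp: P_def not_less measure_le_0_iff)
 finally show False by simp
qed

lemma growth_nonneg:
 assumes "has_growth (moment2 \<mu> 0) v"
 shows "0 \<le> v"
proof (rule tendsto_lowerbound[OF growth_tendsto[OF assms]])
 have "eventually (\<lambda>\<delta>::real. \<delta> \<in> {0<..1} \<and> 0 < - ln \<delta>) (at_right 0)"
  using eventually_ln_small[of 1 0] by (auto elim: eventually_mono)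
 then show "eventually (\<lambda>\<delta>. 0 \<le> ln (moment2 \<mu> 0 \<delta>) / (- ln \<delta>)) (at_right 0)"
 proof eventually_elim
  case (elim \<delta>)
  then have "1 \<le> card (P \<delta>)" using P_nonempty[of \<delta>] P_finite[of \<delta>] by (simp add: Suc_leI card_gt_0_iff)
  then have "0 \<le> ln (moment2 \<mu> 0 \<delta>)" by (simp add: moment2_zero)
  then show ?case using elim by (intro divide_nonneg_nonneg) auto
 qed
qed simp

lemma F_sep_bound:
 assumes "has_growth (moment2 \<mu> 0) v" "v < t"
 shows "sep_bound F t"
proof -
 obtain C where C: "C > 0" "\<And>\<delta>. \<delta> \<in> {0<..1} \<Longrightarrow> real (covering_number \<delta> F) \<le> C * \<delta> powr (-t)"
  using has_growthD(1)[OF covering_growth[OF assms(1)] assms(2)] by blast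
 show ?thesis
 proof (rule sep_boundI[OF C(1) zero_less_one])
  fix \<delta> :: real and X assume d: "0 < \<delta>" "\<delta> \<le> 1" and X: "finite X" "X \<subseteq> F"
   and sep: "\<And>x y. x \<in> X \<Longrightarrow> y \<in> X \<Longrightarrow> x \<noteq> y \<Longrightarrow> \<delta> < dist x y"
  obtain \<U> where U: "finite \<U>" "F \<subseteq> \<Union>\<U>" "\<And>U. U \<in> \<U> \<Longrightarrow> bounded U \<and> diameter U \<le> \<delta>" "covering_number \<delta> F = card \<U>"
   using covering_attained[OF d(1)] by blast
  have "\<forall>x\<in>X. \<exists>U\<in>\<U>. x \<in> U" using X U(2) by blast
  then obtain \<sigma> where \<sigma>: "\<And>x. x \<in> X \<Longrightarrow> \<sigma> x \<in> \<U>" "\<And>x. x \<in> X \<Longrightarrow> x \<in> \<sigma> x" by metis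
  have "inj_on \<sigma> X"
  proof (rule inj_onI, rule ccontr)
   fix x y assume xy: "x \<in> X" "y \<in> X" "\<sigma> x = \<sigma> y" "x \<noteq> y"
   have "dist x y \<le> diameter (\<sigma> x)"
    using U(3)[OF \<sigma>(1)[OF xy(1)]] \<sigma>(2)[OF xy(1)] \<sigma>(2)[OF xy(2)] xy(3) by (intro diameter_bounded_bound) auto
   then show False using U(3)[OF \<sigma>(1)[OF xy(1)]] sep[OF xy(1,2,4)] by linarith
  qed
  then have "card X \<le> card \<U>" using \<sigma>(1) U(1) by (intro card_inj_on_le) auto
  then have "real (card X) \<le> real (covering_number \<delta> F)" by (simp add: U(4))
  also have "\<dots> \<le> C * \<delta> powr (-t)" using d by (intro C) auto
  finally show "real (card X) \<le> C * \<delta> powr (-t)" .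
 qed
qed

text \<open>A maximal \<delta>-separated subset gives a cover by balls of diameter
  \<open>2 * \<delta>\<close>, so a bound on separated sets is a bound on covering numbers and
  contradicts their growth.\<close>

lemma F_not_sep_bound:
 assumes g: "has_growth (moment2 \<mu> 0) v" and s: "s < v"
 shows "\<not> sep_bound F s"
proof
 assume "sep_bound F s"
 then obtain C \<delta>0 where C: "0 < C" "0 < \<delta>0" "\<And>\<delta> X. 0 < \<delta> \<Longrightarrow> \<delta> \<le> \<delta>0 \<Longrightarrow> finite X \<Longrightarrow> X \<subseteq> F \<Longrightarrow>
  separated \<delta> X \<Longrightarrow> real (card X) \<le> C * \<delta> powr (-s)" unfolding sep_bound_def by metis
 define t where "t = (s + v) / 2"
 have t: "s < t" "t < v" using s by (auto simp: t_def)
 obtain c where c: "c > 0" "\<And>\<delta>. \<delta> \<in> {0<..1} \<Longrightarrow> c * \<delta> powr (-t) \<le> real (covering_number \<delta> F)"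
  using has_growthD(2)[OF covering_growth[OF g] t(2)] by blast
 have ineq: "c * 2 powr (-t) \<le> C * \<delta> powr (t - s)" if d: "0 < \<delta>" "\<delta> \<le> \<delta>0" "\<delta> \<le> 1 / 2" for \<delta>
 proof -
  obtain X where X: "finite X" "X \<subseteq> F" "separated \<delta> X" "F \<subseteq> (\<Union>x\<in>X. cball x \<delta>)"
   using maximal_separated[OF _ d(1), of F "C * \<delta> powr (-s)"] C(3)[OF d(1,2)] by metis
  have "covering_number (2 * \<delta>) F \<le> card ((\<lambda>x. cball x \<delta>) ` X)"
   unfolding covering_number_def
  proof (rule cInf_lower)
   show "card ((\<lambda>x. cball x \<delta>) ` X) \<in> {card \<U> |\<U>. finite \<U> \<and> F \<subseteq> \<Union>\<U> \<and> (\<forall>U\<in>\<U>. bounded U \<and> diameter U \<le> 2 * \<delta>)}"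
   proof (intro CollectI exI conjI refl ballI)
    fix U assume "U \<in> (\<lambda>x. cball x \<delta>) ` X"
    then obtain x where x: "U = cball x \<delta>" by blast
    show "bounded U" unfolding x by simp
    show "diameter U \<le> 2 * \<delta>" unfolding x using d by simp
   qed (use X in auto)
  qed simp
  also have "\<dots> \<le> card X" by (rule card_image_le[OF X(1)])
  finally have "real (covering_number (2 * \<delta>) F) \<le> C * \<delta> powr (-s)" using C(3)[OF d(1,2) X(1-3)] by linarith
  moreover have "c * (2 * \<delta>) powr (-t) \<le> real (covering_number (2 * \<delta>) F)" using d by (intro c) auto
  ultimately have "c * (2 * \<delta>) powr (-t) \<le> C * \<delta> powr (-s)" by linarith
  then have "c * 2 powr (-t) * \<delta> powr (-t) \<le> C * \<delta> powr (-s)" using d by (simp add: powr_mult)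
  then have "c * 2 powr (-t) * \<delta> powr (-t) * \<delta> powr t \<le> C * \<delta> powr (-s) * \<delta> powr t" by (intro mult_right_mono) auto
  then have "c * 2 powr (-t) * (\<delta> powr (-t) * \<delta> powr t) \<le> C * (\<delta> powr (-s) * \<delta> powr t)" by (simp only: mult.assoc)
  moreover have "\<delta> powr (-t) * \<delta> powr t = 1" "\<delta> powr (-s) * \<delta> powr t = \<delta> powr (t - s)"
   using d by (simp_all add: powr_add[symmetric])
  ultimately show ?thesis by (simp only: mult_1_right)
 qed
 have lim: "((\<lambda>\<delta>. C * \<delta> powr (t - s)) \<longlongrightarrow> C * 0) (at_right 0)"
  using t by (intro tendsto_intros tendsto_zero_powrI[where b = "t - s"]) (auto intro!: eventually_mono[OF eventually_at_right_less[of 0]])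
 have e1: "eventually (\<lambda>\<delta>. C * \<delta> powr (t - s) < c * 2 powr (-t)) (at_right 0)"
  using order_tendstoD(2)[OF lim, of "c * 2 powr (-t)"] c(1) by simp
 have e2: "eventually (\<lambda>\<delta>::real. 0 < \<delta> \<and> \<delta> < min \<delta>0 (1 / 2)) (at_right 0)"
  using C by (auto simp: eventually_at_right[of 0 1] intro!: exI[of _ "min \<delta>0 (1 / 2)"])
 have "eventually (\<lambda>\<delta>::real. False) (at_right 0)" using e1 e2
 proof eventually_elim
  case (elim \<delta>)
  then show False using ineq[of \<delta>] by auto
 qed
 then show False by simp
qed

text \<open>The lower bound needs that no relatively open piece is smaller than the whole. Such a
  piece contains a copy of the support under some word map, and this map shrinks distances by at
  most the factor \<open>\<phi> w\<close>, so a bound for the piece would hold for all of the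
  support.\<close>

theorem packing_dim_F:
 assumes g: "has_growth (moment2 \<mu> 0) v"
 shows "packing_dim F = ereal v"
proof (rule antisym)
 show "packing_dim F \<le> ereal v"
 proof (rule ereal_le_epsilon2)
  fix e :: real assume e: "0 < e"
  have "packing_dim F \<le> ereal (v + e)"
   using F_sep_bound[OF g, of "v + e"] growth_nonneg[OF g] e by (intro packing_dim_le[of F "\<lambda>_. F"]) auto
  then show "packing_dim F \<le> ereal v + ereal e" by simp
 qed
 show "ereal v \<le> packing_dim F"
 proof (rule packing_dim_ge_baire[OF F_closed F_ne], rule notI)
  fix s U assume s: "s < v" and U: "open U" "U \<inter> F \<noteq> {}" and sb: "sep_bound (U \<inter> F) s"
  obtain z where z: "z \<in> U" "z \<in> F" using U(2) by blast
  obtain r where r: "0 < r" "ball z r \<subseteq> U" using U(1) z(1) by (meson openE)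
  \<comment> \<open>Both sides of the rectangle have to be small for a copy of the support to fit
    into \<open>U\<close>, hence a cut by the longer side.\<close>
  define \<phi>' where "\<phi>' w = max (cw w) (dw w)" for w
  \<comment> \<open>Gives the image of the support distance at most
    \<open>2 * (\<eta> * (2 * H)) = r / 2\<close> from a point of it within \<open>r / 2\<close> of
    \<open>z\<close>.\<close>
  define \<eta> where "\<eta> = r / (8 * H)"
  have \<eta>: "0 < \<eta>" using r H_pos by (simp add: \<eta>_def)
  define \<rho> where "\<rho> = Max (c ` I \<union> d ` I)"
  have "\<rho> \<in> c ` I \<union> d ` I" unfolding \<rho>_def using fin ne by (intro Max_in) auto
  then have \<rho>: "0 \<le> \<rho>" "\<rho> < 1" using c d by (auto intro: less_imp_le)
  have "c i \<le> \<rho>" "d i \<le> \<rho>" if "i \<in> I" for i using that fin unfolding \<rho>_def by auto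
  then have "\<phi>' w \<le> \<rho> ^ length w" if "set w \<subseteq> I" for w
   using that c d word_prod_le[of I c \<rho> w] word_prod_le[of I d \<rho> w] by (simp add: \<phi>'_def)
  from cut_exists[OF fin this \<rho> \<eta>] obtain Z where Z: "is_cut I \<phi>' \<eta> Z" by blast
  have bb: "ball z (r / 2) \<in> sets borel" by simp
  have "0 < prob (ball z (r / 2))" using F_pos[OF z(2), of "ball z (r / 2)"] r by simp
  also have "\<dots> = (\<Sum>w\<in>Z. pw w * prob (wmap S w -` ball z (r / 2)))"
   by (rule measure_cut[OF Z bb S_borel self_sim])
  finally have "\<exists>w\<in>Z. pw w * prob (wmap S w -` ball z (r / 2)) \<noteq> 0"
   by (metis (no_types, lifting) less_irrefl sum.neutral)
  then obtain w where w: "w \<in> Z" "0 < prob (wmap S w -` ball z (r / 2))" by (auto simp: zero_less_measure_iff)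
  have wI: "set w \<subseteq> I" using cut_word(1)[OF Z w(1)] .
  have wc: "cw w \<le> \<eta>" "dw w \<le> \<eta>" using cut_word(2)[OF Z w(1)] by (auto simp: \<phi>'_def)
  obtain z' where z': "z' \<in> K" "z' \<in> wmap S w -` ball z (r / 2)"
   using prob_pos_meets[OF word_vimage_borel[OF wI bb] w(2)] by blast
  have img: "wmap S w ` F \<subseteq> U \<inter> F"
  proof
   fix y assume "y \<in> wmap S w ` F"
   then obtain x where x: "x \<in> F" "y = wmap S w x" by blast
   have xK: "x \<in> K" using x F_sub_K by blast
   have "\<bar>fst x - fst z'\<bar> \<le> H" "\<bar>snd x - snd z'\<bar> \<le> H"
    using xK z'(1) by (auto simp: H_def)
   then have "\<bar>fst x - fst z'\<bar> \<le> 2 * H" "\<bar>snd x - snd z'\<bar> \<le> 2 * H" using H_pos by linarith+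
   then have "cw w * \<bar>fst x - fst z'\<bar> \<le> \<eta> * (2 * H)" "dw w * \<bar>snd x - snd z'\<bar> \<le> \<eta> * (2 * H)"
    using wc \<eta> by (auto intro!: mult_mono)
   then have "dist y (wmap S w z') \<le> 2 * (\<eta> * (2 * H))"
    using dist_prod_le[of y "wmap S w z'"] X.word_dist[OF wI, of "fst x" "fst z'"] Y.word_dist[OF wI, of "snd x" "snd z'"]
    by (simp add: x(2) word_eq[OF wI])
   also have "\<dots> = r / 2" using H_pos by (simp add: \<eta>_def)
   finally have "dist z y < r" using z'(2) dist_triangle[of z y "wmap S w z'"] by (simp add: dist_commute)
   then have "y \<in> U" using r(2) by auto
   then show "y \<in> U \<inter> F" using word_F[OF wI x(1)] x(2) by simp
  qed
  have "sep_bound F s"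
  proof (rule sep_bound_expand[OF sb img])
   show "0 < \<phi> w" using wpos[OF wI] by (simp add: \<phi>_def)
   fix x y assume "x \<in> F" "y \<in> F"
   have dx: "dist (fst (wmap S w x)) (fst (wmap S w y)) = cw w * dist (fst x) (fst y)"
    "dist (snd (wmap S w x)) (snd (wmap S w y)) = dw w * dist (snd x) (snd y)"
    by (simp_all add: dist_real_def word_eq[OF wI] X.word_dist[OF wI] Y.word_dist[OF wI])
   have p0: "0 \<le> \<phi> w" "\<phi> w \<le> cw w" "\<phi> w \<le> dw w" using wpos[OF wI] by (auto simp: \<phi>_def)
   have "\<phi> w * dist x y = sqrt ((\<phi> w * dist (fst x) (fst y))\<^sup>2 + (\<phi> w * dist (snd x) (snd y))\<^sup>2)"
   proof -
    have "(\<phi> w * dist (fst x) (fst y))\<^sup>2 + (\<phi> w * dist (snd x) (snd y))\<^sup>2 =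
      (\<phi> w)\<^sup>2 * ((dist (fst x) (fst y))\<^sup>2 + (dist (snd x) (snd y))\<^sup>2)" by (simp add: power_mult_distrib algebra_simps)
    then show ?thesis using p0 by (simp add: dist_prod_def real_sqrt_mult)
   qed
   also have "\<dots> \<le> dist (wmap S w x) (wmap S w y)"
    unfolding dist_prod_def dx using p0
    by (intro real_sqrt_le_mono add_mono power_mono mult_right_mono mult_nonneg_nonneg) auto
   finally show "\<phi> w * dist x y \<le> dist (wmap S w x) (wmap S w y)" .
  qed
  then show False using F_not_sep_bound[OF g s] by simp
 qed
qed

end

subsection \<open>Dimensions of measures\<close>

lemma (in prob_space) AE_prob_one_subset:
 assumes "AE x in M. Q x" "E \<in> events" "prob E = 1"
 obtains E' where "E' \<in> events" "prob E' = 1" "E' \<subseteq> E" "\<And>x. x \<in> E' \<Longrightarrow> Q x"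
proof -
 obtain N where N: "{x \<in> space M. \<not> Q x} \<subseteq> N" "N \<in> null_sets M" using assms(1) by (auto elim: AE_E simp: null_sets_def)
 have ev: "E - N \<in> events" using N assms(2) by auto
 have "prob (E - N) = prob E"
  using N by (intro measure_eq_AE) (auto intro: AE_mp[OF AE_not_in[OF N(2)]] simp: assms ev)
 then show ?thesis using that[of "E - N"] ev assms(3) N(1) sets.sets_into_space[OF assms(2)] by fastforce
qed

text \<open>On \<open>A m\<close> balls of radius \<rho> about separated points are disjoint and
  have mass at least \<open>k * \<rho> powr t\<close>, and total mass 1 limits their number. The
  sets \<open>A m\<close> exhaust a set of full measure.\<close>

lemma packing_dim_measure_le:
 fixes \<mu> :: "'a::euclidean_space measure"
 assumes \<mu>: "prob_space \<mu>" "sets \<mu> = sets borel" and t: "0 \<le> t" and k: "0 < k"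
  and AE: "AE x in \<mu>. eventually (\<lambda>n. k * ((1/2) ^ n) powr t \<le> measure \<mu> (cball x ((1/2) ^ n))) sequentially"
 shows "packing_dim_measure \<mu> \<le> ereal t"
proof -
 interpret prob_space \<mu> by fact
 obtain E where E: "E \<in> events" "prob E = 1"
  "\<And>x. x \<in> E \<Longrightarrow> eventually (\<lambda>n. k * ((1/2) ^ n) powr t \<le> prob (cball x ((1/2) ^ n))) sequentially"
  by (rule AE_prob_one_subset[OF AE sets.top prob_space]) blast
 define A where "A m = {x. \<forall>n\<ge>m. k * ((1/2) ^ n) powr t \<le> prob (cball x ((1/2) ^ n))}" for m
 have cover: "E \<subseteq> (\<Union>m. A m)" using E(3) by (fastforce simp: A_def eventually_sequentially)
 have sb: "sep_bound (A m) t" for m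
 proof (rule sep_boundI[of "4 powr t / k" "(1/2) ^ m"])
  show "0 < 4 powr t / k" using k by simp
  fix \<eta> :: real and X assume d: "0 < \<eta>" "\<eta> \<le> (1/2) ^ m" and X: "finite X" "X \<subseteq> A m"
   and sep: "\<And>x y. x \<in> X \<Longrightarrow> y \<in> X \<Longrightarrow> x \<noteq> y \<Longrightarrow> \<eta> < dist x y"
  have "\<eta> / 2 \<le> 1" using d power_le_one[of "1/2::real" m] by simp
  then obtain n where n: "(1/2) ^ Suc n < \<eta> / 2" "\<eta> / 2 \<le> (1/2) ^ n" using dyadic_floor[of "\<eta> / 2"] d by auto
  have nm: "m \<le> Suc n"
  proof (rule ccontr)
   assume "\<not> m \<le> Suc n"
   then have "(1/2::real) ^ m \<le> (1/2) ^ Suc (Suc n)" by (intro power_decreasing) auto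
   then show False using n(1) d zero_less_power[of "1/2::real" n] by simp
  qed
  define \<rho> :: real where "\<rho> = (1/2) ^ Suc n"
  have \<rho>: "0 < \<rho>" "\<rho> < \<eta> / 2" "\<eta> / 4 \<le> \<rho>" using n by (auto simp: \<rho>_def)
  have "disjoint_family_on (\<lambda>x. cball x \<rho>) X"
   unfolding disjoint_family_on_def
  proof (intro ballI impI, rule ccontr)
   fix x y assume xy: "x \<in> X" "y \<in> X" "x \<noteq> y" "cball x \<rho> \<inter> cball y \<rho> \<noteq> {}"
   then obtain z where "dist x z \<le> \<rho>" "dist y z \<le> \<rho>" by auto
   then have "dist x y \<le> \<eta>" using dist_triangle2[of x y z] \<rho> by linarith
   then show False using sep[OF xy(1-3)] by simp
  qed
  then have "(\<Sum>x\<in>X. prob (cball x \<rho>)) = prob (\<Union>x\<in>X. cball x \<rho>)"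
   using X \<mu>(2) by (intro finite_measure_finite_Union[symmetric]) auto
  then have le1: "(\<Sum>x\<in>X. prob (cball x \<rho>)) \<le> 1" by simp
  have "(\<Sum>x\<in>X. k * (\<eta> / 4) powr t) \<le> (\<Sum>x\<in>X. prob (cball x \<rho>))"
  proof (rule sum_mono)
   fix x assume "x \<in> X"
   have "k * (\<eta> / 4) powr t \<le> k * \<rho> powr t" using \<rho> d t k by (intro mult_left_mono powr_mono2) auto
   also have "\<dots> \<le> prob (cball x \<rho>)" using X \<open>x \<in> X\<close> nm unfolding A_def \<rho>_def by blast
   finally show "k * (\<eta> / 4) powr t \<le> prob (cball x \<rho>)" .
  qed
  then have "real (card X) * (k * (\<eta> / 4) powr t) \<le> 1" using le1 by simp
  moreover have "(\<eta> / 4) powr t = \<eta> powr t / 4 powr t" using d by (simp add: powr_divide)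
  ultimately show "real (card X) \<le> 4 powr t / k * \<eta> powr (-t)"
   using d k by (simp add: powr_minus field_simps)
 qed simp
 have "packing_dim E \<le> ereal t" by (rule packing_dim_le[OF cover sb t])
 moreover have "packing_dim_measure \<mu> \<le> packing_dim E"
  unfolding packing_dim_measure_def using E \<mu>(2) by (intro INF_lower) (auto simp: emeasure_eq_measure)
 ultimately show ?thesis by (rule order_trans[rotated])
qed

lemma hausdorff_dim_nonneg: "0 \<le> hausdorff_dim E"
 unfolding hausdorff_dim_def by (rule Inf_greatest) auto

text \<open>Mass distribution principle with bounds that hold from a point-dependent stage on. Where
  they hold from \<open>m\<close> on, a covering set that meets \<open>G m\<close> has mass at most
  \<open>k'\<close> times its s-th diameter power plus a summable error. Vanishing Hausdorff measure
  for some \<open>s < t\<close> would thus make every \<open>E \<inter> G m\<close> negligible,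
  although these sets exhaust almost all of \<open>E\<close>. Measurable supersets stand in for
  \<open>E \<inter> G m\<close>.\<close>

lemma hausdorff_dim_measure_ge:
 fixes \<mu> :: "'a::euclidean_space measure"
 assumes \<mu>: "prob_space \<mu>" "sets \<mu> = sets borel" and t: "0 < t" and k: "0 < k"
  and AE: "AE x in \<mu>. eventually (\<lambda>n. measure \<mu> (cball x ((1/2) ^ n)) \<le> k * ((1/2) ^ n) powr t) sequentially"
 shows "ereal t \<le> hausdorff_dim_measure \<mu>"
 unfolding hausdorff_dim_measure_def
proof (rule INF_greatest)
 interpret prob_space \<mu> by fact
 fix E :: "'a set" assume "E \<in> {E \<in> sets borel. emeasure \<mu> E = 1}"
 then have E: "E \<in> events" "prob E = 1" using \<mu>(2) by (auto simp: measure_def)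
 show "ereal t \<le> hausdorff_dim E"
  unfolding hausdorff_dim_def
 proof (rule Inf_greatest)
  fix z assume "z \<in> {ereal s |s. 0 \<le> s \<and> hausdorff_measure s E = 0}"
  then obtain s where s: "z = ereal s" "0 \<le> s" "hausdorff_measure s E = 0" by blast
  have "t \<le> s"
  proof (rule ccontr)
   assume "\<not> t \<le> s"
   then have st: "s < t" by simp
   define G where "G m = {x. \<forall>n\<ge>m. prob (cball x ((1/2) ^ n)) \<le> k * ((1/2) ^ n) powr t}" for m
   have step: "\<exists>V. V \<in> events \<and> E \<inter> G m \<subseteq> V \<and> emeasure \<mu> V \<le> ennreal \<epsilon>" if \<epsilon>: "0 < \<epsilon>" for m \<epsilon>
   proof -
    define k' where "k' = k * 2 powr t"
    have k': "0 < k'" using k by (simp add: k'_def)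
    define \<epsilon>' where "\<epsilon>' = \<epsilon> / (k' + 1)"
    have \<epsilon>': "0 < \<epsilon>'" using \<epsilon> k' by (simp add: \<epsilon>'_def)
    have "hausdorff_premeasure s ((1/2) ^ m) E \<le> hausdorff_measure s E"
     unfolding hausdorff_measure_def by (intro SUP_upper) auto
    then have "hausdorff_premeasure s ((1/2) ^ m) E < ennreal \<epsilon>'" using s(3) \<epsilon>' by simp
    then obtain U where U: "E \<subseteq> (\<Union>n. U n)" "\<And>n. bounded (U n)" "\<And>n. diameter (U n) \<le> (1/2) ^ m"
     "(\<Sum>n. ennreal (diam_pow s (U n))) < ennreal \<epsilon>'"
     unfolding hausdorff_premeasure_def INF_less_iff by auto
    have "\<exists>V. V \<in> events \<and> U j \<inter> G m \<subseteq> V \<and> prob V \<le> k' * diam_pow s (U j) + \<epsilon>' * (1/2) ^ Suc j" for j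
    proof (cases "U j \<inter> G m = {}")
     case True
     have "0 \<le> k' * diam_pow s (U j)" using k' by (simp add: diam_pow_def)
     then show ?thesis using True \<epsilon>' by (intro exI[of _ "{}"]) auto
    next
     case False
     then obtain x where x: "x \<in> U j" "x \<in> G m" by blast
     have sub: "U j \<subseteq> cball x r" if "diameter (U j) \<le> r" for r
     proof
      fix y assume "y \<in> U j"
      then have "dist x y \<le> diameter (U j)" using U(2) x(1) by (intro diameter_bounded_bound) auto
      then show "y \<in> cball x r" using that by simp
     qed
     have d0: "0 \<le> diameter (U j)" by (rule diameter_ge_0[OF U(2)])
     have d1: "diameter (U j) \<le> 1" using U(3)[of j] power_le_one[of "1/2::real" m] by simp
     show ?thesis
     proof (cases "diameter (U j) = 0")
      \<comment> \<open>A set of diameter 0 is a point, and its diameter power may vanish. A ball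
        small enough that its mass is below the error term takes its place, which uses
        \<open>0 < t\<close>.\<close>
      case True
      have "((\<lambda>n. k * ((1/2::real) ^ n) powr t) \<longlongrightarrow> k * 0) sequentially"
       using t by (intro tendsto_intros tendsto_zero_powrI[where b = t] LIMSEQ_power_zero) auto
      then have "eventually (\<lambda>n. k * ((1/2::real) ^ n) powr t < \<epsilon>' * (1/2) ^ Suc j) sequentially"
       using order_tendstoD(2)[of _ "k * 0" sequentially "\<epsilon>' * (1/2) ^ Suc j"] \<epsilon>' by simp
      then have "eventually (\<lambda>n. k * ((1/2::real) ^ n) powr t < \<epsilon>' * (1/2) ^ Suc j \<and> m \<le> n) sequentially"
       using eventually_ge_at_top[of m] by eventually_elim auto
      then obtain n where n: "k * ((1/2::real) ^ n) powr t < \<epsilon>' * (1/2) ^ Suc j" "m \<le> n"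
       by (auto dest: eventually_happens)
      have "prob (cball x ((1/2) ^ n)) \<le> k * ((1/2) ^ n) powr t" using x(2) n(2) by (auto simp: G_def)
      then have "prob (cball x ((1/2) ^ n)) \<le> \<epsilon>' * (1/2) ^ Suc j" using n(1) by linarith
      moreover have "0 \<le> k' * diam_pow s (U j)" using k' by (simp add: diam_pow_def)
      ultimately show ?thesis using sub[of "(1/2) ^ n"] True \<mu>(2)
       by (intro exI[of _ "cball x ((1/2) ^ n)"]) auto
     next
      case False
      then obtain n where n: "(1/2) ^ Suc n < diameter (U j)" "diameter (U j) \<le> (1/2) ^ n"
       using dyadic_floor[of "diameter (U j)"] d0 d1 by auto
      have nm: "m \<le> n"
      proof (rule ccontr)
       assume "\<not> m \<le> n"
       then have "(1/2::real) ^ m \<le> (1/2) ^ Suc n" by (intro power_decreasing) auto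
       then show False using n(1) U(3)[of j] by simp
      qed
      have "prob (cball x ((1/2) ^ n)) \<le> k * ((1/2) ^ n) powr t" using x(2) nm by (auto simp: G_def)
      also have "\<dots> \<le> k * (2 * diameter (U j)) powr t"
       using n(1) t k by (intro mult_left_mono powr_mono2) auto
      also have "\<dots> = k' * diameter (U j) powr t" using d0 by (simp add: powr_mult k'_def)
      also have "\<dots> \<le> k' * diam_pow s (U j)"
      proof (rule mult_left_mono)
       have "diameter (U j) powr t \<le> diameter (U j) powr s" using d0 d1 st False by (intro powr_mono') auto
       then show "diameter (U j) powr t \<le> diam_pow s (U j)"
        using x(1) False d0 by (auto simp: diam_pow_def)
      qed (use k' in simp)
      finally have "prob (cball x ((1/2) ^ n)) \<le> k' * diam_pow s (U j) + \<epsilon>' * (1/2) ^ Suc j"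
       using \<epsilon>' by (smt (verit) mult_nonneg_nonneg zero_le_power divide_nonneg_nonneg)
      then show ?thesis using sub[OF n(2)] \<mu>(2) by (intro exI[of _ "cball x ((1/2) ^ n)"]) auto
     qed
    qed
    then obtain V where V: "\<And>j. V j \<in> events" "\<And>j. U j \<inter> G m \<subseteq> V j"
     "\<And>j. prob (V j) \<le> k' * diam_pow s (U j) + \<epsilon>' * (1/2) ^ Suc j" by metis
    have dp: "0 \<le> diam_pow s A" for A :: "'a set" by (simp add: diam_pow_def)
    have "emeasure \<mu> (\<Union>j. V j) \<le> (\<Sum>j. emeasure \<mu> (V j))"
     using V(1) by (intro emeasure_subadditive_countably) auto
    also have "\<dots> \<le> (\<Sum>j. ennreal k' * ennreal (diam_pow s (U j)) + ennreal (\<epsilon>' * (1/2) ^ Suc j))"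
    proof (rule suminf_le)
     fix j
     have "emeasure \<mu> (V j) \<le> ennreal (k' * diam_pow s (U j) + \<epsilon>' * (1/2) ^ Suc j)"
      using V(3)[of j] by (simp add: emeasure_eq_measure ennreal_leI)
     also have "\<dots> = ennreal k' * ennreal (diam_pow s (U j)) + ennreal (\<epsilon>' * (1/2) ^ Suc j)"
      using k' \<epsilon>' dp by (simp add: ennreal_plus ennreal_mult)
     finally show "emeasure \<mu> (V j) \<le> \<dots>" .
    qed auto
    also have "\<dots> = ennreal k' * (\<Sum>j. ennreal (diam_pow s (U j))) + (\<Sum>j. ennreal (\<epsilon>' * (1/2) ^ Suc j))"
     by (subst suminf_add[symmetric]) (auto simp: ennreal_suminf_cmult)
    also have "(\<Sum>j. ennreal (\<epsilon>' * (1/2) ^ Suc j)) = ennreal \<epsilon>'"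
    proof (rule suminf_ennreal_eq)
     show "(\<lambda>n. \<epsilon>' * (1/2) ^ Suc n) sums \<epsilon>'" using sums_mult[OF power_half_series, of \<epsilon>'] by simp
    qed (use \<epsilon>' in simp)
    also have "ennreal k' * (\<Sum>j. ennreal (diam_pow s (U j))) + ennreal \<epsilon>' \<le> ennreal k' * ennreal \<epsilon>' + ennreal \<epsilon>'"
     using U(4) by (intro add_right_mono mult_left_mono) (auto intro: less_imp_le)
    also have "\<dots> = ennreal (k' * \<epsilon>' + \<epsilon>')" using k' \<epsilon>' by (simp add: ennreal_plus ennreal_mult)
    also have "k' * \<epsilon>' + \<epsilon>' = (k' + 1) * \<epsilon>'" by (simp add: algebra_simps)
    also have "\<dots> = \<epsilon>" using k' by (simp add: \<epsilon>'_def)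
    finally have "emeasure \<mu> (\<Union>j. V j) \<le> ennreal \<epsilon>" .
    moreover have "E \<inter> G m \<subseteq> (\<Union>j. V j)" using U(1) V(2) by blast
    ultimately show ?thesis using V(1) by (intro exI[of _ "\<Union>j. V j"]) auto
   qed
   have "\<exists>N\<in>null_sets \<mu>. E \<inter> G m \<subseteq> N" for m
   proof -
    obtain V where V: "\<And>j::nat. V j \<in> events" "\<And>j. E \<inter> G m \<subseteq> V j" "\<And>j. emeasure \<mu> (V j) \<le> ennreal (1 / real (Suc j))"
     using step[of "1 / real (Suc _)" m] by (metis of_nat_0_less_iff zero_less_Suc zero_less_divide_1_iff)
    have "emeasure \<mu> (\<Inter>j. V j) \<le> 0 + ennreal e" if e: "0 < e" for e
    proof -
     obtain j where "1 / real (Suc j) < e" using reals_Archimedean[OF e] by (auto simp: inverse_eq_divide)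
     have "emeasure \<mu> (\<Inter>j. V j) \<le> emeasure \<mu> (V j)" using V(1) by (intro emeasure_mono) auto
     also have "\<dots> \<le> ennreal (1 / real (Suc j))" by (rule V(3))
     also have "\<dots> \<le> ennreal e" using \<open>1 / real (Suc j) < e\<close> by (intro ennreal_leI) simp
     finally show ?thesis by simp
    qed
    then have "emeasure \<mu> (\<Inter>j. V j) \<le> 0" by (rule ennreal_le_epsilon)
    then have "(\<Inter>j. V j) \<in> null_sets \<mu>" using V(1) by (intro null_setsI) auto
    then show ?thesis using V(2) by blast
   qed
   then obtain N where N: "\<And>m. N m \<in> null_sets \<mu>" "\<And>m. E \<inter> G m \<subseteq> N m" by metis
   have "AE x in \<mu>. x \<in> E" using E by (simp add: prob_eq_1)
   moreover have "AE x in \<mu>. \<forall>m. x \<notin> N m" using N(1) by (simp add: AE_all_countable AE_not_in)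
   ultimately have "AE x in \<mu>. False"
    using AE
   proof eventually_elim
    case (elim x)
    then obtain m where "x \<in> G m" by (auto simp: G_def eventually_sequentially)
    then show False using elim N(2) by blast
   qed
   then show False by simp
  qed
  then show "ereal t \<le> z" by (simp add: s(1))
 qed
qed

section \<open>Local dimensions and entropy from moment bounds\<close>

context planar
begin

lemma sum_P: "0 < \<delta> \<Longrightarrow> (\<Sum>Q\<in>P \<delta>. prob (cell \<delta> Q)) = 1"
proof -
 assume \<delta>: "0 < \<delta>"
 have "(\<Sum>Q\<in>P \<delta>. prob (cell \<delta> Q)) = (\<Sum>Q\<in>window2 \<delta>. prob (cell \<delta> Q))"
  using P_window window2(1)[OF \<delta>] by (intro sum.mono_neutral_left) (auto simp: P_def not_less measure_le_0_iff)
 also have "\<dots> = prob (\<Union>Q\<in>window2 \<delta>. cell \<delta> Q)"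
 proof (rule finite_measure_finite_Union[symmetric])
  show "disjoint_family_on (cell \<delta>) (window2 \<delta>)"
   unfolding disjoint_family_on_def
  proof (intro ballI impI, rule ccontr)
   fix Q Q' assume ne: "Q \<noteq> Q'" and meet: "cell \<delta> Q \<inter> cell \<delta> Q' \<noteq> {}"
   have "\<exists>z. Q = cell_index \<delta> z \<and> Q' = cell_index \<delta> z"
    using meet unfolding meets_iff cell_index[OF \<delta>] .
   then show False using ne by metis
  qed
  show "cell \<delta> ` window2 \<delta> \<subseteq> events" unfolding sets_borel by (intro image_subsetI cell_borel)
 qed (rule window2(1)[OF \<delta>])
 also have "\<dots> = 1"
 proof -
  have "K \<subseteq> (\<Union>Q\<in>window2 \<delta>. cell \<delta> Q)"
  proof
   fix z assume z: "z \<in> K"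
   have zc: "z \<in> cell \<delta> (cell_index \<delta> z)" using \<delta> by (simp add: cell_index)
   then have "cell \<delta> (cell_index \<delta> z) \<inter> K \<noteq> {}" using z by blast
   then show "z \<in> (\<Union>Q\<in>window2 \<delta>. cell \<delta> Q)" using window2(2)[of \<delta>] zc by blast
  qed
  moreover have "(\<Union>Q\<in>window2 \<delta>. cell \<delta> Q) \<in> events"
   unfolding sets_borel by (intro sets.finite_UN window2(1)[OF \<delta>] cell_borel)
  ultimately have "prob K \<le> prob (\<Union>Q\<in>window2 \<delta>. cell \<delta> Q)"
   by (rule finite_measure_mono)
  then show ?thesis using measure_K prob_le_1[of "\<Union>Q\<in>window2 \<delta>. cell \<delta> Q"] by linarith
 qed
 finally show ?thesis .
qed

text \<open>Borel-Cantelli: along dyadic scales a polynomial bound in the scale is a geometric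
  series.\<close>

lemma bad_cells:
 assumes q: "0 \<le> q" and \<sigma>: "0 < \<sigma>"
  and B: "\<And>n. B n \<in> sets borel" "\<And>n. prob (B n) \<le> C * ((1/2) ^ n) powr \<sigma>"
 shows "AE x in \<mu>. eventually (\<lambda>n. x \<notin> B n) sequentially"
proof -
 have "AE x in \<mu>. eventually (\<lambda>n. x \<in> space \<mu> - B n) sequentially"
 proof (rule borel_cantelli_AE1)
  show "B n \<in> events" for n using B(1) sets_borel by simp
  show "emeasure \<mu> (B n) < \<infinity>" for n by (simp add: emeasure_eq_measure)
  have "summable (\<lambda>n. C * ((1/2) powr \<sigma>) ^ n)"
   using \<sigma> powr01_less_one[of "1/2" \<sigma>] by (intro summable_mult summable_geometric) auto
  moreover have eq: "((1/2) powr \<sigma>) ^ n = ((1/2) ^ n) powr \<sigma>" for n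
   by (simp add: powr_realpow[symmetric] powr_powr mult.commute)
  ultimately show "summable (\<lambda>n. prob (B n))"
  proof (elim summable_comparison_test'[where N = 0])
   fix n show "norm (prob (B n)) \<le> C * ((1/2) powr \<sigma>) ^ n" unfolding eq using B(2)[of n] by simp
  qed
 qed
 then show ?thesis by (rule AE_mp) (auto intro!: AE_I2 elim: eventually_mono)
qed

text \<open>Markov's inequality for \<open>q < 1\<close>: a cell lighter than
  \<open>h n powr t\<close> has mass at most \<open>h n powr (t * (1 - q))\<close> times its q-th
  power, so light cells together carry at most this factor times the moment. The condition on
  \<open>s\<close> makes that summable.\<close>

lemma local_upper:
 assumes q: "0 \<le> q" "q < 1" and C: "\<And>\<delta>. \<delta> \<in> {0<..1} \<Longrightarrow> moment2 \<mu> q \<delta> \<le> C * \<delta> powr (-s)" and st: "s < t * (1 - q)"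
 shows "AE x in \<mu>. eventually (\<lambda>n. ((1/2) ^ n) powr t \<le> prob (cell ((1/2) ^ n) (cell_index ((1/2) ^ n) x))) sequentially"
proof -
 define h where "h n = (1/2::real) ^ n" for n
 have h: "h n \<in> {0<..1}" for n by (simp add: h_def power_le_one)
 define X where "X n = {Q \<in> P (h n). prob (cell (h n) Q) < h n powr t}" for n
 \<comment> \<open>Uncharged cells of the window join the bad set, so a point of \<open>K\<close>
   outside it lies in a charged cell that is not light.\<close>
 define Z where "Z n = window2 (h n) - P (h n)" for n
 define B where "B n = (\<Union>Q\<in>X n \<union> Z n. cell (h n) Q) \<union> - K" for n
 have fin: "finite (X n)" "finite (Z n)" for n
  using P_finite window2(1) h by (auto simp: X_def Z_def)
 have Bm: "B n \<in> sets borel" for n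
  unfolding B_def using fin K_borel by (intro sets.Un sets.finite_UN) auto
 have Bp: "prob (B n) \<le> C * h n powr (t * (1 - q) - s)" for n
 proof -
  have "prob (B n) \<le> (\<Sum>Q\<in>X n \<union> Z n. prob (cell (h n) Q))"
   unfolding B_def using fin sets_borel Bm[of n] K_borel
   by (intro prob_le_sum_cover[OF _ K_events measure_K]) (auto simp: B_def)
  also have "\<dots> = (\<Sum>Q\<in>X n. prob (cell (h n) Q))"
   using fin by (intro sum.mono_neutral_right) (auto simp: X_def Z_def P_def not_less measure_le_0_iff)
  also have "\<dots> \<le> (\<Sum>Q\<in>X n. h n powr (t * (1 - q)) * prob (cell (h n) Q) powr q)"
  proof (rule sum_mono)
   fix Q assume Q: "Q \<in> X n"
   then have pos: "0 < prob (cell (h n) Q)" by (auto simp: X_def P_def)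
   have "prob (cell (h n) Q) = prob (cell (h n) Q) powr (1 - q) * prob (cell (h n) Q) powr q"
    using pos by (simp add: powr_add[symmetric])
   also have "\<dots> \<le> (h n powr t) powr (1 - q) * prob (cell (h n) Q) powr q"
    using Q q pos by (intro mult_right_mono powr_mono2) (auto simp: X_def)
   finally show "prob (cell (h n) Q) \<le> h n powr (t * (1 - q)) * prob (cell (h n) Q) powr q"
    by (simp add: powr_powr)
  qed
  also have "\<dots> = h n powr (t * (1 - q)) * (\<Sum>Q\<in>X n. prob (cell (h n) Q) powr q)" by (simp add: sum_distrib_left)
  also have "\<dots> \<le> h n powr (t * (1 - q)) * moment2 \<mu> q (h n)"
   unfolding moment2_P using P_finite h by (intro mult_left_mono sum_mono2) (auto simp: X_def)
  also have "\<dots> \<le> h n powr (t * (1 - q)) * (C * h n powr (-s))" using C[OF h] by (intro mult_left_mono) auto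
  also have "\<dots> = C * (h n powr (t * (1 - q)) * h n powr (-s))" by simp
  also have "h n powr (t * (1 - q)) * h n powr (-s) = h n powr (t * (1 - q) - s)" by (simp add: powr_add[symmetric])
  finally show ?thesis .
 qed
 have "AE x in \<mu>. eventually (\<lambda>n. x \<notin> B n) sequentially"
  using Bm Bp q st by (intro bad_cells[of q "t * (1 - q) - s" B C]) (auto simp: h_def)
 then show ?thesis
 proof eventually_elim
  case (elim x)
  then show ?case
  proof eventually_elim
   case (elim n)
   have xc: "x \<in> cell (h n) (cell_index (h n) x)" using h[of n] by (simp add: cell_index)
   have "x \<in> K" using elim by (auto simp: B_def)
   then have "cell_index (h n) x \<in> window2 (h n)" using window2(2)[of "h n"] xc by blast
   then have "\<not> prob (cell (h n) (cell_index (h n) x)) < h n powr t"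
    using elim xc unfolding B_def X_def Z_def by blast
   then show ?case by (simp add: h_def)
  qed
 qed
qed

text \<open>The counterpart for \<open>q > 1\<close>, with heavy cells instead of light ones.
  Because a ball reaches into neighbouring cells, heaviness is measured on five by five blocks,
  whose moment is at most \<open>25 powr q * 25\<close> times that of the cells.\<close>

lemma local_lower:
 assumes q: "1 < q" and C: "\<And>\<delta>. \<delta> \<in> {0<..1} \<Longrightarrow> moment2 \<mu> q \<delta> \<le> C * \<delta> powr (-s)" and st: "s < - t * (q - 1)"
 shows "AE x in \<mu>. eventually (\<lambda>n. prob (cball x ((1/2) ^ n)) \<le> ((1/2) ^ n) powr t) sequentially"
proof -
 define h where "h n = (1/2::real) ^ n" for n
 have h: "h n \<in> {0<..1}" for n by (simp add: h_def power_le_one)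
 define bm where "bm n Q = (\<Sum>Q'\<in>nbhd Q \<inter> P (h n). prob (cell (h n) Q'))" for n Q
 have bm_eq: "(\<Sum>Q'\<in>nbhd Q. prob (cell (h n) Q')) = bm n Q" for n Q
  unfolding bm_def using nbhd(1) by (intro sum.mono_neutral_right) (auto simp: P_def not_less measure_le_0_iff)
 have bm0: "0 \<le> bm n Q" for n Q unfolding bm_def by (intro sum_nonneg) auto
 have le_bm: "prob (cell (h n) Q) \<le> bm n Q" for n Q
  unfolding bm_eq[symmetric] using nbhd(1) by (intro member_le_sum) (auto simp: nbhd_def mem_Times_iff)
 define X where "X n = {Q \<in> window2 (h n). h n powr t < bm n Q}" for n
 define B where "B n = (\<Union>Q\<in>X n. cell (h n) Q) \<union> - K" for n
 have fin: "finite (X n)" for n using window2(1) h by (auto simp: X_def)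
 have Bm: "B n \<in> sets borel" for n
  unfolding B_def using fin K_borel by (intro sets.Un sets.finite_UN) auto
 define C' where "C' = 25 powr q * 25 * C"
 have Bp: "prob (B n) \<le> C' * h n powr (- t * (q - 1) - s)" for n
 proof -
  have hn: "0 < h n" using h[of n] by simp
  have "prob (B n) \<le> (\<Sum>Q\<in>X n. prob (cell (h n) Q))"
   unfolding B_def using fin sets_borel Bm[of n] K_borel
   by (intro prob_le_sum_cover[OF _ K_events measure_K]) (auto simp: B_def)
  also have "\<dots> \<le> (\<Sum>Q\<in>X n. h n powr (- t * (q - 1)) * bm n Q powr q)"
  proof (rule sum_mono)
   fix Q assume Q: "Q \<in> X n"
   then have g: "h n powr t < bm n Q" by (auto simp: X_def)
   then have pos: "0 < bm n Q" by (rule less_trans[rotated]) (use hn in simp)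
   have "(h n powr t) powr (q - 1) \<le> bm n Q powr (q - 1)" using g q by (intro powr_mono2) auto
   then have "h n powr (t * (q - 1)) \<le> bm n Q powr (q - 1)" by (simp add: powr_powr)
   then have "h n powr (- t * (q - 1)) * h n powr (t * (q - 1)) \<le> h n powr (- t * (q - 1)) * bm n Q powr (q - 1)"
    by (intro mult_left_mono) auto
   moreover have "h n powr (- t * (q - 1)) * h n powr (t * (q - 1)) = 1" using hn by (simp add: powr_add[symmetric])
   ultimately have "1 * bm n Q \<le> h n powr (- t * (q - 1)) * bm n Q powr (q - 1) * bm n Q" using pos by (intro mult_right_mono) auto
   also have "\<dots> = h n powr (- t * (q - 1)) * bm n Q powr q" using pos by (simp add: powr_diff)
   finally show "prob (cell (h n) Q) \<le> h n powr (- t * (q - 1)) * bm n Q powr q" using le_bm[of n Q] by simp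
  qed
  also have "\<dots> = h n powr (- t * (q - 1)) * (\<Sum>Q\<in>X n. bm n Q powr q)" by (simp add: sum_distrib_left)
  also have "\<dots> \<le> h n powr (- t * (q - 1)) * (25 powr q * 25 * moment2 \<mu> q (h n))"
  proof (rule mult_left_mono)
   show "(\<Sum>Q\<in>X n. bm n Q powr q) \<le> 25 powr q * 25 * moment2 \<mu> q (h n)"
    unfolding moment2_P
   proof (rule moment_compare[where N = "\<lambda>Q. nbhd Q \<inter> P (h n)"])
    fix Q
    have "card (nbhd Q \<inter> P (h n)) \<le> card (nbhd Q)" using nbhd(1) by (intro card_mono) auto
    then show "real (card (nbhd Q \<inter> P (h n))) \<le> 25" by (simp add: nbhd(2))
    have "card {j \<in> X n. Q \<in> nbhd j \<inter> P (h n)} \<le> card (nbhd Q)" using nbhd(1,3) by (intro card_mono) auto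
    then show "real (card {j \<in> X n. Q \<in> nbhd j \<inter> P (h n)}) \<le> 25" by (simp add: nbhd(2))
   qed (use fin P_finite[OF hn] q bm0 in \<open>auto simp: bm_def\<close>)
  qed simp
  also have "\<dots> \<le> h n powr (- t * (q - 1)) * (25 powr q * 25 * (C * h n powr (-s)))"
   using C[OF h] by (intro mult_left_mono) auto
  also have "\<dots> = C' * (h n powr (- t * (q - 1)) * h n powr (-s))" by (simp add: C'_def)
  also have "h n powr (- t * (q - 1)) * h n powr (-s) = h n powr (- t * (q - 1) - s)" by (simp add: powr_add[symmetric])
  finally show ?thesis .
 qed
 have "AE x in \<mu>. eventually (\<lambda>n. x \<notin> B n) sequentially"
  using Bm Bp q st by (intro bad_cells[of q "- t * (q - 1) - s" B C']) (auto simp: h_def)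
 then show ?thesis
 proof eventually_elim
  case (elim x)
  then show ?case
  proof eventually_elim
   case (elim n)
   have hn: "0 < h n" using h[of n] by simp
   have xc: "x \<in> cell (h n) (cell_index (h n) x)" using hn by (simp add: cell_index)
   have "x \<in> K" using elim by (auto simp: B_def)
   then have "cell_index (h n) x \<in> window2 (h n)" using window2(2)[of "h n"] xc by blast
   then have "\<not> h n powr t < bm n (cell_index (h n) x)" using elim xc unfolding B_def X_def by blast
   moreover have "prob (cball x (h n)) \<le> bm n (cell_index (h n) x)" using ball_le_nbhd[OF hn, of x] unfolding bm_eq .
   ultimately show ?case unfolding h_def[symmetric] by linarith
  qed
 qed
qed

definition mesh_entropy where "mesh_entropy \<delta> = (\<Sum>Q\<in>P \<delta>. prob (cell \<delta> Q) * ln (prob (cell \<delta> Q)))"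

lemma mesh_entropy_infsum:
 assumes \<delta>: "0 < \<delta>"
 shows "(\<Sum>\<^sub>\<infinity>Q\<in>{Q \<in> mesh_squares \<delta>. measure \<mu> Q > 0}. measure \<mu> Q * ln (measure \<mu> Q)) = mesh_entropy \<delta>"
proof -
 have set: "{Q \<in> mesh_squares \<delta>. 0 < prob Q} = cell \<delta> ` P \<delta>"
 proof -
  have "mesh_squares \<delta> = range (cell \<delta>)"
  proof (intro equalityI subsetI)
   fix X assume "X \<in> mesh_squares \<delta>"
   then obtain m n :: int where "X = {of_int m * \<delta>..<(of_int m + 1) * \<delta>} \<times> {of_int n * \<delta>..<(of_int n + 1) * \<delta>}"
    unfolding mesh_squares_def by blast
   then have "X = cell \<delta> (m, n)" by (simp add: mesh_def)
   then show "X \<in> range (cell \<delta>)" by (rule range_eqI)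
  next
   fix X assume "X \<in> range (cell \<delta>)"
   then obtain Q where "X = cell \<delta> Q" by blast
   then show "X \<in> mesh_squares \<delta>" unfolding mesh_squares_def mesh_def by blast
  qed
  then show ?thesis by (auto simp: P_def)
 qed
 have "inj (cell \<delta>)"
 proof (rule injI)
  fix Q Q' assume eq: "cell \<delta> Q = cell \<delta> Q'"
  have "(of_int (fst Q) * \<delta>, of_int (snd Q) * \<delta>) \<in> cell \<delta> Q" using \<delta> by (simp add: mesh_def)
  then have "(of_int (fst Q) * \<delta>, of_int (snd Q) * \<delta>) \<in> cell \<delta> Q" "(of_int (fst Q) * \<delta>, of_int (snd Q) * \<delta>) \<in> cell \<delta> Q'"
   using eq by auto
  then show "Q = Q'" unfolding cell_index[OF \<delta>] by simp
 qed
 then have inj: "inj_on (cell \<delta>) (P \<delta>)" by (rule inj_on_subset) simp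
 show ?thesis
  unfolding set mesh_entropy_def using P_finite[OF \<delta>] inj by (simp add: sum.reindex)
qed

text \<open>Jensen for the logarithm, through \<open>ln x \<le> x - 1\<close>. The sign of
  \<open>q - 1\<close> turns the same inequality into an upper or a lower bound for the
  entropy.\<close>

lemma mesh_entropy_le:
 assumes \<delta>: "0 < \<delta>"
 shows "(q - 1) * mesh_entropy \<delta> \<le> ln (moment2 \<mu> q \<delta>)"
proof -
 let ?p = "\<lambda>Q. prob (cell \<delta> Q)"
 have pp: "0 < ?p Q" if "Q \<in> P \<delta>" for Q using that by (simp add: P_def)
 have fin: "finite (P \<delta>)" by (rule P_finite[OF \<delta>])
 define M where "M = moment2 \<mu> q \<delta>"
 have M: "M = (\<Sum>Q\<in>P \<delta>. ?p Q * ?p Q powr (q - 1))"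
  unfolding M_def moment2_P using pp by (intro sum.cong refl) (simp add: powr_diff less_imp_neq[symmetric])
 have M0: "0 < M" unfolding M by (intro sum_pos fin P_nonempty[OF \<delta>] mult_pos_pos) (simp_all add: P_def)
 have "(q - 1) * mesh_entropy \<delta> - ln M = (\<Sum>Q\<in>P \<delta>. ?p Q * ln (?p Q powr (q - 1) / M))"
 proof -
  have "(\<Sum>Q\<in>P \<delta>. ?p Q * ln (?p Q powr (q - 1) / M)) = (\<Sum>Q\<in>P \<delta>. (q - 1) * (?p Q * ln (?p Q)) - ?p Q * ln M)"
   using pp M0 by (intro sum.cong refl) (simp add: ln_div ln_powr algebra_simps)
  also have "\<dots> = (q - 1) * mesh_entropy \<delta> - (\<Sum>Q\<in>P \<delta>. ?p Q) * ln M"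
   by (simp add: sum_subtractf sum_distrib_left sum_distrib_right mesh_entropy_def)
  finally show ?thesis using sum_P[OF \<delta>] by simp
 qed
 also have "\<dots> \<le> (\<Sum>Q\<in>P \<delta>. ?p Q * (?p Q powr (q - 1) / M - 1))"
  by (intro sum_mono mult_left_mono ln_le_minus_one divide_pos_pos) (simp_all add: P_def M0)
 also have "\<dots> = (\<Sum>Q\<in>P \<delta>. ?p Q * ?p Q powr (q - 1)) / M - (\<Sum>Q\<in>P \<delta>. ?p Q)"
  by (simp add: right_diff_distrib sum_subtractf sum_divide_distrib)
 also have "\<dots> = 0" using M M0 sum_P[OF \<delta>] by simp
 finally show ?thesis by (simp add: M_def)
qed

text \<open>Both hypotheses are upper bounds for moments. The first, with \<open>q > 1\<close>,
  keeps the Hausdorff and entropy dimensions from falling below \<open>D\<close>; the second, with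
  \<open>q < 1\<close>, keeps the packing and entropy dimensions from exceeding it.\<close>

theorem measure_dims:
 assumes H1: "\<And>\<epsilon>. 0 < \<epsilon> \<Longrightarrow> \<exists>q>1. \<exists>C>0. \<forall>\<delta>\<in>{0<..1}. moment2 \<mu> q \<delta> \<le> C * \<delta> powr (- ((- D + \<epsilon>) * (q - 1)))"
  and H2: "\<And>\<epsilon>. 0 < \<epsilon> \<Longrightarrow> \<exists>q\<ge>0. q < 1 \<and> (\<exists>C>0. \<forall>\<delta>\<in>{0<..1}. moment2 \<mu> q \<delta> \<le> C * \<delta> powr (- ((D + \<epsilon>) * (1 - q))))"
 shows "hausdorff_dim_measure \<mu> = ereal D \<and> packing_dim_measure \<mu> = ereal D \<and> has_entropy_dim \<mu> D"
proof -
 have ent: "((\<lambda>\<delta>. 1 / ln \<delta> * mesh_entropy \<delta>) \<longlongrightarrow> D) (at_right 0)"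
 proof (rule tendstoI)
  fix e :: real assume e: "0 < e"
  define \<epsilon> where "\<epsilon> = e / 4"
  have \<epsilon>: "0 < \<epsilon>" using e by (simp add: \<epsilon>_def)
  obtain q C where q: "1 < q" "0 < C" "\<And>\<delta>. \<delta> \<in> {0<..1} \<Longrightarrow> moment2 \<mu> q \<delta> \<le> C * \<delta> powr (- ((- D + \<epsilon>) * (q - 1)))"
   using H1[OF \<epsilon>] by blast
  obtain q' C' where q': "0 \<le> q'" "q' < 1" "0 < C'" "\<And>\<delta>. \<delta> \<in> {0<..1} \<Longrightarrow> moment2 \<mu> q' \<delta> \<le> C' * \<delta> powr (- ((D + \<epsilon>) * (1 - q')))"
   using H2[OF \<epsilon>] by blast
  have mpos: "0 < moment2 \<mu> q \<delta>" if "0 < \<delta>" for q \<delta>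
   unfolding moment2_P using P_finite[OF that] P_nonempty[OF that] by (intro sum_pos) (auto simp: P_def)
  show "eventually (\<lambda>\<delta>. dist (1 / ln \<delta> * mesh_entropy \<delta>) D < e) (at_right 0)"
   using eventually_ln_small[OF \<epsilon>, of "ln C / (q - 1)"] eventually_ln_small[OF \<epsilon>, of "ln C' / (1 - q')"]
  proof eventually_elim
   case (elim \<delta>)
   then have d: "\<delta> \<in> {0<..1}" "0 < \<delta>" and l: "0 < - ln \<delta>" by auto
   define l where "l = - ln \<delta>"
   have l0: "0 < l" using l by (simp add: l_def)
   have "(q - 1) * mesh_entropy \<delta> \<le> ln (moment2 \<mu> q \<delta>)" by (rule mesh_entropy_le[OF d(2)])
   also have "\<dots> \<le> ln (C * \<delta> powr (- ((- D + \<epsilon>) * (q - 1))))" using q(3)[OF d(1)] mpos[OF d(2)] q(2) d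
    by (subst ln_le_cancel_iff) auto
   also have "\<dots> = (q - 1) * (ln C / (q - 1) + (- D + \<epsilon>) * l)" using q d
    by (subst ln_mult_pos) (auto simp: ln_powr l_def field_simps)
   finally have "mesh_entropy \<delta> \<le> ln C / (q - 1) + (- D + \<epsilon>) * l" using q(1) by simp
   also have "\<dots> \<le> \<epsilon> * l + (- D + \<epsilon>) * l" using elim by (simp add: l_def)
   finally have 1: "mesh_entropy \<delta> \<le> (2 * \<epsilon> - D) * l" by (simp add: algebra_simps)
   have "(q' - 1) * mesh_entropy \<delta> \<le> ln (moment2 \<mu> q' \<delta>)" by (rule mesh_entropy_le[OF d(2)])
   also have "\<dots> \<le> ln (C' * \<delta> powr (- ((D + \<epsilon>) * (1 - q'))))" using q'(4)[OF d(1)] mpos[OF d(2)] q'(3) d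
    by (subst ln_le_cancel_iff) auto
   also have "\<dots> = (1 - q') * (ln C' / (1 - q') + (D + \<epsilon>) * l)" using q' d
    by (subst ln_mult_pos) (auto simp: ln_powr l_def field_simps)
   finally have "(1 - q') * (- mesh_entropy \<delta>) \<le> (1 - q') * (ln C' / (1 - q') + (D + \<epsilon>) * l)" by (simp add: algebra_simps)
   then have "- mesh_entropy \<delta> \<le> ln C' / (1 - q') + (D + \<epsilon>) * l"
    by (rule mult_left_le_imp_le) (use q'(2) in simp)
   also have "\<dots> \<le> \<epsilon> * l + (D + \<epsilon>) * l" using elim by (simp add: l_def)
   finally have 2: "- mesh_entropy \<delta> \<le> (D + 2 * \<epsilon>) * l" by (simp add: algebra_simps)
   have eq: "1 / ln \<delta> * mesh_entropy \<delta> = - mesh_entropy \<delta> / l" by (simp add: l_def)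
   have "D - 2 * \<epsilon> \<le> - mesh_entropy \<delta> / l" using 1 l0 by (subst pos_le_divide_eq) (auto simp: algebra_simps)
   moreover have "- mesh_entropy \<delta> / l \<le> D + 2 * \<epsilon>" using 2 l0 by (subst pos_divide_le_eq) auto
   ultimately have "\<bar>- mesh_entropy \<delta> / l - D\<bar> \<le> 2 * \<epsilon>" by linarith
   then show ?case unfolding eq dist_real_def using e by (simp add: \<epsilon>_def)
  qed
 qed
 have ev1: "eventually (\<lambda>\<delta>::real. \<delta> \<in> {0<..1} \<and> 0 < - ln \<delta>) (at_right 0)"
  using eventually_ln_small[of 1 0] by (auto elim: eventually_mono)
 have edim: "has_entropy_dim \<mu> D"
  unfolding has_entropy_dim_def
 proof (rule Lim_transform_eventually[OF ent])
  show "eventually (\<lambda>\<delta>. 1 / ln \<delta> * mesh_entropy \<delta> = 1 / ln \<delta> * (\<Sum>\<^sub>\<infinity>Q\<in>{Q \<in> mesh_squares \<delta>. measure \<mu> Q > 0}.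
    measure \<mu> Q * ln (measure \<mu> Q))) (at_right 0)"
   using ev1 by eventually_elim (simp add: mesh_entropy_infsum)
 qed
 have D0: "0 \<le> D"
 proof (rule tendsto_lowerbound[OF ent])
  show "eventually (\<lambda>\<delta>. 0 \<le> 1 / ln \<delta> * mesh_entropy \<delta>) (at_right 0)"
   using ev1
  proof eventually_elim
   case (elim \<delta>)
   have "mesh_entropy \<delta> \<le> 0" unfolding mesh_entropy_def
    by (intro sum_nonpos mult_nonneg_nonpos) (auto simp: P_def)
   then show ?case using elim by (simp add: divide_nonpos_nonpos)
  qed
 qed simp
 have pack: "packing_dim_measure \<mu> \<le> ereal D"
 proof (rule ereal_le_epsilon2)
  fix e :: real assume e: "0 < e"
  obtain q C where q: "0 \<le> q" "q < 1" "\<And>\<delta>. \<delta> \<in> {0<..1} \<Longrightarrow> moment2 \<mu> q \<delta> \<le> C * \<delta> powr (- ((D + e / 2) * (1 - q)))"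
   using H2[OF half_gt_zero[OF e]] by blast
  have AE: "AE x in \<mu>. eventually (\<lambda>n. ((1/2) ^ n) powr (D + e) \<le> prob (cell ((1/2) ^ n) (cell_index ((1/2) ^ n) x))) sequentially"
   using q e by (intro local_upper[of q C "(D + e / 2) * (1 - q)"]) auto
  have "AE x in \<mu>. eventually (\<lambda>n. (1/2) powr (D + e) * ((1/2) ^ n) powr (D + e) \<le> prob (cball x ((1/2) ^ n))) sequentially"
   using AE
  proof eventually_elim
   case (elim x)
   then have "eventually (\<lambda>n. ((1/2) ^ Suc n) powr (D + e) \<le> prob (cell ((1/2) ^ Suc n) (cell_index ((1/2) ^ Suc n) x))) sequentially"
    by (subst eventually_sequentially_Suc)
   then show ?case
   proof eventually_elim
    case (elim n)
    define h :: real where "h = (1/2) ^ Suc n"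
    have hp: "0 < h" by (simp add: h_def)
    \<comment> \<open>A cell has diameter at most twice its side, so the ball of level
      \<open>n\<close> is compared with the cell of level \<open>Suc n\<close>.\<close>
    have "cell h (cell_index h x) \<subseteq> cball x ((1/2) ^ n)"
    proof
     fix y assume y: "y \<in> cell h (cell_index h x)"
     have x: "x \<in> cell h (cell_index h x)" using hp by (simp add: cell_index)
     have "\<bar>fst x - fst y\<bar> \<le> h" "\<bar>snd x - snd y\<bar> \<le> h"
      using mesh_close(2)[OF hp, of "fst x" "fst (cell_index h x)" "fst y" "fst (cell_index h x)"]
       mesh_close(2)[OF hp, of "snd x" "snd (cell_index h x)" "snd y" "snd (cell_index h x)"] x y
      by (simp_all add: mem_Times_iff)
     then have "dist x y \<le> 2 * h" using dist_prod_le[of x y] by linarith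
     then show "y \<in> cball x ((1/2) ^ n)" by (simp add: h_def)
    qed
    then have "prob (cell h (cell_index h x)) \<le> prob (cball x ((1/2) ^ n))"
     using sets_borel by (intro finite_measure_mono) auto
    then have "h powr (D + e) \<le> prob (cball x ((1/2) ^ n))" using elim by (simp add: h_def)
    moreover have "h powr (D + e) = (1/2) powr (D + e) * ((1/2) ^ n) powr (D + e)"
     unfolding h_def power_Suc by (rule powr_mult)
    ultimately show ?case by simp
   qed
  qed
  then have "packing_dim_measure \<mu> \<le> ereal (D + e)"
   using D0 e by (intro packing_dim_measure_le[OF prob_space_axioms sets_borel, of _ "(1/2) powr (D + e)"]) auto
  then show "packing_dim_measure \<mu> \<le> ereal D + ereal e" by simp
 qed
 have haus: "ereal D \<le> hausdorff_dim_measure \<mu>"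
 \<comment> \<open>The mass distribution bound is for positive exponents, so \<open>D = 0\<close> is
   treated by nonnegativity of the dimension.\<close>
 proof (cases "D = 0")
  case True
  have "0 \<le> hausdorff_dim_measure \<mu>"
   unfolding hausdorff_dim_measure_def using hausdorff_dim_nonneg by (intro INF_greatest) auto
  then show ?thesis by (simp add: True zero_ereal_def)
 next
  case False
  then have Dp: "0 < D" using D0 by simp
  show ?thesis
  proof (rule ereal_le_epsilon2)
   fix e :: real assume e: "0 < e"
   define e' where "e' = min e (D / 2)"
   have e': "0 < e'" "e' < D" "e' \<le> e" using e Dp by (auto simp: e'_def)
   obtain q C where q: "1 < q" "\<And>\<delta>. \<delta> \<in> {0<..1} \<Longrightarrow> moment2 \<mu> q \<delta> \<le> C * \<delta> powr (- ((- D + e' / 2) * (q - 1)))"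
    using H1[OF half_gt_zero[OF e'(1)]] by blast
   have "AE x in \<mu>. eventually (\<lambda>n. prob (cball x ((1/2) ^ n)) \<le> ((1/2) ^ n) powr (D - e')) sequentially"
   proof (rule local_lower[OF q(1)])
    have "(- D + e' / 2) * (q - 1) < (- D + e') * (q - 1)" using q(1) e' by (intro mult_strict_right_mono) auto
    then show "(- D + e' / 2) * (q - 1) < - (D - e') * (q - 1)" by simp
   qed (use q in auto)
   then have "ereal (D - e') \<le> hausdorff_dim_measure \<mu>"
    using e' by (intro hausdorff_dim_measure_ge[OF prob_space_axioms sets_borel, of _ 1]) auto
   then have "ereal (D - e') + ereal e' \<le> hausdorff_dim_measure \<mu> + ereal e"
    using e' by (intro add_mono) auto
   then show "ereal D \<le> hausdorff_dim_measure \<mu> + ereal e" by simp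
  qed
 qed
 have "hausdorff_dim_measure \<mu> \<le> packing_dim_measure \<mu>"
  unfolding hausdorff_dim_measure_def packing_dim_measure_def
  by (intro INF_mono) (use hausdorff_le_packing_dim in blast)
 then show ?thesis using pack haus edim by (metis antisym order_trans)
qed

end

subsection \<open>The pressure near \<open>q = 1\<close>\<close>

text \<open>For negative \<open>x\<close> the bound is inverted: \<open>1 - y + y\<^sup>2\<close>
  times the quadratic Taylor polynomial of \<open>exp y\<close> is at least 1 for
  \<open>y \<ge> 0\<close>.\<close>

lemma exp_le_quadratic:
 fixes x :: real
 assumes "\<bar>x\<bar> \<le> 1"
 shows "exp x \<le> 1 + x + x\<^sup>2"
proof (cases "0 \<le> x")
 case True
 then show ?thesis using exp_bound[of x] assms by simp
next
 case False
 define y where "y = - x"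
 have y: "0 \<le> y" using False by (simp add: y_def)
 have q: "1 + y + y\<^sup>2 / 2 \<le> exp y" by (rule exp_lower_Taylor_quadratic[OF y])
 have "1 - y + y\<^sup>2 = (y - 1 / 2)\<^sup>2 + 3 / 4" by (simp add: power2_eq_square algebra_simps)
 then have pos: "0 \<le> 1 - y + y\<^sup>2" by simp
 have "1 \<le> (1 - y + y\<^sup>2) * (1 + y + y\<^sup>2 / 2)"
 proof -
  have "(1 - y + y\<^sup>2) * (1 + y + y\<^sup>2 / 2) = 1 + (y ^ 2 / 2 + y ^ 3 / 2 + y ^ 4 / 2)"
   by (simp add: field_simps power2_eq_square power3_eq_cube power4_eq_xxxx)
  then show ?thesis using y by simp
 qed
 also have "\<dots> \<le> (1 - y + y\<^sup>2) * exp y" using q pos by (rule mult_left_mono)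
 finally have "exp (- y) \<le> 1 - y + y\<^sup>2" by (simp add: exp_minus field_simps)
 then show ?thesis by (simp add: y_def)
qed

lemma has_derivative_squeeze:
 fixes f :: "real \<Rightarrow> real"
 assumes f: "f 1 = 0"
  and le: "\<And>\<epsilon>. 0 < \<epsilon> \<Longrightarrow> \<forall>\<^sub>F u in at 0. g * u - \<epsilon> * \<bar>u\<bar> \<le> f (1 + u) \<and> f (1 + u) \<le> g * u + \<epsilon> * \<bar>u\<bar>"
 shows "(f has_real_derivative g) (at 1)"
 unfolding DERIV_def
proof (rule tendstoI)
 fix e :: real assume e: "0 < e"
 show "\<forall>\<^sub>F u in at 0. dist ((f (1 + u) - f 1) / u) g < e"
  using le[OF half_gt_zero[OF e]] eventually_neq_at_within[of 0]
 proof eventually_elim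
  case (elim u)
  have "\<bar>f (1 + u) - g * u\<bar> \<le> (e / 2) * \<bar>u\<bar>" using elim(1) by linarith
  moreover have "(f (1 + u) - f 1) / u - g = (f (1 + u) - g * u) / u" using elim(2) f by (simp add: field_simps)
  ultimately have "\<bar>(f (1 + u) - f 1) / u - g\<bar> \<le> e / 2" using elim(2) by (simp add: abs_divide pos_divide_le_eq)
  then show ?case using e by (simp add: dist_real_def)
 qed
qed

lemma has_derivative_bound:
 fixes f :: "real \<Rightarrow> real"
 assumes f: "(f has_real_derivative g) (at 1)" "f 1 = 0" and e: "0 < \<epsilon>"
 shows "\<forall>\<^sub>F u in at 0. \<bar>f (1 + u) - g * u\<bar> \<le> \<epsilon> * \<bar>u\<bar>"
 using tendstoD[OF f(1)[unfolded DERIV_def] e] eventually_neq_at_within[of 0]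
proof eventually_elim
 case (elim u)
 have "(f (1 + u) - f 1) / u - g = (f (1 + u) - g * u) / u" using elim(2) f(2) by (simp add: diff_divide_distrib)
 then have "\<bar>f (1 + u) - g * u\<bar> / \<bar>u\<bar> < \<epsilon>" using elim(1) by (metis abs_divide dist_real_def)
 then show ?case using elim(2) by (simp add: pos_divide_less_eq less_imp_le)
qed

text \<open>Only the numerical data. They are symmetric in \<open>c\<close> and \<open>d\<close>, so
  the locale can be interpreted a second time with the coordinates exchanged.\<close>

locale weights =
 fixes I :: "'i set" and p c d :: "'i \<Rightarrow> real"
 assumes fin: "finite I" and ne: "I \<noteq> {}"
  and c: "\<And>i. i \<in> I \<Longrightarrow> 0 < c i" "\<And>i. i \<in> I \<Longrightarrow> c i < 1"
  and d: "\<And>i. i \<in> I \<Longrightarrow> 0 < d i" "\<And>i. i \<in> I \<Longrightarrow> d i < 1"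
  and p: "\<And>i. i \<in> I \<Longrightarrow> 0 < p i" "(\<Sum>i\<in>I. p i) = 1"
begin

abbreviation "cw \<equiv> word_prod c"
abbreviation "dw \<equiv> word_prod d"
abbreviation "pw \<equiv> word_prod p"
abbreviation "\<psi> t t' \<equiv> psi p c d (\<lambda>_. t) (\<lambda>_. t')"

lemma nz: "i \<in> I \<Longrightarrow> c i \<noteq> 0" "i \<in> I \<Longrightarrow> d i \<noteq> 0" "i \<in> I \<Longrightarrow> p i \<noteq> 0"
 using c(1)[of i] d(1)[of i] p(1)[of i] by auto

definition gA where "gA q t s i = p i powr q * c i powr t * d i powr (s - t)"
definition sumA where "sumA q t s = (\<Sum>i\<in>I. gA q t s i)"
text \<open>Logarithm of \<open>gA (1 + u) t s i / p i\<close>. Its mean \<open>lin\<close> under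
  \<open>p\<close> is the first-order part of \<open>sumA (1 + u) t s - 1\<close>.\<close>

definition xA where "xA u t s i = u * ln (p i) + t * ln (c i / d i) + s * ln (d i)"
definition lin where "lin u t s = (\<Sum>i\<in>I. p i * xA u t s i)"
text \<open>\<open>h\<close> is the entropy of the probability vector; \<open>\<chi>1\<close> and
  \<open>\<chi>2\<close> are the Lyapunov exponents of the two coordinates.\<close>

definition h where "h = - (\<Sum>i\<in>I. p i * ln (p i))"
definition \<chi>1 where "\<chi>1 = - (\<Sum>i\<in>I. p i * ln (c i))"
definition \<chi>2 where "\<chi>2 = - (\<Sum>i\<in>I. p i * ln (d i))"
text \<open>The number for which \<open>lin u (t1 * u) (slope t1 * u)\<close> vanishes, hence the
  candidate for the derivative of \<open>\<gamma>A\<close> at 1.\<close>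

definition slope where "slope t1 = (- h + t1 * (\<chi>2 - \<chi>1)) / \<chi>2"

lemma \<chi>_pos: "0 < \<chi>1" "0 < \<chi>2"
proof -
 have "(\<Sum>i\<in>I. p i * ln (c i)) < (\<Sum>i\<in>I. 0)" "(\<Sum>i\<in>I. p i * ln (d i)) < (\<Sum>i\<in>I. 0)"
  using fin ne c d p by (intro sum_strict_mono mult_pos_neg; simp)+
 then show "0 < \<chi>1" "0 < \<chi>2" by (simp_all add: \<chi>1_def \<chi>2_def)
qed

lemma gA_pos: "i \<in> I \<Longrightarrow> 0 < gA q t s i"
 using c[of i] d[of i] p(1)[of i] by (simp add: gA_def)

lemma gA_exp: "i \<in> I \<Longrightarrow> gA (1 + u) t s i = p i * exp (xA u t s i)"
proof -
 assume i: "i \<in> I"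
 have pos: "0 < p i" "0 < c i" "0 < d i" using c[OF i] d[OF i] p(1)[OF i] by auto
 have "gA (1 + u) t s i = exp ((1 + u) * ln (p i) + t * ln (c i) + (s - t) * ln (d i))"
  using pos by (simp add: gA_def powr_def exp_add)
 also have "(1 + u) * ln (p i) + t * ln (c i) + (s - t) * ln (d i) = ln (p i) + xA u t s i"
  using pos by (simp add: xA_def ln_div algebra_simps)
 finally show ?thesis using pos by (simp add: exp_add)
qed

lemma lin_eq: "lin u t s = - u * h + t * (\<chi>2 - \<chi>1) - s * \<chi>2"
proof -
 have "lin u t s = (\<Sum>i\<in>I. u * (p i * ln (p i)) + t * (p i * ln (c i)) - t * (p i * ln (d i)) + s * (p i * ln (d i)))"
  unfolding lin_def xA_def using c d by (intro sum.cong refl) (simp add: nz ln_div algebra_simps)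
 also have "\<dots> = - u * h + t * (\<chi>2 - \<chi>1) - s * \<chi>2"
  by (simp add: sum.distrib sum_subtractf sum_distrib_left[symmetric] h_def \<chi>1_def \<chi>2_def algebra_simps)
 finally show ?thesis .
qed

lemma lin_slope: "lin u t (slope t1 * u + \<sigma>) = (t - t1 * u) * (\<chi>2 - \<chi>1) - \<sigma> * \<chi>2"
proof -
 have "slope t1 * u * \<chi>2 = u * (- h + t1 * (\<chi>2 - \<chi>1))" using \<chi>_pos by (simp add: slope_def)
 then show ?thesis unfolding lin_eq by (simp add: algebra_simps)
qed

lemma sumA_ge: "1 + lin u t s \<le> sumA (1 + u) t s"
proof -
 have "1 + lin u t s = (\<Sum>i\<in>I. p i * (1 + xA u t s i))" using p by (simp add: lin_def algebra_simps sum.distrib)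
 also have "\<dots> \<le> (\<Sum>i\<in>I. p i * exp (xA u t s i))"
  using p by (intro sum_mono mult_left_mono exp_ge_add_one_self) (auto intro: less_imp_le)
 also have "\<dots> = sumA (1 + u) t s" unfolding sumA_def by (intro sum.cong refl gA_exp[symmetric])
 finally show ?thesis .
qed

lemma sumA_le:
 assumes M: "\<And>i. i \<in> I \<Longrightarrow> \<bar>xA u t s i\<bar> \<le> m" "m \<le> 1"
 shows "sumA (1 + u) t s \<le> 1 + lin u t s + m\<^sup>2"
proof -
 have "sumA (1 + u) t s = (\<Sum>i\<in>I. p i * exp (xA u t s i))" unfolding sumA_def by (intro sum.cong refl gA_exp)
 also have "\<dots> \<le> (\<Sum>i\<in>I. p i * (1 + xA u t s i + m\<^sup>2))"
 proof (intro sum_mono mult_left_mono)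
  fix i assume i: "i \<in> I"
  have "exp (xA u t s i) \<le> 1 + xA u t s i + (xA u t s i)\<^sup>2" using M(1)[OF i] M(2) by (intro exp_le_quadratic) linarith
  also have "(xA u t s i)\<^sup>2 \<le> m\<^sup>2" using M(1)[OF i] abs_le_square_iff[of "xA u t s i" m] by linarith
  finally show "exp (xA u t s i) \<le> 1 + xA u t s i + m\<^sup>2" by simp
  show "0 \<le> p i" using p(1)[OF i] by simp
 qed
 also have "\<dots> = 1 + lin u t s + m\<^sup>2"
  using p(2) by (simp add: lin_def algebra_simps sum.distrib sum_distrib_left[symmetric] sum_distrib_right[symmetric])
 finally show ?thesis .
qed

lemma sumA_pos: "0 < sumA q t s"
 unfolding sumA_def using fin ne gA_pos by (intro sum_pos) auto

lemma sumA_strict_anti: "s < s' \<Longrightarrow> sumA q t s' < sumA q t s"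
 unfolding sumA_def gA_def using fin ne c d p nz
 by (intro sum_strict_mono mult_strict_left_mono powr_less_mono') (simp_all add: zero_less_mult_iff)

lemma sumA_continuous: "continuous_on UNIV (\<lambda>s. sumA q t s)" "continuous_on UNIV (\<lambda>t. sumA q t s)"
 unfolding sumA_def gA_def using nz by (auto intro!: continuous_intros)

text \<open>With \<open>\<rho>\<close> the largest ratio, \<open>a * \<rho> powr s\<close> bounds
  the sum from above for \<open>s \<ge> 0\<close> and from below for \<open>s \<le> 0\<close>. The
  point \<open>s0\<close> where this bound equals 1 therefore brackets the root together with
  0.\<close>

lemma ex1_root: "\<exists>!s. sumA q t s = 1"
proof -
 define \<rho> where "\<rho> = Max (d ` I)"
 have "\<rho> \<in> d ` I" unfolding \<rho>_def using fin ne by (intro Max_in) auto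
 then have \<rho>: "0 < \<rho>" "\<rho> < 1" using d by auto
 have dl: "d i \<le> \<rho>" if "i \<in> I" for i using that fin unfolding \<rho>_def by auto
 define a where "a = sumA q t 0"
 have a: "0 < a" by (simp add: a_def sumA_pos)
 have up: "sumA q t s \<le> a * \<rho> powr s" if "0 \<le> s" for s
 proof -
  have "sumA q t s = (\<Sum>i\<in>I. gA q t 0 i * d i powr s)"
   unfolding sumA_def gA_def by (intro sum.cong refl) (simp add: powr_add[symmetric])
  also have "\<dots> \<le> (\<Sum>i\<in>I. gA q t 0 i * \<rho> powr s)"
   using dl d that gA_pos by (intro sum_mono mult_left_mono powr_mono2) (auto intro: less_imp_le)
  finally show ?thesis by (simp add: a_def sumA_def sum_distrib_right)
 qed
 have lo: "a * \<rho> powr s \<le> sumA q t s" if "s \<le> 0" for s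
 proof -
  have "a * \<rho> powr s = (\<Sum>i\<in>I. gA q t 0 i * \<rho> powr s)" by (simp add: a_def sumA_def sum_distrib_right)
  also have "\<dots> \<le> (\<Sum>i\<in>I. gA q t 0 i * d i powr s)"
   using dl d that gA_pos by (intro sum_mono mult_left_mono powr_mono2') (auto intro: less_imp_le)
  also have "\<dots> = sumA q t s"
   unfolding sumA_def gA_def by (intro sum.cong refl) (simp add: powr_add[symmetric])
  finally show ?thesis .
 qed
 define s0 where "s0 = ln (1 / a) / ln \<rho>"
 have s0: "a * \<rho> powr s0 = 1"
  using a \<rho> by (simp add: s0_def powr_def)
 have "\<exists>s\<ge>min s0 0. s \<le> max s0 0 \<and> sumA q t s = 1"
 proof (rule IVT2')
  show "sumA q t (max s0 0) \<le> 1"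
  proof (cases "s0 \<ge> 0")
   case True
   then show ?thesis using up[of s0] s0 by (simp add: max_def)
  next
   case False
   have "a = a * \<rho> powr 0" using \<rho> by simp
   also have "\<dots> \<le> a * \<rho> powr s0" using False \<rho> a by (intro mult_left_mono powr_mono') auto
   finally show ?thesis using False s0 by (simp add: max_def a_def)
  qed
  show "1 \<le> sumA q t (min s0 0)"
  proof (cases "s0 \<le> 0")
   case True
   then show ?thesis using lo[of s0] s0 by (simp add: min_def)
  next
   case False
   have "a * \<rho> powr s0 \<le> a * \<rho> powr 0" using False \<rho> a by (intro mult_left_mono powr_mono') auto
   then show ?thesis using False s0 \<rho> by (simp add: min_def a_def)
  qed
  show "continuous_on {min s0 0..max s0 0} (sumA q t)"
   using sumA_continuous(1)[of q t] continuous_on_subset by blast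
 qed auto
 then obtain s where s: "sumA q t s = 1" by blast
 show ?thesis
 proof (rule ex1I[of _ s])
  fix s' assume "sumA q t s' = 1"
  then show "s' = s" using s sumA_strict_anti[of s s' q t] sumA_strict_anti[of s' s q t] by (cases s s' rule: linorder_cases) auto
 qed (rule s)
qed

definition sroot where "sroot q t = (THE s. sumA q t s = 1)"

lemma sroot: "sumA q t (sroot q t) = 1"
 unfolding sroot_def by (rule theI'[OF ex1_root])

lemma sroot_less: "sumA q t s < 1 \<Longrightarrow> sroot q t < s" "1 < sumA q t s \<Longrightarrow> s < sroot q t"
 "sumA q t s \<le> 1 \<Longrightarrow> sroot q t \<le> s" "1 \<le> sumA q t s \<Longrightarrow> s \<le> sroot q t"
 using sroot[of q t] sumA_strict_anti[of s "sroot q t" q t] sumA_strict_anti[of "sroot q t" s q t]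
 by (cases s "sroot q t" rule: linorder_cases; auto)+

lemma sumA_root: "s < sroot q t \<Longrightarrow> 1 < sumA q t s" "sroot q t < s \<Longrightarrow> sumA q t s < 1"
 using sroot[of q t] sumA_strict_anti[of s "sroot q t" q t] sumA_strict_anti[of "sroot q t" s q t] by auto

lemma gamma_A_root: "gamma_A I p c d \<tau> q = sroot q (\<tau> q)"
 unfolding gamma_A_def sroot_def sumA_def gA_def by simp

text \<open>To first order the sum is \<open>1 + lin\<close>, and moving \<open>s\<close> by
  \<open>\<epsilon> * \<bar>u\<bar>\<close> shifts \<open>lin\<close> by
  \<open>\<epsilon> * \<chi>2 * \<bar>u\<bar>\<close>, which beats the quadratic error. Uniformity
  in \<open>t\<close> allows the spectrum to be replaced by a slightly larger exponent. On the lower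
  side positivity of \<open>lin\<close> is recorded, which the variance argument needs beyond a sum
  exceeding 1.\<close>

lemma key_estimate:
 assumes e: "0 < \<epsilon>"
 shows "\<exists>\<eta>>0. \<forall>\<^sub>F u in at 0. \<forall>t. \<bar>t - t1 * u\<bar> \<le> \<eta> * \<bar>u\<bar> \<longrightarrow>
   sumA (1 + u) t (slope t1 * u + \<epsilon> * \<bar>u\<bar>) < 1 \<and> 0 < lin u t (slope t1 * u - \<epsilon> * \<bar>u\<bar>)"
proof -
 \<comment> \<open>Lets the deviation of \<open>t\<close> from \<open>t1 * u\<close> change
   \<open>lin\<close> by at most half of the gain
   \<open>\<epsilon> * \<chi>2 * \<bar>u\<bar>\<close>.\<close>
 define \<eta> where "\<eta> = \<epsilon> * \<chi>2 / (2 * (\<bar>\<chi>2 - \<chi>1\<bar> + 1))"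
 have \<eta>: "0 < \<eta>" "\<eta> * \<bar>\<chi>2 - \<chi>1\<bar> \<le> \<epsilon> * \<chi>2 / 2"
 proof -
  show "0 < \<eta>" unfolding \<eta>_def using e \<chi>_pos by (intro divide_pos_pos mult_pos_pos) auto
  have "\<eta> * \<bar>\<chi>2 - \<chi>1\<bar> \<le> \<eta> * (\<bar>\<chi>2 - \<chi>1\<bar> + 1)" using \<open>0 < \<eta>\<close> by (intro mult_left_mono) auto
  also have "\<dots> = \<epsilon> * \<chi>2 / 2"
  proof -
   have "e / (2 * K) * K = e / 2" if "0 < K" for e K :: real using that by simp
   then show ?thesis unfolding \<eta>_def by (meson abs_ge_zero add_nonneg_pos zero_less_one)
  qed
  finally show "\<eta> * \<bar>\<chi>2 - \<chi>1\<bar> \<le> \<epsilon> * \<chi>2 / 2" .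
 qed
 define T where "T = \<bar>t1\<bar> + \<eta>"
 define Sg where "Sg = \<bar>slope t1\<bar> + \<epsilon>"
 define m where "m i = \<bar>ln (p i)\<bar> + T * \<bar>ln (c i / d i)\<bar> + Sg * \<bar>ln (d i)\<bar>" for i
 define M where "M = 1 + (\<Sum>i\<in>I. m i)"
 have TS: "0 \<le> T" "0 \<le> Sg" using \<eta> e by (auto simp: T_def Sg_def)
 have m0: "0 \<le> m i" for i using TS by (simp add: m_def)
 have M1: "1 \<le> M" unfolding M_def using m0 by (simp add: sum_nonneg)
 have mM: "m i \<le> M" if "i \<in> I" for i
 proof -
  have "m i \<le> (\<Sum>i\<in>I. m i)" using that fin m0 by (intro member_le_sum) auto
  then show ?thesis by (simp add: M_def)
 qed
 \<comment> \<open>The first bound makes every exponent at most 1 in absolute value, so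
   \<open>exp_le_quadratic\<close> applies; the second limits the quadratic error to a quarter of
   the gain.\<close>
 define r where "r = min (1 / M) (\<epsilon> * \<chi>2 / (4 * M\<^sup>2))"
 have r: "0 < r" using M1 e \<chi>_pos by (simp add: r_def)
 have "\<forall>\<^sub>F u in at 0. 0 < \<bar>u\<bar> \<and> \<bar>u\<bar> < r"
  using r unfolding eventually_at by (intro exI[of _ r]) (auto simp: dist_real_def)
 then show ?thesis
 proof (intro exI[of _ \<eta>] conjI \<eta>(1), elim eventually_mono, intro allI impI)
  fix u t :: real assume "0 < \<bar>u\<bar> \<and> \<bar>u\<bar> < r" and t: "\<bar>t - t1 * u\<bar> \<le> \<eta> * \<bar>u\<bar>"
  then have u: "0 < \<bar>u\<bar>" "\<bar>u\<bar> < r" by auto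
  have tb: "\<bar>(t - t1 * u) * (\<chi>2 - \<chi>1)\<bar> \<le> \<epsilon> * \<chi>2 / 2 * \<bar>u\<bar>"
  proof -
   have "\<bar>(t - t1 * u) * (\<chi>2 - \<chi>1)\<bar> \<le> \<eta> * \<bar>u\<bar> * \<bar>\<chi>2 - \<chi>1\<bar>" unfolding abs_mult using t by (intro mult_right_mono) auto
   also have "\<dots> = \<eta> * \<bar>\<chi>2 - \<chi>1\<bar> * \<bar>u\<bar>" by simp
   also have "\<dots> \<le> \<epsilon> * \<chi>2 / 2 * \<bar>u\<bar>" using \<eta>(2) by (intro mult_right_mono) auto
   finally show ?thesis .
  qed
  have eu: "0 < \<epsilon> * \<chi>2 * \<bar>u\<bar>" using e \<chi>_pos u by simp
  have l1: "lin u t (slope t1 * u + \<epsilon> * \<bar>u\<bar>) \<le> - (\<epsilon> * \<chi>2 * \<bar>u\<bar> / 2)"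
   unfolding lin_slope using abs_le_D1[OF tb] by (simp add: mult.commute mult.left_commute)
  have "slope t1 * u - \<epsilon> * \<bar>u\<bar> = slope t1 * u + (- (\<epsilon> * \<bar>u\<bar>))" by simp
  then have "lin u t (slope t1 * u - \<epsilon> * \<bar>u\<bar>) = (t - t1 * u) * (\<chi>2 - \<chi>1) + \<epsilon> * \<bar>u\<bar> * \<chi>2"
   by (simp only: lin_slope) simp
  then have l2: "0 < lin u t (slope t1 * u - \<epsilon> * \<bar>u\<bar>)" using abs_le_D2[OF tb] eu by (simp add: mult.commute mult.left_commute)
  define s where "s = slope t1 * u + \<epsilon> * \<bar>u\<bar>"
  have tT: "\<bar>t\<bar> \<le> T * \<bar>u\<bar>"
  proof -
   have "\<bar>t\<bar> \<le> \<bar>t1 * u\<bar> + \<eta> * \<bar>u\<bar>" using t by linarith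
   then show ?thesis by (simp add: T_def abs_mult algebra_simps)
  qed
  have sS: "\<bar>s\<bar> \<le> Sg * \<bar>u\<bar>"
  proof -
   have "\<bar>s\<bar> \<le> \<bar>slope t1 * u\<bar> + \<epsilon> * \<bar>u\<bar>" unfolding s_def using e by (smt (verit) abs_mult_pos abs_triangle_ineq abs_ge_zero abs_of_nonneg mult_nonneg_nonneg)
   then show ?thesis by (simp add: Sg_def abs_mult algebra_simps)
  qed
  have x: "\<bar>xA u t s i\<bar> \<le> M * \<bar>u\<bar>" if i: "i \<in> I" for i
  proof -
   have "\<bar>xA u t s i\<bar> \<le> \<bar>u\<bar> * \<bar>ln (p i)\<bar> + \<bar>t\<bar> * \<bar>ln (c i / d i)\<bar> + \<bar>s\<bar> * \<bar>ln (d i)\<bar>"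
    unfolding xA_def by (rule order_trans[OF abs_triangle_ineq] add_mono)+ (auto simp: abs_mult intro: order_trans[OF abs_triangle_ineq])
   also have "\<dots> \<le> \<bar>u\<bar> * \<bar>ln (p i)\<bar> + (T * \<bar>u\<bar>) * \<bar>ln (c i / d i)\<bar> + (Sg * \<bar>u\<bar>) * \<bar>ln (d i)\<bar>"
    using tT sS by (intro add_mono mult_right_mono) auto
   also have "\<dots> = m i * \<bar>u\<bar>" by (simp add: m_def algebra_simps)
   also have "\<dots> \<le> M * \<bar>u\<bar>" using mM[OF i] by (intro mult_right_mono) auto
   finally show ?thesis .
  qed
  have "M * \<bar>u\<bar> \<le> M * (1 / M)" using u(2) M1 by (intro mult_left_mono) (auto simp: r_def)
  then have Mu: "M * \<bar>u\<bar> \<le> 1" using M1 by simp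
  have "sumA (1 + u) t s \<le> 1 + lin u t s + (M * \<bar>u\<bar>)\<^sup>2" using x Mu by (rule sumA_le)
  also have "(M * \<bar>u\<bar>)\<^sup>2 \<le> \<epsilon> * \<chi>2 * \<bar>u\<bar> / 4"
  proof -
   have "M\<^sup>2 * \<bar>u\<bar> \<le> M\<^sup>2 * (\<epsilon> * \<chi>2 / (4 * M\<^sup>2))" using u(2) by (intro mult_left_mono) (auto simp: r_def)
   also have "\<dots> = \<epsilon> * \<chi>2 / 4" using M1 by simp
   finally have "M\<^sup>2 * \<bar>u\<bar> * \<bar>u\<bar> \<le> \<epsilon> * \<chi>2 / 4 * \<bar>u\<bar>" by (intro mult_right_mono) auto
   then show ?thesis by (simp add: power2_eq_square ac_simps)
  qed
  also have "1 + lin u t s + \<epsilon> * \<chi>2 * \<bar>u\<bar> / 4 < 1" using l1 eu unfolding s_def by linarith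
  finally show "sumA (1 + u) t (slope t1 * u + \<epsilon> * \<bar>u\<bar>) < 1 \<and> 0 < lin u t (slope t1 * u - \<epsilon> * \<bar>u\<bar>)"
   using l2 by (simp add: s_def)
 qed
qed

lemma sroot_one: "sroot 1 0 = 0"
proof -
 have "sumA 1 0 0 = 1" unfolding sumA_def gA_def using p nz by (simp add: less_imp_le)
 then show ?thesis using sroot_less(3,4)[of 1 0 0] by simp
qed

theorem gamma_A_derivative:
 assumes \<tau>: "(\<tau> has_real_derivative t1) (at 1)" "\<tau> 1 = 0"
 shows "(gamma_A I p c d \<tau> has_real_derivative slope t1) (at 1)"
proof (rule has_derivative_squeeze)
 show "gamma_A I p c d \<tau> 1 = 0" by (simp add: gamma_A_root \<tau>(2) sroot_one)
 fix \<epsilon> :: real assume "0 < \<epsilon>"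
 from key_estimate[OF this, of t1] obtain \<eta> where \<eta>: "0 < \<eta>" and
  ev: "\<forall>\<^sub>F u in at 0. \<forall>t. \<bar>t - t1 * u\<bar> \<le> \<eta> * \<bar>u\<bar> \<longrightarrow>
   sumA (1 + u) t (slope t1 * u + \<epsilon> * \<bar>u\<bar>) < 1 \<and> 0 < lin u t (slope t1 * u - \<epsilon> * \<bar>u\<bar>)" by blast
 show "\<forall>\<^sub>F u in at 0. slope t1 * u - \<epsilon> * \<bar>u\<bar> \<le> gamma_A I p c d \<tau> (1 + u) \<and>
   gamma_A I p c d \<tau> (1 + u) \<le> slope t1 * u + \<epsilon> * \<bar>u\<bar>"
  using ev has_derivative_bound[OF \<tau> \<eta>]
 proof eventually_elim
  case (elim u)
  then show ?case
   using sroot_less(3,4)[of "1 + u" "\<tau> (1 + u)"] sumA_ge[of u "\<tau> (1 + u)" "slope t1 * u - \<epsilon> * \<bar>u\<bar>"]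
   unfolding gamma_A_root by force
 qed
qed

text \<open>All words of all lengths together give a geometric series. The bound is independent of
  \<open>Z\<close>, as required for cuts that vary with the scale.\<close>

lemma finite_word_sum:
 assumes g: "\<And>i. i \<in> I \<Longrightarrow> 0 \<le> g i" "(\<Sum>i\<in>I. g i) < (1::real)" and Z: "finite Z" "\<forall>w\<in>Z. set w \<subseteq> I"
 shows "(\<Sum>w\<in>Z. word_prod g w) \<le> 1 / (1 - (\<Sum>i\<in>I. g i))"
proof -
 define a where "a = (\<Sum>i\<in>I. g i)"
 have a: "0 \<le> a" "a < 1" using g by (auto simp: a_def intro: sum_nonneg)
 have wp: "0 \<le> word_prod g w" if "set w \<subseteq> I" for w
  using that g(1) by (induction w) auto
 define N where "N = Max (insert 0 (length ` Z))"
 have len: "length w \<le> N" if "w \<in> Z" for w unfolding N_def using Z(1) that by (intro Max_ge) auto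
 have "(\<Sum>w\<in>Z. word_prod g w) \<le> (\<Sum>w\<in>(\<Union>k\<in>{..N}. words I k). word_prod g w)"
  using Z len finite_words[OF fin] wp by (intro sum_mono2) (auto simp: words_def)
 also have "\<dots> = (\<Sum>k\<in>{..N}. \<Sum>w\<in>words I k. word_prod g w)"
  using finite_words[OF fin] by (intro sum.UNION_disjoint) (auto simp: words_def)
 also have "\<dots> = (\<Sum>k\<in>{..N}. a ^ k)" by (simp add: sum_word_prod a_def)
 also have "\<dots> \<le> 1 / (1 - a)"
 proof -
  have "(\<Sum>k\<in>{..N}. a ^ k) = (1 - a ^ Suc N) / (1 - a)" using a sum_gp0[of a N] by simp
  also have "\<dots> \<le> 1 / (1 - a)" using a by (intro divide_right_mono) auto
  finally show ?thesis .
 qed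
 finally show ?thesis by (simp add: a_def)
qed

end

section \<open>The pressure: existence, monotonicity and first-order behaviour\<close>

lemma root_tendsto_le:
 assumes P: "(\<lambda>k. root k (x k)) \<longlonglongrightarrow> P" and Q: "(\<lambda>k. root k (y k)) \<longlonglongrightarrow> Q"
  and K: "0 < K" "\<And>k. x k \<le> K * y k"
 shows "P \<le> (Q :: real)"
proof (rule tendsto_le[OF sequentially_bot _ P])
 show "(\<lambda>k. root k K * root k (y k)) \<longlonglongrightarrow> Q" using tendsto_mult[OF LIMSEQ_root_const[OF K(1)] Q] by simp
 show "\<forall>\<^sub>F k in sequentially. root k (x k) \<le> root k K * root k (y k)"
  using eventually_gt_at_top[of 0]
 proof eventually_elim
  case (elim k)
  show ?case using real_root_le_mono[OF elim K(2)] by (simp add: real_root_mult)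
 qed
qed

lemma root_power_tendsto: "0 \<le> m \<Longrightarrow> (\<lambda>k. root k (m ^ k)) \<longlonglongrightarrow> m"
 by (rule tendsto_eventually, use eventually_gt_at_top[of 0] in eventually_elim) (simp add: real_root_power_cancel)

text \<open>Fekete's lemma for \<open>- ln (x k)\<close> yields the limit. It dominates each
  \<open>root k (x k)\<close>, as seen along the multiples of \<open>k\<close>; this gives the
  strict inequality.\<close>

lemma root_supermultiplicative:
 fixes x :: "nat \<Rightarrow> real"
 assumes pos: "\<And>k. 0 < x k" and super: "\<And>m n. x m * x n \<le> x (m + n)" and le: "\<And>k. x k \<le> a ^ k"
 shows "\<exists>P. (\<lambda>k. root k (x k)) \<longlonglongrightarrow> P \<and> (\<forall>k>0. 1 < x k \<longrightarrow> 1 < P)"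
proof -
 have a: "0 < a" using le[of 1] pos[of 1] by simp
 have b: "- ln (x k) \<ge> - \<bar>ln a\<bar> * (real k + 1)" for k
 proof -
  have "ln (x k) \<le> ln (a ^ k)" using pos le a by (subst ln_le_cancel_iff) auto
  also have "\<dots> = real k * ln a" using a by (simp add: ln_realpow)
  also have "\<dots> \<le> real k * \<bar>ln a\<bar>" by (intro mult_left_mono) auto
  also have "\<dots> \<le> (real k + 1) * \<bar>ln a\<bar>" by (intro mult_right_mono) auto
  finally show ?thesis by (simp add: mult.commute)
 qed
 have "\<exists>L. (\<lambda>k. - ln (x k) / real k) \<longlonglongrightarrow> L"
 proof (rule fekete[OF _ b])
  fix m n
  have "ln (x m * x n) \<le> ln (x (m + n))" using pos super by (subst ln_le_cancel_iff) auto
  then show "- ln (x (m + n)) \<le> - ln (x m) + - ln (x n)" using pos[of m] pos[of n] by (simp add: ln_mult)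
 qed simp
 then obtain L where L: "(\<lambda>k. - ln (x k) / real k) \<longlonglongrightarrow> L" by blast
 have e: "\<forall>\<^sub>F k in sequentially. exp (- (- ln (x k) / real k)) = root k (x k)"
  using eventually_gt_at_top[of 0]
 proof eventually_elim
  case (elim k)
  have "root k (x k) = exp (ln (x k) / real k)" using elim pos[of k] by (simp add: root_powr_inverse powr_def divide_inverse mult.commute)
  then show ?case by simp
 qed
 have lim: "(\<lambda>k. root k (x k)) \<longlonglongrightarrow> exp (- L)"
  using tendsto_exp[OF tendsto_minus[OF L]] tendsto_cong[OF e] by blast
 have "1 < exp (- L)" if k: "0 < k" "1 < x k" for k
 proof -
  have pw: "x k ^ Suc m \<le> x (Suc m * k)" for m
  proof (induction m)
   case (Suc m)
   have "x k ^ Suc (Suc m) \<le> x k * x (Suc m * k)" using Suc pos[of k] by (simp add: mult_left_mono)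
   also have "\<dots> \<le> x (k + Suc m * k)" by (rule super)
   finally show ?case by simp
  qed simp
  have sub: "strict_mono (\<lambda>m. Suc m * k)" by (rule strict_monoI) (use k in \<open>auto intro!: mult_less_mono1\<close>)
  have "root k (x k) \<le> exp (- L)"
  proof (rule tendsto_le[OF sequentially_bot LIMSEQ_subseq_LIMSEQ[OF lim sub] tendsto_const], rule always_eventually, rule allI)
   fix m
   have "root k (x k) = root (Suc m * k) (x k ^ Suc m)"
    using pos[of k] by (simp only: mult.commute[of "Suc m"] real_root_mult_exp real_root_power_cancel[OF zero_less_Suc] less_imp_le)
   also have "\<dots> \<le> root (Suc m * k) (x (Suc m * k))" by (rule real_root_le_mono) (use k pw in auto)
   finally show "root k (x k) \<le> ((\<lambda>k. root k (x k)) \<circ> (\<lambda>m. Suc m * k)) m" by simp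
  qed
  moreover have "1 < root k (x k)" using k by simp
  ultimately show ?thesis by linarith
 qed
 then show ?thesis using lim by blast
qed

text \<open>Two-sided linear rates of decrease give continuity, a sign change and uniqueness at
  once. It is applied to the logarithm of the pressure.\<close>

lemma ex1_zero_decreasing:
 fixes f :: "real \<Rightarrow> real"
 assumes lo: "0 < l" "\<And>s s'. s \<le> s' \<Longrightarrow> f s' \<le> f s - l * (s' - s)"
  and hi: "\<And>s s'. s \<le> s' \<Longrightarrow> f s - h * (s' - s) \<le> f s'"
 shows "\<exists>!s. f s = 0"
proof -
 have h: "l \<le> h" using lo(2)[of 0 1] hi[of 0 1] by simp
 have "\<bar>f x - f y\<bar> \<le> h * \<bar>x - y\<bar>" for x y
 proof (cases "x \<le> y")
  case True
  have "0 \<le> l * (y - x)" using lo(1) True by simp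
  then show ?thesis using lo(2)[OF True] hi[OF True] True by simp
 next
  case False
  then have "0 \<le> l * (x - y)" using lo(1) by simp
  then show ?thesis using lo(2)[of y x] hi[of y x] False by simp
 qed
 then have "h-lipschitz_on UNIV f" using h lo(1) by (intro lipschitz_onI) (auto simp: dist_real_def)
 then have cont: "continuous_on UNIV f" by (rule lipschitz_on_continuous_on)
 define S where "S = f 0 / l"
 have lS: "l * S = f 0" using lo(1) by (simp add: S_def)
 have "\<exists>s\<ge>min S 0. s \<le> max S 0 \<and> f s = 0"
 proof (rule IVT2')
  show "f (max S 0) \<le> 0" using lo(2)[of 0 S] lS mult_pos_neg[OF lo(1), of S] by (cases "0 \<le> S") (auto simp: max_def)
  show "0 \<le> f (min S 0)" using lo(2)[of S 0] lS mult_pos_pos[OF lo(1), of S] by (cases "S \<le> 0") (auto simp: min_def)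
  show "continuous_on {min S 0..max S 0} f" using cont continuous_on_subset by blast
 qed auto
 then obtain s where s: "f s = 0" by blast
 show ?thesis
 proof (rule ex1I[of _ s])
  fix s' assume z: "f s' = 0"
  show "s' = s"
  proof (rule ccontr)
   assume "s' \<noteq> s"
   then consider "s' < s" | "s < s'" by linarith
   then show False
   proof cases
    case 1
    then have "0 < l * (s - s')" using lo(1) by simp
    then show False using lo(2)[of s' s] 1 s z by simp
   next
    case 2
    then have "0 < l * (s' - s)" using lo(1) by simp
    then show False using lo(2)[of s s'] 2 s z by simp
   qed
  qed
 qed (rule s)
qed

context weights
begin

text \<open>Exchange of the coordinates: each statement about the weights behind
  \<open>\<gamma>A\<close> has a counterpart for \<open>\<gamma>B\<close> under the prefix
  \<open>B\<close>.\<close>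

sublocale B: weights I p d c
 by (standard) (use fin ne c d p in auto)

lemma swap: "B.\<chi>1 = \<chi>2" "B.\<chi>2 = \<chi>1"
 by (simp_all add: B.\<chi>1_def B.\<chi>2_def \<chi>1_def \<chi>2_def)

abbreviation wA where "wA q t s w \<equiv> word_prod (gA q t s) w"
abbreviation wB where "wB q t s w \<equiv> word_prod (B.gA q t s) w"

definition \<Psi> where "\<Psi> q t t' s k = (\<Sum>w\<in>words I k. \<psi> t t' s q w)"

lemma wpos: "set w \<subseteq> I \<Longrightarrow> 0 < cw w" "set w \<subseteq> I \<Longrightarrow> 0 < dw w" "set w \<subseteq> I \<Longrightarrow> 0 < pw w"
 "set w \<subseteq> I \<Longrightarrow> 0 < wA q t s w"
 by (rule word_prod_pos[of I]; use c d p gA_pos in auto)+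

lemma wA_eq: "set w \<subseteq> I \<Longrightarrow> wA q t s w = pw w powr q * cw w powr t * dw w powr (s - t)"
 unfolding gA_def word_prod_mult
 by (simp add: word_prod_powr[of I p] word_prod_powr[of I c] word_prod_powr[of I d] c d p)

end

context weights
begin

text \<open>Both weights have a common factor \<open>K\<close>; what remains is the long side for
  \<open>wA\<close> and the short side for \<open>wB\<close>, each to the power
  \<open>t + t' - s\<close>. The sign of this exponent decides which weight is larger.\<close>

lemma wA_compare:
 assumes w: "set w \<subseteq> I" and CD: "dw w \<le> cw w"
 shows "s \<le> t + t' \<Longrightarrow> wB q t' s w \<le> wA q t s w" "t + t' \<le> s \<Longrightarrow> wA q t s w \<le> wB q t' s w"
proof -
 define C D where "C = cw w" and "D = dw w"
 define K where "K = pw w powr q * C powr (s - t') * D powr (s - t)"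
 have pos: "0 < C" "0 < D" "D \<le> C" "0 \<le> K" using wpos[OF w] CD by (auto simp: C_def D_def K_def)
 have A: "wA q t s w = K * C powr (t + t' - s)"
  unfolding wA_eq[OF w] K_def C_def[symmetric] D_def[symmetric] by (simp add: powr_add[symmetric])
 have B: "wB q t' s w = K * D powr (t + t' - s)"
  unfolding B.wA_eq[OF w] K_def C_def[symmetric] D_def[symmetric] by (simp add: powr_add[symmetric])
 show "s \<le> t + t' \<Longrightarrow> wB q t' s w \<le> wA q t s w" unfolding A B using pos by (intro mult_left_mono powr_mono2) auto
 show "t + t' \<le> s \<Longrightarrow> wA q t s w \<le> wB q t' s w" unfolding A B using pos by (intro mult_left_mono powr_mono2') auto
qed

end

context weights
begin

lemma psi_A: "set w \<subseteq> I \<Longrightarrow> dw w \<le> cw w \<Longrightarrow> \<psi> t t' s q w = wA q t s w"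
 by (simp add: wA_eq psi_def Let_def)

lemma psi_B:
 assumes "set w \<subseteq> I" "cw w \<le> dw w"
 shows "\<psi> t t' s q w = wB q t' s w"
proof (cases "cw w = dw w")
 case True
 then show ?thesis using assms wpos[OF assms(1)] by (simp add: B.wA_eq psi_def Let_def powr_add[symmetric] mult.assoc)
next
 case False
 then show ?thesis using assms by (simp add: B.wA_eq psi_def Let_def)
qed

end

context weights
begin

lemma psi_swap: "set w \<subseteq> I \<Longrightarrow> psi p d c (\<lambda>_. t') (\<lambda>_. t) s q w = \<psi> t t' s q w"
 by (metis nle_le psi_A psi_B B.psi_A B.psi_B)

lemma psi_max: "set w \<subseteq> I \<Longrightarrow> s \<le> t + t' \<Longrightarrow> \<psi> t t' s q w = max (wA q t s w) (wB q t' s w)"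
 using psi_A[of w t t' s q] psi_B[of w t t' s q] wA_compare(1)[of w s t t' q] B.wA_compare(1)[of w s t' t q]
 by (cases "dw w \<le> cw w") (auto simp: max_def add.commute)

lemma psi_min: "set w \<subseteq> I \<Longrightarrow> t + t' \<le> s \<Longrightarrow> \<psi> t t' s q w = min (wA q t s w) (wB q t' s w)"
 using psi_A[of w t t' s q] psi_B[of w t t' s q] wA_compare(2)[of w t t' s q] B.wA_compare(2)[of w t' t s q]
 by (cases "dw w \<le> cw w") (auto simp: min_def add.commute)

lemma psi_pos: "set w \<subseteq> I \<Longrightarrow> 0 < \<psi> t t' s q w"
 by (metis nle_le psi_A psi_B wpos(4) B.wpos(4))

end

context weights
begin

lemma psi_le_add: "set w \<subseteq> I \<Longrightarrow> \<psi> t t' s q w \<le> wA q t s w + wB q t' s w"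
 using psi_A[of w t t' s q] psi_B[of w t t' s q] wpos(4)[of w q t s] B.wpos(4)[of w q t' s]
 by (cases "dw w \<le> cw w") auto

lemma words_in: "w \<in> words I k \<Longrightarrow> set w \<subseteq> I" "w \<in> words I k \<Longrightarrow> length w = k"
 by (auto simp: words_def)

lemma sum_wA: "(\<Sum>w\<in>words I k. wA q t s w) = sumA q t s ^ k"
 by (simp add: sum_word_prod sumA_def)

lemma \<Psi>_pos: "0 < \<Psi> q t t' s k"
proof -
 obtain i where "i \<in> I" using ne by blast
 then have "replicate k i \<in> words I k" by (auto simp: words_def)
 then show ?thesis unfolding \<Psi>_def using words_in psi_pos finite_words[OF fin] by (intro sum_pos) auto
qed

end

context weights
begin

lemma \<Psi>_swap: "B.\<Psi> q t' t s k = \<Psi> q t t' s k"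
 unfolding B.\<Psi>_def \<Psi>_def by (intro sum.cong refl psi_swap words_in)

lemma \<Psi>_le: "\<Psi> q t t' s k \<le> 2 * max (sumA q t s) (B.sumA q t' s) ^ k"
proof -
 have "\<Psi> q t t' s k \<le> (\<Sum>w\<in>words I k. wA q t s w + wB q t' s w)"
  unfolding \<Psi>_def by (intro sum_mono psi_le_add words_in)
 also have "\<dots> = sumA q t s ^ k + B.sumA q t' s ^ k" by (simp add: sum.distrib sum_wA B.sum_wA)
 also have "\<dots> \<le> max (sumA q t s) (B.sumA q t' s) ^ k + max (sumA q t s) (B.sumA q t' s) ^ k"
  using sumA_pos[of q t s] B.sumA_pos[of q t' s] by (intro add_mono power_mono) auto
 finally show ?thesis by simp
qed

lemma \<Psi>_le_A: "t + t' \<le> s \<Longrightarrow> \<Psi> q t t' s k \<le> sumA q t s ^ k"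
 unfolding \<Psi>_def sum_wA[symmetric] by (intro sum_mono) (auto simp: psi_min words_in)

lemma \<Psi>_ge_A: "s \<le> t + t' \<Longrightarrow> sumA q t s ^ k \<le> \<Psi> q t t' s k"
 unfolding \<Psi>_def sum_wA[symmetric] by (intro sum_mono) (auto simp: psi_max words_in)

lemma words_add: "words I (m + n) = (\<lambda>(v, w). v @ w) ` (words I m \<times> words I n)"
proof (intro equalityI subsetI)
 fix u assume u: "u \<in> words I (m + n)"
 have "u = take m u @ drop m u" by simp
 moreover have "take m u \<in> words I m" "drop m u \<in> words I n"
  using u set_take_subset[of m u] set_drop_subset[of m u] by (auto simp: words_def)
 ultimately show "u \<in> (\<lambda>(v, w). v @ w) ` (words I m \<times> words I n)" by (metis (mono_tags, lifting) SigmaI case_prod_conv image_eqI)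
qed (auto simp: words_def)

text \<open>In this range psi is the minimum of two multiplicative functions of words, and such a
  minimum is supermultiplicative.\<close>

lemma \<Psi>_super:
 assumes s: "t + t' \<le> s"
 shows "\<Psi> q t t' s m * \<Psi> q t t' s n \<le> \<Psi> q t t' s (m + n)"
proof -
 let ?g = "\<psi> t t' s q"
 have "\<Psi> q t t' s m * \<Psi> q t t' s n = (\<Sum>(v, w)\<in>words I m \<times> words I n. ?g v * ?g w)"
  unfolding \<Psi>_def sum_product sum.cartesian_product ..
 also have "\<dots> \<le> (\<Sum>(v, w)\<in>words I m \<times> words I n. ?g (v @ w))"
 proof (rule sum_mono, clarify)
  fix v w assume vw: "v \<in> words I m" "w \<in> words I n"
  have v: "set v \<subseteq> I" "set w \<subseteq> I" "set (v @ w) \<subseteq> I" using words_in(1)[OF vw(1)] words_in(1)[OF vw(2)] by auto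
  show "?g v * ?g w \<le> ?g (v @ w)"
   unfolding psi_min[OF v(1) s] psi_min[OF v(2) s] psi_min[OF v(3) s] word_prod_simps
   using wpos(4)[OF v(1), of q t s] wpos(4)[OF v(2), of q t s] B.wpos(4)[OF v(1), of q t' s] B.wpos(4)[OF v(2), of q t' s]
   by (intro min.boundedI mult_mono) auto
 qed
 also have "\<dots> = \<Psi> q t t' s (m + n)"
  unfolding \<Psi>_def words_add by (subst sum.reindex) (auto simp: inj_on_def words_def case_prod_unfold)
 finally show ?thesis .
qed

end

context weights
begin

definition Pr where "Pr q t t' s = lim (\<lambda>k. root k (\<Psi> q t t' s k))"

lemma pressure_Pr: "pressure I p c d \<tau> \<tau>' s q = Pr q (\<tau> q) (\<tau>' q) s"
 by (simp add: pressure_def Pr_def \<Psi>_def psi_def)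

text \<open>Supermultiplicativity handles \<open>t + t' \<le> s\<close>. In the other range psi is
  the maximum of the two weights, so the sums lie between \<open>m ^ k\<close> and
  \<open>2 * m ^ k\<close>, where \<open>m\<close> is the larger of the two one-letter sums.\<close>

lemma Pr_aux: "(\<lambda>k. root k (\<Psi> q t t' s k)) \<longlonglongrightarrow> Pr q t t' s \<and> (t + t' \<le> s \<longrightarrow> (\<forall>k>0. 1 < \<Psi> q t t' s k \<longrightarrow> 1 < Pr q t t' s))"
proof (cases "t + t' \<le> s")
 case True
 obtain P where P: "(\<lambda>k. root k (\<Psi> q t t' s k)) \<longlonglongrightarrow> P" "\<forall>k>0. 1 < \<Psi> q t t' s k \<longrightarrow> 1 < P"
  using root_supermultiplicative[OF \<Psi>_pos \<Psi>_super[OF True] \<Psi>_le_A[OF True]] by blast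
 have "Pr q t t' s = P" unfolding Pr_def by (rule limI[OF P(1)])
 then show ?thesis using P by blast
next
 case False
 define m where "m = max (sumA q t s) (B.sumA q t' s)"
 have m: "0 < m" using sumA_pos[of q t s] by (auto simp: m_def)
 have ge: "m ^ k \<le> \<Psi> q t t' s k" for k
  using \<Psi>_ge_A[of s t t' q k] B.\<Psi>_ge_A[of s t' t q k] False by (auto simp: m_def max_def \<Psi>_swap)
 have "(\<lambda>k. root k (\<Psi> q t t' s k)) \<longlonglongrightarrow> m"
 proof (rule tendsto_sandwich[OF _ _ root_power_tendsto[of m]])
  show "(\<lambda>k. root k 2 * root k (m ^ k)) \<longlonglongrightarrow> m"
   using tendsto_mult[OF LIMSEQ_root_const[of 2] root_power_tendsto[of m]] m by simp
  show "\<forall>\<^sub>F k in sequentially. root k (\<Psi> q t t' s k) \<le> root k 2 * root k (m ^ k)"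
   using eventually_gt_at_top[of 0]
  proof eventually_elim
   case (elim k)
   have "\<Psi> q t t' s k \<le> 2 * m ^ k" unfolding m_def by (rule \<Psi>_le)
   then show ?case using real_root_le_mono[OF elim] by (simp add: real_root_mult[symmetric])
  qed
  show "\<forall>\<^sub>F k in sequentially. root k (m ^ k) \<le> root k (\<Psi> q t t' s k)"
   using eventually_gt_at_top[of 0]
  proof eventually_elim
   case (elim k)
   then show ?case using ge by simp
  qed
 qed (use m in auto)
 then show ?thesis using False limI by (metis Pr_def)
qed

lemmas Pr_tendsto = Pr_aux[THEN conjunct1]

end

context weights
begin

lemma Pr_swap: "B.Pr q t' t s = Pr q t t' s"
 by (simp add: B.Pr_def Pr_def \<Psi>_swap)

lemma gamma_swap: "gamma I p d c \<tau>' \<tau> = gamma I p c d \<tau> \<tau>'"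
 by (simp add: fun_eq_iff gamma_def pressure_Pr B.pressure_Pr Pr_swap)

lemma Pr_le: "Pr q t t' s \<le> max (sumA q t s) (B.sumA q t' s)"
 using sumA_pos[of q t s] by (intro root_tendsto_le[OF Pr_tendsto root_power_tendsto _ \<Psi>_le]) auto

lemma Pr_le_A: "t + t' \<le> s \<Longrightarrow> Pr q t t' s \<le> sumA q t s"
 using sumA_pos[of q t s] \<Psi>_le_A[of t t' s q] by (intro root_tendsto_le[OF Pr_tendsto root_power_tendsto, of _ 1]) auto

lemma Pr_ge_A: "s \<le> t + t' \<Longrightarrow> sumA q t s \<le> Pr q t t' s"
 using sumA_pos[of q t s] \<Psi>_ge_A[of s t t' q] by (intro root_tendsto_le[OF root_power_tendsto Pr_tendsto, of _ 1]) auto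

lemma Pr_pos: "0 < Pr q t t' s"
proof -
 define m where "m = \<Psi> q t t' s 1"
 have m: "0 < m" unfolding m_def by (rule \<Psi>_pos)
 show ?thesis
 proof (cases "t + t' \<le> s")
  case True
  have "m ^ k \<le> \<Psi> q t t' s k" for k
  proof (induction k)
   case (Suc k)
   have "m ^ Suc k \<le> m * \<Psi> q t t' s k" using Suc m by (simp add: mult_left_mono)
   also have "\<dots> \<le> \<Psi> q t t' s (1 + k)" unfolding m_def by (rule \<Psi>_super[OF True])
   finally show ?case by simp
  qed (simp add: \<Psi>_def psi_def)
  then have "m \<le> Pr q t t' s" using m by (intro root_tendsto_le[OF root_power_tendsto Pr_tendsto, of _ 1]) auto
  then show ?thesis using m by simp
 next
  case False
  then show ?thesis using Pr_ge_A[of s t t' q] sumA_pos[of q t s] by simp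
 qed
qed

lemma psi_shift:
 assumes "set w \<subseteq> I"
 shows "\<psi> t t' s' q w
   = \<psi> t t' s q w * min (cw w) (dw w) powr (s' - s)"
 by (simp add: psi_def Let_def powr_add[symmetric] mult.assoc)

text \<open>Raising \<open>s\<close> multiplies psi of a word of length \<open>k\<close> by a factor
  between the k-th powers of \<open>\<kappa> powr (s' - s)\<close> and
  \<open>\<rho> powr (s' - s)\<close>. The logarithm of the pressure therefore decreases at a rate
  between \<open>- ln \<rho>\<close> and \<open>- ln \<kappa>\<close>. The largest \<open>c\<close>
  serves as \<open>\<rho>\<close> because the short side never exceeds \<open>cw w\<close>.\<close>

lemma ex1_Pr_aux: "(\<exists>!s. Pr q t t' s = 1) \<and> (\<forall>s s'. s \<le> s' \<longrightarrow> Pr q t t' s' \<le> Pr q t t' s)"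
proof -
 define \<rho> where "\<rho> = Max (c ` I)"
 define \<kappa> where "\<kappa> = Min (c ` I \<union> d ` I)"
 have "\<rho> \<in> c ` I" "\<kappa> \<in> c ` I \<union> d ` I" unfolding \<rho>_def \<kappa>_def using fin ne by (intro Max_in Min_in; auto)+
 then have rk: "0 < \<rho>" "\<rho> < 1" "0 < \<kappa>" using c d by auto
 have cr: "c i \<le> \<rho>" "\<kappa> \<le> c i" "\<kappa> \<le> d i" if "i \<in> I" for i using that fin by (auto simp: \<rho>_def \<kappa>_def)
 have bounds: "\<kappa> ^ length w \<le> min (cw w) (dw w)" "min (cw w) (dw w) \<le> \<rho> ^ length w"
  if w: "set w \<subseteq> I" for w
  using word_prod_le[of I c \<rho> w] word_prod_ge[of I \<kappa> c w] word_prod_ge[of I \<kappa> d w] w cr rk c d by (auto simp: min_le_iff_disj)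
 have pk: "(m ^ k) powr e = (m powr e) ^ k" if "0 < m" for m e :: real and k :: nat
  using that by (simp add: powr_realpow[symmetric] powr_powr mult.commute)
 have up: "Pr q t t' s' \<le> \<rho> powr (s' - s) * Pr q t t' s" if "s \<le> s'" for s s'
 proof (rule root_tendsto_le[OF Pr_tendsto, where K = 1])
  show "(\<lambda>k. root k ((\<rho> powr (s' - s)) ^ k * \<Psi> q t t' s k)) \<longlonglongrightarrow> \<rho> powr (s' - s) * Pr q t t' s"
   unfolding real_root_mult using rk by (intro tendsto_mult root_power_tendsto Pr_tendsto) auto
  fix k
  have "\<Psi> q t t' s' k \<le> (\<Sum>w\<in>words I k. \<psi> t t' s q w * (\<rho> powr (s' - s)) ^ k)"
   unfolding \<Psi>_def
  proof (intro sum_mono)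
   fix w assume w: "w \<in> words I k"
   note wI = words_in(1)[OF w]
   have "min (cw w) (dw w) powr (s' - s) \<le> (\<rho> ^ k) powr (s' - s)"
    using bounds(2)[OF wI] words_in(2)[OF w] wpos(1,2)[OF wI] that by (intro powr_mono2) auto
   then show "\<psi> t t' s' q w \<le> \<psi> t t' s q w * (\<rho> powr (s' - s)) ^ k"
    unfolding psi_shift[OF wI, of t t' s' q s] pk[OF rk(1)] using psi_pos[OF wI, of t t' s q] by (intro mult_left_mono) auto
  qed
  then show "\<Psi> q t t' s' k \<le> 1 * ((\<rho> powr (s' - s)) ^ k * \<Psi> q t t' s k)"
   by (simp add: \<Psi>_def sum_distrib_left mult.commute)
 qed simp
 have lo: "\<kappa> powr (s' - s) * Pr q t t' s \<le> Pr q t t' s'" if "s \<le> s'" for s s'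
 proof (rule root_tendsto_le[OF _ Pr_tendsto, where K = 1])
  show "(\<lambda>k. root k ((\<kappa> powr (s' - s)) ^ k * \<Psi> q t t' s k)) \<longlonglongrightarrow> \<kappa> powr (s' - s) * Pr q t t' s"
   unfolding real_root_mult using rk by (intro tendsto_mult root_power_tendsto Pr_tendsto) auto
  fix k
  have "(\<Sum>w\<in>words I k. \<psi> t t' s q w * (\<kappa> powr (s' - s)) ^ k) \<le> \<Psi> q t t' s' k"
   unfolding \<Psi>_def
  proof (intro sum_mono)
   fix w assume w: "w \<in> words I k"
   note wI = words_in(1)[OF w]
   have "(\<kappa> ^ k) powr (s' - s) \<le> min (cw w) (dw w) powr (s' - s)"
    using bounds(1)[OF wI] words_in(2)[OF w] rk that by (intro powr_mono2) auto
   then show "\<psi> t t' s q w * (\<kappa> powr (s' - s)) ^ k \<le> \<psi> t t' s' q w"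
    unfolding psi_shift[OF wI, of t t' s' q s] pk[OF rk(3)] using psi_pos[OF wI, of t t' s q] by (intro mult_left_mono) auto
  qed
  then show "(\<kappa> powr (s' - s)) ^ k * \<Psi> q t t' s k \<le> 1 * \<Psi> q t t' s' k"
   by (simp add: \<Psi>_def sum_distrib_left mult.commute)
 qed simp
 have "\<exists>!s. ln (Pr q t t' s) = 0"
 proof (rule ex1_zero_decreasing)
  show "0 < - ln \<rho>" using rk by simp
  fix s s' :: real assume s: "s \<le> s'"
  have "ln (Pr q t t' s') \<le> ln (\<rho> powr (s' - s) * Pr q t t' s)" using up[OF s] Pr_pos rk by (subst ln_le_cancel_iff) auto
  also have "\<dots> = ln (Pr q t t' s) - (- ln \<rho>) * (s' - s)" using Pr_pos[of q t t' s] rk by (simp add: ln_mult ln_powr)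
  finally show "ln (Pr q t t' s') \<le> ln (Pr q t t' s) - (- ln \<rho>) * (s' - s)" .
  have "ln (Pr q t t' s) - (- ln \<kappa>) * (s' - s) = ln (\<kappa> powr (s' - s) * Pr q t t' s)"
   using Pr_pos[of q t t' s] rk by (simp add: ln_mult ln_powr)
  also have "\<dots> \<le> ln (Pr q t t' s')" using lo[OF s] Pr_pos rk by (subst ln_le_cancel_iff) auto
  finally show "ln (Pr q t t' s) - (- ln \<kappa>) * (s' - s) \<le> ln (Pr q t t' s')" .
 qed
 moreover have "ln (Pr q t t' s) = 0 \<longleftrightarrow> Pr q t t' s = 1" for s using Pr_pos[of q t t' s] by simp
 moreover have "Pr q t t' s' \<le> Pr q t t' s" if s: "s \<le> s'" for s s'
 proof -
  have "\<rho> powr (s' - s) * Pr q t t' s \<le> 1 * Pr q t t' s"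
   using s rk Pr_pos[of q t t' s] by (intro mult_right_mono) (auto intro: powr_le1)
  then show ?thesis using up[OF s] by simp
 qed
 ultimately show ?thesis by simp
qed

lemma gamma_root:
 shows "1 \<le> Pr q (\<tau> q) (\<tau>' q) s \<Longrightarrow> s \<le> gamma I p c d \<tau> \<tau>' q"
  and "Pr q (\<tau> q) (\<tau>' q) s \<le> 1 \<Longrightarrow> gamma I p c d \<tau> \<tau>' q \<le> s"
proof -
 let ?g = "gamma I p c d \<tau> \<tau>' q"
 have ex: "\<exists>!s. Pr q (\<tau> q) (\<tau>' q) s = 1" and anti: "\<And>s s'. s \<le> s' \<Longrightarrow> Pr q (\<tau> q) (\<tau>' q) s' \<le> Pr q (\<tau> q) (\<tau>' q) s"
  using ex1_Pr_aux by blast+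
 have g: "Pr q (\<tau> q) (\<tau>' q) ?g = 1" unfolding gamma_def pressure_Pr by (rule theI'[OF ex])
 show "s \<le> ?g" if "1 \<le> Pr q (\<tau> q) (\<tau>' q) s"
 proof (rule ccontr)
  assume "\<not> s \<le> ?g"
  then have "Pr q (\<tau> q) (\<tau>' q) s = 1" "s \<noteq> ?g" using anti[of ?g s] g that by auto
  then show False using ex g by blast
 qed
 show "?g \<le> s" if "Pr q (\<tau> q) (\<tau>' q) s \<le> 1"
 proof (rule ccontr)
  assume "\<not> ?g \<le> s"
  then have "Pr q (\<tau> q) (\<tau>' q) s = 1" "s \<noteq> ?g" using anti[of s ?g] g that by auto
  then show False using ex g by blast
 qed
qed

text \<open>Mean and variance of a sum of \<open>k\<close> independent centred variables with law
  \<open>p\<close>; the cross terms vanish by centring.\<close>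

lemma sum_words_moments:
 assumes y: "(\<Sum>i\<in>I. p i * y i) = 0"
 shows "(\<Sum>w\<in>words I k. pw w * sum_list (map y w)) = 0"
  "(\<Sum>w\<in>words I k. pw w * (sum_list (map y w))\<^sup>2) = real k * (\<Sum>i\<in>I. p i * (y i)\<^sup>2)"
proof (induction k)
 case 0
 { case 1 show ?case by simp next case 2 show ?case by simp }
next
 case (Suc k)
 let ?s = "\<lambda>w. sum_list (map y w)"
 have m: "(\<Sum>w\<in>words I k. pw w) = 1" by (simp add: sum_word_prod p)
 { case 1
  have "(\<Sum>w\<in>words I (Suc k). pw w * ?s w)
   = (\<Sum>i\<in>I. p i * y i * (\<Sum>w\<in>words I k. pw w) + p i * (\<Sum>w\<in>words I k. pw w * ?s w))"
   unfolding sum_words_Suc by (intro sum.cong refl) (simp add: algebra_simps sum.distrib sum_distrib_left)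
  then show ?case using Suc(1) y m by simp
 next
  case 2
  have "(\<Sum>w\<in>words I (Suc k). pw w * (?s w)\<^sup>2)
   = (\<Sum>i\<in>I. p i * (y i)\<^sup>2 * (\<Sum>w\<in>words I k. pw w) + 2 * p i * y i * (\<Sum>w\<in>words I k. pw w * ?s w)
     + p i * (\<Sum>w\<in>words I k. pw w * (?s w)\<^sup>2))"
   unfolding sum_words_Suc by (intro sum.cong refl) (simp add: power2_eq_square algebra_simps sum.distrib sum_distrib_left)
  also have "\<dots> = (\<Sum>i\<in>I. p i * (y i)\<^sup>2) + (\<Sum>i\<in>I. p i) * (real k * (\<Sum>i\<in>I. p i * (y i)\<^sup>2))"
   unfolding Suc m sum.distrib sum_distrib_right by simp
  finally show ?case using p(2) by (simp add: algebra_simps)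
 }
qed

lemma wA_exp: "set w \<subseteq> I \<Longrightarrow> wA (1 + u) t s w = pw w * exp (sum_list (map (xA u t s) w))"
 by (induction w) (auto simp: gA_exp exp_add)

end

context weights
begin

text \<open>Psi is the minimum of the two weights here, yet both have logarithms of mean at least
  \<open>k * l\<close> relative to \<open>pw\<close>, with fluctuations of order the square root of
  \<open>k\<close>. For \<open>k\<close> past \<open>2 * v / l\<^sup>2\<close> the mean of their
  minimum is still positive, and \<open>exp x \<ge> 1 + x\<close> makes the sum of order
  \<open>k\<close> exceed 1.\<close>

lemma Pr_gt_one:
 assumes s: "t + t' \<le> s" and l: "0 < lin u t s" "0 < B.lin u t' s"
 shows "1 < Pr (1 + u) t t' s"
proof -
 define l where "l = min (lin u t s) (B.lin u t' s)"
 define y where "y i = xA u t s i - lin u t s" for i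
 define y' where "y' i = B.xA u t' s i - B.lin u t' s" for i
 define v where "v = (\<Sum>i\<in>I. p i * (y i)\<^sup>2) + (\<Sum>i\<in>I. p i * (y' i)\<^sup>2)"
 have l0: "0 < l" using l by (simp add: l_def)
 have y: "(\<Sum>i\<in>I. p i * y i) = 0" "(\<Sum>i\<in>I. p i * y' i) = 0"
  using p(2) by (simp_all add: y_def y'_def right_diff_distrib sum_subtractf sum_distrib_right[symmetric] lin_def[symmetric] B.lin_def[symmetric])
 define k where "k = Suc (nat \<lceil>2 * v / l\<^sup>2\<rceil>)"
 have k: "2 * v / l\<^sup>2 < real k" "0 < k" unfolding k_def by linarith+
 let ?s = "\<lambda>f w. sum_list (map f w)"
 have X: "?s (xA u t s) w = ?s y w + real (length w) * lin u t s" for w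
  by (induction w) (auto simp: y_def algebra_simps)
 have Y: "?s (B.xA u t' s) w = ?s y' w + real (length w) * B.lin u t' s" for w
  by (induction w) (auto simp: y'_def algebra_simps)
 \<comment> \<open>Trades the absolute fluctuation for its square, whose mean is known. The two
   fluctuations cost at most \<open>k * l / 4\<close> each, leaving
   \<open>k * l / 2\<close>.\<close>
 have amgm: "\<bar>z\<bar> \<le> z\<^sup>2 / (l * k) + k * l / 4 \<and> 0 \<le> z\<^sup>2 / (l * k)" for z :: real
 proof -
  have "0 \<le> (\<bar>z\<bar> - l * k / 2)\<^sup>2 / (l * k)" using l0 k by simp
  also have "\<dots> = z\<^sup>2 / (l * k) - \<bar>z\<bar> + k * l / 4"
   using l0 k by (simp add: power2_diff add_divide_distrib diff_divide_distrib) (simp add: power2_eq_square)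
  finally show ?thesis using l0 by simp
 qed
 have "1 < 1 + (k * l / 2 - v / l)"
 proof -
  have "2 * v < k * l\<^sup>2" using k l0 by (simp add: pos_divide_less_eq)
  then have "v / l < k * l / 2" using l0 by (simp add: pos_divide_less_eq power2_eq_square)
  then show ?thesis by simp
 qed
 also have "1 + (k * l / 2 - v / l) = (\<Sum>w\<in>words I k. pw w * (1 + (k * l / 2 - (?s y w)\<^sup>2 / (l * k) - (?s y' w)\<^sup>2 / (l * k))))"
 proof -
  have "(\<Sum>w\<in>words I k. pw w * (1 + (k * l / 2 - (?s y w)\<^sup>2 / (l * k) - (?s y' w)\<^sup>2 / (l * k))))
   = (\<Sum>w\<in>words I k. pw w * (1 + k * l / 2) - pw w * (?s y w)\<^sup>2 / (l * k) - pw w * (?s y' w)\<^sup>2 / (l * k))"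
   by (intro sum.cong refl) (simp add: algebra_simps)
  also have "\<dots> = (1 + k * l / 2) - k * (\<Sum>i\<in>I. p i * (y i)\<^sup>2) / (l * k) - k * (\<Sum>i\<in>I. p i * (y' i)\<^sup>2) / (l * k)"
   unfolding sum_subtractf sum_distrib_right[symmetric] sum_divide_distrib[symmetric] sum_words_moments(2)[OF y(1)] sum_words_moments(2)[OF y(2)]
   by (simp add: sum_word_prod p)
  also have "\<dots> = 1 + (k * l / 2 - v / l)" using k l0 by (simp add: v_def add_divide_distrib)
  finally show ?thesis by simp
 qed
 also have "\<dots> \<le> \<Psi> (1 + u) t t' s k"
  unfolding \<Psi>_def
 proof (intro sum_mono)
  fix w assume w: "w \<in> words I k"
  note wI = words_in(1)[OF w]
  have kl: "k * l \<le> k * lin u t s" "k * l \<le> k * B.lin u t' s" using k by (auto simp: l_def intro!: mult_left_mono)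
  have "1 + (k * l / 2 - (?s y w)\<^sup>2 / (l * k) - (?s y' w)\<^sup>2 / (l * k)) \<le> 1 + min (?s (xA u t s) w) (?s (B.xA u t' s) w)"
   unfolding X Y words_in(2)[OF w] using amgm[of "?s y w"] amgm[of "?s y' w"] kl by linarith
  also have "\<dots> \<le> exp (min (?s (xA u t s) w) (?s (B.xA u t' s) w))" by (rule exp_ge_add_one_self)
  finally have "pw w * (1 + (k * l / 2 - (?s y w)\<^sup>2 / (l * k) - (?s y' w)\<^sup>2 / (l * k)))
    \<le> pw w * exp (min (?s (xA u t s) w) (?s (B.xA u t' s) w))"
   using wpos(3)[OF wI] by (intro mult_left_mono) auto
  also have "\<dots> \<le> \<psi> t t' s (1 + u) w"
   unfolding psi_min[OF wI s] wA_exp[OF wI] B.wA_exp[OF wI] using wpos(3)[OF wI] by (auto simp: min_def)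
  finally show "pw w * (1 + (k * l / 2 - (?s y w)\<^sup>2 / (l * k) - (?s y' w)\<^sup>2 / (l * k)))
    \<le> \<psi> t t' s (1 + u) w" .
 qed
 finally show ?thesis using Pr_aux[of "1 + u" t t' s] s k by blast
qed

text \<open>The uniform bound over finite sets of words that the upper estimate for planar moments
  takes as input.\<close>

definition psi_bounded where
 "psi_bounded t t' s q \<longleftrightarrow> (\<exists>W. \<forall>Z. finite Z \<longrightarrow> (\<forall>w\<in>Z. set w \<subseteq> I) \<longrightarrow>
   (\<Sum>w\<in>Z. \<psi> t t' s q w) \<le> W)"

text \<open>Under the first alternative psi is the minimum and under the third it is the A-weight
  itself, so the convergent A-series dominates; under the second both series converge and psi is at
  most the sum of the weights.\<close>

lemma finite_psi_sum:
 assumes a: "sumA q t s < 1" and b: "t + t' \<le> s \<or> B.sumA q t' s < 1 \<or> (\<forall>i\<in>I. d i \<le> c i)"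
 shows "psi_bounded t t' s q"
proof -
 have A: "(\<Sum>w\<in>Z. wA q t s w) \<le> 1 / (1 - sumA q t s)" if "finite Z" "\<forall>w\<in>Z. set w \<subseteq> I" for Z
  using finite_word_sum[of "gA q t s" Z] that a gA_pos[THEN less_imp_le] unfolding sumA_def by blast
 have B: "(\<Sum>w\<in>Z. wB q t' s w) \<le> 1 / (1 - B.sumA q t' s)" if "finite Z" "\<forall>w\<in>Z. set w \<subseteq> I" "B.sumA q t' s < 1" for Z
  using B.finite_word_sum[of "B.gA q t' s" Z] that B.gA_pos[THEN less_imp_le] unfolding B.sumA_def by blast
 show ?thesis
 proof (cases "B.sumA q t' s < 1")
  case True
  have "(\<Sum>w\<in>Z. \<psi> t t' s q w) \<le> 1 / (1 - sumA q t s) + 1 / (1 - B.sumA q t' s)"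
   if Z: "finite Z" "\<forall>w\<in>Z. set w \<subseteq> I" for Z
  proof -
   have "(\<Sum>w\<in>Z. \<psi> t t' s q w) \<le> (\<Sum>w\<in>Z. wA q t s w + wB q t' s w)"
    using Z(2) by (intro sum_mono psi_le_add) auto
   then show ?thesis using A[OF Z] B[OF Z True] by (simp add: sum.distrib)
  qed
  then show ?thesis unfolding psi_bounded_def by blast
 next
  case False
  have le: "\<psi> t t' s q w \<le> wA q t s w" if w: "set w \<subseteq> I" for w
  proof (cases "t + t' \<le> s")
   case True
   then show ?thesis by (simp add: psi_min w)
  next
   case False
   then have dc: "\<forall>i\<in>I. d i \<le> c i" using b \<open>\<not> B.sumA q t' s < 1\<close> by blast
   have "dw w \<le> cw w"
    using w
   proof (induction w)
    case (Cons i w)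
    then show ?case using dc d(1)[of i] c(1)[of i] wpos(2)[of w] by (auto intro!: mult_mono)
   qed simp
   then show ?thesis by (simp add: psi_A w)
  qed
  have "(\<Sum>w\<in>Z. \<psi> t t' s q w) \<le> 1 / (1 - sumA q t s)"
   if Z: "finite Z" "\<forall>w\<in>Z. set w \<subseteq> I" for Z
  proof -
   have "(\<Sum>w\<in>Z. \<psi> t t' s q w) \<le> (\<Sum>w\<in>Z. wA q t s w)" using Z(2) by (intro sum_mono le) auto
   then show ?thesis using A[OF Z] by simp
  qed
  then show ?thesis unfolding psi_bounded_def by blast
 qed
qed

lemma lin_anti: "s \<le> s' \<Longrightarrow> lin u t s' \<le> lin u t s"
 unfolding lin_eq using \<chi>_pos by (simp add: mult_right_mono)

lemma sumA_anti: "s \<le> s' \<Longrightarrow> sumA q t s' \<le> sumA q t s"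
 using sumA_strict_anti[of s s' q t] by (cases "s = s'") auto

lemma slope_diff: "slope t1 - (t1 + t2) = (- h - t1 * \<chi>1 - t2 * \<chi>2) / \<chi>2"
 using \<chi>_pos by (simp add: slope_def field_simps)

end

context weights
begin

text \<open>Both \<open>slope t1\<close> and \<open>B.slope t2\<close> lie on the same side of \<open>t1 + t2\<close>, at distances
 inversely proportional to \<open>\<chi>2\<close> and \<open>\<chi>1\<close>; this decides which of the two sums is relevant.\<close>
lemma core_estimate:
 assumes chi: "\<chi>1 \<le> \<chi>2" and e: "0 < \<epsilon>"
 shows "\<exists>\<eta>>0. \<forall>\<^sub>F u in at 0. \<forall>t t'. \<bar>t - t1 * u\<bar> \<le> \<eta> * \<bar>u\<bar> \<longrightarrow> \<bar>t' - t2 * u\<bar> \<le> \<eta> * \<bar>u\<bar> \<longrightarrow>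
   sumA (1 + u) t (slope t1 * u + \<epsilon> * \<bar>u\<bar>) < 1 \<and>
   (t + t' \<le> slope t1 * u + \<epsilon> * \<bar>u\<bar> \<or> B.sumA (1 + u) t' (slope t1 * u + \<epsilon> * \<bar>u\<bar>) < 1) \<and>
   1 < Pr (1 + u) t t' (slope t1 * u - \<epsilon> * \<bar>u\<bar>)"
proof -
 obtain \<eta>1 where 1: "0 < \<eta>1" "\<forall>\<^sub>F u in at 0. \<forall>t. \<bar>t - t1 * u\<bar> \<le> \<eta>1 * \<bar>u\<bar> \<longrightarrow>
   sumA (1 + u) t (slope t1 * u + \<epsilon> * \<bar>u\<bar>) < 1 \<and> 0 < lin u t (slope t1 * u - \<epsilon> * \<bar>u\<bar>)"
  using key_estimate[OF e, of t1] by blast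
 obtain \<eta>2 where 2: "0 < \<eta>2" "\<forall>\<^sub>F u in at 0. \<forall>t. \<bar>t - t2 * u\<bar> \<le> \<eta>2 * \<bar>u\<bar> \<longrightarrow>
   B.sumA (1 + u) t (B.slope t2 * u + \<epsilon> * \<bar>u\<bar>) < 1 \<and> 0 < B.lin u t (B.slope t2 * u - \<epsilon> * \<bar>u\<bar>)"
  using B.key_estimate[OF e, of t2] by blast
 define \<eta> where "\<eta> = min (min \<eta>1 \<eta>2) (\<epsilon> / 2)"
 define X where "X = - h - t1 * \<chi>1 - t2 * \<chi>2"
 define g where "g = slope t1"
 define g' where "g' = B.slope t2"
 define T where "T = t1 + t2"
 have gT: "g = T + X / \<chi>2" "g' = T + X / \<chi>1"
  using slope_diff[of t1 t2] B.slope_diff[of t2 t1] unfolding swap by (simp_all add: g_def g'_def T_def X_def algebra_simps)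
 have inv: "1 / \<chi>2 \<le> 1 / \<chi>1" using chi \<chi>_pos by (simp add: frac_le)
 have eq: "g * u = T * u + (X * u) * (1 / \<chi>2)" "g' * u = T * u + (X * u) * (1 / \<chi>1)" for u
  unfolding gT by (simp_all add: distrib_right)
 have cmp1: "g' * u \<le> g * u" if "g * u < T * u" for u
 proof -
  have "(X * u) * (1 / \<chi>2) < 0" using that eq(1)[of u] by linarith
  then have "X * u \<le> 0" using \<chi>_pos by (simp add: divide_less_0_iff)
  then have "(X * u) * (1 / \<chi>1) \<le> (X * u) * (1 / \<chi>2)" using inv by (rule mult_left_mono_neg[rotated])
  then show ?thesis unfolding eq by linarith
 qed
 have cmp2: "g * u \<le> g' * u" if "T * u < g * u" for u
 proof -
  have "0 < (X * u) * (1 / \<chi>2)" using that eq(1)[of u] by linarith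
  then have "0 \<le> X * u" using \<chi>_pos by (simp add: zero_less_divide_iff)
  then have "(X * u) * (1 / \<chi>2) \<le> (X * u) * (1 / \<chi>1)" using inv by (rule mult_left_mono[rotated])
  then show ?thesis unfolding eq by linarith
 qed
 have goal: "sumA (1 + u) t (g * u + \<epsilon> * \<bar>u\<bar>) < 1 \<and>
   (t + t' \<le> g * u + \<epsilon> * \<bar>u\<bar> \<or> B.sumA (1 + u) t' (g * u + \<epsilon> * \<bar>u\<bar>) < 1) \<and>
   1 < Pr (1 + u) t t' (g * u - \<epsilon> * \<bar>u\<bar>)"
  if u: "\<forall>t. \<bar>t - t1 * u\<bar> \<le> \<eta>1 * \<bar>u\<bar> \<longrightarrow>
    sumA (1 + u) t (g * u + \<epsilon> * \<bar>u\<bar>) < 1 \<and> 0 < lin u t (g * u - \<epsilon> * \<bar>u\<bar>)"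
   "\<forall>t. \<bar>t - t2 * u\<bar> \<le> \<eta>2 * \<bar>u\<bar> \<longrightarrow>
    B.sumA (1 + u) t (g' * u + \<epsilon> * \<bar>u\<bar>) < 1 \<and> 0 < B.lin u t (g' * u - \<epsilon> * \<bar>u\<bar>)"
   and t: "\<bar>t - t1 * u\<bar> \<le> \<eta> * \<bar>u\<bar>" "\<bar>t' - t2 * u\<bar> \<le> \<eta> * \<bar>u\<bar>" for u t t'
 proof -
  have eta: "\<eta> * \<bar>u\<bar> \<le> \<eta>1 * \<bar>u\<bar>" "\<eta> * \<bar>u\<bar> \<le> \<eta>2 * \<bar>u\<bar>" "\<eta> * \<bar>u\<bar> \<le> \<epsilon> / 2 * \<bar>u\<bar>"
   unfolding \<eta>_def by (rule mult_right_mono; simp)+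
  have A: "sumA (1 + u) t (g * u + \<epsilon> * \<bar>u\<bar>) < 1" "0 < lin u t (g * u - \<epsilon> * \<bar>u\<bar>)"
   using u(1) t(1) eta(1) by auto
  have B: "B.sumA (1 + u) t' (g' * u + \<epsilon> * \<bar>u\<bar>) < 1" "0 < B.lin u t' (g' * u - \<epsilon> * \<bar>u\<bar>)"
   using u(2) t(2) eta(2) by auto
  have Tt: "\<bar>t + t' - T * u\<bar> \<le> \<epsilon> * \<bar>u\<bar>"
  proof -
   have "\<bar>t + t' - T * u\<bar> \<le> \<bar>t - t1 * u\<bar> + \<bar>t' - t2 * u\<bar>" unfolding T_def distrib_right by linarith
   then show ?thesis using t eta(3) by linarith
  qed
  \<comment> \<open>Below \<open>t + t'\<close> psi is the larger weight. There
    \<open>g * u < T * u\<close>, so \<open>g' * u \<le> g * u\<close>, and the B-sum, below 1 at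
    the smaller argument, is below 1 here as well.\<close>
  have 3: "B.sumA (1 + u) t' (g * u + \<epsilon> * \<bar>u\<bar>) < 1" if n: "g * u + \<epsilon> * \<bar>u\<bar> < t + t'"
  proof -
   have "g' * u + \<epsilon> * \<bar>u\<bar> \<le> g * u + \<epsilon> * \<bar>u\<bar>" using cmp1[of u] n Tt by linarith
   from B.sumA_anti[OF this, of "1 + u" t'] show ?thesis using B(1) by linarith
  qed
  \<comment> \<open>Where psi is the maximum, one sum exceeding 1 is enough. Where it is the
    minimum, \<open>cmp2\<close> places the argument at or below
    \<open>g' * u - \<epsilon> * \<bar>u\<bar>\<close>, so both means are positive.\<close>
  have 4: "1 < Pr (1 + u) t t' (g * u - \<epsilon> * \<bar>u\<bar>)"
  proof (cases "g * u - \<epsilon> * \<bar>u\<bar> \<le> t + t'")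
   case True
   have "1 < sumA (1 + u) t (g * u - \<epsilon> * \<bar>u\<bar>)" using sumA_ge[of u t "g * u - \<epsilon> * \<bar>u\<bar>"] A(2) by linarith
   then show ?thesis using Pr_ge_A[OF True, of "1 + u"] by linarith
  next
   case False
   have "g * u - \<epsilon> * \<bar>u\<bar> \<le> g' * u - \<epsilon> * \<bar>u\<bar>" using cmp2[of u] False Tt by linarith
   from B.lin_anti[OF this, of u t'] have "0 < B.lin u t' (g * u - \<epsilon> * \<bar>u\<bar>)" using B(2) by linarith
   then show ?thesis using Pr_gt_one[of t t' "g * u - \<epsilon> * \<bar>u\<bar>" u] A(2) False by linarith
  qed
  show ?thesis using A(1) 3 4 by (meson not_le)
 qed
 have "0 < \<eta>" using 1(1) 2(1) e by (auto simp: \<eta>_def)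
 moreover have "\<forall>\<^sub>F u in at 0. \<forall>t t'. \<bar>t - t1 * u\<bar> \<le> \<eta> * \<bar>u\<bar> \<longrightarrow> \<bar>t' - t2 * u\<bar> \<le> \<eta> * \<bar>u\<bar> \<longrightarrow>
   sumA (1 + u) t (g * u + \<epsilon> * \<bar>u\<bar>) < 1 \<and>
   (t + t' \<le> g * u + \<epsilon> * \<bar>u\<bar> \<or> B.sumA (1 + u) t' (g * u + \<epsilon> * \<bar>u\<bar>) < 1) \<and>
   1 < Pr (1 + u) t t' (g * u - \<epsilon> * \<bar>u\<bar>)"
  using 1(2) 2(2) unfolding g_def[symmetric] g'_def[symmetric]
  by eventually_elim (use goal in blast)
 ultimately show ?thesis unfolding g_def by blast
qed

text \<open>The core estimate places the pressure at most 1 just above the line of slope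
  \<open>slope t1\<close> and above 1 just below it, so the root is squeezed. Choosing the
  coordinate with the larger exponent is what \<open>\<chi>1 \<le> \<chi>2\<close> does.\<close>

theorem gamma_derivative:
 assumes chi: "\<chi>1 \<le> \<chi>2" and \<tau>: "(\<tau> has_real_derivative t1) (at 1)" "\<tau> 1 = 0" "(\<tau>' has_real_derivative t2) (at 1)" "\<tau>' 1 = 0"
 shows "(gamma I p c d \<tau> \<tau>' has_real_derivative slope t1) (at 1)"
proof (rule has_derivative_squeeze)
 have "sumA 1 0 0 = 1" unfolding sumA_def gA_def using p nz by (simp add: less_imp_le)
 then have "Pr 1 0 0 0 \<le> 1" "1 \<le> Pr 1 0 0 0" using Pr_le_A[of 0 0 0 1] Pr_ge_A[of 0 0 0 1] by auto
 then show "gamma I p c d \<tau> \<tau>' 1 = 0"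
  using gamma_root[of 1 \<tau> \<tau>' 0] by (simp add: \<tau>)
 fix \<epsilon> :: real assume "0 < \<epsilon>"
 from core_estimate[OF chi this, of t1 t2] obtain \<eta> where \<eta>: "0 < \<eta>" and
  ev: "\<forall>\<^sub>F u in at 0. \<forall>t t'. \<bar>t - t1 * u\<bar> \<le> \<eta> * \<bar>u\<bar> \<longrightarrow> \<bar>t' - t2 * u\<bar> \<le> \<eta> * \<bar>u\<bar> \<longrightarrow>
   sumA (1 + u) t (slope t1 * u + \<epsilon> * \<bar>u\<bar>) < 1 \<and>
   (t + t' \<le> slope t1 * u + \<epsilon> * \<bar>u\<bar> \<or> B.sumA (1 + u) t' (slope t1 * u + \<epsilon> * \<bar>u\<bar>) < 1) \<and>
   1 < Pr (1 + u) t t' (slope t1 * u - \<epsilon> * \<bar>u\<bar>)" by blast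
 show "\<forall>\<^sub>F u in at 0. slope t1 * u - \<epsilon> * \<bar>u\<bar> \<le> gamma I p c d \<tau> \<tau>' (1 + u) \<and>
   gamma I p c d \<tau> \<tau>' (1 + u) \<le> slope t1 * u + \<epsilon> * \<bar>u\<bar>"
  using ev has_derivative_bound[OF \<tau>(1,2) \<eta>] has_derivative_bound[OF \<tau>(3,4) \<eta>]
 proof eventually_elim
  case (elim u)
  let ?t = "\<tau> (1 + u)" and ?t' = "\<tau>' (1 + u)" and ?s = "slope t1 * u + \<epsilon> * \<bar>u\<bar>"
  have k: "sumA (1 + u) ?t ?s < 1" "?t + ?t' \<le> ?s \<or> B.sumA (1 + u) ?t' ?s < 1"
   "1 < Pr (1 + u) ?t ?t' (slope t1 * u - \<epsilon> * \<bar>u\<bar>)"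
   using elim by auto
  then have "Pr (1 + u) ?t ?t' ?s \<le> 1"
   using Pr_le[of "1 + u" ?t ?t' ?s] Pr_le_A[of ?t ?t' ?s "1 + u"] by (auto simp: max_def split: if_splits)
  then show ?case using k(3) gamma_root[where \<tau> = \<tau> and \<tau>' = \<tau>' and q = "1 + u"] less_imp_le by blast
 qed
qed

end

context weights
begin

text \<open>Identifies the slope of the coordinate with the larger exponent as the minimum or the
  maximum in the statement of the theorem.\<close>

lemma slope_order:
 assumes "\<chi>1 \<le> \<chi>2"
 shows "t1 + t2 \<le> slope t1 \<Longrightarrow> slope t1 \<le> B.slope t2" "slope t1 \<le> t1 + t2 \<Longrightarrow> B.slope t2 \<le> slope t1"
proof -
 define X where "X = - h - t1 * \<chi>1 - t2 * \<chi>2"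
 have gT: "slope t1 = t1 + t2 + X / \<chi>2" "B.slope t2 = t1 + t2 + X / \<chi>1"
  using slope_diff[of t1 t2] B.slope_diff[of t2 t1] unfolding swap by (simp_all add: X_def algebra_simps)
 show "slope t1 \<le> B.slope t2" if "t1 + t2 \<le> slope t1"
 proof -
  have "0 \<le> X" using that \<chi>_pos by (simp add: gT zero_le_divide_iff)
  then show ?thesis unfolding gT using assms \<chi>_pos by (simp add: divide_left_mono)
 qed
 show "B.slope t2 \<le> slope t1" if "slope t1 \<le> t1 + t2"
 proof -
  have "0 \<le> - X" using that \<chi>_pos by (simp add: gT divide_le_0_iff)
  then have "- X / \<chi>2 \<le> - X / \<chi>1" using assms \<chi>_pos by (intro divide_left_mono) auto
  then show ?thesis unfolding gT by simp
 qed
qed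

lemma slope_formula: "slope t1 = - ((\<Sum>i\<in>I. p i * (ln (p i) + t1 * ln (c i / d i))) / (\<Sum>i\<in>I. p i * ln (d i)))"
proof -
 have "(\<Sum>i\<in>I. p i * (ln (p i) + t1 * ln (c i / d i))) = lin 1 t1 0"
  by (simp add: lin_def xA_def)
 then show ?thesis by (simp add: lin_eq slope_def \<chi>2_def)
qed

lemma dominated_sums:
 assumes dc: "\<forall>i\<in>I. d i \<le> c i" and s: "s \<le> t + t'"
 shows "B.sumA q t' s \<le> sumA q t s"
 unfolding sumA_def B.sumA_def
proof (rule sum_mono)
 fix i assume i: "i \<in> I"
 show "B.gA q t' s i \<le> gA q t s i" using wA_compare(1)[of "[i]" s t t' q] i dc s by simp
qed

text \<open>Here psi dominates the multiplicative A-weight, which does not lose mass under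
  one-letter extension when the sum is at least 1. Completeness of the cut, in its subadditive form,
  passes this to the whole cut.\<close>

lemma cut_psi_ge_one:
 assumes Z: "is_cut I \<phi> \<delta> Z" and s: "s \<le> t + t'" and ge: "1 \<le> sumA q t s"
 shows "1 \<le> (\<Sum>w\<in>Z. \<psi> t t' s q w)"
proof -
 have "wA q t s w \<le> (\<Sum>i\<in>I. wA q t s (w @ [i]))" if w: "set w \<subseteq> I" for w
 proof -
  have "wA q t s w * 1 \<le> wA q t s w * sumA q t s" using ge wpos(4)[OF w, of q t s] by (intro mult_left_mono) auto
  then show ?thesis by (simp add: sumA_def sum_distrib_left)
 qed
 then have "wA q t s [] \<le> sum (wA q t s) Z" using Z unfolding is_cut_def by blast
 also have "\<dots> \<le> (\<Sum>w\<in>Z. \<psi> t t' s q w)"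
  using cut_word(1)[OF Z] by (intro sum_mono) (simp add: psi_max[OF _ s])
 finally show ?thesis by simp
qed

lemma psi_bounded_swap: "B.psi_bounded t' t s q \<longleftrightarrow> psi_bounded t t' s q"
proof -
 have "(\<Sum>w\<in>Z. psi p d c (\<lambda>_. t') (\<lambda>_. t) s q w) = (\<Sum>w\<in>Z. \<psi> t t' s q w)"
  if "\<forall>w\<in>Z. set w \<subseteq> I" for Z
  using that by (intro sum.cong refl psi_swap) auto
 then show ?thesis unfolding psi_bounded_def B.psi_bounded_def by (metis (no_types, lifting))
qed

text \<open>Supplies exponents strictly above the spectra for which psi is still summable. The
  alternative \<open>?dom\<close> serves the one-sided cases of the theorem, where only one spectrum
  is assumed differentiable.\<close>

lemma psi_bounded_near_one:
 assumes \<tau>: "(\<tau> has_real_derivative t1) (at 1)" "\<tau> 1 = 0" and e: "0 < \<epsilon>"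
  and dom: "\<chi>1 \<le> \<chi>2 \<and> (\<tau>' has_real_derivative t2) (at 1) \<and> \<tau>' 1 = 0 \<or> (\<forall>i\<in>I. d i \<le> c i)" (is "_ \<or> ?dom")
 shows "\<forall>\<^sub>F u in at 0. \<exists>t>\<tau> (1 + u). \<exists>t'>\<tau>' (1 + u). psi_bounded t t' (slope t1 * u + \<epsilon> * \<bar>u\<bar>) (1 + u)"
proof -
 let ?s = "\<lambda>u. slope t1 * u + \<epsilon> * \<bar>u\<bar>"
 have "\<exists>\<eta>>0. \<forall>\<^sub>F u in at 0. \<forall>t t'. \<bar>t - t1 * u\<bar> \<le> \<eta> * \<bar>u\<bar> \<longrightarrow> (\<bar>t' - t2 * u\<bar> \<le> \<eta> * \<bar>u\<bar> \<or> ?dom) \<longrightarrow>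
   sumA (1 + u) t (?s u) < 1 \<and> (t + t' \<le> ?s u \<or> B.sumA (1 + u) t' (?s u) < 1 \<or> ?dom)"
 proof (cases ?dom)
  case True
  then show ?thesis using key_estimate[OF e, of t1] by (auto elim!: eventually_mono)
 next
  case False
  then have "\<chi>1 \<le> \<chi>2" using dom by blast
  from core_estimate[OF this e, of t1 t2] obtain \<eta> where "0 < \<eta>" and
   ev: "\<forall>\<^sub>F u in at 0. \<forall>t t'. \<bar>t - t1 * u\<bar> \<le> \<eta> * \<bar>u\<bar> \<longrightarrow> \<bar>t' - t2 * u\<bar> \<le> \<eta> * \<bar>u\<bar> \<longrightarrow>
    sumA (1 + u) t (?s u) < 1 \<and> (t + t' \<le> ?s u \<or> B.sumA (1 + u) t' (?s u) < 1) \<and>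
    1 < Pr (1 + u) t t' (slope t1 * u - \<epsilon> * \<bar>u\<bar>)" by blast
  then show ?thesis using False by (intro exI[of _ \<eta>] conjI) (auto intro: eventually_mono[OF ev])
 qed
 then obtain \<eta> where \<eta>: "0 < \<eta>" and ev: "\<forall>\<^sub>F u in at 0. \<forall>t t'. \<bar>t - t1 * u\<bar> \<le> \<eta> * \<bar>u\<bar> \<longrightarrow>
   (\<bar>t' - t2 * u\<bar> \<le> \<eta> * \<bar>u\<bar> \<or> ?dom) \<longrightarrow>
   sumA (1 + u) t (?s u) < 1 \<and> (t + t' \<le> ?s u \<or> B.sumA (1 + u) t' (?s u) < 1 \<or> ?dom)" by blast
 have "\<forall>\<^sub>F u in at 0. \<bar>\<tau>' (1 + u) - t2 * u\<bar> \<le> \<eta> / 2 * \<bar>u\<bar> \<or> ?dom"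
  using dom has_derivative_bound[of \<tau>' t2, OF _ _ half_gt_zero[OF \<eta>]] by (auto elim: eventually_mono)
 with ev has_derivative_bound[OF \<tau> half_gt_zero[OF \<eta>]] eventually_neq_at_within[of 0]
 show ?thesis
 proof eventually_elim
  case (elim u)
  \<comment> \<open>Half of the admissible deviation is used by the derivative estimate, the other
    half to get strictly above the spectra.\<close>
  define t t' where "t = \<tau> (1 + u) + \<eta> / 2 * \<bar>u\<bar>" and "t' = \<tau>' (1 + u) + \<eta> / 2 * \<bar>u\<bar>"
  have pos: "0 < \<eta> / 2 * \<bar>u\<bar>" using \<eta> elim(3) by simp
  have t: "\<bar>t - t1 * u\<bar> \<le> \<eta> * \<bar>u\<bar>" using elim(2) pos unfolding t_def by linarith
  have t': "\<bar>t' - t2 * u\<bar> \<le> \<eta> * \<bar>u\<bar> \<or> ?dom"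
   using elim(4)
  proof
   assume "\<bar>\<tau>' (1 + u) - t2 * u\<bar> \<le> \<eta> / 2 * \<bar>u\<bar>"
   then show ?thesis using pos unfolding t'_def by linarith
  qed simp
  have "psi_bounded t t' (?s u) (1 + u)" using elim(1) t t' finite_psi_sum by blast
  moreover have "\<tau> (1 + u) < t" "\<tau>' (1 + u) < t'" using pos by (auto simp: t_def t'_def)
  ultimately show ?case by blast
 qed
qed

end

section \<open>Dimensions of the self-affine measure and of its support\<close>

lemma (in self_similar) Lq_spectrum_one: "Lq_spectrum \<nu> 1 = 0"
proof -
 have lim: "((\<lambda>\<delta>. ln (moment \<nu> 1 \<delta>) / (- ln \<delta>)) \<longlongrightarrow> Lq_spectrum \<nu> 1) (at_right 0)"
  by (rule growth_tendsto[OF Lq_spectrum_growth]) simp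
 have "\<forall>\<^sub>F \<delta> in at_right 0. 0 = ln (moment \<nu> 1 \<delta>) / (- ln \<delta>)"
  using eventually_at_right_less[of 0]
 proof eventually_elim
  case (elim \<delta>)
  have "moment \<nu> 1 \<delta> = 1" unfolding moment_window[OF elim] using sum_mesh[OF elim] by simp
  then show ?case by simp
 qed
 then have "((\<lambda>\<delta>. ln (moment \<nu> 1 \<delta>) / (- ln \<delta>)) \<longlongrightarrow> 0) (at_right 0)"
  by (rule Lim_transform_eventually[OF tendsto_const])
 then show ?thesis using tendsto_unique[OF trivial_limit_at_right_real lim] by blast
qed

context planar
begin

sublocale W: weights I p c d
 by (standard) (use fin ne c d p in auto)

abbreviation "T1 \<equiv> Lq_spectrum \<nu>1"
abbreviation "T2 \<equiv> Lq_spectrum \<nu>2"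

text \<open>A linear bound with error \<open>\<epsilon> * \<bar>u\<bar>\<close> on both sides of
  \<open>u = 0\<close> is exactly a pair of moment bounds with common slope \<open>\<beta>\<close>,
  so the dimension is \<open>- \<beta>\<close>.\<close>

lemma dims_from_psi:
 assumes ev: "\<And>\<epsilon>. 0 < \<epsilon> \<Longrightarrow> \<forall>\<^sub>F u in at 0. \<exists>t>T1 (1 + u). \<exists>t'>T2 (1 + u). W.psi_bounded t t' (\<beta> * u + \<epsilon> * \<bar>u\<bar>) (1 + u)"
 shows "hausdorff_dim_measure \<mu> = ereal (- \<beta>) \<and> packing_dim_measure \<mu> = ereal (- \<beta>) \<and> has_entropy_dim \<mu> (- \<beta>)"
proof -
 have *: "\<exists>r>0. \<forall>u. u \<noteq> 0 \<and> \<bar>u\<bar> < r \<longrightarrow> 0 \<le> 1 + u \<and>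
   (\<exists>C>0. \<forall>\<delta>\<in>{0<..1}. moment2 \<mu> (1 + u) \<delta> \<le> C * \<delta> powr (- (\<beta> * u + \<epsilon> * \<bar>u\<bar>)))"
  if e: "0 < \<epsilon>" for \<epsilon>
 proof -
  obtain r where r: "0 < r" "\<And>u. u \<noteq> 0 \<Longrightarrow> \<bar>u\<bar> < r \<Longrightarrow>
    \<exists>t>T1 (1 + u). \<exists>t'>T2 (1 + u). W.psi_bounded t t' (\<beta> * u + \<epsilon> * \<bar>u\<bar>) (1 + u)"
   using ev[OF e] unfolding eventually_at by (auto simp: dist_real_def)
  show ?thesis
  proof (rule exI[of _ "min r 1"], intro conjI allI impI)
   fix u :: real assume u: "u \<noteq> 0 \<and> \<bar>u\<bar> < min r 1"
   then show u0: "0 \<le> 1 + u" by linarith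
   obtain t t' W where t: "T1 (1 + u) < t" "T2 (1 + u) < t'"
    "\<And>Z. finite Z \<Longrightarrow> (\<forall>w\<in>Z. set w \<subseteq> I) \<Longrightarrow> (\<Sum>w\<in>Z. \<psi> t t' (\<beta> * u + \<epsilon> * \<bar>u\<bar>) (1 + u) w) \<le> W"
    using r(2)[of u] u unfolding W.psi_bounded_def by auto
   show "\<exists>C>0. \<forall>\<delta>\<in>{0<..1}. moment2 \<mu> (1 + u) \<delta> \<le> C * \<delta> powr (- (\<beta> * u + \<epsilon> * \<bar>u\<bar>))"
    by (rule moment2_upper[OF u0 has_growthD(1)[OF X.Lq_spectrum_growth[OF u0] t(1)]
       has_growthD(1)[OF Y.Lq_spectrum_growth[OF u0] t(2)] t(3)])
  qed (use r in auto)
 qed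
 show ?thesis
 proof (rule measure_dims)
  fix \<epsilon> :: real assume "0 < \<epsilon>"
  from *[OF this] obtain r where r: "0 < r" "\<And>u. u \<noteq> 0 \<Longrightarrow> \<bar>u\<bar> < r \<Longrightarrow> 0 \<le> 1 + u \<and>
    (\<exists>C>0. \<forall>\<delta>\<in>{0<..1}. moment2 \<mu> (1 + u) \<delta> \<le> C * \<delta> powr (- (\<beta> * u + \<epsilon> * \<bar>u\<bar>)))" by blast
  \<comment> \<open>With \<open>D = - \<beta>\<close>, the exponent is
    \<open>(- D + \<epsilon>) * (q - 1)\<close> for \<open>u > 0\<close> and
    \<open>(D + \<epsilon>) * (1 - q)\<close> for \<open>u < 0\<close>.\<close>
  have "\<beta> * (r / 2) + \<epsilon> * \<bar>r / 2\<bar> = (- (- \<beta>) + \<epsilon>) * (1 + r / 2 - 1)"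
   "\<beta> * - (r / 2) + \<epsilon> * \<bar>- (r / 2)\<bar> = (- \<beta> + \<epsilon>) * (1 - (1 + - (r / 2)))" using r(1) by (simp_all add: field_simps)
  note r2 = r(2)[of "r / 2", unfolded this(1)] r(2)[of "- (r / 2)", unfolded this(2)]
  show "\<exists>q>1. \<exists>C>0. \<forall>\<delta>\<in>{0<..1}. moment2 \<mu> q \<delta> \<le> C * \<delta> powr (- ((- (- \<beta>) + \<epsilon>) * (q - 1)))"
   using r2(1) r(1) by (intro exI[of _ "1 + r / 2"]) simp
  show "\<exists>q\<ge>0. q < 1 \<and> (\<exists>C>0. \<forall>\<delta>\<in>{0<..1}. moment2 \<mu> q \<delta> \<le> C * \<delta> powr (- ((- \<beta> + \<epsilon>) * (1 - q))))"
   using r2(2) r(1) by (intro exI[of _ "1 + - (r / 2)"]) simp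
 qed
qed

lemma measure_dims_A:
 assumes "(T1 has_real_derivative t1) (at 1)"
  and "W.\<chi>1 \<le> W.\<chi>2 \<and> (T2 has_real_derivative t2) (at 1) \<or> (\<forall>i\<in>I. d i \<le> c i)"
 shows "hausdorff_dim_measure \<mu> = ereal (- W.slope t1) \<and> packing_dim_measure \<mu> = ereal (- W.slope t1)
   \<and> has_entropy_dim \<mu> (- W.slope t1)"
 using W.psi_bounded_near_one[OF assms(1) X.Lq_spectrum_one, of _ T2 t2] assms(2) Y.Lq_spectrum_one
 by (intro dims_from_psi) blast

lemma measure_dims_B:
 assumes "(T2 has_real_derivative t2) (at 1)"
  and "W.\<chi>2 \<le> W.\<chi>1 \<and> (T1 has_real_derivative t1) (at 1) \<or> (\<forall>i\<in>I. c i \<le> d i)"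
 shows "hausdorff_dim_measure \<mu> = ereal (- W.B.slope t2) \<and> packing_dim_measure \<mu> = ereal (- W.B.slope t2)
   \<and> has_entropy_dim \<mu> (- W.B.slope t2)"
proof (rule dims_from_psi)
 fix \<epsilon> :: real assume "0 < \<epsilon>"
 then have "\<forall>\<^sub>F u in at 0. \<exists>t'>T2 (1 + u). \<exists>t>T1 (1 + u). W.B.psi_bounded t' t (W.B.slope t2 * u + \<epsilon> * \<bar>u\<bar>) (1 + u)"
  using W.B.psi_bounded_near_one[OF assms(1) Y.Lq_spectrum_one, of \<epsilon> T1 t1] assms(2) X.Lq_spectrum_one
  unfolding W.swap by blast
 then show "\<forall>\<^sub>F u in at 0. \<exists>t>T1 (1 + u). \<exists>t'>T2 (1 + u). W.psi_bounded t t' (W.B.slope t2 * u + \<epsilon> * \<bar>u\<bar>) (1 + u)"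
  unfolding W.psi_bounded_swap by (rule eventually_mono) blast
qed

abbreviation "GA \<equiv> W.sroot 0 (T1 0)"
abbreviation "GB \<equiv> W.B.sroot 0 (T2 0)"

text \<open>At \<open>s = T1 0 + T2 0\<close> both defining sums become the sum estimated by
  counting rectangles, so both roots have been passed.\<close>

lemma roots_le: "GA \<le> T1 0 + T2 0" "GB \<le> T1 0 + T2 0"
proof -
 have 1: "(\<Sum>i\<in>I. c i powr T1 0 * d i powr T2 0) \<le> 1"
  by (rule sum_box_dims_le_one[OF X.Lq_spectrum_growth Y.Lq_spectrum_growth]) auto
 have "W.sumA 0 (T1 0) (T1 0 + T2 0) \<le> 1" unfolding W.sumA_def W.gA_def using 1 W.nz by simp
 then show "GA \<le> T1 0 + T2 0" by (rule W.sroot_less(3))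
 have "W.B.sumA 0 (T2 0) (T1 0 + T2 0) \<le> 1" unfolding W.B.sumA_def W.B.gA_def using 1 W.nz by (simp add: mult.commute)
 then show "GB \<le> T1 0 + T2 0" by (rule W.B.sroot_less(3))
qed

lemma near_above:
 fixes h :: "real \<Rightarrow> real"
 assumes "continuous_on UNIV h" "h t < 1"
 shows "\<exists>e>0. \<forall>x. \<bar>x - t\<bar> < e \<longrightarrow> h x < 1"
proof -
 have "open {x. h x < 1}" using assms(1) by (intro open_Collect_less) auto
 then obtain e where "0 < e" "\<And>x. dist x t < e \<Longrightarrow> h x < 1" using assms(2) unfolding open_dist by blast
 then show ?thesis by (auto simp: dist_real_def)
qed

text \<open>Above both roots the two sums stay below 1 when the spectra are raised slightly, so psi
  is summable. Below the larger root \<open>roots_le\<close> gives \<open>s < T1 0 + T2 0\<close>,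
  so psi is the maximum of the weights, and one sum of at least 1 bounds its sum over every cut from
  below.\<close>

lemma moment2_growth: "has_growth (moment2 \<mu> 0) (max GA GB)"
 unfolding has_growth_def
proof (intro conjI allI impI)
 fix s assume s: "max GA GB < s"
 have "W.sumA 0 (T1 0) s < 1" "W.B.sumA 0 (T2 0) s < 1" using s by (auto intro: W.sumA_root W.B.sumA_root)
 then obtain e1 e2 where e: "0 < e1" "\<And>x. \<bar>x - T1 0\<bar> < e1 \<Longrightarrow> W.sumA 0 x s < 1"
  "0 < e2" "\<And>x. \<bar>x - T2 0\<bar> < e2 \<Longrightarrow> W.B.sumA 0 x s < 1"
  using near_above[OF W.sumA_continuous(2)] near_above[OF W.B.sumA_continuous(2)] by metis
 have "W.sumA 0 (T1 0 + e1 / 2) s < 1" "W.B.sumA 0 (T2 0 + e2 / 2) s < 1" using e by auto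
 then obtain V where V: "\<And>Z. finite Z \<Longrightarrow> (\<forall>w\<in>Z. set w \<subseteq> I) \<Longrightarrow>
   (\<Sum>w\<in>Z. \<psi> (T1 0 + e1 / 2) (T2 0 + e2 / 2) s 0 w) \<le> V"
  using W.finite_psi_sum unfolding W.psi_bounded_def by metis
 show "\<exists>C>0. \<forall>\<delta>\<in>{0<..1}. moment2 \<mu> 0 \<delta> \<le> C * \<delta> powr (- s)"
  using e by (intro moment2_upper[OF order_refl has_growthD(1)[OF X.Lq_spectrum_growth]
   has_growthD(1)[OF Y.Lq_spectrum_growth] V]) auto
next
 fix s assume s: "s < max GA GB"
 have "\<exists>e>0. s \<le> T1 0 - e + (T2 0 - e) \<and> (1 \<le> W.sumA 0 (T1 0 - e) s \<or> 1 \<le> W.B.sumA 0 (T2 0 - e) s)"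
 proof -
  have sT: "s < T1 0 + T2 0" using s roots_le by linarith
  have near: "\<exists>e>0. s \<le> T1 0 - e + (T2 0 - e) \<and> 1 \<le> h (t - e)" if h: "continuous_on UNIV h" "1 < h t" for h :: "real \<Rightarrow> real" and t
  proof -
   have "continuous_on UNIV (\<lambda>x. 2 - h x)" using h(1) by (intro continuous_intros)
   then obtain e where e: "0 < e" "\<And>x. \<bar>x - t\<bar> < e \<Longrightarrow> 2 - h x < 1" using near_above[of "\<lambda>x. 2 - h x" t] h(2) by auto
   \<comment> \<open>Small enough for continuity of the sum and for \<open>s \<le> t + t'\<close> to
     survive lowering both spectra by \<open>e'\<close>.\<close>
   define e' where "e' = min (e / 2) ((T1 0 + T2 0 - s) / 2)"
   have e': "0 < e'" "e' < e" "e' \<le> (T1 0 + T2 0 - s) / 2" using e(1) sT unfolding e'_def by (simp, simp add: min_less_iff_disj, intro min.cobounded2)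
   then show ?thesis using e(2)[of "t - e'"] by (intro exI[of _ e']) auto
  qed
  have "1 < W.sumA 0 (T1 0) s \<or> 1 < W.B.sumA 0 (T2 0) s"
   using s W.sumA_root(1)[of s 0 "T1 0"] W.B.sumA_root(1)[of s 0 "T2 0"] by (auto simp: less_max_iff_disj)
  then show ?thesis
  proof
   assume "1 < W.sumA 0 (T1 0) s"
   from near[OF W.sumA_continuous(2) this] show ?thesis by metis
  next
   assume "1 < W.B.sumA 0 (T2 0) s"
   from near[OF W.B.sumA_continuous(2) this] show ?thesis by metis
  qed
 qed
 then obtain e where e: "0 < e" "s \<le> T1 0 - e + (T2 0 - e)" "1 \<le> W.sumA 0 (T1 0 - e) s \<or> 1 \<le> W.B.sumA 0 (T2 0 - e) s" by blast
 have *: "T1 0 - e < T1 0" "T2 0 - e < T2 0" using e(1) by auto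
 obtain C where C: "0 < C" "\<And>\<delta> Z. \<delta> \<in> {0<..1} \<Longrightarrow> is_cut I \<phi> \<delta> Z \<Longrightarrow>
   C * \<delta> powr (-s) * (\<Sum>w\<in>Z. \<psi> (T1 0 - e) (T2 0 - e) s 0 w) \<le> moment2 \<mu> 0 \<delta>"
  using moment2_lower[OF has_growthD(2)[OF X.Lq_spectrum_growth[OF order_refl] *(1)]
   has_growthD(2)[OF Y.Lq_spectrum_growth[OF order_refl] *(2)], of s] by blast
 show "\<exists>C>0. \<forall>\<delta>\<in>{0<..1}. C * \<delta> powr (- s) \<le> moment2 \<mu> 0 \<delta>"
 proof (rule exI[of _ C], intro conjI C(1) ballI)
  fix \<delta> :: real assume \<delta>: "\<delta> \<in> {0<..1}"
  obtain Z where Z: "is_cut I \<phi> \<delta> Z" using cut2_exists \<delta> by auto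
  have "1 \<le> (\<Sum>w\<in>Z. \<psi> (T1 0 - e) (T2 0 - e) s 0 w)"
   using e(3)
  proof
   assume "1 \<le> W.sumA 0 (T1 0 - e) s"
   then show ?thesis by (rule W.cut_psi_ge_one[OF Z e(2)])
  next
   assume "1 \<le> W.B.sumA 0 (T2 0 - e) s"
   then have "1 \<le> (\<Sum>w\<in>Z. psi p d c (\<lambda>_. T2 0 - e) (\<lambda>_. T1 0 - e) s 0 w)"
    using e(2) by (intro W.B.cut_psi_ge_one[OF Z]) auto
   also have "\<dots> = (\<Sum>w\<in>Z. \<psi> (T1 0 - e) (T2 0 - e) s 0 w)"
    using cut_word(1)[OF Z] by (intro sum.cong refl W.psi_swap)
   finally show ?thesis .
  qed
  then have "C * \<delta> powr (-s) * 1 \<le> C * \<delta> powr (-s) * (\<Sum>w\<in>Z. \<psi> (T1 0 - e) (T2 0 - e) s 0 w)"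
   using C(1) by (intro mult_left_mono) auto
  then show "C * \<delta> powr (- s) \<le> moment2 \<mu> 0 \<delta>" using C(2)[OF \<delta> Z] by simp
 qed
qed

lemma set_dims: "has_box_dim F (max GA GB) \<and> packing_dim F = ereal (max GA GB)"
 using box_dim[OF moment2_growth] packing_dim_F[OF moment2_growth] by blast

text \<open>When one side is always the longer, its weight dominates letter by letter at its own
  root, which lies in the range where the longer side carries the larger weight.\<close>

lemma max_roots:
 shows "\<forall>i\<in>I. d i \<le> c i \<Longrightarrow> max GA GB = GA" and "\<forall>i\<in>I. c i \<le> d i \<Longrightarrow> max GA GB = GB"
proof -
 assume "\<forall>i\<in>I. d i \<le> c i"
 then have "W.B.sumA 0 (T2 0) GA \<le> 1" using W.dominated_sums[OF _ roots_le(1), of 0] W.sroot[of 0 "T1 0"] by simp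
 then show "max GA GB = GA" using W.B.sroot_less(3)[of 0 "T2 0" GA] by (simp add: max_def)
next
 assume "\<forall>i\<in>I. c i \<le> d i"
 then have "W.sumA 0 (T1 0) GB \<le> 1"
  using W.B.dominated_sums[of GB "T2 0" "T1 0" 0] roots_le(2) W.B.sroot[of 0 "T2 0"] by (simp add: add.commute)
 then show "max GA GB = GB" using W.sroot_less(3)[of 0 "T1 0" GB] by (simp add: max_def)
qed

text \<open>The comparison of \<open>\<chi>1\<close> and \<open>\<chi>2\<close> selects the
  coordinate. Its slope is at once the derivative of \<gamma> and minus the dimension; in the second
  case everything is applied with the coordinates exchanged.\<close>

lemma dims_at_one:
 fixes t1 t2 :: real
 defines "\<gamma> \<equiv> gamma I p c d T1 T2"
 assumes D: "(T1 has_real_derivative t1) (at 1)" "(T2 has_real_derivative t2) (at 1)"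
 shows "\<exists>G. (\<gamma> has_real_derivative G) (at 1) \<and>
   hausdorff_dim_measure \<mu> = ereal (- G) \<and> packing_dim_measure \<mu> = ereal (- G) \<and> has_entropy_dim \<mu> (- G) \<and>
   (t1 + t2 \<le> min (W.slope t1) (W.B.slope t2) \<longrightarrow> G = min (W.slope t1) (W.B.slope t2)) \<and>
   (max (W.slope t1) (W.B.slope t2) \<le> t1 + t2 \<longrightarrow> G = max (W.slope t1) (W.B.slope t2))"
proof (cases "W.\<chi>1 \<le> W.\<chi>2")
 case True
 then show ?thesis
  using W.gamma_derivative[OF True D(1) X.Lq_spectrum_one D(2) Y.Lq_spectrum_one] measure_dims_A[OF D(1), of t2] D(2)
   W.slope_order[OF True, of t1 t2] unfolding \<gamma>_def
  by (intro exI[of _ "W.slope t1"]) auto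
next
 case False
 then have le: "W.B.\<chi>1 \<le> W.B.\<chi>2" "W.\<chi>2 \<le> W.\<chi>1" unfolding W.swap by auto
 show ?thesis
  using W.B.gamma_derivative[OF le(1) D(2) Y.Lq_spectrum_one D(1) X.Lq_spectrum_one] measure_dims_B[OF D(2), of t1] D(1) le(2)
   W.B.slope_order[OF le(1), of t2 t1] unfolding \<gamma>_def W.gamma_swap
  by (intro exI[of _ "W.B.slope t2"]) (auto simp: add.commute)
qed

lemma gamma_AB_derivative:
 shows "(T1 has_real_derivative t1) (at 1) \<Longrightarrow> (gamma_A I p c d T1 has_real_derivative W.slope t1) (at 1)"
  and "(T2 has_real_derivative t2) (at 1) \<Longrightarrow> (gamma_B I p c d T2 has_real_derivative W.B.slope t2) (at 1)"
proof -
 show "(T1 has_real_derivative t1) (at 1) \<Longrightarrow> (gamma_A I p c d T1 has_real_derivative W.slope t1) (at 1)"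
  using W.gamma_A_derivative X.Lq_spectrum_one by blast
 have "gamma_B I p c d T2 = gamma_A I p d c T2" by (simp add: fun_eq_iff gamma_A_def gamma_B_def)
 then show "(T2 has_real_derivative t2) (at 1) \<Longrightarrow> (gamma_B I p c d T2 has_real_derivative W.B.slope t2) (at 1)"
  using W.B.gamma_A_derivative Y.Lq_spectrum_one by metis
qed

end

theorem corollary2p13:
  fixes I :: "'i set"
    and S :: "'i \<Rightarrow> real \<times> real \<Rightarrow> real \<times> real"
    and p c d :: "'i \<Rightarrow> real"
    and \<mu> :: "(real \<times> real) measure"
    and F :: "(real \<times> real) set"
    and \<tau>1 \<tau>2 \<gamma> \<gamma>A \<gamma>B :: "real \<Rightarrow> real"
  assumes "box_like_ifs I S c d"
    and "probability_vector_on I p"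
    and "is_self_affine_measure I S p \<mu>"
    and "rectangular_osc I S"
    and "F = measure_support \<mu>"
    and "\<tau>1 = Lq_spectrum (distr \<mu> borel fst)"
    and "\<tau>2 = Lq_spectrum (distr \<mu> borel snd)"
    and "\<gamma> = gamma I p c d \<tau>1 \<tau>2"
    and "\<gamma>A = gamma_A I p c d \<tau>1"
    and "\<gamma>B = gamma_B I p c d \<tau>2"
  shows
    "(has_box_dim F (max (\<gamma>A 0) (\<gamma>B 0)) \<and> packing_dim F = ereal (max (\<gamma>A 0) (\<gamma>B 0))) \<and>
     (\<tau>1 differentiable (at 1) \<and> \<tau>2 differentiable (at 1) \<longrightarrow>
        \<gamma> differentiable (at 1) \<and>
        hausdorff_dim_measure \<mu> = ereal (- deriv \<gamma> 1) \<and>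
        packing_dim_measure \<mu> = ereal (- deriv \<gamma> 1) \<and>
        has_entropy_dim \<mu> (- deriv \<gamma> 1) \<and>
        (min (deriv \<gamma>A 1) (deriv \<gamma>B 1) \<ge> deriv \<tau>1 1 + deriv \<tau>2 1 \<longrightarrow>
           deriv \<gamma> 1 = min (deriv \<gamma>A 1) (deriv \<gamma>B 1)) \<and>
        (max (deriv \<gamma>A 1) (deriv \<gamma>B 1) \<le> deriv \<tau>1 1 + deriv \<tau>2 1 \<longrightarrow>
           deriv \<gamma> 1 = max (deriv \<gamma>A 1) (deriv \<gamma>B 1)) \<and>
        (\<gamma>A has_real_derivative
           - ((\<Sum>i\<in>I. p i * (ln (p i) + deriv \<tau>1 1 * ln (c i / d i))) / (\<Sum>i\<in>I. p i * ln (d i)))) (at 1) \<and>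
        (\<gamma>B has_real_derivative
           - ((\<Sum>i\<in>I. p i * (ln (p i) + deriv \<tau>2 1 * ln (d i / c i))) / (\<Sum>i\<in>I. p i * ln (c i)))) (at 1)) \<and>
     ((\<forall>i\<in>I. c i \<ge> d i) \<longrightarrow>
        has_box_dim F (\<gamma>A 0) \<and> packing_dim F = ereal (\<gamma>A 0) \<and>
        (\<tau>1 differentiable (at 1) \<longrightarrow>
           \<gamma>A differentiable (at 1) \<and>
           hausdorff_dim_measure \<mu> = ereal (- deriv \<gamma>A 1) \<and>
           packing_dim_measure \<mu> = ereal (- deriv \<gamma>A 1) \<and>
           has_entropy_dim \<mu> (- deriv \<gamma>A 1) \<and>
           - deriv \<gamma>A 1 =
             (\<Sum>i\<in>I. p i * (ln (p i) + deriv \<tau>1 1 * ln (c i / d i))) / (\<Sum>i\<in>I. p i * ln (d i)))) \<and>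
     ((\<forall>i\<in>I. d i \<ge> c i) \<longrightarrow>
        has_box_dim F (\<gamma>B 0) \<and> packing_dim F = ereal (\<gamma>B 0) \<and>
        (\<tau>2 differentiable (at 1) \<longrightarrow>
           \<gamma>B differentiable (at 1) \<and>
           hausdorff_dim_measure \<mu> = ereal (- deriv \<gamma>B 1) \<and>
           packing_dim_measure \<mu> = ereal (- deriv \<gamma>B 1) \<and>
           has_entropy_dim \<mu> (- deriv \<gamma>B 1) \<and>
           - deriv \<gamma>B 1 =
             (\<Sum>i\<in>I. p i * (ln (p i) + deriv \<tau>2 1 * ln (d i / c i))) / (\<Sum>i\<in>I. p i * ln (c i))))"
proof -
 obtain a b a' b' where ab: "a < b" "a' < b'"
  and osc: "\<And>i. i \<in> I \<Longrightarrow> S i ` ({a<..<b} \<times> {a'<..<b'}) \<subseteq> {a<..<b} \<times> {a'<..<b'}"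
   "disjoint_family_on (\<lambda>i. S i ` ({a<..<b} \<times> {a'<..<b'})) I"
  using assms(4) unfolding rectangular_osc_def Let_def by metis
 have ifs: "finite I" "I \<noteq> {}" "\<And>i. i \<in> I \<Longrightarrow> 0 < c i" "\<And>i. i \<in> I \<Longrightarrow> c i < 1" "\<And>i. i \<in> I \<Longrightarrow> 0 < d i"
  "\<And>i. i \<in> I \<Longrightarrow> d i < 1" "\<And>i. i \<in> I \<Longrightarrow> diagonal_affine (c i) (d i) (S i)"
  using \<open>box_like_ifs I S c d\<close> unfolding box_like_ifs_def by auto
 have p: "\<And>i. i \<in> I \<Longrightarrow> 0 < p i" "(\<Sum>i\<in>I. p i) = 1"
  using \<open>probability_vector_on I p\<close> unfolding probability_vector_on_def by auto
 have \<mu>: "prob_space \<mu>" "sets \<mu> = sets borel"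
  "\<And>A. A \<in> sets borel \<Longrightarrow> measure \<mu> A = (\<Sum>i\<in>I. p i * measure (distr \<mu> borel (S i)) A)"
  using \<open>is_self_affine_measure I S p \<mu>\<close> unfolding is_self_affine_measure_def by auto
 have sp: "space \<mu> = UNIV" using sets_eq_imp_space_eq[OF \<mu>(2)] by simp
 have meas: "S i \<in> measurable \<mu> borel" if i: "i \<in> I" for i
 proof -
  obtain e e' u v where S: "S i = (\<lambda>(x, y). (e * c i * x + u, e' * d i * y + v))"
   using ifs(7)[OF i] unfolding diagonal_affine_def by blast
  have "continuous_on UNIV (S i)" unfolding S case_prod_unfold by (intro continuous_intros)
  then have "S i \<in> borel_measurable borel" by (rule borel_measurable_continuous_onI)
  then show ?thesis using measurable_cong_sets[OF \<mu>(2) refl, of borel] by blast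
 qed
 have "measure \<mu> A = (\<Sum>i\<in>I. p i * measure \<mu> (S i -` A))" if "A \<in> sets borel" for A
  unfolding \<mu>(3)[OF that] using meas that by (intro sum.cong refl) (simp add: measure_distr sp)
 then interpret M: planar \<mu> I S p c d a b a' b'
  using \<mu> ifs p ab osc by (intro planar.intro planar_axioms.intro) auto
 have \<tau>: "\<tau>1 = M.T1" "\<tau>2 = M.T2" using assms(6,7) by (simp_all add: M.\<nu>1_def M.\<nu>2_def)
 have \<gamma>: "\<gamma>A = gamma_A I p c d M.T1" "\<gamma>B = gamma_B I p c d M.T2" "\<gamma> = gamma I p c d M.T1 M.T2"
  using assms(8-10) unfolding \<tau> by simp_all
 have F: "F = M.F" using assms(5) by (simp add: M.F_def)
 have \<gamma>0: "\<gamma>A 0 = M.GA" "\<gamma>B 0 = M.GB"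
  using M.W.gamma_A_root[of M.T1 0] M.W.B.gamma_A_root[of M.T2 0] unfolding \<gamma> by (simp_all add: gamma_A_def gamma_B_def)
 have box: "has_box_dim F (max (\<gamma>A 0) (\<gamma>B 0)) \<and> packing_dim F = ereal (max (\<gamma>A 0) (\<gamma>B 0))"
  unfolding F \<gamma>0 by (rule M.set_dims)
 have D: "(\<tau>1 has_real_derivative deriv \<tau>1 1) (at 1)" if "\<tau>1 differentiable (at 1)"
  using that DERIV_deriv_iff_real_differentiable by blast
 have D': "(\<tau>2 has_real_derivative deriv \<tau>2 1) (at 1)" if "\<tau>2 differentiable (at 1)"
  using that DERIV_deriv_iff_real_differentiable by blast
 have A: "(\<gamma>A has_real_derivative M.W.slope (deriv \<tau>1 1)) (at 1)" if "\<tau>1 differentiable (at 1)"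
  using M.gamma_AB_derivative(1) D[OF that] unfolding \<gamma> \<tau> by blast
 have B: "(\<gamma>B has_real_derivative M.W.B.slope (deriv \<tau>2 1)) (at 1)" if "\<tau>2 differentiable (at 1)"
  using M.gamma_AB_derivative(2) D'[OF that] unfolding \<gamma> \<tau> by blast
 have dA: "deriv \<gamma>A 1 = M.W.slope (deriv \<tau>1 1)" if "\<tau>1 differentiable (at 1)" by (rule DERIV_imp_deriv[OF A[OF that]])
 have dB: "deriv \<gamma>B 1 = M.W.B.slope (deriv \<tau>2 1)" if "\<tau>2 differentiable (at 1)" by (rule DERIV_imp_deriv[OF B[OF that]])
 have main: "\<gamma> differentiable (at 1) \<and>
    hausdorff_dim_measure \<mu> = ereal (- deriv \<gamma> 1) \<and>
    packing_dim_measure \<mu> = ereal (- deriv \<gamma> 1) \<and>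
    has_entropy_dim \<mu> (- deriv \<gamma> 1) \<and>
    (min (deriv \<gamma>A 1) (deriv \<gamma>B 1) \<ge> deriv \<tau>1 1 + deriv \<tau>2 1 \<longrightarrow>
      deriv \<gamma> 1 = min (deriv \<gamma>A 1) (deriv \<gamma>B 1)) \<and>
    (max (deriv \<gamma>A 1) (deriv \<gamma>B 1) \<le> deriv \<tau>1 1 + deriv \<tau>2 1 \<longrightarrow>
      deriv \<gamma> 1 = max (deriv \<gamma>A 1) (deriv \<gamma>B 1))"
  if d: "\<tau>1 differentiable (at 1)" "\<tau>2 differentiable (at 1)"
 proof -
  obtain G where G: "(\<gamma> has_real_derivative G) (at 1)"
   "hausdorff_dim_measure \<mu> = ereal (- G) \<and> packing_dim_measure \<mu> = ereal (- G) \<and> has_entropy_dim \<mu> (- G)"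
   "deriv \<tau>1 1 + deriv \<tau>2 1 \<le> min (deriv \<gamma>A 1) (deriv \<gamma>B 1) \<Longrightarrow> G = min (deriv \<gamma>A 1) (deriv \<gamma>B 1)"
   "max (deriv \<gamma>A 1) (deriv \<gamma>B 1) \<le> deriv \<tau>1 1 + deriv \<tau>2 1 \<Longrightarrow> G = max (deriv \<gamma>A 1) (deriv \<gamma>B 1)"
   using M.dims_at_one[OF D[OF d(1), unfolded \<tau>] D'[OF d(2), unfolded \<tau>]]
   unfolding dA[OF d(1)] dB[OF d(2)] \<tau>[symmetric] assms(8)[symmetric] by blast
  have "deriv \<gamma> 1 = G" by (rule DERIV_imp_deriv[OF G(1)])
  then show ?thesis using G real_differentiable_def by blast
 qed
 have domA: "\<gamma>A differentiable (at 1) \<and> hausdorff_dim_measure \<mu> = ereal (- deriv \<gamma>A 1) \<and>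
    packing_dim_measure \<mu> = ereal (- deriv \<gamma>A 1) \<and> has_entropy_dim \<mu> (- deriv \<gamma>A 1)"
  if "\<forall>i\<in>I. d i \<le> c i" "\<tau>1 differentiable (at 1)"
  using M.measure_dims_A[OF D[OF that(2), unfolded \<tau>]] that A[OF that(2)] real_differentiable_def unfolding dA[OF that(2)] \<tau> by blast
 have domB: "\<gamma>B differentiable (at 1) \<and> hausdorff_dim_measure \<mu> = ereal (- deriv \<gamma>B 1) \<and>
    packing_dim_measure \<mu> = ereal (- deriv \<gamma>B 1) \<and> has_entropy_dim \<mu> (- deriv \<gamma>B 1)"
  if "\<forall>i\<in>I. c i \<le> d i" "\<tau>2 differentiable (at 1)"
  using M.measure_dims_B[OF D'[OF that(2), unfolded \<tau>]] that B[OF that(2)] real_differentiable_def unfolding dB[OF that(2)] \<tau> by blast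
 have boxA: "has_box_dim F (\<gamma>A 0) \<and> packing_dim F = ereal (\<gamma>A 0)" if "\<forall>i\<in>I. d i \<le> c i"
  using box M.max_roots(1)[OF that] unfolding \<gamma>0 by simp
 have boxB: "has_box_dim F (\<gamma>B 0) \<and> packing_dim F = ereal (\<gamma>B 0)" if "\<forall>i\<in>I. c i \<le> d i"
  using box M.max_roots(2)[OF that] unfolding \<gamma>0 by simp
 note fA = M.W.slope_formula[of "deriv \<tau>1 1"] and fB = M.W.B.slope_formula[of "deriv \<tau>2 1"]
 show ?thesis
 \<comment> \<open>Goals 9 and 10 are the derivative formulas of the two-sided part, 17 and 24 the
   explicit dimension formulas of the one-sided parts; all others are conjuncts of the facts
   collected above.\<close>
 proof (intro conjI impI, goal_cases)
  case 1 then show ?case using box by blast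
 next
  case 2 then show ?case using box by blast
 next
  case 9 then show ?case using A unfolding fA by blast
 next
  case 10 then show ?case using B unfolding fB by blast
 next
  case 17 then show ?case unfolding dA[OF 17(2)] fA by simp
 next
  case 24 then show ?case unfolding dB[OF 24(2)] fB by simp
 qed (use main domA domB boxA boxB in blast)+
qed

end
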